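(* Let $\theta^*=\frac{2\beta}{\mu}+\frac{\mu}{\sigma^2}$ and $\alpha=\frac{2\beta}{2\beta+\mu^2/\sigma^2}$. Let $x^*>0$ be the solution of $$\alpha=[ax^*+\alpha]\exp\{-a[x^*-h(x^* )-k]\},$$ and let $x_0^*>0$ be the solution of the same equation with $h\equiv0$, i.e. $\alpha=[ax_0^*+\alpha]e^{-a(x_0^*-k)}$. Suppose that $$x_0^*>\frac{2-\alpha}{a},\qquad h''(x)\le0\ \ \forall\,0<x<x^*,$$ and, for all $0<x<x^*$, $$h'(x)<\min\left\{\frac{1}{2\left(1+\frac{1}{ax_0^*+\alpha-1}\right)},\ \frac{1}{1-e^{-ax^*}}\left[1-\frac{\alpha}{\min\{\alpha e^{ak},\,2e^{\alpha-2+ak}\}}\right],\ \frac12\right\}.$$ Then $$\left(\frac{x}{x^*}\right)^{\alpha}\left[1-\exp\{-a[x^*-h(x)-k]\}\right]\ \ge\ 1-\exp\{-a[x-h(x)-k]\}\qquad\forall\,0<x<x^*.$$ As a consequence, if in addition $x^*\ge\frac{\mu^2\alpha}{2\beta\sigma^2a}$, then $(\theta^*,(0,x^* )\times[0,\infty))$ is an equilibrium (for the problem described in the context, with constant control $\theta^*$).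
   Context: Constants $\mu,\sigma,\beta,a,k>0$. $h$ is an increasing (twice differentiable) function on $[0,\infty)$ with $h(0)=0$ and $x-h(x)$ nondecreasing. Problem. A control (investment proportion) is a measurable function $\theta$ of wealth with values in $(0,\infty)$; it is admissible if $x\mapsto x\theta(x)$ is Lipschitz (constants $\vartheta\in(0,\infty)$ are admissible). The wealth, with values in $(0,\infty)$, follows $dX^\theta_t=\mu\theta(X^\theta_t)X^\theta_t\,dt+\sigma\theta(X^\theta_t)X^\theta_t\,dW_t$, $W$ a one-dimensional Brownian motion. $\mathbb E^{t,x}$ is expectation when wealth is $x$ at time $t$. For open $C\subset(0,\infty)$, $C\times[0,\infty)$ denotes the continuation region of all (time, wealth) pairs with wealth in $C$, and $\tau_{(u,C,s)}=\inf\{r\ge s:X^u_r\notin C\}$ ($\inf\varnothing=\infty$). The pay-off is $$J(t,x;u,\tau)=\mathbb E^{t,x}\Big[e^{-\beta(\tau-t)}\big(1-\exp\{-a[X^u_\tau-h(x)-k]\}\big)I_{\{\tau<\infty\}}\Big].$$ For $\vartheta\in(0,\infty)$, $\epsilon>0$, the perturbed control $\theta_{(t,\epsilon,\vartheta)}$ equals $\vartheta$ on times $[t,t+\epsilon)$ and $\theta$ otherwise. $(\theta,C\times[0,\infty))$ is an equilibrium iff, with $\hat\tau=\tau_{(\theta,C,t)}$: (i) $1-\exp\{-a[x-h(x)-k]\}\le J(t,x;\theta,\hat\tau)$ for all $t\ge0,x>0$; (ii) $\limsup_{\epsilon\downarrow0}\epsilon^{-1}\big(J(t,x;\theta,\tau_{(\theta,C,t+\epsilon)})-J(t,x;\theta,\hat\tau)\big)\le0$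 for all $t\ge0,x>0$; (iii) $\limsup_{\epsilon\downarrow0}\epsilon^{-1}\big(J(t,x;\theta_{(t,\epsilon,\vartheta)},\tau_{(\theta_{(t,\epsilon,\vartheta)},C,t)})-J(t,x;\theta,\hat\tau)\big)\le0$ for all $t\ge0$, $x\in C$, $\vartheta\in(0,\infty)$. *)

theory Defs
  imports "HOL-Probability.Probability"
begin

section \<open>Brownian motion and the Ito integral\<close>

text \<open>Processes are functions \<open>time \<Rightarrow> sample point \<Rightarrow> value\<close>; only times in \<open>[0,\<infinity>)\<close> matter.\<close>

definition brownian_motion :: "'w measure \<Rightarrow> (real \<Rightarrow> 'w \<Rightarrow> real) \<Rightarrow> bool" where
  "brownian_motion M W \<longleftrightarrow>
     prob_space M \<and>
     (\<forall>t\<ge>0. W t \<in> borel_measurable M) \<and>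
     (AE \<omega> in M. W 0 \<omega> = 0) \<and>
     (AE \<omega> in M. continuous_on {0..} (\<lambda>t. W t \<omega>)) \<and>
     (\<forall>s t. 0 \<le> s \<and> s < t \<longrightarrow>
        distributed M lborel (\<lambda>\<omega>. W t \<omega> - W s \<omega>) (\<lambda>z. ennreal (normal_density 0 (sqrt (t - s)) z))) \<and>
     (\<forall>n (p :: nat \<Rightarrow> real). 0 \<le> p 0 \<and> mono p \<longrightarrow>
        prob_space.indep_vars M (\<lambda>_. borel) (\<lambda>i \<omega>. W (p (Suc i)) \<omega> - W (p i) \<omega>) {..<n})"

text \<open>The natural filtration of \<open>W\<close>, augmented by the null sets of the completed measure.
  It is a filtration of sub-sigma-algebras of \<open>completion M\<close>, which is why probabilities and
  expectations of adapted processes are taken below with respect to \<open>completion M\<close>.\<close>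

definition brownian_filtration :: "'w measure \<Rightarrow> (real \<Rightarrow> 'w \<Rightarrow> real) \<Rightarrow> real \<Rightarrow> 'w measure" where
  "brownian_filtration M W r =
     sigma (space M)
       ({W s -` A \<inter> space M | s A. 0 \<le> s \<and> s \<le> r \<and> A \<in> sets borel} \<union> null_sets (completion M))"

definition tends_in_prob :: "'w measure \<Rightarrow> (nat \<Rightarrow> 'w \<Rightarrow> real) \<Rightarrow> ('w \<Rightarrow> real) \<Rightarrow> bool" where
  "tends_in_prob M Z Z' \<longleftrightarrow>
     (\<forall>\<delta>>0. (\<lambda>j. measure M {\<omega> \<in> space M. \<delta> < \<bar>Z j \<omega> - Z' \<omega>\<bar>}) \<longlonglongrightarrow> 0)"

text \<open>A simple integrand on \<open>[t,\<infinity>)\<close> is encoded as \<open>(n, p, \<xi>)\<close> and stands for the process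
  \<open>\<Sum>i<n. \<xi> i * indicator {p i <.. p (i+1)}\<close>, with \<open>\<xi> i\<close> bounded and known at time \<open>p i\<close>.\<close>

type_synonym 'w simple_integrand = "nat \<times> (nat \<Rightarrow> real) \<times> (nat \<Rightarrow> 'w \<Rightarrow> real)"

definition is_simple_integrand :: "(real \<Rightarrow> 'w measure) \<Rightarrow> real \<Rightarrow> 'w simple_integrand \<Rightarrow> bool" where
  "is_simple_integrand F t = (\<lambda>(n, p, \<xi>).
     t \<le> p 0 \<and> mono p \<and>
     (\<forall>i<n. \<xi> i \<in> borel_measurable (F (p i)) \<and> (\<exists>B. \<forall>\<omega>\<in>space (F (p i)). \<bar>\<xi> i \<omega>\<bar> \<le> B)))"

definition simple_value :: "'w simple_integrand \<Rightarrow> real \<Rightarrow> 'w \<Rightarrow> real" where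
  "simple_value = (\<lambda>(n, p, \<xi>) s \<omega>. \<Sum>i<n. \<xi> i \<omega> * indicator {p i <.. p (Suc i)} s)"

definition simple_integral ::
  "(real \<Rightarrow> 'w \<Rightarrow> real) \<Rightarrow> 'w simple_integrand \<Rightarrow> real \<Rightarrow> 'w \<Rightarrow> real" where
  "simple_integral W = (\<lambda>(n, p, \<xi>) r \<omega>.
     \<Sum>i<n. \<xi> i \<omega> * (W (min (p (Suc i)) r) \<omega> - W (min (p i) r) \<omega>))"

definition progressively_measurable ::
  "(real \<Rightarrow> 'w measure) \<Rightarrow> real \<Rightarrow> (real \<Rightarrow> 'w \<Rightarrow> real) \<Rightarrow> bool" where
  "progressively_measurable F t Y \<longleftrightarrow>
     (\<forall>T\<ge>t. (\<lambda>(s, \<omega>). Y s \<omega>) \<in> borel_measurable (restrict_space borel {t..T} \<Otimes>\<^sub>M F T))"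

text \<open>\<open>I r\<close> is (a version of) the Ito integral of \<open>Y\<close> over \<open>[t,r]\<close>, for every \<open>r \<ge> t\<close>: the
  integrand is progressive with almost surely locally square-integrable paths, and the integral
  is the limit in probability of the integrals of simple integrands that approximate \<open>Y\<close>.\<close>

definition is_ito_integral ::
  "'w measure \<Rightarrow> (real \<Rightarrow> 'w \<Rightarrow> real) \<Rightarrow> real \<Rightarrow> (real \<Rightarrow> 'w \<Rightarrow> real) \<Rightarrow> (real \<Rightarrow> 'w \<Rightarrow> real) \<Rightarrow> bool" where
  "is_ito_integral M W t Y I \<longleftrightarrow>
     (let F = brownian_filtration M W in
      progressively_measurable F t Y \<and>
      (\<forall>T\<ge>t. AE \<omega> in M. set_integrable lborel {t..T} (\<lambda>s. (Y s \<omega>)\<^sup>2)) \<and>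
      (\<forall>r\<ge>t. I r \<in> borel_measurable (F r)) \<and>
      (\<exists>H. (\<forall>j. is_simple_integrand F t (H j)) \<and>
           (\<forall>T\<ge>t. tends_in_prob (completion M)
                      (\<lambda>j \<omega>. LINT s:{t..T}|lborel. (simple_value (H j) s \<omega> - Y s \<omega>)\<^sup>2) (\<lambda>_. 0)) \<and>
           (\<forall>r\<ge>t. tends_in_prob (completion M) (\<lambda>j. simple_integral W (H j) r) (I r))))"


section \<open>Controls, wealth and pay-off\<close>

text \<open>The wealth equation is posed for controls \<open>u\<close> depending on time and wealth, since perturbed
  controls depend on time; a control \<open>\<theta>\<close> of wealth only is the special case \<open>\<lambda>_. \<theta>\<close>.\<close>

definition admissible :: "(real \<Rightarrow> real) \<Rightarrow> bool" where
  "admissible \<theta> \<longleftrightarrow>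
     \<theta> \<in> borel_measurable (restrict_space borel {0<..}) \<and>
     (\<forall>x>0. 0 < \<theta> x) \<and>
     (\<exists>L. lipschitz_on L {0<..} (\<lambda>x. x * \<theta> x))"

definition perturbed :: "(real \<Rightarrow> real) \<Rightarrow> real \<Rightarrow> real \<Rightarrow> real \<Rightarrow> real \<Rightarrow> real \<Rightarrow> real" where
  "perturbed \<theta> t \<epsilon> \<eta> s y = (if t \<le> s \<and> s < t + \<epsilon> then \<eta> else \<theta> y)"

definition is_wealth ::
  "'w measure \<Rightarrow> (real \<Rightarrow> 'w \<Rightarrow> real) \<Rightarrow> real \<Rightarrow> real \<Rightarrow> real \<Rightarrow> real \<Rightarrow> (real \<Rightarrow> real \<Rightarrow> real)
     \<Rightarrow> (real \<Rightarrow> 'w \<Rightarrow> real) \<Rightarrow> bool" where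
  "is_wealth M W \<mu> \<sigma> t x u X \<longleftrightarrow>
     (\<forall>\<omega>\<in>space M. X t \<omega> = x \<and> continuous_on {t..} (\<lambda>r. X r \<omega>) \<and> (\<forall>r\<ge>t. 0 < X r \<omega>)) \<and>
     (\<forall>r\<ge>t. X r \<in> borel_measurable (brownian_filtration M W r)) \<and>
     (\<forall>r\<ge>t. AE \<omega> in M. set_integrable lborel {t..r} (\<lambda>s. \<mu> * u s (X s \<omega>) * X s \<omega>)) \<and>
     (\<exists>I. is_ito_integral M W t (\<lambda>s \<omega>. \<sigma> * u s (X s \<omega>) * X s \<omega>) I \<and>
          (\<forall>r\<ge>t. AE \<omega> in M.
             X r \<omega> = x + (LINT s:{t..r}|lborel. \<mu> * u s (X s \<omega>) * X s \<omega>) + I r \<omega>))"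

text \<open>For admissible controls and their perturbations the strong solution exists and is unique up
  to indistinguishability, so the choice below does not affect any expectation.\<close>

definition wealth ::
  "'w measure \<Rightarrow> (real \<Rightarrow> 'w \<Rightarrow> real) \<Rightarrow> real \<Rightarrow> real \<Rightarrow> real \<Rightarrow> real \<Rightarrow> (real \<Rightarrow> real \<Rightarrow> real)
     \<Rightarrow> real \<Rightarrow> 'w \<Rightarrow> real" where
  "wealth M W \<mu> \<sigma> t x u = (SOME X. is_wealth M W \<mu> \<sigma> t x u X)"

text \<open>\<open>Inf {} = \<infinity>\<close> in \<^typ>\<open>ereal\<close>.\<close>

definition exit_time :: "real set \<Rightarrow> real \<Rightarrow> (real \<Rightarrow> 'w \<Rightarrow> real) \<Rightarrow> 'w \<Rightarrow> ereal" where
  "exit_time C s X \<omega> = Inf {ereal r | r. s \<le> r \<and> X r \<omega> \<notin> C}"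

text \<open>The pay-off \<open>J(t,x;u,\<tau>)\<close>. The stopping rule \<open>\<tau>\<close> is a functional of the wealth process, so that
  \<open>exit_time C s\<close> below stands for the exit time of the process controlled by the same \<open>u\<close>. The
  reference level \<open>h x\<close> is frozen at the initial wealth.\<close>

definition payoff ::
  "'w measure \<Rightarrow> (real \<Rightarrow> 'w \<Rightarrow> real) \<Rightarrow> real \<Rightarrow> real \<Rightarrow> real \<Rightarrow> real \<Rightarrow> real \<Rightarrow> (real \<Rightarrow> real)
     \<Rightarrow> real \<Rightarrow> real \<Rightarrow> (real \<Rightarrow> real \<Rightarrow> real) \<Rightarrow> ((real \<Rightarrow> 'w \<Rightarrow> real) \<Rightarrow> 'w \<Rightarrow> ereal) \<Rightarrow> real" where
  "payoff M W \<mu> \<sigma> \<beta> a k h t x u \<tau> =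
     (let X = wealth M W \<mu> \<sigma> t x u in
      LINT \<omega>|completion M.
        (if \<tau> X \<omega> < \<infinity>
        then exp (- \<beta> * (real_of_ereal (\<tau> X \<omega>) - t))
               * (1 - exp (- a * (X (real_of_ereal (\<tau> X \<omega>)) \<omega> - h x - k)))
        else 0))"

definition equilibrium ::
  "'w measure \<Rightarrow> (real \<Rightarrow> 'w \<Rightarrow> real) \<Rightarrow> real \<Rightarrow> real \<Rightarrow> real \<Rightarrow> real \<Rightarrow> real \<Rightarrow> (real \<Rightarrow> real)
     \<Rightarrow> (real \<Rightarrow> real) \<Rightarrow> real set \<Rightarrow> bool" where
  "equilibrium M W \<mu> \<sigma> \<beta> a k h \<theta> C \<longleftrightarrow>
     (let J = payoff M W \<mu> \<sigma> \<beta> a k h in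
      admissible \<theta> \<and> open C \<and> C \<subseteq> {0<..} \<and>
      (\<forall>t\<ge>0. \<forall>x>0.
         1 - exp (- a * (x - h x - k)) \<le> J t x (\<lambda>_. \<theta>) (exit_time C t)) \<and>
      (\<forall>t\<ge>0. \<forall>x>0.
         Limsup (at_right 0) (\<lambda>\<epsilon>. ereal
           ((J t x (\<lambda>_. \<theta>) (exit_time C (t + \<epsilon>)) - J t x (\<lambda>_. \<theta>) (exit_time C t)) / \<epsilon>)) \<le> 0) \<and>
      (\<forall>t\<ge>0. \<forall>x\<in>C. \<forall>\<eta>>0.
         Limsup (at_right 0) (\<lambda>\<epsilon>. ereal
           ((J t x (perturbed \<theta> t \<epsilon> \<eta>) (exit_time C t) - J t x (\<lambda>_. \<theta>) (exit_time C t)) / \<epsilon>)) \<le> 0))"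

end

theory Submission
  imports Defs
begin

text \<open>With a constant control the wealth is a geometric Brownian motion, and the exponent \<open>\<alpha>\<close> and the
  control \<open>\<theta>\<^sup>*\<close> are matched so that \<open>exp (-\<beta> s) X\<^sub>s powr \<alpha>\<close> is a supermartingale under every constant or
  perturbed control and a martingale under \<open>\<theta>\<^sup>*\<close>. Optional stopping therefore evaluates the pay-off of
  the first exit from \<open>(0, x\<^sup>*)\<close> and bounds every perturbed pay-off started below \<open>x\<^sup>*\<close>. Above \<open>x\<^sup>*\<close> the
  gain from waiting is controlled to first order by a quartic majorant with explicit moments.

  The stopping inequality reduces to linear \<open>h\<close>, because a concave \<open>h\<close> lies above its chord, and then
  follows from the sign changes of two successive derivatives.

  To identify the chosen wealth process, the Ito sums of the explicit geometric Brownian motion are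
  shown to converge, and any two solutions are compared with the same Euler scheme by a discrete
  Gronwall argument.\<close>

section \<open>The stopping inequality\<close>

text \<open>The equation for \<open>xstar\<close> is smooth fit: at \<open>xstar\<close> both sides
  of the stopping inequality agree to first order. The sign nearby is therefore a second-order
  matter, and the slope bound on \<open>h'\<close> is what makes the decisive second derivative
  factor nonnegative at that point. The wealth in the pay-off is a \<open>SOME\<close> choice, so
  only the stochastic equation is known of it: its Ito integral is a limit in probability along
  simple integrands belonging to that one solution, and no moments are given. The L2 estimates for
  uniqueness are therefore made for truncated increments, where the truncation is inactive outside
  an event of small probability. Optional stopping is done on finite grids. Upper bounds reach the
  exit time by Fatou; the lower bound needs uniform integrability, taken from the discounted power 2
  * \<alpha>. A stopping rule delayed to time t + \<epsilon> may find the wealth above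
  \<open>xstar\<close> and stop there, so the power function has to dominate the reward beyond
  \<open>xstar\<close> as well. Measurability of the delayed reward is not established; its integral
  is bounded in a way that also covers a default value 0.\<close>

text \<open>The expression is the function \<open>P2\<close> of the next lemma; the point is that it
  can change sign only from minus to plus and back. Where the affine factor \<open>N\<close> is
  positive, its sign is that of \<open>Fn\<close> minus a constant, and the derivative of
  \<open>Fn\<close> is \<open>(q - Gn t) / N t\<close> with \<open>Gn\<close> nondecreasing, so
  \<open>Fn\<close> rises and then falls.\<close>

lemma quasiconcave_exp_powr:
  fixes q p \<alpha> C1 C2 y :: real
  assumes q: "q > 0" and p: "p \<ge> 0" and al: "0 < \<alpha>" "\<alpha> < 1" and C2: "C2 > 0" and C1: "C1 > 0"
    and xz: "0 < x" "x < z" "z < y"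
    and fx: "C1 * q * (q * x + \<alpha> - 1) - C2 * p * (exp x * x powr \<alpha> * (p * x + \<alpha> + 1)) \<ge> 0"
    and fy: "C1 * q * (q * y + \<alpha> - 1) - C2 * p * (exp y * y powr \<alpha> * (p * y + \<alpha> + 1)) \<ge> 0"
  shows "C1 * q * (q * z + \<alpha> - 1) - C2 * p * (exp z * z powr \<alpha> * (p * z + \<alpha> + 1)) \<ge> 0"
proof -
  define N where "N t = q * t + \<alpha> - 1" for t
  define Dn where "Dn t = exp t * t powr \<alpha> * (p * t + \<alpha> + 1)" for t
  have Dpos: "Dn t > 0" if "t > 0" for t
    unfolding Dn_def using that p al by (intro mult_pos_pos) (auto intro: add_nonneg_pos)
  have N0: "N x \<ge> 0"
  proof -
    have "0 \<le> C2 * p * Dn x" using C2 p Dpos[OF xz(1)] by simp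
    then have "0 \<le> C1 * q * N x" using fx unfolding N_def Dn_def by linarith
    then show ?thesis using C1 q by (smt (verit) mult_pos_neg mult_pos_pos)
  qed
  show ?thesis
  \<comment> \<open>Here the logarithms below degenerate. A zero of \<open>N\<close> at
    \<open>x\<close> forces \<open>p = 0\<close>, and with \<open>p = 0\<close> only the
    monotonicity of \<open>N\<close> is left to use.\<close>
  proof (cases "p = 0 \<or> N x = 0")
    case True
    then show ?thesis
    proof
      assume "p = 0"
      moreover have "N z \<ge> 0" using N0 q xz(2) mult_strict_left_mono[OF xz(2) q] unfolding N_def by linarith
      ultimately show ?thesis using C1 q unfolding N_def by simp
    next
      assume "N x = 0"
      then have "C2 * p * Dn x \<le> 0" using fx unfolding N_def Dn_def by simp
      then have "p = 0" using C2 p Dpos[OF xz(1)]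
        by (smt (verit) mult_pos_pos)
      moreover have "N z \<ge> 0" using N0 q xz(2) mult_strict_left_mono[OF xz(2) q] unfolding N_def by linarith
      ultimately show ?thesis using C1 q unfolding N_def by simp
    qed
  next
    case False
    then have pp: "p > 0" and Nx: "N x > 0" using p N0 by auto
    have Npos: "N t > 0" if "t \<ge> x" for t
      using Nx q that mult_left_mono[OF that less_imp_le[OF q]] unfolding N_def by linarith
    define Fn where "Fn t = ln (N t) - t - \<alpha> * ln t - ln (p * t + \<alpha> + 1)" for t
    define F' where "F' t = q / N t - 1 - \<alpha> / t - p / (p * t + \<alpha> + 1)" for t
    have dF: "(Fn has_real_derivative F' t) (at t)" if "t \<ge> x" for t
      unfolding Fn_def[abs_def] F'_def using that xz(1) Npos[OF that] pp al
      unfolding N_def by (auto intro!: derivative_eq_intros simp: add_pos_pos)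
    define Gn where "Gn t = N t * (1 + \<alpha> / t + p / (p * t + \<alpha> + 1))" for t
    have FG: "N t * F' t = q - Gn t" if "t \<ge> x" for t
      unfolding F'_def Gn_def using Npos[OF that] by (simp add: field_simps)
    have Gmono: "Gn s \<le> Gn t" if "x \<le> s" "s \<le> t" for s t
    proof -
      have s0: "s > 0" and t0: "t > 0" using that xz by auto
      \<comment> \<open>Partial fractions: every summand is nondecreasing in \<open>u\<close>,
        because the numerators \<open>1 - \<alpha>\<close> and
        \<open>q * (1 + \<alpha>) / p + 1 - \<alpha>\<close> are nonnegative.\<close>
      have G: "Gn u = N u + \<alpha> * (q - (1 - \<alpha>) / u) + (q - (q * (1 + \<alpha>) / p + 1 - \<alpha>) / (u + (1+\<alpha>)/p))" if "u > 0" for u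
      proof -
        have n0: "p * u + \<alpha> + 1 \<noteq> 0" "p * u + (1 + \<alpha>) \<noteq> 0" using that pp al by (smt (verit) mult_pos_pos)+
        have "p * N u / (p * u + \<alpha> + 1) = q - (q * (1 + \<alpha>) + p * (1 - \<alpha>)) / (p * u + \<alpha> + 1)"
          using n0 unfolding N_def by (simp add: field_simps)
        also have "(q * (1 + \<alpha>) + p * (1 - \<alpha>)) / (p * u + \<alpha> + 1) = (q * (1 + \<alpha>) / p + 1 - \<alpha>) / (u + (1+\<alpha>)/p)"
        proof -
          have "(q * (1 + \<alpha>) / p + 1 - \<alpha>) = (q * (1 + \<alpha>) + p * (1 - \<alpha>)) / p"
            and "(u + (1+\<alpha>)/p) = (p * u + \<alpha> + 1) / p" using pp by (auto simp: field_simps)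
          then show ?thesis using pp by simp
        qed
        finally have 1: "p * N u / (p * u + \<alpha> + 1) = q - (q * (1 + \<alpha>) / p + 1 - \<alpha>) / (u + (1+\<alpha>)/p)" .
        have 2: "\<alpha> * N u / u = \<alpha> * (q - (1 - \<alpha>) / u)" using that unfolding N_def by (simp add: field_simps)
        show ?thesis unfolding Gn_def using 1 2 by (simp add: algebra_simps)
      qed
      have a: "N s \<le> N t" unfolding N_def using q that by simp
      have b: "(1 - \<alpha>) / t \<le> (1 - \<alpha>) / s" using that s0 al by (intro divide_left_mono) auto
      have c: "(q * (1 + \<alpha>) / p + 1 - \<alpha>) / (t + (1+\<alpha>)/p) \<le> (q * (1 + \<alpha>) / p + 1 - \<alpha>) / (s + (1+\<alpha>)/p)"
      proof (rule divide_left_mono)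
        have "q * (1 + \<alpha>) / p \<ge> 0" using al q pp by simp
        then show "0 \<le> q * (1 + \<alpha>) / p + 1 - \<alpha>" using al by linarith
      qed (use that s0 t0 al pp in \<open>auto intro!: mult_pos_pos add_pos_pos\<close>)
      have b': "\<alpha> * (q - (1 - \<alpha>) / s) \<le> \<alpha> * (q - (1 - \<alpha>) / t)" using b al by (intro mult_left_mono) auto
      show ?thesis using G[OF s0] G[OF t0] a b' c by linarith
    qed
    have key: "C1 * q * N t - C2 * p * Dn t \<ge> 0 \<longleftrightarrow> Fn t \<ge> ln (C2 * p / (C1 * q))" if "t \<ge> x" for t
    proof -
      have t0: "t > 0" using that xz by simp
      have pt: "p * t + \<alpha> + 1 > 0" using pp t0 al by (smt (verit) mult_pos_pos)
      have "Fn t = ln (N t / Dn t)"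
        unfolding Fn_def Dn_def using Npos[OF that] t0 pt
        by (simp add: ln_div ln_mult ln_powr)
      then have "Fn t \<ge> ln (C2 * p / (C1 * q)) \<longleftrightarrow> C2 * p / (C1 * q) \<le> N t / Dn t"
        using Npos[OF that] Dpos[OF t0] C1 C2 q pp by simp
      also have "\<dots> \<longleftrightarrow> C1 * q * N t - C2 * p * Dn t \<ge> 0"
        using Dpos[OF t0] C1 C2 q pp by (simp add: field_simps)
      finally show ?thesis by simp
    qed
    have Fx: "Fn x \<ge> ln (C2 * p / (C1 * q))" using key[of x] fx unfolding N_def Dn_def by simp
    have Fy: "Fn y \<ge> ln (C2 * p / (C1 * q))" using key[of y] fy xz unfolding N_def Dn_def by simp
    \<comment> \<open>A dip at \<open>z\<close> would produce a negative slope at some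
      \<open>u < z\<close> and a positive slope at some \<open>v > z\<close>, that is
      \<open>Gn v < q < Gn u\<close>, against monotonicity.\<close>
    have "Fn z \<ge> ln (C2 * p / (C1 * q))"
    proof (rule ccontr)
      assume neg: "\<not> ?thesis"
      obtain u where u: "x < u" "u < z" "Fn z - Fn x = (z - x) * F' u"
        using MVT2[of x z Fn F'] dF xz by auto
      obtain v where v: "z < v" "v < y" "Fn y - Fn z = (y - z) * F' v"
        using MVT2[of z y Fn F'] dF xz by auto
      have "(z - x) * F' u < 0" using u neg Fx by linarith
      then have "F' u < 0" using xz by (simp add: mult_less_0_iff)
      then have "N u * F' u < 0" using Npos[of u] u by (simp add: mult_less_0_iff)
      then have 1: "q < Gn u" using FG[of u] u by simp
      have "(y - z) * F' v > 0" using v neg Fy by linarith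
      then have "F' v > 0" using xz by (simp add: zero_less_mult_iff)
      then have "N v * F' v > 0" using Npos[of v] v xz by (simp add: zero_less_mult_iff)
      then have 2: "Gn v < q" using FG[of v] v xz by simp
      have "Gn u \<le> Gn v" using Gmono[of u v] u v by simp
      then show False using 1 2 by simp
    qed
    then show ?thesis using key[of z] xz unfolding N_def Dn_def by simp
  qed
qed

text \<open>The case of linear \<open>h\<close> with slope \<open>p\<close>, in the units \<open>a = 1\<close>, \<open>y = a * xstar\<close>.\<close>

lemma stopping_inequality_linear:
  fixes q p \<alpha> y K x :: real
  assumes al: "0 < \<alpha>" "\<alpha> < 1" and p: "p \<ge> 0" "p < 1" and y: "y > 0"
    and slope: "p \<le> (y + \<alpha> - 1) / (2 * (y + \<alpha>))"
    and orig: "\<alpha> * exp ((1 - p) * y) \<ge> y + \<alpha>"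
    and x: "0 < x" "x < y"
  shows "\<alpha> * exp ((1 - p) * (y - x)) - \<alpha> * exp (- p * (y - x)) * (x / y) powr \<alpha> \<ge> (y + \<alpha>) * (1 - (x / y) powr \<alpha>)"
proof -
  define q where "q = 1 - p"
  define C1 where "C1 = \<alpha> * exp (q * y)"
  define C2 where "C2 = \<alpha> * exp (- p * y) * y powr (- \<alpha>)"
  define C3 where "C3 = y + \<alpha>"
  define C4 where "C4 = (y + \<alpha>) * y powr (- \<alpha>)"
  have q: "q > 0" and C1: "C1 > 0" and C2: "C2 > 0" using p al y by (auto simp: q_def C1_def C2_def)
  \<comment> \<open>\<open>R t * t powr \<alpha>\<close> is the left side minus the right side of
    the claim at \<open>t\<close>. Stripping a positive power of \<open>t\<close> from
    \<open>R'\<close> gives \<open>P1\<close>, and stripping an exponential from \<open>P1'\<close>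
    gives \<open>P2\<close>, whose sign pattern is known from the previous lemma.\<close>
  define P1 where "P1 t = - C1 * exp (- q * t) * (q * t + \<alpha>) + \<alpha> * C3 - C2 * p * exp (p * t) * t powr (\<alpha> + 1)" for t
  define P2 where "P2 t = C1 * q * (q * t + \<alpha> - 1) - C2 * p * (exp t * t powr \<alpha> * (p * t + \<alpha> + 1))" for t
  define R where "R t = C1 * exp (- q * t) * t powr (- \<alpha>) - C3 * t powr (- \<alpha>) - C2 * exp (p * t) + C4" for t
  have dP1: "(P1 has_real_derivative exp (- q * t) * P2 t) (at t)" if "t > 0" for t
  proof -
    have e: "exp (p * t) = exp (- q * t) * exp t" unfolding q_def by (simp add: exp_add [symmetric] algebra_simps)
    have w: "t powr (\<alpha> + 1) = t * t powr \<alpha>" using that by (simp add: powr_add)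
    have d: "((\<lambda>t. t powr (\<alpha> + 1)) has_real_derivative (\<alpha> + 1) * t powr \<alpha>) (at t)"
      using has_real_derivative_powr[OF that, of "\<alpha> + 1"] by simp
    have "(P1 has_real_derivative C1 * q * exp (- q * t) * (q * t + \<alpha>) - C1 * exp (- q * t) * q
        - C2 * p * (p * exp (p * t) * t powr (\<alpha> + 1) + exp (p * t) * ((\<alpha> + 1) * t powr \<alpha>))) (at t)"
      unfolding P1_def[abs_def] using that by (auto intro!: derivative_eq_intros d simp: algebra_simps)
    also have "C1 * q * exp (- q * t) * (q * t + \<alpha>) - C1 * exp (- q * t) * q
        - C2 * p * (p * exp (p * t) * t powr (\<alpha> + 1) + exp (p * t) * ((\<alpha> + 1) * t powr \<alpha>)) = exp (- q * t) * P2 t"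
      unfolding P2_def w e by (simp add: algebra_simps)
    finally show ?thesis .
  qed
  have dR: "(R has_real_derivative t powr (- \<alpha> - 1) * P1 t) (at t)" if "t > 0" for t
  proof -
    have w: "t powr (\<alpha> + 1) * t powr (- \<alpha> - 1) = 1" "t powr (- \<alpha>) = t * t powr (- \<alpha> - 1)"
      using that by (auto simp: powr_add[symmetric] powr_mult_base)
    have d: "((\<lambda>t. t powr (- \<alpha>)) has_real_derivative (- \<alpha>) * t powr (- \<alpha> - 1)) (at t)"
      using has_real_derivative_powr[OF that, of "- \<alpha>"] by simp
    have "(R has_real_derivative - (C1 * q * exp (- q * t) * t powr (- \<alpha>)) - C1 * exp (- q * t) * \<alpha> * t powr (- \<alpha> - 1)
        + C3 * \<alpha> * t powr (- \<alpha> - 1) - C2 * p * exp (p * t)) (at t)"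
      unfolding R_def[abs_def] using that by (auto intro!: derivative_eq_intros d simp: algebra_simps)
    also have "- (C1 * q * exp (- q * t) * t powr (- \<alpha>)) - C1 * exp (- q * t) * \<alpha> * t powr (- \<alpha> - 1)
        + C3 * \<alpha> * t powr (- \<alpha> - 1) - C2 * p * exp (p * t) 
      = t powr (- \<alpha> - 1) * (- C1 * exp (- q * t) * (q * t + \<alpha>) + \<alpha> * C3) - C2 * p * exp (p * t) * (t powr (\<alpha> + 1) * t
        powr (- \<alpha> - 1))"
      unfolding w by (simp add: algebra_simps)
    also have "\<dots> = t powr (- \<alpha> - 1) * P1 t" unfolding P1_def by (simp add: algebra_simps)
    finally show ?thesis .
  qed
  \<comment> \<open>Smooth fit: \<open>R\<close> and its derivative both vanish at
    \<open>y\<close>.\<close>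
  have P1y: "P1 y = 0"
  proof -
    have "y powr (- \<alpha>) * y powr (\<alpha> + 1) = y" using y by (simp add: powr_add[symmetric])
    moreover have "exp (q * y) * exp (- (q * y)) = 1" "exp (-p * y) * exp (p * y) = 1"
      by (simp_all add: exp_add [symmetric])
    ultimately have "P1 y = - \<alpha> * (q * y + \<alpha>) + \<alpha> * (y + \<alpha>) - \<alpha> * p * y"
      unfolding P1_def C1_def C2_def C3_def by (simp add: mult.assoc mult.left_commute[of "exp _"])
    then show ?thesis unfolding q_def by (simp add: algebra_simps)
  qed
  \<comment> \<open>Up to a positive factor \<open>P2 y\<close> is
    \<open>y + \<alpha> - 1 - 2 * p * (y + \<alpha>)\<close>, so this is the slope bound
    rewritten.\<close>
  have P2y: "P2 y \<ge> 0"
  proof -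
    have e: "exp (- p * y) * exp y = exp (q * y)" unfolding q_def by (simp add: exp_add [symmetric] algebra_simps)
    have w: "y powr (- \<alpha>) * y powr \<alpha> = 1" using y by (simp add: powr_add[symmetric])
    have "P2 y = \<alpha> * exp (q * y) * q * (q * y + \<alpha> - 1)
      - \<alpha> * p * ((exp (- p * y) * exp y) * (y powr (- \<alpha>) * y powr \<alpha>) * (p * y + \<alpha> + 1))"
      unfolding P2_def C1_def C2_def by (simp add: algebra_simps)
    also have "\<dots> = \<alpha> * exp (q * y) * (q * (q * y + \<alpha> - 1) - p * (p * y + \<alpha> + 1))"
      unfolding e w by (simp add: algebra_simps)
    also have "q * (q * y + \<alpha> - 1) - p * (p * y + \<alpha> + 1) = y + \<alpha> - 1 - 2 * p * (y + \<alpha>)"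
      unfolding q_def by (simp add: algebra_simps)
    finally have P2: "P2 y = \<alpha> * exp (q * y) * (y + \<alpha> - 1 - 2 * p * (y + \<alpha>))" .
    have "p * (2 * (y + \<alpha>)) \<le> (y + \<alpha> - 1)" using slope y al by (simp add: field_simps)
    then have "0 \<le> y + \<alpha> - 1 - 2 * p * (y + \<alpha>)" by linarith
    then have "0 \<le> \<alpha> * exp (q * y) * (y + \<alpha> - 1 - 2 * p * (y + \<alpha>))" using al by simp
    then show ?thesis using P2 by simp
  qed
  \<comment> \<open>On \<open>(0, y]\<close> the set where \<open>P2\<close> is nonnegative is an
    interval ending at \<open>y\<close>. If \<open>t\<close> belongs to it, \<open>P1\<close>
    increases from \<open>t\<close> to its zero at \<open>y\<close>. Otherwise \<open>P2\<close> is
    nonpositive up to \<open>t\<close>, and \<open>P1\<close> decreases from \<open>P1 0\<close>,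
    which is nonpositive by \<open>orig\<close>.\<close>
  have P1neg: "P1 t \<le> 0" if t: "0 < t" "t < y" for t
  proof (cases "P2 t \<ge> 0")
    case True
    have "P1 t \<le> P1 y"
    proof (rule DERIV_nonneg_imp_nondecreasing[of t y P1])
      show "t \<le> y" using t by simp
      fix s assume s: "t \<le> s" "s \<le> y"
      have "P2 s \<ge> 0"
      proof (cases "s = t \<or> s = y")
        case False
        then show ?thesis
          using quasiconcave_exp_powr[OF q p(1) al C2 C1 t(1), of s y] s True P2y unfolding P2_def by simp
      qed (use True P2y in auto)
      then show "\<exists>d. (P1 has_real_derivative d) (at s) \<and> d \<ge> 0"
        using dP1[of s] s t by (intro exI[of _ "exp (- q * s) * P2 s"]) auto
    qed
    then show ?thesis using P1y by simp
  next
    case False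
    have neg: "P2 s \<le> 0" if "0 < s" "s \<le> t" for s
    proof (rule ccontr)
      assume "\<not> P2 s \<le> 0"
      then have "P2 t \<ge> 0" if "s \<noteq> t"
        using quasiconcave_exp_powr[OF q p(1) al C2 C1 \<open>0 < s\<close>, of t y] t P2y \<open>s \<le> t\<close> that unfolding P2_def by simp
      then show False using False \<open>\<not> P2 s \<le> 0\<close> by (cases "s = t") auto
    qed
    have "P1 t \<le> P1 0"
    proof (rule DERIV_nonpos_imp_decreasing_open[of 0 t P1])
      show "0 \<le> t" using t by simp
      show "\<exists>d. (P1 has_real_derivative d) (at s) \<and> d \<le> 0" if "0 < s" "s < t" for s
        using dP1[of s] neg[of s] that by (intro exI[of _ "exp (- q * s) * P2 s"]) (auto simp: mult_le_0_iff)
      have "continuous_on {0..t} (\<lambda>s. s powr (\<alpha> + 1))"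
        using al by (intro continuous_on_powr' continuous_on_id continuous_on_const) auto
      then show "continuous_on {0..t} P1"
        unfolding P1_def[abs_def]
          by (intro continuous_on_add continuous_on_diff continuous_on_mult continuous_on_const
          continuous_on_minus continuous_on_exp continuous_on_id)
    qed
    also have "P1 0 = - \<alpha> * (C1 - C3)" unfolding P1_def using al by (simp add: algebra_simps)
    also have "\<dots> \<le> 0" using orig al unfolding C1_def C3_def q_def by simp
    finally show ?thesis .
  qed
  have "R y \<le> R x"
  proof (rule DERIV_nonpos_imp_nonincreasing[of x y R])
    show "x \<le> y" using x by simp
    fix s assume s: "x \<le> s" "s \<le> y"
    have "P1 s \<le> 0" using P1neg[of s] P1y s x by (cases "s = y") auto
    then show "\<exists>d. (R has_real_derivative d) (at s) \<and> d \<le> 0"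
      using dR[of s] s x by (intro exI[of _ "s powr (- \<alpha> - 1) * P1 s"]) (auto simp: mult_le_0_iff)
  qed
  moreover have "R y = 0"
  proof -
    have e: "exp (q * y) * exp (- q * y) = 1" "exp (-p * y) * exp (p * y) = 1" by (simp_all add: exp_add [symmetric])
    have "R y = \<alpha> * (exp (q * y) * exp (- q * y)) * y powr (-\<alpha>) - C3 * y powr (-\<alpha>)
        - \<alpha> * (exp (-p * y) * exp (p * y)) * y powr (-\<alpha>) + C4"
      unfolding R_def C1_def C2_def by (simp only: mult_ac)
    then show ?thesis unfolding e unfolding C3_def C4_def by simp
  qed
  ultimately have Rx: "0 \<le> R x * x powr \<alpha>" by simp
  have w: "x powr (-\<alpha>) * x powr \<alpha> = 1" using x by (simp add: powr_add[symmetric])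
  have xy: "(x / y) powr \<alpha> = x powr \<alpha> * y powr (-\<alpha>)" using x y by (simp add: powr_divide powr_minus_divide)
  have "R x * x powr \<alpha> = C1 * exp (- q * x) * (x powr (-\<alpha>) * x powr \<alpha>) - C3 * (x powr (-\<alpha>) * x powr \<alpha>)
     - C2 * exp (p * x) * x powr \<alpha> + C4 * x powr \<alpha>" unfolding R_def by (simp add: algebra_simps)
  also have "\<dots> = C1 * exp (- q * x) - C3 - C2 * exp (p * x) * x powr \<alpha> + C4 * x powr \<alpha>" unfolding w by simp
  also have "C1 * exp (- q * x) = \<alpha> * exp (q * (y - x))"
  proof -
    have "exp (q * (y - x)) = exp (q * y) * exp (- q * x)" by (simp add: exp_add[symmetric] right_diff_distrib)
    then show ?thesis unfolding C1_def by simp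
  qed
  also have "C2 * exp (p * x) * x powr \<alpha> = \<alpha> * exp (- p * (y - x)) * (x / y) powr \<alpha>"
  proof -
    have "exp (- p * (y - x)) = exp (- p * y) * exp (p * x)" by (simp add: exp_add[symmetric] right_diff_distrib)
    then show ?thesis unfolding C2_def xy by simp
  qed
  also have "C4 * x powr \<alpha> = (y + \<alpha>) * (x / y) powr \<alpha>" unfolding C4_def xy by simp
  finally have "R x * x powr \<alpha> = \<alpha> * exp (q * (y - x)) - C3 - \<alpha> * exp (- p * (y - x)) * (x / y) powr \<alpha>
    + (y + \<alpha>) * (x / y) powr \<alpha>" .
  moreover have "(y + \<alpha>) * (1 - (x / y) powr \<alpha>) = C3 - (y + \<alpha>) * (x / y) powr \<alpha>"
    unfolding C3_def by (simp add: right_diff_distrib)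
  ultimately show ?thesis using Rx unfolding q_def by linarith
qed

lemma exp_mult_exp_eq: "x + y = z \<Longrightarrow> exp x * exp y = exp (z :: real)"
  by (simp add: exp_add[symmetric])

text \<open>A threshold solves \<open>\<alpha> * exp y / (y + \<alpha>) = exp cost\<close>, and the
  benchmark term \<open>H\<close> raises the cost. The left side is not monotone: it starts at 1,
  falls until \<open>1 - \<alpha>\<close> and then rises. A positive cost excludes the falling part
  for \<open>y\<close>, and on the rising part the larger cost has the larger solution.\<close>

lemma threshold_ge:
  fixes y y0 \<alpha> c H :: real
  assumes al: "0 < \<alpha>" "\<alpha> < 1" and c: "c > 0" and H: "H \<ge> 0" and y: "y > 0"
    and eq: "\<alpha> = (y + \<alpha>) * exp (- (y - H - c))"
    and eq0: "\<alpha> = (y0 + \<alpha>) * exp (- (y0 - c))"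
  shows "y \<ge> y0"
proof (rule ccontr)
  assume "\<not> y \<ge> y0"
  then have d: "y0 - y > 0" by simp
  have e1: "\<alpha> * exp y = (y + \<alpha>) * exp (H + c)"
  proof -
    have "\<alpha> * exp y = (y + \<alpha>) * (exp (- (y - H - c)) * exp y)" using eq by (metis mult.assoc)
    also have "exp (- (y - H - c)) * exp y = exp (H + c)" by (intro exp_mult_exp_eq) simp
    finally show ?thesis .
  qed
  have e0: "\<alpha> * exp y0 = (y0 + \<alpha>) * exp c"
  proof -
    have "\<alpha> * exp y0 = (y0 + \<alpha>) * (exp (- (y0 - c)) * exp y0)" using eq0 by (metis mult.assoc)
    then show ?thesis by (simp add: exp_add[symmetric])
  qed
  show False
  proof (cases "y < 1 - \<alpha>")
    case True
    have "exp (H + c) > 1" using H c by simp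
    then have "(y + \<alpha>) < \<alpha> * exp y" unfolding e1 using y al by simp
    moreover have "exp y * (1 - y) \<le> 1"
    proof -
      have "1 - y \<le> exp (- y)" using exp_ge_add_one_self[of "- y"] by simp
      then have "exp y * (1 - y) \<le> exp y * exp (- y)" by (intro mult_left_mono) auto
      then show ?thesis by (simp add: exp_add[symmetric])
    qed
    ultimately have "(y + \<alpha>) * (1 - y) < \<alpha> * exp y * (1 - y)" "\<alpha> * (exp y * (1 - y)) \<le> \<alpha> * 1"
      using True al by (auto intro!: mult_strict_right_mono mult_left_mono)
    then have "(y + \<alpha>) * (1 - y) < \<alpha>" by (simp add: mult.assoc)
    then have "y * (1 - \<alpha> - y) < 0" by (simp add: algebra_simps)
    then show False using y True by (simp add: mult_less_0_iff)
  next
    case False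
    define d where "d = y0 - y"
    have d: "d > 0" using \<open>y0 - y > 0\<close> unfolding d_def .
    \<comment> \<open>The two threshold equations divided by each other. Since
      \<open>y + \<alpha> \<ge> 1\<close>, the quadratic lower bound of \<open>exp d\<close> already
      exceeds what this inequality allows.\<close>
    have "(y + \<alpha>) * exp d \<le> y + d + \<alpha>"
    proof -
      have "(y + \<alpha>) * exp c * exp y0 \<le> (y + \<alpha>) * exp (H + c) * exp y0"
        using y al H by simp
      also have "\<dots> = (\<alpha> * exp y0) * exp y" unfolding e1[symmetric] by simp
      also have "\<dots> = (y0 + \<alpha>) * exp c * exp y" unfolding e0 by simp
      finally have "(y + \<alpha>) * exp y0 \<le> (y0 + \<alpha>) * exp y"
        by (simp add: mult.assoc mult.left_commute[of _ "exp c"])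
      moreover have "exp y0 = exp d * exp y" unfolding d_def by (simp add: exp_add[symmetric])
      ultimately have "((y + \<alpha>) * exp d) * exp y \<le> (y0 + \<alpha>) * exp y" by simp
      then show ?thesis unfolding d_def by simp
    qed
    moreover have "(y + \<alpha>) * (1 + d + d\<^sup>2 / 2) \<le> (y + \<alpha>) * exp d"
      using exp_lower_Taylor_quadratic[of d] d y al by (intro mult_left_mono) auto
    moreover have "(y + \<alpha>) * (d + d\<^sup>2 / 2) \<ge> 1 * (d + d\<^sup>2 / 2)"
      using False d by (intro mult_right_mono) auto
    moreover have "d\<^sup>2 > 0" using d by simp
    ultimately show False by (simp add: distrib_left)
  qed
qed

text \<open>With the threshold equation inserted the claim reads
  \<open>1 - s \<le> exp (a * h x) * (E * (exp v - s))\<close>. Because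
  \<open>exp v \<ge> 1 \<ge> s\<close>, the right side grows with \<open>h x\<close>, so a lower
  bound for \<open>h x\<close> suffices. The chord from 0 to \<open>xstar\<close> has the same value
  at \<open>xstar\<close>, hence the same threshold.\<close>

lemma stopping_inequality:
  fixes a k \<alpha> xstar y0 b :: real and h h' h'' :: "real \<Rightarrow> real"
  assumes pos: "a > 0" "k > 0" and al: "0 < \<alpha>" "\<alpha> < 1"
    and h_incr: "mono_on {0..} h" and h_zero: "h 0 = 0"
    and h_deriv: "\<And>x. x \<ge> 0 \<Longrightarrow> (h has_real_derivative h' x) (at x within {0..})"
    and h_deriv2: "\<And>x. x \<ge> 0 \<Longrightarrow> (h' has_real_derivative h'' x) (at x within {0..})"
    and xs: "xstar > 0" "\<alpha> = (a * xstar + \<alpha>) * exp (- a * (xstar - h xstar - k))"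
    and h_concave: "\<And>x. 0 < x \<Longrightarrow> x < xstar \<Longrightarrow> h'' x \<le> 0"
    and h_slope: "\<And>x. 0 < x \<Longrightarrow> x < xstar \<Longrightarrow> h' x \<le> (a * xstar + \<alpha> - 1) / (2 * (a * xstar + \<alpha>))"
    and x: "0 < x" "x < xstar"
  shows "(x / xstar) powr \<alpha> * (1 - exp (- a * (xstar - h x - k))) \<ge> 1 - exp (- a * (x - h x - k))"
proof -
  define p where "p = h xstar / xstar"
  define y where "y = a * xstar"
  define s where "s = (x / xstar) powr \<alpha>"
  have y: "y > 0" unfolding y_def using pos xs by simp
  have hd: "(h has_real_derivative h' t) (at t)" and hd2: "(h' has_real_derivative h'' t) (at t)" if "t > 0" for t
    using h_deriv[of t] h_deriv2[of t] that by (simp_all add: at_within_interior[of t "{0..}"])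
  have hcont: "continuous_on {0..} h"
    by (rule DERIV_continuous_on[where D = h']) (use h_deriv in auto)
  have MVh: "\<exists>z>u. z < v \<and> h v - h u = (v - u) * h' z" if "0 \<le> u" "u < v" for u v
  proof -
    have "continuous_on {u..v} h" using hcont that by (rule_tac continuous_on_subset) auto
    moreover have "h differentiable (at t)" if "u < t" for t
      using hd[of t] that \<open>0 \<le> u\<close> unfolding real_differentiable_def by auto
    ultimately obtain l z where "u < z" "z < v" "(h has_real_derivative l) (at z)" "h v - h u = (v - u) * l"
      using MVT[of u v h] \<open>u < v\<close> by blast
    moreover have "l = h' z" using calculation hd[of z] that DERIV_unique by (metis le_less_trans)
    ultimately show ?thesis by auto
  qed
  have anti: "h' v \<le> h' u" if "0 < u" "u \<le> v" "v < xstar" for u v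
    by (rule DERIV_nonpos_imp_nonincreasing[of u v h'])
      (use that hd2 h_concave in \<open>force+\<close>)
  have p0: "p \<ge> 0" unfolding p_def using xs h_zero mono_onD[OF h_incr, of 0 xstar] by simp
  \<comment> \<open>The chord slope is a value of \<open>h'\<close> inside the interval, so it
    inherits the pointwise slope bound.\<close>
  obtain \<xi> where xi: "0 < \<xi>" "\<xi> < xstar" "h xstar = xstar * h' \<xi>"
    using MVh[of 0 xstar] xs h_zero by auto
  then have "p = h' \<xi>" unfolding p_def using xs by simp
  then have pb: "p \<le> (y + \<alpha> - 1) / (2 * (y + \<alpha>))" using h_slope[of \<xi>] xi unfolding y_def by simp
  also have "\<dots> < 1" using y al by (simp add: field_simps)
  finally have p1: "p < 1" .
  have hx: "h x \<ge> p * x"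
  proof (rule ccontr)
    assume neg: "\<not> ?thesis"
    obtain u where u: "0 < u" "u < x" "h x = x * h' u" using MVh[of 0 x] x h_zero by auto
    obtain v where v: "x < v" "v < xstar" "h xstar - h x = (xstar - x) * h' v" using MVh[of x xstar] x by auto
    have "x * h' u < x * p" using neg u by (simp add: mult.commute)
    then have 1: "h' u < p" using x by simp
    have "h xstar = p * xstar" unfolding p_def using xs by simp
    then have "(xstar - x) * h' v > (xstar - x) * p" using neg v by (simp add: algebra_simps)
    then have 2: "h' v > p" using x by simp
    have "h' v \<le> h' u" using anti[of u v] u v by simp
    then show False using 1 2 by simp
  qed
  have ky: "a * h xstar = p * y" unfolding p_def y_def using xs by simp
  define E where "E = exp (- (y - a * k))"
  have eE: "(y + \<alpha>) * (E * exp (p * y)) = \<alpha>"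
  proof -
    have "\<alpha> = (y + \<alpha>) * exp (- (y - p * y - a * k))"
    proof -
      have e: "- (y - p * y - a * k) = - a * (xstar - h xstar - k)"
        using ky unfolding y_def by (auto simp: algebra_simps)
      show ?thesis unfolding e using xs(2) unfolding y_def .
    qed
    moreover have "exp (- (y - p * y - a * k)) = E * exp (p * y)" unfolding E_def by (simp add: exp_add[symmetric])
    ultimately show ?thesis by simp
  qed
  \<comment> \<open>By the threshold equation the left side equals
    \<open>(y + \<alpha>) * exp (a * k)\<close>; the claim expresses that the fixed cost is not
    negative.\<close>
  have orig: "\<alpha> * exp ((1 - p) * y) \<ge> y + \<alpha>"
  proof -
    have "\<alpha> * exp ((1 - p) * y) = (y + \<alpha>) * (E * exp (p * y) * exp ((1 - p) * y))"
      using eE by (metis mult.assoc)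
    also have "E * exp (p * y) * exp ((1 - p) * y) = exp (a * k)" unfolding E_def
      by (simp add: exp_add[symmetric] left_diff_distrib)
    also have "(y + \<alpha>) * exp (a * k) \<ge> (y + \<alpha>) * 1" using y al pos by (intro mult_left_mono) auto
    finally show ?thesis by simp
  qed
  have sy: "(a * x / y) = x / xstar" unfolding y_def using pos by simp
  define v where "v = y - a * x"
  have v: "v > 0" unfolding v_def y_def using x pos by simp
  have lin: "\<alpha> * exp ((1 - p) * v) - \<alpha> * exp (- p * v) * s \<ge> (y + \<alpha>) * (1 - s)"
    using stopping_inequality_linear[OF al p0 p1 y pb orig, of "a * x"] x pos unfolding sy s_def[symmetric] v_def
    by (simp add: y_def)
  have s1: "s \<le> 1" unfolding s_def using x al by (intro powr_le1) auto
  have es: "exp v - s \<ge> 0" using s1 one_le_exp_iff[of v] v by linarith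
  have "(y + \<alpha>) * (exp (p * a * x) * (E * (exp v - s))) = \<alpha> * exp ((1 - p) * v) - \<alpha> * exp (- p * v) * s"
  proof -
    have "exp (p * a * x) = exp (p * y) * exp (- p * v)"
      unfolding v_def by (intro exp_mult_exp_eq[symmetric]) (simp add: algebra_simps)
    then have "(y + \<alpha>) * (exp (p * a * x) * (E * (exp v - s)))
      = ((y + \<alpha>) * (E * exp (p * y))) * (exp (- p * v) * (exp v - s))" by simp
    also have "\<dots> = \<alpha> * (exp (- p * v) * exp v) - \<alpha> * exp (- p * v) * s" unfolding eE by (simp add: algebra_simps)
    also have "exp (- p * v) * exp v = exp ((1 - p) * v)" by (simp add: exp_add[symmetric] left_diff_distrib)
    finally show ?thesis .
  qed
  then have "(y + \<alpha>) * (1 - s) \<le> (y + \<alpha>) * (exp (p * a * x) * (E * (exp v - s)))" using lin by simp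
  then have "1 - s \<le> exp (p * a * x) * (E * (exp v - s))" using y al by simp
  also have "\<dots> \<le> exp (a * h x) * (E * (exp v - s))"
    using hx pos es unfolding E_def by (intro mult_right_mono) (auto simp: mult.assoc mult.left_commute)
  also have "\<dots> = exp (a * h x) * E * exp v - s * (exp (a * h x) * E)" by (simp add: algebra_simps)
  also have "exp (a * h x) * E * exp v = exp (- a * (x - h x - k))"
    unfolding E_def v_def exp_add[symmetric] by (intro arg_cong[where f = exp]) (simp add: algebra_simps)
  also have "exp (a * h x) * E = exp (- a * (xstar - h x - k))"
    unfolding E_def y_def exp_add[symmetric] by (intro arg_cong[where f = exp]) (simp add: algebra_simps)
  finally show ?thesis unfolding s_def[symmetric] by (simp add: algebra_simps)
qed

section \<open>Independence and moments of Brownian increments\<close>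

text \<open>Independence of Brownian increments is given along monotone sequences of times. Finitely
  many observation times up to \<open>s\<close> are sorted into one such sequence, whose last two
  points are \<open>s\<close> and \<open>r\<close>, so that the future increment becomes a single
  separate coordinate.\<close>

lemma sorted_grid:
  fixes I :: "real set" and s r :: real
  assumes "finite I" "I \<subseteq> {0..s}" "0 \<le> s" "s \<le> r"
  obtains p :: "nat \<Rightarrow> real" and n where "p 0 = 0" "mono p" "p (Suc n) = s" "p (Suc (Suc n)) = r"
    "\<And>u. u \<in> I \<Longrightarrow> \<exists>k\<le>n. p k = u"
proof -
  define xs where "xs = sorted_list_of_set I"
  define n where "n = length xs"
  define p where "p k = (if k = 0 then 0 else if k \<le> n then xs ! (k - 1) else if k = Suc n then s else r)" for k
  have xs: "sorted xs" "set xs = I" using assms(1) unfolding xs_def by auto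
  have nth: "xs ! i \<in> {0..s}" if "i < n" for i using that xs assms(2) unfolding n_def by (metis nth_mem subsetD)
  have "mono p"
  proof (rule mono_iff_le_Suc[THEN iffD2], rule allI)
    fix k show "p k \<le> p (Suc k)"
    proof (cases "k = 0")
      case True
      then show ?thesis unfolding p_def using nth[of 0] assms by auto
    next
      case False
      consider "Suc k \<le> n" | "k = n" | "k > n" by linarith
      then show ?thesis
      proof cases
        case 1
        then show ?thesis using False xs(1) sorted_nth_mono[of xs "k - 1" k] unfolding p_def n_def by auto
      next
        case 2
        then show ?thesis using False nth[of "k - 1"] unfolding p_def by auto
      next
        case 3
        then show ?thesis using assms unfolding p_def by auto
      qed
    qed
  qed
  moreover have "\<exists>k\<le>n. p k = u" if "u \<in> I" for u
  proof -
    have "u \<in> set xs" using that xs(2) by simp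
    then obtain i where "i < n" "xs ! i = u" unfolding n_def in_set_conv_nth by blast
    then have "p (Suc i) = u" "Suc i \<le> n" unfolding p_def by auto
    then show ?thesis by blast
  qed
  ultimately show thesis by (intro that[of p n]) (auto simp: p_def)
qed

locale brownian =
  fixes M :: "'w measure" and W :: "real \<Rightarrow> 'w \<Rightarrow> real"
  assumes bm: "brownian_motion M W"
begin

abbreviation "P \<equiv> completion M"
abbreviation "F \<equiv> brownian_filtration M W"

sublocale base: prob_space M using bm unfolding brownian_motion_def by blast

sublocale prob_space P
proof
  show "emeasure P (space P) = 1" using base.emeasure_space_1 by simp
qed

lemma W_meas_M: "0 \<le> s \<Longrightarrow> W s \<in> borel_measurable M"
  using bm unfolding brownian_motion_def by blast

lemma W_meas_P [measurable]: "0 \<le> s \<Longrightarrow> W s \<in> borel_measurable P"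
  using W_meas_M by (rule measurable_completion)

lemma W_0: "AE \<omega> in M. W 0 \<omega> = 0"
  using bm unfolding brownian_motion_def by blast

lemma W_cont: "AE \<omega> in M. continuous_on {0..} (\<lambda>t. W t \<omega>)"
  using bm unfolding brownian_motion_def by blast

lemma W_distr: "0 \<le> s \<Longrightarrow> s < t \<Longrightarrow> distributed M lborel (\<lambda>\<omega>. W t \<omega>
  - W s \<omega>) (\<lambda>z. ennreal (normal_density 0 (sqrt (t - s)) z))"
  using bm unfolding brownian_motion_def by blast

definition filt_gen :: "real \<Rightarrow> 'w set set" where
  "filt_gen r = {W s -` A \<inter> space M | s A. 0 \<le> s \<and> s \<le> r \<and> A \<in> sets borel} \<union> null_sets P"

lemma filt_gen_sets: "filt_gen r \<subseteq> sets P"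
proof -
  have "W s -` A \<inter> space M \<in> sets P" if "0 \<le> s" "A \<in> sets borel" for s A
    using measurable_sets[OF W_meas_P[OF that(1)] that(2)] by simp
  then show ?thesis unfolding filt_gen_def by auto
qed

lemma filt_gen_Pow: "filt_gen r \<subseteq> Pow (space M)"
  using filt_gen_sets sets.space_closed by force

lemma F_eq: "F r = sigma (space M) (filt_gen r)"
  unfolding brownian_filtration_def filt_gen_def ..

lemma space_F [simp]: "space (F r) = space M"
  unfolding F_eq using filt_gen_Pow by (rule space_measure_of)

lemma sets_F: "sets (F r) = sigma_sets (space M) (filt_gen r)"
  unfolding F_eq using filt_gen_Pow by (rule sets_measure_of)

lemma F_sub_P: "sets (F r) \<subseteq> sets P"
  unfolding sets_F using sets.sigma_sets_subset[OF filt_gen_sets] by simp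

lemma F_mono_sets:
  assumes "r \<le> r'" shows "sets (F r) \<subseteq> sets (F r')"
proof -
  have "filt_gen r \<subseteq> filt_gen r'"
    unfolding filt_gen_def using order_trans[OF _ assms] by (intro Un_mono) blast+
  then show ?thesis unfolding sets_F by (rule sigma_sets_mono')
qed

lemma F_meas_P: "f \<in> borel_measurable (F r) \<Longrightarrow> f \<in> borel_measurable P"
  using F_sub_P[of r] by (auto simp: measurable_def)

lemma F_meas_mono: "f \<in> borel_measurable (F r) \<Longrightarrow> r \<le> r' \<Longrightarrow> f \<in> borel_measurable (F r')"
  using F_mono_sets[of r r'] by (auto simp: measurable_def)

lemma W_meas_F: "0 \<le> s \<Longrightarrow> s \<le> r \<Longrightarrow> W s \<in> borel_measurable (F r)"
proof (rule measurableI)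
  fix A :: "real set" assume "0 \<le> s" "s \<le> r" "A \<in> sets borel"
  then have "W s -` A \<inter> space M \<in> filt_gen r" unfolding filt_gen_def by blast
  then show "W s -` A \<inter> space (F r) \<in> sets (F r)" unfolding sets_F space_F by (rule sigma_sets.Basic)
qed auto

lemma null_F: "N \<in> null_sets P \<Longrightarrow> N \<in> sets (F r)"
  unfolding sets_F filt_gen_def by (intro sigma_sets.Basic) auto

lemma null_sub: "N \<in> null_sets P \<Longrightarrow> N' \<subseteq> N \<Longrightarrow> N' \<in> null_sets P"
  using null_sets_completion_subset by blast

lemma AE_null: assumes "AE \<omega> in P. Q \<omega>" shows "{\<omega> \<in> space M. \<not> Q \<omega>} \<in> null_sets P"
  using assms completion.AE_iff_null_sets[of Q M] by simp

text \<open>Each \<sigma>-algebra of the filtration contains all null sets, so a modification on a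
  null set stays adapted. This permits redefining paths where Brownian motion fails to be
  continuous.\<close>

lemma F_meas_AE:
  fixes f g :: "'w \<Rightarrow> real"
  assumes f: "f \<in> borel_measurable (F r)" and ae: "AE \<omega> in P. f \<omega> = g \<omega>"
  shows "g \<in> borel_measurable (F r)"
proof (rule measurableI)
  define N where "N = {\<omega> \<in> space M. f \<omega> \<noteq> g \<omega>}"
  have N: "N \<in> null_sets P" unfolding N_def using AE_null[OF ae] by simp
  fix A assume A: "A \<in> sets (borel :: real measure)"
  have "g -` A \<inter> space (F r) = (f -` A \<inter> space (F r) - N) \<union> (N \<inter> g -` A)"
    unfolding N_def by auto
  moreover have "N \<inter> g -` A \<in> sets (F r)" using null_sub[OF N] by (intro null_F) auto
  moreover have "N \<in> sets (F r)" using N by (rule null_F)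
  ultimately show "g -` A \<inter> space (F r) \<in> sets (F r)"
    using measurable_sets[OF f A] by (metis sets.Diff sets.Un)
qed auto

section \<open>Independence of an increment from the past\<close>

text \<open>Each \<open>W u\<close> is \<open>W 0\<close> plus a partial sum of increments, and
  \<open>W 0\<close> vanishes only almost surely. The cylinder event rewritten in increments,
  \<open>E'\<close>, is independent of the last increment by grouping, and it differs from the
  original event \<open>E\<close> by a null set.\<close>

lemma indep_fin:
  assumes I: "finite I" "I \<subseteq> {0..s}" and s: "0 \<le> s" "s < r" and A: "\<And>u. u \<in> I \<Longrightarrow> A u \<in> sets borel"
    and B: "B \<in> sets borel"
  shows "prob ({\<omega> \<in> space M. \<forall>u\<in>I. W u \<omega> \<in> A u} \<inter> {\<omega> \<in> space M. W r \<omega> - W s \<omega> \<in> B})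
    = prob {\<omega> \<in> space M. \<forall>u\<in>I. W u \<omega> \<in> A u} * prob {\<omega> \<in> space M. W r \<omega> - W s \<omega> \<in> B}"
proof -
  obtain p n where p: "p 0 = 0" "mono p" "p (Suc n) = s" "p (Suc (Suc n)) = r" "\<And>u. u \<in> I \<Longrightarrow> \<exists>k\<le>n. p k = u"
    using sorted_grid[OF I s(1) less_imp_le[OF s(2)]] by blast
  obtain k where k: "\<And>u. u \<in> I \<Longrightarrow> k u \<le> n \<and> p (k u) = u" using p(5) by metis
  define D where "D i \<omega> = W (p (Suc i)) \<omega> - W (p i) \<omega>" for i \<omega>
  have ind: "base.indep_vars (\<lambda>_. borel) D {..<Suc (Suc n)}"
    using bm p(1,2) unfolding brownian_motion_def D_def[abs_def] by simp
  have sum: "(\<Sum>i<m. D i \<omega>) = W (p m) \<omega> - W 0 \<omega>" for m \<omega>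
    unfolding D_def p(1)[symmetric] by (rule sum_lessThan_telescope)
  define S where "S = {x \<in> space (PiM {..n} (\<lambda>_. borel :: real measure)). \<forall>u\<in>I. (\<Sum>i<k u. x i) \<in> A u}"
  define T where "T = {x \<in> space (PiM {Suc n} (\<lambda>_. borel :: real measure)). x (Suc n) \<in> B}"
  have S: "S \<in> sets (PiM {..n} (\<lambda>_. borel))"
  proof -
    have "(\<lambda>x. \<Sum>i<k u. x i) \<in> borel_measurable (PiM {..n} (\<lambda>_. borel :: real measure))" if "u \<in> I" for u
      using k[OF that] by (intro borel_measurable_sum measurable_component_singleton) auto
    then show ?thesis unfolding S_def using I(1) A by measurable
  qed
  have T: "T \<in> sets (PiM {Suc n} (\<lambda>_. borel))" unfolding T_def using B by measurable
  \<comment> \<open>The coordinates up to \<open>n\<close> lead to time \<open>s\<close>; coordinate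
    \<open>Suc n\<close> is the increment from \<open>s\<close> to \<open>r\<close>.\<close>
  have "base.indep_var (PiM {..n} (\<lambda>_. borel)) (\<lambda>\<omega>. restrict (\<lambda>i. D i \<omega>) {..n}) (PiM {Suc n} (\<lambda>_. borel))
    (\<lambda>\<omega>. restrict (\<lambda>i. D i \<omega>) {Suc n})"
    by (rule base.indep_var_restrict[OF ind]) auto
  note iv = base.indep_varD[OF this S T]
  have eq: "base.prob ({\<omega> \<in> space M. \<forall>u\<in>I. (\<Sum>i<k u. D i \<omega>) \<in> A u} \<inter> {\<omega> \<in> space M. W r \<omega> - W s \<omega> \<in> B})
    = base.prob {\<omega> \<in> space M. \<forall>u\<in>I. (\<Sum>i<k u. D i \<omega>) \<in> A u} * base.prob {\<omega> \<in> space M. W r \<omega> - W s \<omega> \<in> B}"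
  proof -
    have e: "(\<Sum>i<k u. restrict (\<lambda>i. D i \<omega>) {..n} i) = (\<Sum>i<k u. D i \<omega>)" if "u \<in> I" for u \<omega>
      using k[OF that] by (intro sum.cong) auto
    have 1: "(\<lambda>\<omega>. restrict (\<lambda>i. D i \<omega>) {..n}) -` S \<inter> space M = {\<omega> \<in> space M. \<forall>u\<in>I. (\<Sum>i<k u. D i \<omega>) \<in> A u}"
      unfolding S_def using e by (auto simp: space_PiM)
    have 2: "(\<lambda>\<omega>. restrict (\<lambda>i. D i \<omega>) {Suc n}) -` T \<inter> space M = {\<omega> \<in> space M. W r \<omega> - W s \<omega> \<in> B}"
      unfolding T_def by (auto simp: space_PiM D_def p)
    have 3: "(\<lambda>x. (restrict (\<lambda>i. D i x) {..n}, restrict (\<lambda>i. D i x) {Suc n})) -` (S \<times> T) \<inter> space M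
       = ((\<lambda>\<omega>. restrict (\<lambda>i. D i \<omega>) {..n}) -` S \<inter> space M) \<inter> ((\<lambda>\<omega>. restrict (\<lambda>i. D i \<omega>) {Suc n}) -` T \<inter> space
         M)" by auto
    show ?thesis using iv unfolding 3 unfolding 1 2 .
  qed
  define E where "E = {\<omega> \<in> space M. \<forall>u\<in>I. W u \<omega> \<in> A u}"
  define E' where "E' = {\<omega> \<in> space M. \<forall>u\<in>I. (\<Sum>i<k u. D i \<omega>) \<in> A u}"
  define G where "G = {\<omega> \<in> space M. W r \<omega> - W s \<omega> \<in> B}"
  have coll: "{\<omega> \<in> space M. \<forall>u\<in>I. f u \<omega> \<in> A u} \<in> sets M" if "\<And>u. u \<in> I \<Longrightarrow> f u \<in> borel_measurable M"
    for f :: "real \<Rightarrow> 'w \<Rightarrow> real"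
  proof (rule sets.sets_Collect_finite_All[OF _ I(1)])
    fix u assume "u \<in> I"
    then show "{\<omega> \<in> space M. f u \<omega> \<in> A u} \<in> sets M"
      using measurable_sets[OF that[of u] A[of u]] by (simp add: vimage_def Int_def conj_commute)
  qed
  have Wm: "W u \<in> borel_measurable M" if "u \<in> I" for u using W_meas_M[of u] that I(2) by auto
  have E: "E \<in> sets M" unfolding E_def using Wm by (rule coll)
  have E': "E' \<in> sets M" unfolding E'_def
  proof (rule coll)
    fix u assume "u \<in> I"
    have "W 0 \<in> borel_measurable M" "W (p (k u)) \<in> borel_measurable M" using W_meas_M Wm k[OF \<open>u \<in> I\<close>] \<open>u \<in> I\<close> by auto
    then show "(\<lambda>\<omega>. \<Sum>i<k u. D i \<omega>) \<in> borel_measurable M" unfolding sum by simp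
  qed
  have G: "G \<in> sets M"
  proof -
    have [measurable]: "W r \<in> borel_measurable M" "W s \<in> borel_measurable M" using W_meas_M s by auto
    show ?thesis unfolding G_def using B by measurable
  qed
  have ae: "AE \<omega> in M. (\<omega> \<in> E') = (\<omega> \<in> E)"
    using W_0 unfolding E_def E'_def by eventually_elim (use k in \<open>auto simp: sum\<close>)
  have 1: "base.prob E' = base.prob E" by (rule measure_eq_AE[OF ae E' E])
  have 2: "base.prob (E' \<inter> G) = base.prob (E \<inter> G)"
    by (rule measure_eq_AE) (use ae E E' G in auto)
  have "prob (E \<inter> G) = prob E * prob G"
    using eq unfolding E'_def[symmetric] G_def[symmetric] using 1 2 E G by simp
  then show ?thesis unfolding E_def G_def .
qed

text \<open>Finite cylinders together with the null sets are stable under intersection and generate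
  \<open>F s\<close>, so independence extends from this generator to the generated \<sigma>-algebra.
  Null sets are independent of every event.\<close>

lemma indep_F:
  assumes s: "0 \<le> s" "s < r"
  shows "indep_set (sets (F s)) (sets (vimage_algebra (space M) (\<lambda>\<omega>. W r \<omega> - W s \<omega>) borel))"
proof -
  define E where "E = {{\<omega> \<in> space M. \<forall>u\<in>I. W u \<omega> \<in> A u} | I A. finite I \<and> I \<subseteq> {0..s} \<and> (\<forall>u. A u \<in> sets borel)}"
  define G where "G = {(\<lambda>\<omega>. W r \<omega> - W s \<omega>) -` B \<inter> space M | B. B \<in> sets borel}"
  have Gm: "g \<in> sets P" if "g \<in> G" for g
  proof -
    have [measurable]: "W r \<in> borel_measurable P" "W s \<in> borel_measurable P" using W_meas_P s by auto
    have "(\<lambda>\<omega>. W r \<omega> - W s \<omega>) -` B \<inter> space P \<in> sets P" if "B \<in> sets borel" for B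
      using that by measurable
    then show ?thesis using that unfolding G_def by auto
  qed
  have Em: "e \<in> sets P" if "e \<in> E" for e
  proof -
    obtain I A where I: "finite I" "I \<subseteq> {0..s}" "\<forall>u. A u \<in> sets borel" "e = {\<omega> \<in> space M. \<forall>u\<in>I. W u \<omega> \<in> A u}"
      using \<open>e \<in> E\<close> unfolding E_def by blast
    have "{\<omega> \<in> space P. \<forall>u\<in>I. W u \<omega> \<in> A u} \<in> sets P"
    proof (rule sets.sets_Collect_finite_All[OF _ I(1)])
      fix u assume "u \<in> I"
      then show "{\<omega> \<in> space P. W u \<omega> \<in> A u} \<in> sets P"
        using measurable_sets[OF W_meas_P[of u]] I by (auto simp: vimage_def Int_def conj_commute)
    qed
    then show ?thesis unfolding I(4) by simp
  qed
  have ind: "indep_set (E \<union> null_sets P) G"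
  proof (rule indep_setI)
    show "E \<union> null_sets P \<subseteq> events" "G \<subseteq> events" using Gm Em by auto
    fix e g assume e: "e \<in> E \<union> null_sets P" and g: "g \<in> G"
    show "prob (e \<inter> g) = prob e * prob g"
    proof (cases "e \<in> null_sets P")
      case True
      then have "e \<inter> g \<in> null_sets P" by (rule null_sub) simp
      then show ?thesis using True by (simp add: measure_eq_0_null_sets)
    next
      case False
      then obtain I A where I: "finite I" "I \<subseteq> {0..s}" "\<forall>u. A u \<in> sets borel" "e = {\<omega> \<in> space M. \<forall>u\<in>I. W u \<omega> \<in> A u}"
        using e unfolding E_def by blast
      obtain B where B: "B \<in> sets borel" "g = (\<lambda>\<omega>. W r \<omega> - W s \<omega>) -` B \<inter> space M" using g unfolding G_def by blast
      have g': "g = {\<omega> \<in> space M. W r \<omega> - W s \<omega> \<in> B}" unfolding B(2) by auto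
      show ?thesis unfolding I(4) g' by (rule indep_fin) (use I B s in auto)
    qed
  qed
  have stE: "Int_stable (E \<union> null_sets P)"
  proof (rule Int_stableI)
    fix a b assume ab: "a \<in> E \<union> null_sets P" "b \<in> E \<union> null_sets P"
    show "a \<inter> b \<in> E \<union> null_sets P"
    proof (cases "a \<in> null_sets P \<or> b \<in> null_sets P")
      case True
      then have "a \<inter> b \<in> null_sets P" using null_sub[of a "a \<inter> b"] null_sub[of b "a \<inter> b"] by auto
      then show ?thesis by simp
    next
      case False
      then obtain I A J B where I: "finite I" "I \<subseteq> {0..s}" "\<forall>u. A u \<in> sets borel"
        "a = {\<omega> \<in> space M. \<forall>u\<in>I. W u \<omega> \<in> A u}"
        and J: "finite J" "J \<subseteq> {0..s}" "\<forall>u. B u \<in> sets borel" "b = {\<omega> \<in> space M. \<forall>u\<in>J. W u \<omega> \<in> B u}"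
        using ab unfolding E_def by blast
      define C where "C u = (if u \<in> I then A u else UNIV) \<inter> (if u \<in> J then B u else UNIV)" for u
      have "a \<inter> b = {\<omega> \<in> space M. \<forall>u\<in>I \<union> J. W u \<omega> \<in> C u}" unfolding I(4) J(4) C_def by auto
      moreover have "\<forall>u. C u \<in> sets borel" unfolding C_def using I(3) J(3) by auto
      ultimately have "a \<inter> b \<in> E" unfolding E_def using I J by (intro CollectI exI[of _ "I \<union> J"] exI[of _ C]) auto
      then show ?thesis by simp
    qed
  qed
  have stG: "Int_stable G"
  proof (rule Int_stableI)
    fix a b assume "a \<in> G" "b \<in> G"
    then obtain A B where "A \<in> sets borel" "B \<in> sets borel" "a = (\<lambda>\<omega>. W r \<omega> - W s \<omega>) -` A \<inter> space M"
      "b = (\<lambda>\<omega>. W r \<omega> - W s \<omega>) -` B \<inter> space M"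
      unfolding G_def by blast
    then show "a \<inter> b \<in> G" unfolding G_def by (intro CollectI exI[of _ "A \<inter> B"]) auto
  qed
  have i2: "indep_set (sigma_sets (space M) (E \<union> null_sets P)) (sigma_sets (space M) G)"
    using indep_set_sigma_sets[OF ind stE stG] by simp
  have sG: "sigma_sets (space M) G = sets (vimage_algebra (space M) (\<lambda>\<omega>. W r \<omega> - W s \<omega>) borel)"
    unfolding G_def vimage_algebra_def by (subst sets_measure_of) auto
  have sE: "sets (F s) \<subseteq> sigma_sets (space M) (E \<union> null_sets P)"
    unfolding sets_F
  proof (rule sigma_sets_mono')
    show "filt_gen s \<subseteq> E \<union> null_sets P"
    proof
      fix e assume "e \<in> filt_gen s"
      then consider "e \<in> null_sets P" | u A where "0 \<le> u" "u \<le> s" "A \<in> sets borel" "e = W u -` A \<inter> space M"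
        unfolding filt_gen_def by blast
      then show "e \<in> E \<union> null_sets P"
      proof cases
        case 2
        then have "e = {\<omega> \<in> space M. \<forall>v\<in>{u}. W v \<omega> \<in> A}" by auto
        then have "e \<in> E" unfolding E_def using 2 by (intro CollectI exI[of _ "{u}"] exI[of _ "\<lambda>_. A"]) auto
        then show ?thesis by simp
      qed simp
    qed
  qed
  show ?thesis
  proof (rule indep_setI)
    show "sets (F s) \<subseteq> events" by (rule F_sub_P)
    show "sets (vimage_algebra (space M) (\<lambda>\<omega>. W r \<omega> - W s \<omega>) borel) \<subseteq> events"
      unfolding sG[symmetric] using sets.sigma_sets_subset[of G P] Gm by auto
    fix a b assume "a \<in> sets (F s)" "b \<in> sets (vimage_algebra (space M) (\<lambda>\<omega>. W r \<omega> - W s \<omega>) borel)"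
    then show "prob (a \<inter> b) = prob a * prob b"
      using indep_setD[OF i2, of a b] sE unfolding sG by blast
  qed
qed

lemma indep_incr:
  fixes f :: "'w \<Rightarrow> real" and g :: "real \<Rightarrow> real"
  assumes s: "0 \<le> s" "s \<le> r" and f: "f \<in> borel_measurable (F s)" and g: "g \<in> borel_measurable borel"
  shows "indep_var borel f borel (\<lambda>\<omega>. g (W r \<omega> - W s \<omega>))"
proof -
  have Wm: "W r \<in> borel_measurable P" "W s \<in> borel_measurable P" using W_meas_P s by auto
  have gm: "(\<lambda>\<omega>. g (W r \<omega> - W s \<omega>)) \<in> borel_measurable P"
    using Wm g by (intro measurable_compose[OF _ g] borel_measurable_diff)
  have "indep_set (sigma_sets (space P) {f -` A \<inter> space P | A. A \<in> sets borel})
      (sigma_sets (space P) {(\<lambda>\<omega>. g (W r \<omega> - W s \<omega>)) -` A \<inter> space P | A. A \<in> sets borel})"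
  proof (rule indep_setI)
    let ?A = "sigma_sets (space P) {f -` A \<inter> space P | A. A \<in> sets borel}"
    let ?B = "sigma_sets (space P) {(\<lambda>\<omega>. g (W r \<omega> - W s \<omega>)) -` A \<inter> space P | A. A \<in> sets borel}"
    have A: "?A \<subseteq> sets (F s)"
      using sets.sigma_sets_subset[of "{f -` A \<inter> space P | A. A \<in> sets borel}" "F s"] measurable_sets[OF f] by auto
    then show "?A \<subseteq> events" using F_sub_P by blast
    show B: "?B \<subseteq> events"
      using sets.sigma_sets_subset[of "{(\<lambda>\<omega>. g (W r \<omega> - W s \<omega>)) -` A \<inter> space P | A. A \<in> sets borel}"
        P] measurable_sets[OF gm] by auto
    fix a b assume a: "a \<in> ?A" and b: "b \<in> ?B"
    show "prob (a \<inter> b) = prob a * prob b"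
    proof (cases "s < r")
      case True
      let ?V = "vimage_algebra (space M) (\<lambda>\<omega>. W r \<omega> - W s \<omega>) borel"
      have "(\<lambda>\<omega>. g (W r \<omega> - W s \<omega>)) \<in> borel_measurable ?V"
        by (rule measurable_compose[OF measurable_vimage_algebra1 g]) auto
      then have "?B \<subseteq> sets ?V"
        using sets.sigma_sets_subset[of "{(\<lambda>\<omega>. g (W r \<omega> - W s \<omega>)) -` A \<inter> space P | A. A \<in> sets borel}" ?V]
          measurable_sets[of "\<lambda>\<omega>. g (W r \<omega> - W s \<omega>)" ?V borel] by auto
      then show ?thesis using indep_setD[OF indep_F[OF s(1) True], of a b] A a b by blast
    next
      case False
      then have "r = s" using s by simp
      \<comment> \<open>For \<open>s = r\<close> the increment is identically 0, so the
        \<sigma>-algebra it generates is trivial.\<close>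
      have "b = {} \<or> b = space M" using b
      proof (induct rule: sigma_sets.induct)
        case (Union a)
        then show ?case by (cases "\<exists>i. a i = space M") blast+
      qed (auto simp: \<open>r = s\<close> split: if_splits)
      then show ?thesis
      proof
        assume "b = space M"
        moreover have "a \<inter> space M = a" using sets.sets_into_space[of a "F s"] A a by auto
        ultimately show ?thesis using prob_space by simp
      qed simp
    qed
  qed
  then show ?thesis unfolding indep_var_eq using gm F_meas_P[OF f] by simp
qed

lemma expectation_indep_incr:
  fixes f :: "'w \<Rightarrow> real" and g :: "real \<Rightarrow> real"
  assumes s: "0 \<le> s" "s \<le> r" and f: "f \<in> borel_measurable (F s)" and g: "g \<in> borel_measurable borel"
    and "integrable P f" "integrable P (\<lambda>\<omega>. g (W r \<omega> - W s \<omega>))"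
  shows "integrable P (\<lambda>\<omega>. f \<omega> * g (W r \<omega> - W s \<omega>))"
    and "(\<integral>\<omega>. f \<omega> * g (W r \<omega> - W s \<omega>) \<partial>P) = (\<integral>\<omega>. f \<omega> \<partial>P) * (\<integral>\<omega>. g (W r \<omega> - W s \<omega>) \<partial>P)"
  using indep_var_integrable[OF indep_incr[OF s f g] assms(5,6)] indep_var_lebesgue_integral[OF indep_incr[OF s f g]
    assms(5,6)]
  by auto

text \<open>Product rule with values in \<open>[0, \<infinity>]\<close>: the moments of the wealth
  are computed by it before their finiteness is known.\<close>

lemma nn_integral_indep_incr:
  fixes f :: "'w \<Rightarrow> real" and g :: "real \<Rightarrow> real"
  assumes s: "0 \<le> s" "s \<le> r" and f: "f \<in> borel_measurable (F s)" and g: "g \<in> borel_measurable borel"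
    and nn: "\<And>\<omega>. f \<omega> \<ge> 0" "\<And>x. g x \<ge> 0"
  shows "(\<integral>\<^sup>+\<omega>. ennreal (f \<omega> * g (W r \<omega> - W s \<omega>)) \<partial>P)
    = (\<integral>\<^sup>+\<omega>. ennreal (f \<omega>) \<partial>P) * (\<integral>\<^sup>+\<omega>. ennreal (g (W r \<omega> - W s \<omega>)) \<partial>P)"
proof -
  have "indep_var borel (ennreal \<circ> f) borel (ennreal \<circ> (\<lambda>\<omega>. g (W r \<omega> - W s \<omega>)))"
    by (rule indep_var_compose[OF indep_incr[OF s f g]]) auto
  moreover have "(\<lambda>_::bool. borel :: ennreal measure) = case_bool borel borel"
    by (auto simp: fun_eq_iff split: bool.split)
  ultimately have "indep_vars (\<lambda>_. borel) (case_bool (ennreal \<circ> f) (ennreal \<circ> (\<lambda>\<omega>. g (W r \<omega> - W s \<omega>)))) UNIV"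
    unfolding indep_var_def by simp
  from indep_vars_nn_integral[OF _ this] show ?thesis
    using nn by (simp add: UNIV_bool mult.commute ennreal_mult comp_def split: bool.split)
qed

end

section \<open>Gaussian moments of the increments\<close>

text \<open>Completing the square: exponential tilting by \<open>u\<close> moves the mean of a
  centred normal law to \<open>u * \<sigma>\<^sup>2\<close> and keeps its variance. All exponential
  moments below come from this.\<close>

lemma normal_density_exp_shift:
  "\<sigma> > 0 \<Longrightarrow> normal_density 0 \<sigma> z * exp (u * z) = exp (u\<^sup>2 * \<sigma>\<^sup>2 / 2) * normal_density (u * \<sigma>\<^sup>2) \<sigma> z"
proof -
  assume s: "\<sigma> > 0"
  have "exp (- (z - 0)\<^sup>2 / (2 * \<sigma>\<^sup>2)) * exp (u * z) = exp (u\<^sup>2 * \<sigma>\<^sup>2 / 2) * exp (- (z - u * \<sigma>\<^sup>2)\<^sup>2 / (2 * \<sigma>\<^sup>2))"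
    unfolding exp_add[symmetric] using s
    by (intro arg_cong[where f = exp]) (simp add: field_simps power2_eq_square)
  then show ?thesis unfolding normal_density_def by simp
qed

context brownian
begin

lemma incr_distr:
  assumes "0 \<le> s" "s < r"
  shows "distributed P lborel (\<lambda>\<omega>. W r \<omega> - W s \<omega>) (\<lambda>z. ennreal (normal_density 0 (sqrt (r - s)) z))"
proof -
  have d: "distributed M lborel (\<lambda>\<omega>. W r \<omega> - W s \<omega>) (\<lambda>z. ennreal (normal_density 0 (sqrt (r - s)) z))"
    using W_distr[OF assms] .
  then have m: "(\<lambda>\<omega>. W r \<omega> - W s \<omega>) \<in> measurable M lborel" unfolding distributed_def by simp
  show ?thesis using d measurable_completion[OF m] distr_completion[OF m]
    unfolding distributed_def by simp
qed

lemma nn_integral_exp_incr: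
  assumes "0 \<le> s" "s \<le> r"
  shows "(\<integral>\<^sup>+\<omega>. ennreal (exp (u * (W r \<omega> - W s \<omega>))) \<partial>P) = ennreal (exp (u\<^sup>2 * (r - s) / 2))"
proof (cases "s = r")
  case True
  then show ?thesis using emeasure_space_1 by simp
next
  case False
  then have sr: "s < r" using assms by simp
  define \<sigma> where "\<sigma> = sqrt (r - s)"
  have s: "\<sigma> > 0" "\<sigma>\<^sup>2 = r - s" using sr unfolding \<sigma>_def by auto
  have "(\<integral>\<^sup>+\<omega>. ennreal (exp (u * (W r \<omega> - W s \<omega>))) \<partial>P)
    = (\<integral>\<^sup>+z. ennreal (normal_density 0 \<sigma> z) * ennreal (exp (u * z)) \<partial>lborel)"
    unfolding \<sigma>_def by (rule distributed_nn_integral[OF incr_distr[OF assms(1) sr], symmetric]) simp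
  also have "\<dots> = (\<integral>\<^sup>+z. ennreal (exp (u\<^sup>2 * \<sigma>\<^sup>2 / 2)) * ennreal (normal_density (u * \<sigma>\<^sup>2) \<sigma> z) \<partial>lborel)"
    using normal_density_exp_shift[OF s(1), of _ u] by (simp add: ennreal_mult'[symmetric])
  also have "\<dots> = ennreal (exp (u\<^sup>2 * \<sigma>\<^sup>2 / 2)) * (\<integral>\<^sup>+z. ennreal (normal_density (u * \<sigma>\<^sup>2) \<sigma> z) \<partial>lborel)"
    by (rule nn_integral_cmult) simp
  also have "(\<integral>\<^sup>+z. ennreal (normal_density (u * \<sigma>\<^sup>2) \<sigma> z) \<partial>lborel) = 1"
    using integral_normal_density[OF s(1), of "u * \<sigma>\<^sup>2"] integrable_normal_density[OF s(1), of "u * \<sigma>\<^sup>2"]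
    by (subst nn_integral_eq_integral) auto
  finally show ?thesis using s by simp
qed

lemma exp_incr:
  assumes "0 \<le> s" "s \<le> r"
  shows "integrable P (\<lambda>\<omega>. exp (u * (W r \<omega> - W s \<omega>)))"
    and "(\<integral>\<omega>. exp (u * (W r \<omega> - W s \<omega>)) \<partial>P) = exp (u\<^sup>2 * (r - s) / 2)"
proof -
  have [measurable]: "W r \<in> borel_measurable P" "W s \<in> borel_measurable P" using W_meas_P assms by auto
  show "integrable P (\<lambda>\<omega>. exp (u * (W r \<omega> - W s \<omega>)))"
    using nn_integral_exp_incr[OF assms, of u] by (intro integrableI_nonneg) auto
  show "(\<integral>\<omega>. exp (u * (W r \<omega> - W s \<omega>)) \<partial>P) = exp (u\<^sup>2 * (r - s) / 2)"
    using nn_integral_exp_incr[OF assms, of u] by (subst integral_eq_nn_integral) auto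
qed

text \<open>The mean of the tilted law. It is needed for the mixed term in the square of the Euler
  remainder, and \<open>u = 0\<close> gives the centring of the increments.\<close>

lemma incr_exp_incr:
  assumes "0 \<le> s" "s \<le> r"
  shows "integrable P (\<lambda>\<omega>. (W r \<omega> - W s \<omega>) * exp (u * (W r \<omega> - W s \<omega>)))"
    and "(\<integral>\<omega>. (W r \<omega> - W s \<omega>) * exp (u * (W r \<omega> - W s \<omega>)) \<partial>P) = u * (r - s) * exp (u\<^sup>2 * (r - s) / 2)"
proof -
  have "integrable P (\<lambda>\<omega>. (W r \<omega> - W s \<omega>) * exp (u * (W r \<omega> - W s \<omega>))) \<and>
    (\<integral>\<omega>. (W r \<omega> - W s \<omega>) * exp (u * (W r \<omega> - W s \<omega>)) \<partial>P) = u * (r - s) * exp (u\<^sup>2 * (r - s) / 2)"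
  proof (cases "s = r")
    case False
    then have sr: "s < r" using assms by simp
    define \<sigma> where "\<sigma> = sqrt (r - s)"
    have s: "\<sigma> > 0" "\<sigma>\<^sup>2 = r - s" using sr unfolding \<sigma>_def by auto
    note D = incr_distr[OF assms(1) sr, folded \<sigma>_def]
    have e: "normal_density 0 \<sigma> z * (z * exp (u * z)) = exp (u\<^sup>2 * \<sigma>\<^sup>2 / 2) * (normal_density (u * \<sigma>\<^sup>2) \<sigma> z * z)" for z
      using normal_density_exp_shift[OF s(1), of z u] by (metis mult.assoc mult.commute)
    have i: "integrable lborel (\<lambda>z. normal_density 0 \<sigma> z * (z * exp (u * z)))"
      unfolding e using integrable_normal_moment_nz_1[OF s(1)] by simp
    have "integrable P (\<lambda>\<omega>. (W r \<omega> - W s \<omega>) * exp (u * (W r \<omega> - W s \<omega>)))"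
      using i distributed_integrable[OF D, of "\<lambda>z. z * exp (u * z)"] by simp
    moreover have "(\<integral>\<omega>. (W r \<omega> - W s \<omega>) * exp (u * (W r \<omega> - W s \<omega>)) \<partial>P)
      = (\<integral>z. normal_density 0 \<sigma> z * (z * exp (u * z)) \<partial>lborel)"
      using distributed_integral[OF D, of "\<lambda>z. z * exp (u * z)"] by simp
    moreover have "\<dots> = u * (r - s) * exp (u\<^sup>2 * (r - s) / 2)"
      unfolding e using integral_normal_moment_nz_1[OF s(1), of "u * \<sigma>\<^sup>2"] s(2) by simp
    ultimately show ?thesis by simp
  qed simp
  then show "integrable P (\<lambda>\<omega>. (W r \<omega> - W s \<omega>) * exp (u * (W r \<omega> - W s \<omega>)))"
    and "(\<integral>\<omega>. (W r \<omega> - W s \<omega>) * exp (u * (W r \<omega> - W s \<omega>)) \<partial>P) = u * (r - s) * exp (u\<^sup>2 * (r - s) / 2)" by auto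
qed

lemma incr_mean:
  assumes "0 \<le> s" "s \<le> r"
  shows "integrable P (\<lambda>\<omega>. W r \<omega> - W s \<omega>)" "(\<integral>\<omega>. W r \<omega> - W s \<omega> \<partial>P) = 0"
  using incr_exp_incr[OF assms, of 0] by auto

lemma incr_square:
  assumes "0 \<le> s" "s \<le> r"
  shows "integrable P (\<lambda>\<omega>. (W r \<omega> - W s \<omega>)\<^sup>2)" "(\<integral>\<omega>. (W r \<omega> - W s \<omega>)\<^sup>2 \<partial>P) = r - s"
proof -
  have "integrable P (\<lambda>\<omega>. (W r \<omega> - W s \<omega>)\<^sup>2) \<and> (\<integral>\<omega>. (W r \<omega> - W s \<omega>)\<^sup>2 \<partial>P) = r - s"
  proof (cases "s = r")
    case False
    then have sr: "s < r" using assms by simp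
    define \<sigma> where "\<sigma> = sqrt (r - s)"
    have s: "\<sigma> > 0" "\<sigma>\<^sup>2 = r - s" using sr unfolding \<sigma>_def by auto
    note D = incr_distr[OF assms(1) sr, folded \<sigma>_def]
    have "integrable lborel (\<lambda>z. normal_density 0 \<sigma> z * z\<^sup>2)" using integrable_normal_moment[OF s(1), of 0 2] by simp
    then have "integrable P (\<lambda>\<omega>. (W r \<omega> - W s \<omega>)\<^sup>2)"
      using distributed_integrable[OF D, of "\<lambda>z. z\<^sup>2"] by simp
    moreover have "(\<integral>\<omega>. (W r \<omega> - W s \<omega>)\<^sup>2 \<partial>P) = r - s"
      using normal_distributed_variance[OF s(1) D] incr_mean(2)[OF assms] s(2) by simp
    ultimately show ?thesis by simp
  qed simp
  then show "integrable P (\<lambda>\<omega>. (W r \<omega> - W s \<omega>)\<^sup>2)" "(\<integral>\<omega>. (W r \<omega> - W s \<omega>)\<^sup>2 \<partial>P) = r - s" by auto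
qed

end

section \<open>Optional stopping on grids\<close>

text \<open>Turns an uncountable union over times into countable operations, so that hitting a level
  is an event of the filtration. Rational times come close to a hit without attaining it, hence the
  slack \<open>1 / Suc k\<close>; compactness recovers the hit from the approximate ones. The end
  points are added because they may be irrational.\<close>

lemma continuous_hit_iff:
  fixes f :: "real \<Rightarrow> real"
  assumes c: "continuous_on {s..r} f" and sr: "s \<le> r"
  shows "(\<exists>u\<in>{s..r}. b \<le> f u) \<longleftrightarrow> (\<forall>k::nat. \<exists>q\<in>insert s (insert r (\<rat> \<inter> {s..r})). b - 1 / real (Suc k) < f q)"
proof
  assume "\<exists>u\<in>{s..r}. b \<le> f u"
  then obtain u where u: "s \<le> u" "u \<le> r" "b \<le> f u" by auto
  show "\<forall>k::nat. \<exists>q\<in>insert s (insert r (\<rat> \<inter> {s..r})). b - 1 / real (Suc k) < f q"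
  proof
    fix k :: nat
    have e: "1 / real (Suc k) > 0" by simp
    show "\<exists>q\<in>insert s (insert r (\<rat> \<inter> {s..r})). b - 1 / real (Suc k) < f q"
    proof (cases "u = s \<or> u = r")
      case True
      have "b - 1 / real (Suc k) < f u" using u e by linarith
      then show ?thesis using True by blast
    next
      case False
      obtain d where d: "d > 0" "\<And>v. v \<in> {s..r} \<Longrightarrow> dist v u < d \<Longrightarrow> dist (f v) (f u) < 1 / real (Suc k)"
        using c u e unfolding continuous_on_iff by (metis atLeastAtMost_iff)
      have "u < min r (u + d)" using False u d by auto
      then obtain q where q: "q \<in> \<rat>" "u < q" "q < min r (u + d)" using Rats_dense_in_real by blast
      then have "dist (f q) (f u) < 1 / real (Suc k)" using u by (intro d(2)) (auto simp: dist_real_def)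
      then have "f q > b - 1 / real (Suc k)" using u unfolding dist_real_def by linarith
      then show ?thesis using q u by (intro bexI[of _ q]) auto
    qed
  qed
next
  assume a: "\<forall>k::nat. \<exists>q\<in>insert s (insert r (\<rat> \<inter> {s..r})). b - 1 / real (Suc k) < f q"
  obtain u where u: "u \<in> {s..r}" "\<And>v. v \<in> {s..r} \<Longrightarrow> f v \<le> f u"
    using continuous_attains_sup[of "{s..r}" f] c sr by (metis atLeastAtMost_iff compact_Icc empty_iff order_refl)
  have "b \<le> f u"
  proof (rule ccontr)
    assume "\<not> b \<le> f u"
    then obtain k :: nat where k: "1 / real (Suc k) < b - f u"
      using nat_approx_posE[of "b - f u"] by (metis diff_gt_0_iff_gt not_le)
    obtain q where "q \<in> {s..r}" "b - 1 / real (Suc k) < f q" using a sr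
      by (metis IntD2 atLeastAtMost_iff insert_iff order_refl)
    then show False using u(2)[of q] k by linarith
  qed
  then show "\<exists>u\<in>{s..r}. b \<le> f u" using u by blast
qed

text \<open>\<open>B n\<close> stands for having stopped by step \<open>n\<close>. It is used with
  increasing \<open>B\<close>, where the result is \<open>Z\<close> at the first index whose event
  has occurred, capped at \<open>n\<close>.\<close>

primrec stopped :: "(real \<Rightarrow> 'w \<Rightarrow> real) \<Rightarrow> (nat \<Rightarrow> real) \<Rightarrow> (nat \<Rightarrow> 'w set) \<Rightarrow> nat \<Rightarrow> 'w \<Rightarrow> real" where
  "stopped Z s B 0 \<omega> = Z (s 0) \<omega>"
| "stopped Z s B (Suc n) \<omega> = (if \<omega> \<in> B n then stopped Z s B n \<omega> else Z (s (Suc n)) \<omega>)"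

lemma stopped_eq:
  assumes "mono B"
  shows "\<exists>m\<le>n. stopped Z s B n \<omega> = Z (s m) \<omega> \<and> (\<forall>i<m. \<omega> \<notin> B i) \<and> (m = n \<or> \<omega> \<in> B m)"
proof (induction n)
  case (Suc n)
  then obtain m where m: "m \<le> n" "stopped Z s B n \<omega> = Z (s m) \<omega>" "\<forall>i<m. \<omega> \<notin> B i" "m = n \<or> \<omega> \<in> B m" by blast
  show ?case
  proof (cases "\<omega> \<in> B n")
    case True
    then show ?thesis using m by (intro exI[of _ m]) auto
  next
    case False
    then have "\<omega> \<notin> B i" if "i < Suc n" for i using monoD[OF assms, of i n] that by auto
    then show ?thesis using False by (intro exI[of _ "Suc n"]) auto
  qed
qed simp

context brownian
begin

lemma stopped_meas:
  assumes s: "mono s" and Zm: "\<And>i. Z (s i) \<in> borel_measurable (F (s i))" and B: "\<And>i. B i \<in> sets (F (s i))"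
  shows "stopped Z s B n \<in> borel_measurable (F (s n))"
proof (induction n)
  case 0
  have "stopped Z s B 0 = Z (s 0)" by (simp add: fun_eq_iff)
  then show ?case using Zm by simp
next
  case (Suc n)
  have le: "s n \<le> s (Suc n)" using monoD[OF s] by simp
  have "(\<lambda>\<omega>. if \<omega> \<in> B n then stopped Z s B n \<omega> else Z (s (Suc n)) \<omega>) \<in> borel_measurable (F (s (Suc n)))"
    using F_meas_mono[OF Suc le] Zm B[of n] F_mono_sets[OF le] by (intro measurable_If_set) auto
  then show ?case by (simp add: fun_eq_iff cong: measurable_cong)
qed

text \<open>A step alters the value only off \<open>B n\<close>. The complement of
  \<open>B n\<close> is known at time \<open>s n\<close>, and on it the stopped value is still
  \<open>Z (s n)\<close>, so the one-step inequality applies there. Abstracting the relation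
  \<open>R\<close> handles both directions in one induction.\<close>

lemma stopped_expectation:
  assumes s: "mono s" and Zm: "\<And>i. Z (s i) \<in> borel_measurable (F (s i))" and B: "\<And>i. B i \<in> sets (F (s i))"
    and mB: "mono B"
    and R: "R = (\<le>) \<or> R = (\<ge>)"
    and super: "\<And>i A. A \<in> sets (F (s i)) \<Longrightarrow> R (\<integral>\<^sup>+\<omega>. ennreal (Z (s (Suc i)) \<omega>)
      * indicator A \<omega> \<partial>P) (\<integral>\<^sup>+\<omega>. ennreal (Z (s i) \<omega>) * indicator A \<omega> \<partial>P)"
  shows "R (\<integral>\<^sup>+\<omega>. ennreal (stopped Z s B n \<omega>) \<partial>P) (\<integral>\<^sup>+\<omega>. ennreal (Z (s 0) \<omega>) \<partial>P)"
proof (induction n)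
  case 0
  show ?case using R by auto
next
  case (Suc n)
  have Bn: "B n \<in> sets (F (s n))" "B n \<in> sets P" "space M - B n \<in> sets (F (s n))" "space M - B n \<in> sets P"
    using B[of n] F_sub_P[of "s n"] sets.compl_sets[of "B n" "F (s n)"] by auto
  have m1: "(\<lambda>\<omega>. ennreal (stopped Z s B n \<omega>)) \<in> borel_measurable P"
    using F_meas_P[OF stopped_meas[OF s Zm B]] by auto
  have split: "(\<integral>\<^sup>+\<omega>. f \<omega> \<partial>P) = (\<integral>\<^sup>+\<omega>. f \<omega> * indicator (B n) \<omega> \<partial>P) + (\<integral>\<^sup>+\<omega>. f \<omega> * indicator (space M - B n) \<omega> \<partial>P)"
    if "f \<in> borel_measurable P" for f
  proof -
    have "(\<integral>\<^sup>+\<omega>. f \<omega> \<partial>P) = (\<integral>\<^sup>+\<omega>. f \<omega> * indicator (B n) \<omega> + f \<omega> * indicator (space M - B n) \<omega> \<partial>P)"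
      by (intro nn_integral_cong) (auto split: split_indicator)
    then show ?thesis using that Bn by (subst nn_integral_add[symmetric]) auto
  qed
  have m3: "(\<lambda>\<omega>. ennreal (stopped Z s B (Suc n) \<omega>)) \<in> borel_measurable P"
    using F_meas_P[OF stopped_meas[OF s Zm B, of "Suc n"]] by (rule measurable_compose) auto
  have "(\<integral>\<^sup>+\<omega>. ennreal (stopped Z s B (Suc n) \<omega>) \<partial>P) =
     (\<integral>\<^sup>+\<omega>. ennreal (stopped Z s B (Suc n) \<omega>) * indicator (B n) \<omega> \<partial>P) + (\<integral>\<^sup>+\<omega>. ennreal (stopped Z s B (Suc n) \<omega>) *
       indicator (space M - B n) \<omega> \<partial>P)"
    by (rule split[OF m3])
  also have "\<dots> = (\<integral>\<^sup>+\<omega>. ennreal (stopped Z s B n \<omega>) * indicator (B n) \<omega> \<partial>P)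
    + (\<integral>\<^sup>+\<omega>. ennreal (Z (s (Suc n)) \<omega>) * indicator (space M - B n) \<omega> \<partial>P)"
    by (intro arg_cong2[where f = "(+)"] nn_integral_cong) (auto split: split_indicator)
  finally have 1: "(\<integral>\<^sup>+\<omega>. ennreal (stopped Z s B (Suc n) \<omega>) \<partial>P) = \<dots>" .
  have 2: "(\<integral>\<^sup>+\<omega>. ennreal (stopped Z s B n \<omega>) * indicator (space M - B n) \<omega> \<partial>P)
    = (\<integral>\<^sup>+\<omega>. ennreal (Z (s n) \<omega>) * indicator (space M - B n) \<omega> \<partial>P)"
  proof (intro nn_integral_cong)
    fix \<omega>
    have "stopped Z s B n \<omega> = Z (s n) \<omega>" if "\<omega> \<notin> B n"
      using that by (cases n) (use monoD[OF mB, of "n - 1" n] in auto)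
    then show "ennreal (stopped Z s B n \<omega>) * indicator (space M - B n) \<omega>
      = ennreal (Z (s n) \<omega>) * indicator (space M - B n) \<omega>"
      by (auto split: split_indicator)
  qed
  have "R (\<integral>\<^sup>+\<omega>. ennreal (stopped Z s B (Suc n) \<omega>) \<partial>P) (\<integral>\<^sup>+\<omega>. ennreal (stopped Z s B n \<omega>) \<partial>P)"
    unfolding 1 split[OF m1] 2 using super[OF Bn(3)] R by (auto intro: add_left_mono)
  then show ?case using Suc R by auto
qed

lemma F_hit:
  fixes X :: "real \<Rightarrow> 'w \<Rightarrow> real"
  assumes c: "\<And>\<omega>. \<omega> \<in> space M \<Longrightarrow> continuous_on {s..} (\<lambda>r. X r \<omega>)" and m: "\<And>q. s \<le> q \<Longrightarrow> X q \<in> borel_measurable (F q)"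
    and sr: "s \<le> r"
  shows "{\<omega> \<in> space M. \<exists>u\<in>{s..r}. b \<le> X u \<omega>} \<in> sets (F r)"
proof -
  define D where "D = insert s (insert r (\<rat> \<inter> {s..r}))"
  have "{\<omega> \<in> space M. \<exists>u\<in>{s..r}. b \<le> X u \<omega>} = {\<omega> \<in> space (F r). \<forall>k::nat. \<exists>q\<in>D. b - 1 / real (Suc k) < X q \<omega>}"
    unfolding D_def using continuous_hit_iff[OF continuous_on_subset[OF c] sr] by auto
  also have "\<dots> \<in> sets (F r)"
  proof (intro sets.sets_Collect_countable_All sets.sets_Collect_countable_Ex')
    show "countable D" unfolding D_def using countable_rat by (intro countable_insert countable_Int1)
    fix k :: nat and q assume "q \<in> D"
    then have "s \<le> q" "q \<le> r" unfolding D_def using sr by auto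
    then have "X q \<in> borel_measurable (F r)" using F_meas_mono m by blast
    then show "{\<omega> \<in> space (F r). b - 1 / real (Suc k) < X q \<omega>} \<in> sets (F r)" by measurable
  qed
  finally show ?thesis .
qed

end

lemma stopped_Least:
  assumes "mono B"
  shows "stopped Z s B n \<omega> = Z (s (LEAST i. i = n \<or> \<omega> \<in> B i)) \<omega>"
proof -
  obtain m where m: "m \<le> n" "stopped Z s B n \<omega> = Z (s m) \<omega>" "\<forall>i<m. \<omega> \<notin> B i" "m = n \<or> \<omega> \<in> B m"
    using stopped_eq[OF assms, of n Z s \<omega>] by blast
  have "(LEAST i. i = n \<or> \<omega> \<in> B i) = m"
    using m by (intro Least_equality) (auto simp: not_less[symmetric])
  then show ?thesis using m by simp
qed

text \<open>A positive path can leave \<open>(0, b)\<close> only through \<open>b\<close>, so the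
  exit time is the first time of a closed set and is attained. A path starting at most at
  \<open>b\<close> exits exactly at \<open>b\<close> by the intermediate value theorem; one starting
  above exits at once, at its own value.\<close>

lemma exit_time_cases:
  fixes X :: "real \<Rightarrow> 'w \<Rightarrow> real"
  assumes c: "continuous_on {s..} (\<lambda>r. X r \<omega>)" and p: "\<And>r. s \<le> r \<Longrightarrow> 0 < X r \<omega>"
  obtains (inf) "exit_time {0<..<b} s X \<omega> = \<infinity>" "\<And>v. s \<le> v \<Longrightarrow> X v \<omega> < b"
  | (fin) \<tau> where "exit_time {0<..<b} s X \<omega> = ereal \<tau>" "s \<le> \<tau>" "b \<le> X \<tau> \<omega>" "\<And>v. s \<le> v \<Longrightarrow> v < \<tau> \<Longrightarrow> X v \<omega> < b"
    "X s \<omega> \<le> b \<Longrightarrow> X \<tau> \<omega> = b"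
proof -
  define S where "S = {u. s \<le> u \<and> b \<le> X u \<omega>}"
  have eS: "{ereal r | r. s \<le> r \<and> X r \<omega> \<notin> {0<..<b}} = ereal ` S"
    unfolding S_def using p by (auto simp: image_def)
  show thesis
  proof (cases "S = {}")
    case True
    then have "exit_time {0<..<b} s X \<omega> = \<infinity>" unfolding exit_time_def eS by (simp add: top_ereal_def)
    moreover have "X v \<omega> < b" if "s \<le> v" for v using True that unfolding S_def
      by (metis (mono_tags, lifting) empty_iff leI mem_Collect_eq)
    ultimately show thesis by (rule inf)
  next
    case False
    have cl: "closed S"
    proof -
      have "closed ({s..} \<inter> (\<lambda>r. X r \<omega>) -` {b..})"
        by (rule continuous_closed_preimage[OF c]) auto
      moreover have "{s..} \<inter> (\<lambda>r. X r \<omega>) -` {b..} = S" unfolding S_def by auto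
      ultimately show ?thesis by simp
    qed
    have bd: "bdd_below S" unfolding S_def by (intro bdd_belowI[of _ s]) auto
    define \<tau> where "\<tau> = Inf S"
    have tS: "\<tau> \<in> S" unfolding \<tau>_def by (rule closed_contains_Inf[OF False bd cl])
    have tm: "\<tau> \<le> v" if "v \<in> S" for v unfolding \<tau>_def by (rule cInf_lower[OF that bd])
    have e: "exit_time {0<..<b} s X \<omega> = ereal \<tau>"
      unfolding exit_time_def eS by (rule cInf_eq_minimum) (use tS tm in auto)
    have lt: "X v \<omega> < b" if "s \<le> v" "v < \<tau>" for v
      using tm[of v] that unfolding S_def by fastforce
    have s\<tau>: "s \<le> \<tau>" "b \<le> X \<tau> \<omega>" using tS unfolding S_def by auto
    have "X \<tau> \<omega> = b" if "X s \<omega> \<le> b"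
    proof -
      have "continuous_on {s..\<tau>} (\<lambda>r. X r \<omega>)" using c by (rule continuous_on_subset) auto
      from IVT'[of "\<lambda>r. X r \<omega>" s b \<tau>, OF that s\<tau>(2,1) this]
      obtain v where v: "s \<le> v" "v \<le> \<tau>" "X v \<omega> = b" by auto
      then have "\<tau> \<le> v" by (intro tm) (auto simp: S_def)
      then show ?thesis using v by simp
    qed
    then show thesis using fin[OF e s\<tau> lt] by blast
  qed
qed

section \<open>Optional stopping of discounted powers at the exit time\<close>

text \<open>Only continuity, positivity and adaptedness are assumed; the dynamics enter later
  through the one-step inequality \<open>mart\<close>.\<close>

locale wealth_path = brownian M W for M :: "'w measure" and W :: "real \<Rightarrow> 'w \<Rightarrow> real" +
  fixes t x :: real and X :: "real \<Rightarrow> 'w \<Rightarrow> real"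
  assumes t0: "0 \<le> t"
    and Xc: "\<And>\<omega>. \<omega> \<in> space M \<Longrightarrow> continuous_on {t..} (\<lambda>r. X r \<omega>)"
    and Xpos: "\<And>\<omega> r. \<omega> \<in> space M \<Longrightarrow> t \<le> r \<Longrightarrow> 0 < X r \<omega>"
    and Xm: "\<And>r. t \<le> r \<Longrightarrow> X r \<in> borel_measurable (F r)"
    and Xt: "\<And>\<omega>. \<omega> \<in> space M \<Longrightarrow> X t \<omega> = x"
begin

definition Z :: "real \<Rightarrow> real \<Rightarrow> real \<Rightarrow> 'w \<Rightarrow> real" where
  "Z l g r \<omega> = exp (- l * (r - t)) * X r \<omega> powr g"

text \<open>\<open>R\<close> is \<open>(\<le>)\<close> for supermartingales and \<open>(\<ge>)\<close> for submartingales.\<close>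

definition mart :: "(ennreal \<Rightarrow> ennreal \<Rightarrow> bool) \<Rightarrow> real \<Rightarrow> real \<Rightarrow> bool" where
  "mart R l g \<longleftrightarrow> (\<forall>r r' A. t \<le> r \<longrightarrow> r \<le> r' \<longrightarrow> A \<in> sets (F r) \<longrightarrow>
     R (\<integral>\<^sup>+\<omega>. ennreal (Z l g r' \<omega>) * indicator A \<omega> \<partial>P) (\<integral>\<^sup>+\<omega>. ennreal (Z l g r \<omega>) * indicator A \<omega> \<partial>P))"

lemma Z_nonneg [simp]: "Z l g r \<omega> \<ge> 0"
  unfolding Z_def by simp

lemma Z_meas: "t \<le> r \<Longrightarrow> Z l g r \<in> borel_measurable (F r)"
  unfolding Z_def[abs_def] using Xm[of r] by measurable

lemma Z_cont: "\<omega> \<in> space M \<Longrightarrow> continuous_on {t..} (\<lambda>r. Z l g r \<omega>)"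
  unfolding Z_def using Xc[of \<omega>] Xpos[of \<omega>]
    by (intro continuous_intros) (auto simp: less_imp_neq[symmetric] order_less_imp_not_eq2)

lemma X_pos_x: "0 < x"
  using Xt Xpos not_empty by (metis all_not_in_conv order_refl space_completion)

lemma Z_t: "(\<integral>\<^sup>+\<omega>. ennreal (Z l g t \<omega>) \<partial>P) = ennreal (x powr g)"
proof -
  have "(\<integral>\<^sup>+\<omega>. ennreal (Z l g t \<omega>) \<partial>P) = (\<integral>\<^sup>+\<omega>. ennreal (x powr g) \<partial>P)"
    by (intro nn_integral_cong) (simp add: Z_def Xt)
  then show ?thesis using emeasure_space_1 by simp
qed

lemma mart_start: "mart R l g \<Longrightarrow> t \<le> r \<Longrightarrow> R (\<integral>\<^sup>+\<omega>. ennreal (Z l g r \<omega>) \<partial>P) (ennreal (x powr g))"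
proof -
  assume a: "mart R l g" "t \<le> r"
  have e: "(\<integral>\<^sup>+\<omega>. f \<omega> * indicator (space M) \<omega> \<partial>P) = (\<integral>\<^sup>+\<omega>. f \<omega> \<partial>P)" for f
    by (intro nn_integral_cong) simp
  have "space M \<in> sets (F t)" using sets.top[of "F t"] by simp
  then have "R (\<integral>\<^sup>+\<omega>. ennreal (Z l g r \<omega>) * indicator (space M) \<omega> \<partial>P) (\<integral>\<^sup>+\<omega>. ennreal (Z l g t \<omega>)
    * indicator (space M) \<omega> \<partial>P)"
    using a unfolding mart_def by blast
  then show ?thesis unfolding e Z_t .
qed

text \<open>The rule stops at the first grid time by which the path has reached \<open>b\<close>.
  The events look at the whole interval up to a grid time and not only at grid times, so the
  rounding exceeds the true exit time by less than one mesh width.\<close>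

lemma grid_stop:
  assumes s: "t \<le> s" and T: "0 < T" and N: "N > 0"
  obtains u where "u \<in> borel_measurable P" "\<And>\<omega>. s \<le> u \<omega>" "\<And>\<omega>. u \<omega> \<le> s + T"
    "\<And>\<omega>. \<omega> \<in> space M \<Longrightarrow> u \<omega> = s + T \<or> (\<exists>v\<in>{s..u \<omega>}. b \<le> X v \<omega>)"
    "\<And>\<omega> v. \<omega> \<in> space M \<Longrightarrow> s \<le> v \<Longrightarrow> v \<le> u \<omega> - T / real N \<Longrightarrow> X v \<omega> < b"
    "\<And>l g. (\<lambda>\<omega>. Z l g (u \<omega>) \<omega>) \<in> borel_measurable P"
    "\<And>R l g. R = (\<le>) \<or> R = (\<ge>) \<Longrightarrow> mart R l g \<Longrightarrow> R (\<integral>\<^sup>+\<omega>. ennreal (Z l g (u \<omega>) \<omega>) \<partial>P) (\<integral>\<^sup>+\<omega>. ennreal (Z l g s \<omega>) \<partial>P)"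
proof -
  define \<delta> where "\<delta> = T / real N"
  have d0: "\<delta> > 0" unfolding \<delta>_def using T N by simp
  define \<sigma> where "\<sigma> i = s + real i * \<delta>" for i :: nat
  have \<sigma>N: "\<sigma> N = s + T" "\<sigma> 0 = s" unfolding \<sigma>_def \<delta>_def using N by auto
  have ms: "mono \<sigma>" unfolding \<sigma>_def using d0 by (intro monoI add_left_mono mult_right_mono) auto
  have st: "s \<le> \<sigma> i" "t \<le> \<sigma> i" for i using d0 s unfolding \<sigma>_def by (auto intro: order_trans)
  define B where "B i = {\<omega> \<in> space M. \<exists>u\<in>{s..\<sigma> i}. b \<le> X u \<omega>}" for i
  have B: "B i \<in> sets (F (\<sigma> i))" for i unfolding B_def
    by (rule F_hit) (use Xm s st in \<open>auto intro: continuous_on_subset[OF Xc]\<close>)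
  have mB: "mono B" unfolding B_def using monoD[OF ms] by (intro monoI) (fastforce intro: order_trans)
  define m where "m \<omega> = (LEAST i. i = N \<or> \<omega> \<in> B i)" for \<omega>
  define u where "u \<omega> = \<sigma> (m \<omega>)" for \<omega>
  have st_eq: "stopped f \<sigma> B N \<omega> = f (u \<omega>) \<omega>" for f :: "real \<Rightarrow> 'w \<Rightarrow> real" and \<omega>
    using stopped_Least[OF mB, of f \<sigma> N \<omega>] unfolding u_def m_def .
  have mm: "m \<omega> = N \<or> \<omega> \<in> B (m \<omega>)" for \<omega> unfolding m_def by (rule LeastI[of _ N]) simp
  have mN: "m \<omega> \<le> N" for \<omega> unfolding m_def by (rule Least_le) simp
  have ml: "\<omega> \<notin> B i" if "i < m \<omega>" for i \<omega> using not_less_Least[OF that[unfolded m_def]] by simp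
  have um: "(\<lambda>\<omega>. f (u \<omega>) \<omega>) \<in> borel_measurable P" if "\<And>r. t \<le> r \<Longrightarrow> f r \<in> borel_measurable (F r)"
    for f :: "real \<Rightarrow> 'w \<Rightarrow> real"
    using F_meas_P[OF stopped_meas[OF ms _ B, of f N]] that st(2) unfolding st_eq[abs_def]
      by (metis (no_types, lifting) ext st_eq)
  show thesis
  proof (rule that[of u])
    show "u \<in> borel_measurable P" using um[of "\<lambda>r \<omega>. r"] by simp
    show "s \<le> u \<omega>" "u \<omega> \<le> s + T" for \<omega> using st(1) monoD[OF ms mN[of \<omega>]] unfolding u_def \<sigma>N by auto
    show "u \<omega> = s + T \<or> (\<exists>v\<in>{s..u \<omega>}. b \<le> X v \<omega>)" if "\<omega> \<in> space M" for \<omega>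
      using mm[of \<omega>] unfolding u_def B_def using \<sigma>N by auto
    show "X v \<omega> < b" if "\<omega> \<in> space M" "s \<le> v" "v \<le> u \<omega> - T / real N" for \<omega> v
    proof (cases "m \<omega>")
      case 0
      then have "u \<omega> = s" unfolding u_def using \<sigma>N by simp
      then show ?thesis using that d0 unfolding \<delta>_def[symmetric] by linarith
    next
      case (Suc j)
      then have "\<omega> \<notin> B j" using ml by simp
      moreover have "u \<omega> - T / real N = \<sigma> j" unfolding u_def Suc \<delta>_def[symmetric] \<sigma>_def by (simp add: algebra_simps)
      ultimately show ?thesis using that unfolding B_def by (auto simp: not_le)
    qed
    show "(\<lambda>\<omega>. Z l g (u \<omega>) \<omega>) \<in> borel_measurable P" for l g using um[of "Z l g"] Z_meas by blast
    show "R (\<integral>\<^sup>+\<omega>. ennreal (Z l g (u \<omega>) \<omega>) \<partial>P) (\<integral>\<^sup>+\<omega>. ennreal (Z l g s \<omega>) \<partial>P)" if "R = (\<le>) \<or> R = (\<ge>)" "mart R l g"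
      for R l g
      using stopped_expectation[OF ms _ B mB that(1), of "Z l g" N] Z_meas st(2) that(2) monoD[OF ms]
      unfolding st_eq \<sigma>N(2) mart_def by auto
  qed
qed

text \<open>\<open>u\<close> is the exit time capped at \<open>s + T\<close> and rounded up to a grid of mesh \<open>T / N\<close>; the last clause is
  optional stopping at \<open>u\<close>.\<close>

definition grid_rounding :: "real \<Rightarrow> real \<Rightarrow> nat \<Rightarrow> real \<Rightarrow> ('w \<Rightarrow> real) \<Rightarrow> bool" where
  "grid_rounding s T N b u \<longleftrightarrow> u \<in> borel_measurable P \<and> (\<forall>\<omega>. s \<le> u \<omega> \<and> u \<omega> \<le> s + T) \<and>
    (\<forall>\<omega>\<in>space M. u \<omega> = s + T \<or> (\<exists>v\<in>{s..u \<omega>}. b \<le> X v \<omega>)) \<and>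
    (\<forall>\<omega>\<in>space M. \<forall>v. s \<le> v \<longrightarrow> v \<le> u \<omega> - T / real N \<longrightarrow> X v \<omega> < b) \<and>
    (\<forall>l g. (\<lambda>\<omega>. Z l g (u \<omega>) \<omega>) \<in> borel_measurable P) \<and>
    (\<forall>R l g. R = (\<le>) \<or> R = (\<ge>) \<longrightarrow> mart R l g \<longrightarrow> R (\<integral>\<^sup>+\<omega>. ennreal (Z l g (u \<omega>) \<omega>) \<partial>P) (\<integral>\<^sup>+\<omega>. ennreal (Z l g s \<omega>) \<partial>P))"

lemma grid_rounding_ex: "t \<le> s \<Longrightarrow> 0 < T \<Longrightarrow> 0 < N \<Longrightarrow> \<exists>u. grid_rounding s T N b u"
  unfolding grid_rounding_def by (rule grid_stop[of s T N b]) blast+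

lemma exit_cases [consumes 2, case_names inf fin]:
  assumes "t \<le> s" "\<omega> \<in> space M"
  obtains (inf) "exit_time {0<..<b} s X \<omega> = \<infinity>" "\<And>v. s \<le> v \<Longrightarrow> X v \<omega> < b"
  | (fin) \<tau> where "exit_time {0<..<b} s X \<omega> = ereal \<tau>" "s \<le> \<tau>" "b \<le> X \<tau> \<omega>" "\<And>v. s \<le> v \<Longrightarrow> v < \<tau> \<Longrightarrow> X v \<omega> < b"
    "X s \<omega> \<le> b \<Longrightarrow> X \<tau> \<omega> = b"
  by (rule exit_time_cases[of s X \<omega> b]) (use assms Xpos in \<open>auto intro: continuous_on_subset[OF Xc]\<close>)

lemma grid_rounding_close:
  assumes g: "grid_rounding s T N b u" and s: "t \<le> s" and w: "\<omega> \<in> space M"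
    and e: "exit_time {0<..<b} s X \<omega> = ereal \<tau>" and T: "\<tau> \<le> s + T"
  shows "\<tau> \<le> u \<omega>" "u \<omega> < \<tau> + T / real N"
proof -
  have g1: "s \<le> u \<omega>" "u \<omega> = s + T \<or> (\<exists>v\<in>{s..u \<omega>}. b \<le> X v \<omega>)" "\<And>v. s \<le> v \<Longrightarrow> v \<le> u \<omega> - T / real N \<Longrightarrow> X v \<omega> < b"
    using g w unfolding grid_rounding_def by auto
  obtain \<tau>' where f: "exit_time {0<..<b} s X \<omega> = ereal \<tau>'" "s \<le> \<tau>'" "b \<le> X \<tau>' \<omega>" "\<And>v. s \<le> v \<Longrightarrow> v < \<tau>' \<Longrightarrow> X v \<omega> < b"
    using exit_cases[OF s w, of b] e by (metis PInfty_neq_ereal(1))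
  have [simp]: "\<tau>' = \<tau>" using e f(1) by simp
  show "\<tau> \<le> u \<omega>"
  proof (cases "u \<omega> = s + T")
    case False
    then obtain v where v: "s \<le> v" "v \<le> u \<omega>" "b \<le> X v \<omega>" using g1(2) by auto
    then have "\<not> v < \<tau>" using f(4)[of v] by auto
    then show ?thesis using v by simp
  qed (use T in simp)
  show "u \<omega> < \<tau> + T / real N"
    using g1(3)[of \<tau>] f(2,3) by (simp add: not_le) (meson leI le_diff_eq not_less)
qed

lemma grid_rounding_far:
  assumes g: "grid_rounding s T N b u" and s: "t \<le> s" and w: "\<omega> \<in> space M"
    and e: "ereal (s + T) < exit_time {0<..<b} s X \<omega>"
  shows "u \<omega> = s + T"
proof (rule ccontr)
  assume n: "u \<omega> \<noteq> s + T"
  have g1: "u \<omega> \<le> s + T" "u \<omega> = s + T \<or> (\<exists>v\<in>{s..u \<omega>}. b \<le> X v \<omega>)"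
    using g w unfolding grid_rounding_def by auto
  then obtain v where v: "s \<le> v" "v \<le> u \<omega>" "b \<le> X v \<omega>" using n by auto
  show False
  using s w
  proof (cases rule: exit_cases[where b = b])
    case inf
    then show ?thesis using v by (meson not_le)
  next
    case (fin \<tau>)
    then have "\<not> v < \<tau>" using v by (meson not_le)
    moreover have "s + T < \<tau>" using e fin by simp
    ultimately show ?thesis using v g1 by simp
  qed
qed

text \<open>For \<open>g = 0\<close> this is the discount factor at exit, to which the pay-off
  reduces for initial wealth at most \<open>b\<close>.\<close>

definition pay :: "real \<Rightarrow> real \<Rightarrow> real \<Rightarrow> real \<Rightarrow> 'w \<Rightarrow> real" where
  "pay b s l g \<omega> = (if exit_time {0<..<b} s X \<omega> < \<infinity> then Z l g (real_of_ereal (exit_time {0<..<b} s X \<omega>)) \<omega> else 0)"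

lemma pay_nonneg [simp]: "pay b s l g \<omega> \<ge> 0"
  unfolding pay_def by simp

text \<open>Horizon \<open>Suc n\<close> with \<open>Suc n * Suc n\<close> cells has mesh
  \<open>1 / Suc n\<close>: the horizon grows while the mesh shrinks, so one sequence removes cap
  and rounding together.\<close>

lemma grid_rounding_seq:
  assumes s: "t \<le> s"
  obtains U where "\<And>n. grid_rounding s (real (Suc n)) (Suc n * Suc n) b (U n)"
    "\<And>\<omega> \<tau>. \<omega> \<in> space M \<Longrightarrow> exit_time {0<..<b} s X \<omega> = ereal \<tau> \<Longrightarrow> (\<lambda>n. U n \<omega>) \<longlonglongrightarrow> \<tau>"
    "\<And>\<omega> n. \<omega> \<in> space M \<Longrightarrow> exit_time {0<..<b} s X \<omega> = \<infinity> \<Longrightarrow> U n \<omega> = s + real (Suc n)"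
proof -
  have "\<exists>u. grid_rounding s (real (Suc n)) (Suc n * Suc n) b u" for n by (rule grid_rounding_ex[OF s]) auto
  then obtain U where U: "\<And>n. grid_rounding s (real (Suc n)) (Suc n * Suc n) b (U n)" by metis
  have lim: "(\<lambda>n. U n \<omega>) \<longlonglongrightarrow> \<tau>" if w: "\<omega> \<in> space M" and e: "exit_time {0<..<b} s X \<omega> = ereal \<tau>" for \<omega> \<tau>
  proof (rule tendsto_sandwich)
    obtain n0 :: nat where n0: "\<tau> - s \<le> real n0" using real_arch_simple by blast
    have c: "\<tau> \<le> U n \<omega> \<and> U n \<omega> < \<tau> + 1 / real (Suc n)" if "n \<ge> n0" for n
    proof -
      have "\<tau> \<le> s + real (Suc n)" using n0 that by simp
      moreover have "real (Suc n) / real (Suc n * Suc n) = 1 / real (Suc n)" unfolding of_nat_mult by simp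
      ultimately show ?thesis using grid_rounding_close[OF U[of n] s w e] by simp
    qed
    show "\<forall>\<^sub>F n in sequentially. \<tau> \<le> U n \<omega>" "\<forall>\<^sub>F n in sequentially. U n \<omega> \<le> \<tau> + 1 / real (Suc n)"
      using c unfolding eventually_sequentially by (auto intro!: exI[of _ n0] simp: less_imp_le)
    show "(\<lambda>n. \<tau> + 1 / real (Suc n)) \<longlonglongrightarrow> \<tau>"
      using tendsto_add[OF tendsto_const[of \<tau>] LIMSEQ_inverse_real_of_nat] by (simp add: inverse_eq_divide)
  qed simp
  show thesis by (rule that[of U]) (use U lim grid_rounding_far[OF U s] in auto)
qed

lemma Z_tendsto:
  assumes w: "\<omega> \<in> space M" and u: "(\<lambda>n. U n) \<longlonglongrightarrow> \<tau>" "\<And>n. t \<le> U n" and \<tau>: "t \<le> \<tau>"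
  shows "(\<lambda>n. Z l g (U n) \<omega>) \<longlonglongrightarrow> Z l g \<tau> \<omega>"
  using continuous_on_tendsto_compose[OF Z_cont[OF w] u(1)] u(2) \<tau> by auto

text \<open>Fatou along the rounded exit times. Paths that never exit contribute 0 on the left,
  which loses nothing in an upper bound for nonnegative processes.\<close>

lemma pay_upper:
  assumes s: "t \<le> s" and m: "mart (\<le>) l g"
  shows "(\<integral>\<^sup>+\<omega>. ennreal (pay b s l g \<omega>) \<partial>P) \<le> ennreal (x powr g)"
proof -
  obtain U where U: "\<And>n. grid_rounding s (real (Suc n)) (Suc n * Suc n) b (U n)"
    "\<And>\<omega> \<tau>. \<omega> \<in> space M \<Longrightarrow> exit_time {0<..<b} s X \<omega> = ereal \<tau> \<Longrightarrow> (\<lambda>n. U n \<omega>) \<longlonglongrightarrow> \<tau>"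
    using grid_rounding_seq[OF s, of b] by metis
  have Us: "s \<le> U n \<omega>" for n \<omega> using U(1)[of n] unfolding grid_rounding_def by blast
  have "(\<integral>\<^sup>+\<omega>. ennreal (pay b s l g \<omega>) \<partial>P) \<le> (\<integral>\<^sup>+\<omega>. liminf (\<lambda>n. ennreal (Z l g (U n \<omega>) \<omega>)) \<partial>P)"
  proof (rule nn_integral_mono)
    fix \<omega> assume "\<omega> \<in> space P"
    then have w: "\<omega> \<in> space M" by simp
    show "ennreal (pay b s l g \<omega>) \<le> liminf (\<lambda>n. ennreal (Z l g (U n \<omega>) \<omega>))"
    using s w
  proof (cases rule: exit_cases[where b = b])
      case inf
      then show ?thesis unfolding pay_def by simp
    next
      case (fin \<tau>)
      have "(\<lambda>n. Z l g (U n \<omega>) \<omega>) \<longlonglongrightarrow> Z l g \<tau> \<omega>"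
        by (rule Z_tendsto[OF w U(2)[OF w fin(1)]]) (use Us s fin(2) in \<open>auto intro: order_trans\<close>)
      then have "(\<lambda>n. ennreal (Z l g (U n \<omega>) \<omega>)) \<longlonglongrightarrow> ennreal (Z l g \<tau> \<omega>)" by (rule tendsto_ennrealI)
      then have "liminf (\<lambda>n. ennreal (Z l g (U n \<omega>) \<omega>)) = ennreal (Z l g \<tau> \<omega>)" by (intro lim_imp_Liminf) auto
      then show ?thesis unfolding pay_def fin(1) by simp
    qed
  qed
  also have "\<dots> \<le> liminf (\<lambda>n. \<integral>\<^sup>+\<omega>. ennreal (Z l g (U n \<omega>) \<omega>) \<partial>P)"
  proof (rule nn_integral_liminf)
    have "(\<lambda>\<omega>. Z l g (U n \<omega>) \<omega>) \<in> borel_measurable P" for n using U(1)[of n] unfolding grid_rounding_def by blast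
    then show "(\<lambda>\<omega>. ennreal (Z l g (U n \<omega>) \<omega>)) \<in> borel_measurable P" for n by measurable
  qed
  also have "\<dots> \<le> liminf (\<lambda>n::nat. ennreal (x powr g))"
  proof (intro Liminf_mono always_eventually allI)
    fix n
    have "(\<integral>\<^sup>+\<omega>. ennreal (Z l g (U n \<omega>) \<omega>) \<partial>P) \<le> (\<integral>\<^sup>+\<omega>. ennreal (Z l g s \<omega>) \<partial>P)"
      using U(1)[of n] m unfolding grid_rounding_def by blast
    also have "\<dots> \<le> ennreal (x powr g)" using mart_start[OF m s] .
    finally show "(\<integral>\<^sup>+\<omega>. ennreal (Z l g (U n \<omega>) \<omega>) \<partial>P) \<le> ennreal (x powr g)" .
  qed
  also have "\<dots> = ennreal (x powr g)" by (simp add: Liminf_const)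
  finally show ?thesis .
qed

text \<open>A pointwise limit of \<open>Z\<close> at rounded times. On paths that never exit the
  rounded times run to infinity, and the limit is the required 0 because \<open>l > 0\<close> and
  the power of the wealth is absent.\<close>

lemma pay_meas:
  assumes s: "t \<le> s" and l: "l > 0"
  shows "pay b s l 0 \<in> borel_measurable P"
proof -
  obtain U where U: "\<And>n. grid_rounding s (real (Suc n)) (Suc n * Suc n) b (U n)"
    "\<And>\<omega> \<tau>. \<omega> \<in> space M \<Longrightarrow> exit_time {0<..<b} s X \<omega> = ereal \<tau> \<Longrightarrow> (\<lambda>n. U n \<omega>) \<longlonglongrightarrow> \<tau>"
    "\<And>\<omega> n. \<omega> \<in> space M \<Longrightarrow> exit_time {0<..<b} s X \<omega> = \<infinity> \<Longrightarrow> U n \<omega> = s + real (Suc n)"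
    using grid_rounding_seq[OF s, of b] by metis
  have Us: "s \<le> U n \<omega>" for n \<omega> using U(1)[of n] unfolding grid_rounding_def by blast
  show ?thesis
  proof (rule borel_measurable_LIMSEQ_real)
    show "(\<lambda>\<omega>. Z l 0 (U n \<omega>) \<omega>) \<in> borel_measurable P" for n using U(1)[of n] unfolding grid_rounding_def by blast
    fix \<omega> assume "\<omega> \<in> space P"
    then have w: "\<omega> \<in> space M" by simp
    show "(\<lambda>n. Z l 0 (U n \<omega>) \<omega>) \<longlonglongrightarrow> pay b s l 0 \<omega>"
    using s w
  proof (cases rule: exit_cases[where b = b])
      case inf
      have "(\<lambda>n. exp (- l * (s + real (Suc n) - t))) \<longlonglongrightarrow> 0"
        using l by real_asymp
      moreover have "Z l 0 (U n \<omega>) \<omega> = exp (- l * (s + real (Suc n) - t))" for n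
        using Xpos[OF w, of "s + real (Suc n)"] s unfolding Z_def U(3)[OF w inf(1)] by simp
      ultimately show ?thesis unfolding pay_def inf by simp
    next
      case (fin \<tau>)
      have "(\<lambda>n. Z l 0 (U n \<omega>) \<omega>) \<longlonglongrightarrow> Z l 0 \<tau> \<omega>"
        by (rule Z_tendsto[OF w U(2)[OF w fin(1)]]) (use Us s fin(2) in \<open>auto intro: order_trans\<close>)
      then show ?thesis unfolding pay_def fin(1) by simp
    qed
  qed
qed

lemma pay_start:
  assumes w: "\<omega> \<in> space M" and xb: "x \<le> b" and b: "b > 0"
  shows "pay b t l g \<omega> = pay b t l 0 \<omega> * b powr g"
using order_refl[of t] w
proof (cases rule: exit_cases[where b = b])
  case inf
  then show ?thesis unfolding pay_def by simp
next
  case (fin \<tau>)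
  then have "X \<tau> \<omega> = b" using Xt[OF w] xb by simp
  then show ?thesis unfolding pay_def fin(1) Z_def using b by simp
qed

text \<open>Fatou points the wrong way here. The values at rounded times are truncated at
  \<open>K\<close> before the limit; the part cut off has mean at most the second moment divided by
  \<open>K\<close>, and the second moment is bounded through the supermartingale of power
  \<open>2 * g\<close>. A path that has not exited by \<open>t + T\<close> is below \<open>b\<close>
  and contributes at most \<open>exp (- l * T) * b powr g\<close>.\<close>

lemma pay_lower_T:
  assumes xb: "x \<le> b" and b: "b > 0" and l: "l > 0" and g: "g > 0" and m: "mart (\<ge>) l g"
    and m2: "mart (\<le>) l2 (2 * g)" and T: "T > 0" and K: "K > 0"
  shows "ennreal (x powr g) \<le> (\<integral>\<^sup>+\<omega>. ennreal (pay b t l 0 \<omega> * b powr g + exp (- l * T) * b powr g) \<partial>P)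
    + ennreal (exp (\<bar>l2 - 2 * l\<bar> * T) * x powr (2 * g) / K)"
proof -
  have "\<exists>u. grid_rounding t T (Suc n) b u" for n by (rule grid_rounding_ex[OF order_refl T]) auto
  then obtain U where U: "\<And>n. grid_rounding t T (Suc n) b (U n)" by metis
  have Us: "t \<le> U n \<omega>" "U n \<omega> \<le> t + T" for n \<omega> using U[of n] unfolding grid_rounding_def by blast+
  define V where "V n \<omega> = Z l g (U n \<omega>) \<omega>" for n \<omega>
  have Vm [measurable]: "V n \<in> borel_measurable P" for n using U[of n] unfolding grid_rounding_def V_def[abs_def]
    by blast
  \<comment> \<open>The squared process is discounted at rate \<open>2 * l\<close>; over the horizon
    \<open>T\<close> this factor converts that rate into \<open>l2\<close>.\<close>
  define C where "C = exp (\<bar>l2 - 2 * l\<bar> * T)"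
  \<comment> \<open>The exit time capped at \<open>t + T\<close>: the limit of the roundings when
    the horizon is kept fixed and the mesh tends to 0.\<close>
  define \<rho> where "\<rho> \<omega> = (if exit_time {0<..<b} t X \<omega>
    \<le> ereal (t + T) then real_of_ereal (exit_time {0<..<b} t X \<omega>) else t + T)" for \<omega>
  have lim: "(\<lambda>n. V n \<omega>) \<longlonglongrightarrow> Z l g (\<rho> \<omega>) \<omega>" if w: "\<omega> \<in> space M" for \<omega>
  proof -
    have "(\<lambda>n. U n \<omega>) \<longlonglongrightarrow> \<rho> \<omega> \<and> t \<le> \<rho> \<omega>"
    proof (cases "exit_time {0<..<b} t X \<omega> \<le> ereal (t + T)")
      case True
      obtain \<tau> where \<tau>: "exit_time {0<..<b} t X \<omega> = ereal \<tau>" "t \<le> \<tau>"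
        using order_refl[of t] w by (cases rule: exit_cases[where b = b]) (use True in auto)
      have "(\<lambda>n. U n \<omega>) \<longlonglongrightarrow> \<tau>"
      proof (rule tendsto_sandwich)
        have c: "\<tau> \<le> U n \<omega> \<and> U n \<omega> < \<tau> + T / real (Suc n)" for n
          using grid_rounding_close[OF U[of n] order_refl w \<tau>(1)] True \<tau>(1) by simp
        show "\<forall>\<^sub>F n in sequentially. \<tau> \<le> U n \<omega>" "\<forall>\<^sub>F n in sequentially. U n \<omega> \<le> \<tau> + T / real (Suc n)"
          using c by (auto intro!: always_eventually less_imp_le)
        show "(\<lambda>n. \<tau> + T / real (Suc n)) \<longlonglongrightarrow> \<tau>" by real_asymp
      qed simp
      then show ?thesis using True \<tau> unfolding \<rho>_def by simp
    next
      case False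
      then have "U n \<omega> = t + T" for n using grid_rounding_far[OF U order_refl w] by (simp add: not_le)
      then show ?thesis using False T unfolding \<rho>_def by simp
    qed
    then show ?thesis unfolding V_def using Z_tendsto[OF w] Us by blast
  qed
  have bound: "Z l g (\<rho> \<omega>) \<omega> \<le> pay b t l 0 \<omega> * b powr g + exp (- l * T) * b powr g" if w: "\<omega> \<in> space M" for \<omega>
  proof (cases "exit_time {0<..<b} t X \<omega> \<le> ereal (t + T)")
    case True
    then have "Z l g (\<rho> \<omega>) \<omega> = pay b t l g \<omega>" unfolding pay_def \<rho>_def by auto
    then show ?thesis using pay_start[OF w xb b, of l g] by simp
  next
    case False
    have "X (t + T) \<omega> \<le> b"
      using order_refl[of t] w by (cases rule: exit_cases[where b = b]) (use False T in \<open>auto intro: less_imp_le\<close>)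
    then have "X (t + T) \<omega> powr g \<le> b powr g" using Xpos[OF w, of "t + T"] T g by (intro powr_mono2) auto
    then have "Z l g (\<rho> \<omega>) \<omega> \<le> exp (- l * T) * b powr g" using False unfolding \<rho>_def Z_def by simp
    moreover have "0 \<le> pay b t l 0 \<omega> * b powr g" by simp
    ultimately show ?thesis by linarith
  qed
  have n1: "ennreal (x powr g) \<le> (\<integral>\<^sup>+\<omega>. ennreal (V n \<omega>) \<partial>P)" for n
    using U[of n] m unfolding grid_rounding_def V_def Z_t[of l g, symmetric] by blast
  have n2: "(\<integral>\<^sup>+\<omega>. ennreal ((V n \<omega>)\<^sup>2) \<partial>P) \<le> ennreal (C * x powr (2 * g))" for n
  proof -
    have "(V n \<omega>)\<^sup>2 \<le> C * Z l2 (2 * g) (U n \<omega>) \<omega>" for \<omega>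
    proof -
      define r where "r = U n \<omega> - t"
      have r: "0 \<le> r" "r \<le> T" unfolding r_def using Us[of n \<omega>] by auto
      have p: "(X (U n \<omega>) \<omega> powr g)\<^sup>2 = X (U n \<omega>) \<omega> powr (2 * g)" by (simp add: power2_eq_square powr_add[symmetric])
      have "(exp (- l * r))\<^sup>2 = exp (- l2 * r) * exp ((l2 - 2 * l) * r)"
        by (simp add: power2_eq_square exp_add[symmetric] left_diff_distrib)
      also have "exp ((l2 - 2 * l) * r) \<le> C"
      proof -
        have "(l2 - 2 * l) * r \<le> \<bar>l2 - 2 * l\<bar> * r" using r by (intro mult_right_mono) auto
        also have "\<dots> \<le> \<bar>l2 - 2 * l\<bar> * T" using r by (intro mult_left_mono) auto
        finally show ?thesis unfolding C_def by simp
      qed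
      finally have "(exp (- l * r))\<^sup>2 \<le> exp (- l2 * r) * C" by simp
      then have "(exp (- l * r))\<^sup>2 * (X (U n \<omega>) \<omega> powr g)\<^sup>2 \<le> exp (- l2 * r) * C * (X (U n \<omega>) \<omega> powr g)\<^sup>2"
        by (rule mult_right_mono) simp
      then show ?thesis unfolding V_def Z_def r_def[symmetric] power_mult_distrib p by (simp add: mult_ac)
    qed
    then have "(\<integral>\<^sup>+\<omega>. ennreal ((V n \<omega>)\<^sup>2) \<partial>P) \<le> (\<integral>\<^sup>+\<omega>. ennreal (C * Z l2 (2 * g) (U n \<omega>) \<omega>) \<partial>P)"
      by (intro nn_integral_mono ennreal_leI)
    also have "\<dots> = ennreal C * (\<integral>\<^sup>+\<omega>. ennreal (Z l2 (2 * g) (U n \<omega>) \<omega>) \<partial>P)"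
    proof -
      have "(\<lambda>\<omega>. Z l2 (2 * g) (U n \<omega>) \<omega>) \<in> borel_measurable P" using U[of n] unfolding grid_rounding_def by blast
      then show ?thesis by (subst nn_integral_cmult[symmetric]) (auto simp: C_def ennreal_mult)
    qed
    also have "(\<integral>\<^sup>+\<omega>. ennreal (Z l2 (2 * g) (U n \<omega>) \<omega>) \<partial>P) \<le> ennreal (x powr (2 * g))"
      using U[of n] m2 unfolding grid_rounding_def Z_t[of l2 "2 * g", symmetric] by blast
    finally show ?thesis by (simp add: C_def ennreal_mult mult_left_mono)
  qed
  have n3: "ennreal (x powr g) \<le> (\<integral>\<^sup>+\<omega>. ennreal (min (V n \<omega>) K) \<partial>P) + ennreal (C * x powr (2 * g) / K)" for n
  proof -
    have "V n \<omega> \<le> min (V n \<omega>) K + (V n \<omega>)\<^sup>2 / K" for \<omega>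
    proof (cases "V n \<omega> \<le> K")
      case False
      then have "V n \<omega> * K \<le> V n \<omega> * V n \<omega>" using K by (intro mult_left_mono) auto
      then have "V n \<omega> \<le> (V n \<omega>)\<^sup>2 / K" using K by (simp add: power2_eq_square field_simps)
      then show ?thesis using K False by simp
    qed (use K in auto)
    then have "(\<integral>\<^sup>+\<omega>. ennreal (V n \<omega>) \<partial>P) \<le> (\<integral>\<^sup>+\<omega>. ennreal (min (V n \<omega>) K + (V n \<omega>)\<^sup>2 / K) \<partial>P)"
      by (intro nn_integral_mono ennreal_leI)
    also have "\<dots> = (\<integral>\<^sup>+\<omega>. ennreal (min (V n \<omega>) K) + ennreal (1 / K) * ennreal ((V n \<omega>)\<^sup>2) \<partial>P)"
      using K by (intro nn_integral_cong) (auto simp: V_def ennreal_plus[symmetric] ennreal_mult[symmetric] simp del: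
        ennreal_plus)
    also have "\<dots> = (\<integral>\<^sup>+\<omega>. ennreal (min (V n \<omega>) K) \<partial>P) + ennreal (1 / K) * (\<integral>\<^sup>+\<omega>. ennreal ((V n \<omega>)\<^sup>2) \<partial>P)"
      by (subst nn_integral_add) (auto simp: nn_integral_cmult)
    also have "\<dots> \<le> (\<integral>\<^sup>+\<omega>. ennreal (min (V n \<omega>) K) \<partial>P) + ennreal (1 / K) * ennreal (C * x powr (2 * g))"
      using n2 by (intro add_left_mono mult_left_mono) auto
    also have "ennreal (1 / K) * ennreal (C * x powr (2 * g)) = ennreal (C * x powr (2 * g) / K)"
      using K by (simp add: C_def ennreal_mult[symmetric])
    finally show ?thesis using n1[of n] by (rule_tac order_trans)
  qed
  have lim2: "(\<lambda>n. \<integral>\<^sup>+\<omega>. ennreal (min (V n \<omega>) K) \<partial>P) \<longlonglongrightarrow> (\<integral>\<^sup>+\<omega>. ennreal (min (Z l g (\<rho> \<omega>) \<omega>) K) \<partial>P)"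
  proof (rule nn_integral_dominated_convergence[where w = "\<lambda>_. ennreal K"])
    have "(\<lambda>\<omega>. Z l g (\<rho> \<omega>) \<omega>) \<in> borel_measurable P"
      by (rule borel_measurable_LIMSEQ_real[of _ V]) (use lim in auto)
    then show "(\<lambda>\<omega>. ennreal (min (Z l g (\<rho> \<omega>) \<omega>) K)) \<in> borel_measurable P" by measurable
    show "AE \<omega> in P. (\<lambda>n. ennreal (min (V n \<omega>) K)) \<longlonglongrightarrow> ennreal (min (Z l g (\<rho> \<omega>) \<omega>) K)"
      using lim by (intro AE_I2 tendsto_ennrealI tendsto_min tendsto_const) auto
  qed (auto simp: ennreal_leI base.emeasure_space_1 ennreal_less_top)
  have "ennreal (x powr g) \<le> (\<integral>\<^sup>+\<omega>. ennreal (min (Z l g (\<rho> \<omega>) \<omega>) K) \<partial>P) + ennreal (C * x powr (2 * g) / K)"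
    by (rule LIMSEQ_le_const[OF tendsto_add[OF lim2 tendsto_const]]) (use n3 in auto)
  also have "(\<integral>\<^sup>+\<omega>. ennreal (min (Z l g (\<rho> \<omega>) \<omega>) K) \<partial>P)
    \<le> (\<integral>\<^sup>+\<omega>. ennreal (pay b t l 0 \<omega> * b powr g + exp (- l * T) * b powr g) \<partial>P)"
    using bound by (intro nn_integral_mono ennreal_leI) (auto intro: order_trans[OF min.cobounded1])
  finally show ?thesis unfolding C_def by (simp add: add_right_mono)
qed

lemma pay_le_1: "t \<le> s \<Longrightarrow> l > 0 \<Longrightarrow> \<omega> \<in> space M \<Longrightarrow> pay b s l 0 \<omega> \<le> 1"
proof -
  assume s: "t \<le> s" and l: "l > 0" and w: "\<omega> \<in> space M"
  from s w show ?thesis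
  proof (cases rule: exit_cases[where b = b])
    case inf
    then show ?thesis unfolding pay_def by simp
  next
    case (fin \<tau>)
    then show ?thesis using s l Xpos[OF w, of \<tau>] unfolding pay_def Z_def by simp
  qed
qed

lemma pay_integrable: "t \<le> s \<Longrightarrow> l > 0 \<Longrightarrow> integrable P (pay b s l 0)"
  by (rule integrable_const_bound[where B = 1]) (use pay_le_1 pay_meas in auto)

text \<open>The order of the limits matters: the second-moment error may grow exponentially in
  \<open>T\<close>, so \<open>K\<close> tends to infinity first, at fixed \<open>T\<close>.\<close>

lemma pay_lower:
  assumes xb: "x \<le> b" and b: "b > 0" and l: "l > 0" and g: "g > 0" and m: "mart (\<ge>) l g" and m2: "mart (\<le>) l2 (2 * g)"
  shows "x powr g \<le> (\<integral>\<omega>. pay b t l 0 \<omega> \<partial>P) * b powr g"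
proof -
  define E where "E = (\<integral>\<omega>. pay b t l 0 \<omega> \<partial>P)"
  define D where "D T = exp (\<bar>l2 - 2 * l\<bar> * T) * x powr (2 * g)" for T
  have i: "integrable P (pay b t l 0)" using pay_integrable[OF order_refl l] .
  have E0: "E \<ge> 0" unfolding E_def by (intro integral_nonneg_AE) auto
  have 1: "x powr g \<le> E * b powr g + exp (- l * T) * b powr g + D T / K" if "T > 0" "K > 0" for T K
  proof -
    have "(\<integral>\<^sup>+\<omega>. ennreal (pay b t l 0 \<omega> * b powr g + exp (- l * T) * b powr g) \<partial>P)
      = ennreal (\<integral>\<omega>. pay b t l 0 \<omega> * b powr g + exp (- l * T) * b powr g \<partial>P)"
      using i by (intro nn_integral_eq_integral) auto
    also have "(\<integral>\<omega>. pay b t l 0 \<omega> * b powr g + exp (- l * T) * b powr g \<partial>P) = E * b powr g + exp (- l * T) * b powr g"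
      unfolding E_def using i prob_space by simp
    finally have "ennreal (x powr g) \<le> ennreal (E * b powr g + exp (- l * T) * b powr g) + ennreal (D T / K)"
      using pay_lower_T[OF xb b l g m m2 that] unfolding D_def by simp
    also have "\<dots> = ennreal (E * b powr g + exp (- l * T) * b powr g + D T / K)"
      using E0 that by (intro ennreal_plus[symmetric]) (auto simp: D_def)
    finally show ?thesis using E0 that by (subst (asm) ennreal_le_iff) (auto simp: D_def)
  qed
  have 2: "x powr g \<le> E * b powr g + exp (- l * T) * b powr g" if "T > 0" for T
  proof (rule tendsto_lowerbound)
    show "((\<lambda>K. E * b powr g + exp (- l * T) * b powr g + D T / K) \<longlongrightarrow> E * b powr g + exp (- l * T) * b powr g) at_top"
      by real_asymp
    show "\<forall>\<^sub>F K in at_top. x powr g \<le> E * b powr g + exp (- l * T) * b powr g + D T / K"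
      using eventually_gt_at_top[of 0] by eventually_elim (use 1 that in auto)
  qed simp
  have "x powr g \<le> E * b powr g"
  proof (rule tendsto_lowerbound)
    show "((\<lambda>T. E * b powr g + exp (- l * T) * b powr g) \<longlongrightarrow> E * b powr g) at_top"
      using l by real_asymp
    show "\<forall>\<^sub>F T in at_top. x powr g \<le> E * b powr g + exp (- l * T) * b powr g"
      using eventually_gt_at_top[of 0] by eventually_elim (use 2 in auto)
  qed simp
  then show ?thesis unfolding E_def .
qed

lemma pay_upper_start:
  assumes xb: "x \<le> b" and b: "b > 0" and l: "l > 0" and m: "mart (\<le>) l g"
  shows "(\<integral>\<omega>. pay b t l 0 \<omega> \<partial>P) \<le> (x / b) powr g"
proof -
  have "ennreal (\<integral>\<omega>. pay b t l 0 \<omega> * b powr g \<partial>P) = (\<integral>\<^sup>+\<omega>. ennreal (pay b t l 0 \<omega> * b powr g) \<partial>P)"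
    using pay_integrable[OF order_refl l] by (intro nn_integral_eq_integral[symmetric]) auto
  also have "\<dots> = (\<integral>\<^sup>+\<omega>. ennreal (pay b t l g \<omega>) \<partial>P)"
    using pay_start[OF _ xb b, of _ l g] by (intro nn_integral_cong) simp
  also have "\<dots> \<le> ennreal (x powr g)" by (rule pay_upper[OF order_refl m])
  finally have "(\<integral>\<omega>. pay b t l 0 \<omega> \<partial>P) * b powr g \<le> x powr g" by simp
  then show ?thesis using b X_pos_x by (simp add: powr_divide field_simps)
qed

lemma pay_value:
  assumes "x \<le> b" "b > 0" "l > 0" "g > 0" "mart (\<le>) l g" "mart (\<ge>) l g" "mart (\<le>) l2 (2 * g)"
  shows "(\<integral>\<omega>. pay b t l 0 \<omega> \<partial>P) = (x / b) powr g"
proof (rule antisym)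
  show "(\<integral>\<omega>. pay b t l 0 \<omega> \<partial>P) \<le> (x / b) powr g" using assms by (intro pay_upper_start)
  have "x powr g \<le> (\<integral>\<omega>. pay b t l 0 \<omega> \<partial>P) * b powr g" using assms by (intro pay_lower)
  then show "(x / b) powr g \<le> (\<integral>\<omega>. pay b t l 0 \<omega> \<partial>P)" using assms X_pos_x by (simp add: powr_divide field_simps)
qed

end

section \<open>Geometric Brownian motion\<close>

context brownian
begin

text \<open>The logarithmic return over \<open>[s, r]\<close> under the constant proportion
  \<open>c\<close>; the quadratic term is the Ito correction.\<close>

definition logw :: "real \<Rightarrow> real \<Rightarrow> real \<Rightarrow> real \<Rightarrow> real \<Rightarrow> 'w \<Rightarrow> real" where
  "logw \<mu> \<sigma> c s r \<omega> = (\<mu> * c - \<sigma>\<^sup>2 * c\<^sup>2 / 2) * (r - s) + \<sigma> * c * (W r \<omega> - W s \<omega>)"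

text \<open>Proportion \<eta> acts up to \<open>te\<close> and \<theta> afterwards. The minimum and
  maximum with \<open>te\<close> make one of the factors trivial on either side, so that perturbed
  controls and, with \<eta> equal to \<theta>, constant ones share a formula.\<close>

definition gbm :: "real \<Rightarrow> real \<Rightarrow> real \<Rightarrow> real \<Rightarrow> real \<Rightarrow> real \<Rightarrow> real \<Rightarrow> real \<Rightarrow> 'w \<Rightarrow> real" where
  "gbm \<mu> \<sigma> \<eta> \<theta> t te x r \<omega> = x * exp (logw \<mu> \<sigma> \<eta> t (min r te) \<omega> + logw \<mu> \<sigma> \<theta> te (max r te) \<omega>)"

lemma logw_add: "logw \<mu> \<sigma> c s r \<omega> + logw \<mu> \<sigma> c r r' \<omega> = logw \<mu> \<sigma> c s r' \<omega>"
proof -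
  have "a * (r - s) + a * (r' - r) = a * (r' - s)" for a :: real by (simp add: algebra_simps)
  from this[of "\<mu> * c - \<sigma>\<^sup>2 * c\<^sup>2 / 2"] show ?thesis unfolding logw_def by (simp add: right_diff_distrib)
qed

lemma logw_refl [simp]: "logw \<mu> \<sigma> c s s \<omega> = 0"
  unfolding logw_def by simp

end

text \<open>The exponential rate of the \<open>g\<close>-th moment under the constant proportion
  \<open>c\<close>, that is, the generator of the wealth applied to the power \<open>g\<close> and
  divided by that power.\<close>

definition growth :: "real \<Rightarrow> real \<Rightarrow> real \<Rightarrow> real \<Rightarrow> real" where
  "growth \<mu> \<sigma> g c = g * \<mu> * c + g * (g - 1) / 2 * \<sigma>\<^sup>2 * c\<^sup>2"

locale gbm_path = wealth_path M W t x X for M :: "'w measure" and W t x X +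
  fixes \<mu> \<sigma> \<eta> \<theta> te :: real
  assumes te: "t \<le> te"
    and XG: "\<And>r. t \<le> r \<Longrightarrow> AE \<omega> in P. X r \<omega> = gbm \<mu> \<sigma> \<eta> \<theta> t te x r \<omega>"
begin

text \<open>The later value is the earlier one times a lognormal factor independent of the past. The
  mean of this factor is exact, so the martingale properties depend only on the sign of
  \<open>growth \<mu> \<sigma> g c - l\<close>.\<close>

lemma step_const:
  assumes r: "t \<le> r" "r \<le> r'" and A: "A \<in> sets (F r)"
    and ae: "AE \<omega> in P. X r' \<omega> = X r \<omega> * exp (logw \<mu> \<sigma> c r r' \<omega>)"
  shows "(\<integral>\<^sup>+\<omega>. ennreal (Z l g r' \<omega>) * indicator A \<omega> \<partial>P) =
    ennreal (exp ((growth \<mu> \<sigma> g c - l) * (r' - r))) * (\<integral>\<^sup>+\<omega>. ennreal (Z l g r \<omega>) * indicator A \<omega> \<partial>P)"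
proof -
  define f where "f \<omega> = Z l g r \<omega> * indicator A \<omega>" for \<omega>
  define G where "G z = exp (- l * (r' - r) + g * (\<mu> * c - \<sigma>\<^sup>2 * c\<^sup>2 / 2) * (r' - r)) * exp (g * \<sigma> * c * z)" for z
  have fm: "f \<in> borel_measurable (F r)" unfolding f_def[abs_def] using Z_meas[OF r(1)] A by measurable
  have Gm: "G \<in> borel_measurable borel" unfolding G_def[abs_def] by measurable
  have rr: "0 \<le> r" using t0 r by simp
  have "(\<integral>\<^sup>+\<omega>. ennreal (Z l g r' \<omega>) * indicator A \<omega> \<partial>P) = (\<integral>\<^sup>+\<omega>. ennreal (f \<omega> * G (W r' \<omega> - W r \<omega>)) \<partial>P)"
  proof (rule nn_integral_cong_AE)
    show "AE \<omega> in P. ennreal (Z l g r' \<omega>) * indicator A \<omega> = ennreal (f \<omega> * G (W r' \<omega> - W r \<omega>))"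
      using ae AE_space
    proof eventually_elim
      case (elim \<omega>)
      have "X r' \<omega> powr g = X r \<omega> powr g * exp (g * logw \<mu> \<sigma> c r r' \<omega>)"
        using elim by (simp add: powr_mult exp_powr_real mult.commute)
      then have "Z l g r' \<omega> = Z l g r \<omega> * (exp (- l * (r' - r)) * exp (g * logw \<mu> \<sigma> c r r' \<omega>))"
      proof -
        have "exp (- l * (r' - t)) = exp (- l * (r - t)) * exp (- l * (r' - r))"
          unfolding exp_add[symmetric] by (intro arg_cong[where f = exp]) (simp add: algebra_simps)
        then show ?thesis unfolding Z_def \<open>X r' \<omega> powr g = _\<close> by simp
      qed
      also have "exp (- l * (r' - r)) * exp (g * logw \<mu> \<sigma> c r r' \<omega>) = G (W r' \<omega> - W r \<omega>)"
        unfolding G_def logw_def exp_add[symmetric] by (intro arg_cong[where f = exp]) (simp add: algebra_simps)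
      finally have "Z l g r' \<omega> = Z l g r \<omega> * G (W r' \<omega> - W r \<omega>)" .
      then show ?case unfolding f_def by (auto split: split_indicator)
    qed
  qed
  also have "\<dots> = (\<integral>\<^sup>+\<omega>. ennreal (f \<omega>) \<partial>P) * (\<integral>\<^sup>+\<omega>. ennreal (G (W r' \<omega> - W r \<omega>)) \<partial>P)"
    by (rule nn_integral_indep_incr[OF rr r(2) fm Gm]) (auto simp: f_def G_def)
  also have "(\<integral>\<^sup>+\<omega>. ennreal (f \<omega>) \<partial>P) = (\<integral>\<^sup>+\<omega>. ennreal (Z l g r \<omega>) * indicator A \<omega> \<partial>P)"
    unfolding f_def by (intro nn_integral_cong) (auto split: split_indicator)
  also have "(\<integral>\<^sup>+\<omega>. ennreal (G (W r' \<omega> - W r \<omega>)) \<partial>P) = ennreal (exp ((growth \<mu> \<sigma> g c - l) * (r' - r)))"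
  proof -
    have [measurable]: "W r \<in> borel_measurable P" "W r' \<in> borel_measurable P" using W_meas_P rr r by auto
    have "(\<integral>\<^sup>+\<omega>. ennreal (G (W r' \<omega> - W r \<omega>)) \<partial>P) = ennreal (exp (- l * (r' - r)
      + g * (\<mu> * c - \<sigma>\<^sup>2 * c\<^sup>2 / 2) * (r' - r))) * (\<integral>\<^sup>+\<omega>. ennreal (exp (g * \<sigma> * c * (W r' \<omega> - W r \<omega>))) \<partial>P)"
      unfolding G_def by (subst nn_integral_cmult[symmetric]) (auto simp: ennreal_mult)
    also have "\<dots> = ennreal (exp (- l * (r' - r) + g * (\<mu> * c - \<sigma>\<^sup>2 * c\<^sup>2 / 2) * (r' - r))
      * exp ((g * \<sigma> * c)\<^sup>2 * (r' - r) / 2))"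
      unfolding nn_integral_exp_incr[OF rr r(2)] by (simp add: ennreal_mult)
    also have "exp (- l * (r' - r) + g * (\<mu> * c - \<sigma>\<^sup>2 * c\<^sup>2 / 2) * (r' - r)) * exp ((g * \<sigma> * c)\<^sup>2 * (r' - r) / 2)
      = exp ((growth \<mu> \<sigma> g c - l) * (r' - r))"
      unfolding exp_add[symmetric] growth_def
        by (intro arg_cong[where f = exp]) (simp add: power2_eq_square field_simps)
    finally show ?thesis .
  qed
  finally show ?thesis by (simp add: mult.commute)
qed

lemma step_before:
  assumes "t \<le> r" "r \<le> r'" "r' \<le> te"
  shows "AE \<omega> in P. X r' \<omega> = X r \<omega> * exp (logw \<mu> \<sigma> \<eta> r r' \<omega>)"
  using XG[OF assms(1)] XG[OF order_trans[OF assms(1,2)]]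
proof eventually_elim
  case (elim \<omega>)
  have "min r te = r" "min r' te = r'" "max r te = te" "max r' te = te" using assms by auto
  moreover have "logw \<mu> \<sigma> \<eta> t r' \<omega> = logw \<mu> \<sigma> \<eta> t r \<omega> + logw \<mu> \<sigma> \<eta> r r' \<omega>" by (rule logw_add[symmetric])
  ultimately show ?case using elim unfolding gbm_def by (simp add: exp_add)
qed

lemma step_after:
  assumes "te \<le> r" "r \<le> r'"
  shows "AE \<omega> in P. X r' \<omega> = X r \<omega> * exp (logw \<mu> \<sigma> \<theta> r r' \<omega>)"
  using XG[OF order_trans[OF te assms(1)]] XG[OF order_trans[OF te order_trans[OF assms]]]
proof eventually_elim
  case (elim \<omega>)
  have "min r te = te" "min r' te = te" "max r te = r" "max r' te = r'" using assms by auto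
  moreover have "logw \<mu> \<sigma> \<theta> te r' \<omega> = logw \<mu> \<sigma> \<theta> te r \<omega> + logw \<mu> \<sigma> \<theta> r r' \<omega>" by (rule logw_add[symmetric])
  ultimately show ?case using elim unfolding gbm_def by (simp add: exp_add)
qed

lemma step_factor:
  assumes r: "t \<le> r" "r \<le> r'" and A: "A \<in> sets (F r)"
  shows "(\<integral>\<^sup>+\<omega>. ennreal (Z l g r' \<omega>) * indicator A \<omega> \<partial>P) =
    ennreal (exp ((growth \<mu> \<sigma> g \<eta> - l) * (min r' te - min r te) + (growth \<mu> \<sigma> g \<theta> - l) * (max r' te - max r te))) *
      (\<integral>\<^sup>+\<omega>. ennreal (Z l g r \<omega>) * indicator A \<omega> \<partial>P)"
proof -
  consider "r' \<le> te" | "te \<le> r" | "r \<le> te" "te \<le> r'" using r by linarith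
  then show ?thesis
  proof cases
    case 1
    then show ?thesis using step_const[OF r A step_before[OF r 1]] r by (simp add: min_def max_def)
  next
    case 2
    have "min r te = te" "min r' te = te" "max r te = r" "max r' te = r'" using 2 r by auto
    then show ?thesis using step_const[OF r A step_after[OF 2 r(2)]] by simp
  next
    case 3
    have m: "min r te = r" "min r' te = te" "max r te = te" "max r' te = r'" using 3 by auto
    have A': "A \<in> sets (F te)" using A F_mono_sets[OF 3(1)] by blast
    show ?thesis
      unfolding step_const[OF te 3(2) A' step_after[OF order_refl 3(2)]] step_const[OF r(1) 3(1) A step_before[OF
        r(1) 3(1) order_refl]] m
      by (simp add: mult.assoc[symmetric] ennreal_mult[symmetric] exp_add[symmetric] add.commute)
  qed
qed

lemma mart_le:
  assumes "growth \<mu> \<sigma> g \<eta> \<le> l" "growth \<mu> \<sigma> g \<theta> \<le> l"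
  shows "mart (\<le>) l g"
  unfolding mart_def
proof (intro allI impI)
  fix r r' A assume r: "t \<le> r" "r \<le> r'" and A: "A \<in> sets (F r)"
  have "(growth \<mu> \<sigma> g \<eta> - l) * (min r' te - min r te) + (growth \<mu> \<sigma> g \<theta> - l) * (max r' te - max r te) \<le> 0"
    using assms r by (intro add_nonpos_nonpos mult_nonpos_nonneg) auto
  then have "ennreal (exp ((growth \<mu> \<sigma> g \<eta> - l) * (min r' te - min r te)
    + (growth \<mu> \<sigma> g \<theta> - l) * (max r' te - max r te))) \<le> 1"
    by (simp add: ennreal_le_1)
  from mult_right_mono[OF this, of "\<integral>\<^sup>+\<omega>. ennreal (Z l g r \<omega>) * indicator A \<omega> \<partial>P"]
  show "(\<integral>\<^sup>+\<omega>. ennreal (Z l g r' \<omega>) * indicator A \<omega> \<partial>P) \<le> (\<integral>\<^sup>+\<omega>. ennreal (Z l g r \<omega>) * indicator A \<omega> \<partial>P)"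
    unfolding step_factor[OF r A] by simp
qed

lemma mart_ge:
  assumes "growth \<mu> \<sigma> g \<eta> = l" "growth \<mu> \<sigma> g \<theta> = l"
  shows "mart (\<ge>) l g"
  unfolding mart_def
proof (intro allI impI)
  fix r r' A assume r: "t \<le> r" "r \<le> r'" and A: "A \<in> sets (F r)"
  show "(\<integral>\<^sup>+\<omega>. ennreal (Z l g r \<omega>) * indicator A \<omega> \<partial>P) \<le> (\<integral>\<^sup>+\<omega>. ennreal (Z l g r' \<omega>) * indicator A \<omega> \<partial>P)"
    unfolding step_factor[OF r A, of l g] assms by simp
qed

lemma moment:
  assumes "growth \<mu> \<sigma> g \<eta> = q" "growth \<mu> \<sigma> g \<theta> = q" "t \<le> r"
  shows "integrable P (\<lambda>\<omega>. X r \<omega> powr g)" "(\<integral>\<omega>. X r \<omega> powr g \<partial>P) = x powr g * exp (q * (r - t))"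
proof -
  have e: "(\<integral>\<^sup>+\<omega>. ennreal (X r \<omega> powr g) \<partial>P) = ennreal (x powr g * exp (q * (r - t)))"
  proof -
    have Z0: "Z 0 g r = (\<lambda>\<omega>. X r \<omega> powr g)" for r unfolding Z_def[abs_def] by simp
    have i: "(\<integral>\<^sup>+\<omega>. f \<omega> * indicator (space M) \<omega> \<partial>P) = (\<integral>\<^sup>+\<omega>. f \<omega> \<partial>P)" for f
      by (intro nn_integral_cong) simp
    have "space M \<in> sets (F t)" using sets.top[of "F t"] by simp
    from step_factor[OF order_refl assms(3) this, of 0 g] have
      "(\<integral>\<^sup>+\<omega>. ennreal (X r \<omega> powr g) \<partial>P) = ennreal (exp (q * (min r te - min t te) + q * (max r te - max t te)))
        * ennreal (x powr g)"
      unfolding i Z_t assms(1,2) by (simp add: Z0)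
    also have "q * (min r te - min t te) + q * (max r te - max t te) = q * (r - t)"
      using te assms(3) by (simp add: min_def max_def algebra_simps)
    finally show ?thesis by (simp add: ennreal_mult mult.commute)
  qed
  have [measurable]: "X r \<in> borel_measurable P" using F_meas_P[OF Xm[OF assms(3)]] .
  show "integrable P (\<lambda>\<omega>. X r \<omega> powr g)" using e by (intro integrableI_nonneg) auto
  show "(\<integral>\<omega>. X r \<omega> powr g \<partial>P) = x powr g * exp (q * (r - t))" using e by (subst integral_eq_nn_integral) auto
qed

end

section \<open>Existence of the wealth process\<close>

lemma restrict_measurable_LINT:
  fixes f :: "real \<Rightarrow> 'w \<Rightarrow> real"
  assumes f: "(\<lambda>(s, \<omega>). f s \<omega>) \<in> borel_measurable (restrict_space borel {a..b} \<Otimes>\<^sub>M N)"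
  shows "(\<lambda>\<omega>. LINT s:{a..b}|lborel. f s \<omega>) \<in> borel_measurable N"
proof -
  have s: "sigma_finite_measure (restrict_space lborel {a..b})"
    by (rule sigma_finite_measure_restrict_space) (auto intro: lborel.sigma_finite_measure_axioms)
  then interpret sigma_finite_measure "restrict_space lborel {a..b}" .
  have "(\<lambda>(\<omega>, s). f s \<omega>) \<in> borel_measurable (N \<Otimes>\<^sub>M restrict_space lborel {a..b})"
  proof -
    have e: "sets (restrict_space lborel {a..b}) = sets (restrict_space borel {a..b})"
      by (rule sets_restrict_space_cong) simp
    have "(\<lambda>(s, \<omega>). f s \<omega>) \<in> borel_measurable (restrict_space lborel {a..b} \<Otimes>\<^sub>M N)"
      using f by (simp cong: measurable_cong_sets[OF sets_pair_measure_cong[OF e refl] refl])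
    from measurable_pair_swap[OF this] show ?thesis by simp
  qed
  then have "(\<lambda>\<omega>. integral\<^sup>L (restrict_space lborel {a..b}) (\<lambda>s. f s \<omega>)) \<in> borel_measurable N"
    by (rule borel_measurable_lebesgue_integral)
  moreover have "integral\<^sup>L (restrict_space lborel {a..b}) (\<lambda>s. f s \<omega>) = (LINT s:{a..b}|lborel. f s \<omega>)" for \<omega>
    unfolding set_lebesgue_integral_def by (subst integral_restrict_space) auto
  ultimately show ?thesis by simp
qed

text \<open>Rounding time down to multiples of \<open>1 / Suc n\<close> makes the process a
  countable family of random variables selected by time, hence jointly measurable; continuity gives
  the limit. The cap at \<open>b\<close> keeps each member of the family measurable for
  \<open>N\<close>.\<close>

lemma continuous_progressive:
  fixes X :: "real \<Rightarrow> 'w \<Rightarrow> real"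
  assumes c: "\<And>\<omega>. \<omega> \<in> space N \<Longrightarrow> continuous_on {a..} (\<lambda>s. X s \<omega>)"
    and m: "\<And>s. a \<le> s \<Longrightarrow> s \<le> b \<Longrightarrow> X s \<in> borel_measurable N" and ab: "a \<le> b"
  shows "(\<lambda>(s, \<omega>). X s \<omega>) \<in> borel_measurable (restrict_space borel {a..b} \<Otimes>\<^sub>M N)"
proof -
  define g where "g n s = min (a + real (nat \<lfloor>(s - a) * real (Suc n)\<rfloor>) / real (Suc n)) b" for n s
  show ?thesis
  proof (rule borel_measurable_LIMSEQ_real)
    fix n
    have "(\<lambda>z. X (min (a + real (nat \<lfloor>(fst z - a) * real (Suc n)\<rfloor>) / real (Suc n)) b) (snd z))
      \<in> borel_measurable (restrict_space borel {a..b} \<Otimes>\<^sub>M N)"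
    proof (rule measurable_compose_countable'[where f = "\<lambda>k z. X (min (a + real k / real (Suc n)) b) (snd z)"
      and g = "\<lambda>z. nat \<lfloor>(fst z - a) * real (Suc n)\<rfloor>" and I = UNIV])
      show "(\<lambda>z. X (min (a + real k / real (Suc n)) b) (snd z))
        \<in> borel_measurable (restrict_space borel {a..b} \<Otimes>\<^sub>M N)" for k
        using ab by (intro measurable_compose[OF measurable_snd m]) auto
      have [measurable]: "fst \<in> measurable (restrict_space borel {a..b} \<Otimes>\<^sub>M N) (borel :: real measure)"
        by (rule measurable_compose[OF measurable_fst]) (rule measurable_restrict_space1, simp)
      show "(\<lambda>z. nat \<lfloor>(fst z - a) * real (Suc n)\<rfloor>) \<in> measurable (restrict_space borel {a..b} \<Otimes>\<^sub>M N) (count_space UNIV)"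
        by measurable
    qed auto
    then show "(\<lambda>(s, \<omega>). X (g n s) \<omega>) \<in> borel_measurable (restrict_space borel {a..b} \<Otimes>\<^sub>M N)"
      unfolding g_def by (simp add: case_prod_beta')
  next
    fix z assume z: "z \<in> space (restrict_space borel {a..b} \<Otimes>\<^sub>M N)"
    obtain s \<omega> where z': "z = (s, \<omega>)" by force
    then have s: "a \<le> s" "s \<le> b" "\<omega> \<in> space N" using z by (auto simp: space_pair_measure)
    have "(\<lambda>n. g n s) \<longlonglongrightarrow> s"
    proof (rule tendsto_sandwich)
      have b: "s - 1 / real (Suc n) \<le> g n s \<and> g n s \<le> s" for n
      proof -
        have "(s - a) * real (Suc n) \<ge> 0" using s by simp
        then have "real (nat \<lfloor>(s - a) * real (Suc n)\<rfloor>) \<le> (s - a) * real (Suc n)"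
          "(s - a) * real (Suc n) - 1 \<le> real (nat \<lfloor>(s - a) * real (Suc n)\<rfloor>)"
          by linarith+
        then have "real (nat \<lfloor>(s - a) * real (Suc n)\<rfloor>) / real (Suc n) \<le> s - a"
          "s - a - 1 / real (Suc n) \<le> real (nat \<lfloor>(s - a) * real (Suc n)\<rfloor>) / real (Suc n)"
          by (simp_all add: pos_divide_le_eq pos_le_divide_eq left_diff_distrib del: of_nat_Suc)
        then show ?thesis using s unfolding g_def by auto
      qed
      show "\<forall>\<^sub>F n in sequentially. s - 1 / real (Suc n) \<le> g n s" "\<forall>\<^sub>F n in sequentially. g n s \<le> s" using b by auto
      show "(\<lambda>n. s - 1 / real (Suc n)) \<longlonglongrightarrow> s" by real_asymp
    qed simp
    moreover have "a \<le> g n s" for n unfolding g_def using ab by auto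
    ultimately have "(\<lambda>n. X (g n s) \<omega>) \<longlonglongrightarrow> X s \<omega>"
      using continuous_on_tendsto_compose[OF c[OF s(3)], of "\<lambda>n. g n s" s sequentially] s by auto
    then show "(\<lambda>n. case z of (s, \<omega>) \<Rightarrow> X (g n s) \<omega>) \<longlonglongrightarrow> (case z of (s, \<omega>) \<Rightarrow> X s \<omega>)" unfolding z' by simp
  qed
qed

section \<open>Convergence in probability and orthogonal sums\<close>

context brownian
begin

lemma tends_in_prob_AE:
  assumes m: "\<And>j. Z j \<in> borel_measurable P" "Z' \<in> borel_measurable P" and ae: "AE \<omega> in P. (\<lambda>j. Z j \<omega>) \<longlonglongrightarrow> Z' \<omega>"
  shows "tends_in_prob P Z Z'"
  unfolding tends_in_prob_def
proof (intro allI impI)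
  fix \<delta> :: real assume d: "\<delta> > 0"
  note [measurable] = m
  have "(\<lambda>j. (\<integral>\<omega>. indicator {\<omega> \<in> space P. \<delta> < \<bar>Z j \<omega> - Z' \<omega>\<bar>} \<omega> \<partial>P)) \<longlonglongrightarrow> (\<integral>\<omega>. (0::real) \<partial>P)"
  proof (rule integral_dominated_convergence[where w = "\<lambda>_. 1"])
    show "AE \<omega> in P. (\<lambda>j. indicator {\<omega> \<in> space P. \<delta> < \<bar>Z j \<omega> - Z' \<omega>\<bar>} \<omega> :: real) \<longlonglongrightarrow> 0"
      using ae
    proof eventually_elim
      case (elim \<omega>)
      have "\<forall>\<^sub>F j in sequentially. dist (Z j \<omega>) (Z' \<omega>) < \<delta>" using elim d by (rule tendstoD)
      then have "\<forall>\<^sub>F j in sequentially. indicator {\<omega> \<in> space P. \<delta> < \<bar>Z j \<omega> - Z' \<omega>\<bar>} \<omega> = (0::real)"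
        by eventually_elim (auto simp: dist_real_def)
      then show ?case by (rule tendsto_eventually)
    qed
    show "(indicator {\<omega> \<in> space P. \<delta> < \<bar>Z j \<omega> - Z' \<omega>\<bar>} :: 'w \<Rightarrow> real) \<in> borel_measurable P" for j by measurable
  qed (auto split: split_indicator)
  moreover have "{\<omega> \<in> space M. \<delta> < \<bar>Z j \<omega> - Z' \<omega>\<bar>} \<inter> space M = {\<omega> \<in> space M. \<delta> < \<bar>Z j \<omega> - Z' \<omega>\<bar>}" for j by auto
  ultimately show "(\<lambda>j. measure P {\<omega> \<in> space P. \<delta> < \<bar>Z j \<omega> - Z' \<omega>\<bar>}) \<longlonglongrightarrow> 0" by simp
qed

lemma tends_in_prob_add:
  assumes "\<And>j. Z1 j \<in> borel_measurable P" "A \<in> borel_measurable P" "\<And>j. Z2 j \<in> borel_measurable P"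
    "B \<in> borel_measurable P"
    and 1: "tends_in_prob P Z1 A" and 2: "tends_in_prob P Z2 B"
  shows "tends_in_prob P (\<lambda>j \<omega>. Z1 j \<omega> + Z2 j \<omega>) (\<lambda>\<omega>. A \<omega> + B \<omega>)"
  unfolding tends_in_prob_def
proof (intro allI impI)
  note [measurable] = assms(1-4)
  fix \<delta> :: real assume d: "\<delta> > 0"
  show "(\<lambda>j. prob {\<omega> \<in> space P. \<delta> < \<bar>Z1 j \<omega> + Z2 j \<omega> - (A \<omega> + B \<omega>)\<bar>}) \<longlonglongrightarrow> 0"
  proof (rule tendsto_sandwich[of "\<lambda>_. 0" _ sequentially "\<lambda>j. prob {\<omega> \<in> space P. \<delta>/2 < \<bar>Z1 j \<omega> - A \<omega>\<bar>} + prob {\<omega>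
    \<in> space P. \<delta>/2 < \<bar>Z2 j \<omega> - B \<omega>\<bar>}"])
    have "prob {\<omega> \<in> space P. \<delta> < \<bar>Z1 j \<omega> + Z2 j \<omega> - (A \<omega> + B \<omega>)\<bar>}
      \<le> prob ({\<omega> \<in> space P. \<delta>/2 < \<bar>Z1 j \<omega> - A \<omega>\<bar>} \<union> {\<omega> \<in> space P. \<delta>/2 < \<bar>Z2 j \<omega> - B \<omega>\<bar>})" for j
    proof (rule finite_measure_mono)
      show "{\<omega> \<in> space P. \<delta>/2 < \<bar>Z1 j \<omega> - A \<omega>\<bar>} \<union> {\<omega> \<in> space P. \<delta>/2 < \<bar>Z2 j \<omega> - B \<omega>\<bar>} \<in> events" by measurable
    qed (auto simp: abs_if split: if_splits)
    also have "\<dots> j \<le> prob {\<omega> \<in> space P. \<delta>/2 < \<bar>Z1 j \<omega> - A \<omega>\<bar>} + prob {\<omega> \<in> space P. \<delta>/2 < \<bar>Z2 j \<omega> - B \<omega>\<bar>}" for j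
      by (rule measure_Un_le) measurable
    finally show "\<forall>\<^sub>F j in sequentially. prob {\<omega> \<in> space P. \<delta> < \<bar>Z1 j \<omega> + Z2 j \<omega> - (A \<omega> + B \<omega>)\<bar>}
      \<le> prob {\<omega> \<in> space P. \<delta>/2 < \<bar>Z1 j \<omega> - A \<omega>\<bar>} + prob {\<omega> \<in> space P. \<delta>/2 < \<bar>Z2 j \<omega> - B \<omega>\<bar>}"
      by simp
    have "\<delta>/2 > 0" using d by simp
    then have "(\<lambda>j. prob {\<omega> \<in> space P. \<delta>/2 < \<bar>Z1 j \<omega> - A \<omega>\<bar>}) \<longlonglongrightarrow> 0"
      "(\<lambda>j. prob {\<omega> \<in> space P. \<delta>/2 < \<bar>Z2 j \<omega> - B \<omega>\<bar>}) \<longlonglongrightarrow> 0"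
      using 1 2 unfolding tends_in_prob_def by blast+
    then show "(\<lambda>j. prob {\<omega> \<in> space P. \<delta>/2 < \<bar>Z1 j \<omega> - A \<omega>\<bar>} + prob {\<omega> \<in> space P. \<delta>/2 < \<bar>Z2 j \<omega> - B \<omega>\<bar>}) \<longlonglongrightarrow> 0"
      by (rule tendsto_add_zero)
  qed auto
qed

lemma prob_gt_le_second_moment:
  assumes i: "integrable P (\<lambda>\<omega>. (f \<omega>)\<^sup>2)" and f: "f \<in> borel_measurable P" and d: "\<delta> > 0"
  shows "prob {\<omega> \<in> space P. \<delta> < \<bar>f \<omega>\<bar>} \<le> (\<integral>\<omega>. (f \<omega>)\<^sup>2 \<partial>P) / \<delta>\<^sup>2"
proof -
  note [measurable] = f
  have "prob {\<omega> \<in> space P. \<delta> < \<bar>f \<omega>\<bar>} \<le> prob {\<omega> \<in> space P. \<delta>\<^sup>2 \<le> (f \<omega>)\<^sup>2}"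
  proof (rule finite_measure_mono)
    show "{\<omega> \<in> space P. \<delta>\<^sup>2 \<le> (f \<omega>)\<^sup>2} \<in> events" by measurable
  qed (use d in \<open>auto simp: abs_le_square_iff[symmetric]\<close>)
  also have "\<dots> \<le> (\<integral>\<omega>. (f \<omega>)\<^sup>2 \<partial>P) / \<delta>\<^sup>2"
    using integral_Markov_inequality_measure[OF i, of "{}" "\<delta>\<^sup>2"] d by simp
  finally show ?thesis .
qed

lemma tends_in_prob_L2:
  assumes i: "\<And>j. integrable P (\<lambda>\<omega>. (Z j \<omega>)\<^sup>2)" and m: "\<And>j. Z j \<in> borel_measurable P"
    and l: "(\<lambda>j. \<integral>\<omega>. (Z j \<omega>)\<^sup>2 \<partial>P) \<longlonglongrightarrow> 0"
  shows "tends_in_prob P Z (\<lambda>_. 0)"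
  unfolding tends_in_prob_def
proof (intro allI impI)
  fix \<delta> :: real assume d: "\<delta> > 0"
  show "(\<lambda>j. prob {\<omega> \<in> space P. \<delta> < \<bar>Z j \<omega> - 0\<bar>}) \<longlonglongrightarrow> 0"
  proof (rule tendsto_sandwich[of "\<lambda>_. 0" _ sequentially "\<lambda>j. (\<integral>\<omega>. (Z j \<omega>)\<^sup>2 \<partial>P) / \<delta>\<^sup>2"])
    show "\<forall>\<^sub>F j in sequentially. prob {\<omega> \<in> space P. \<delta> < \<bar>Z j \<omega> - 0\<bar>} \<le> (\<integral>\<omega>. (Z j \<omega>)\<^sup>2 \<partial>P) / \<delta>\<^sup>2"
      using prob_gt_le_second_moment[OF i m d] by simp
    show "(\<lambda>j. (\<integral>\<omega>. (Z j \<omega>)\<^sup>2 \<partial>P) / \<delta>\<^sup>2) \<longlonglongrightarrow> 0"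
      using tendsto_divide[OF l tendsto_const, of "\<delta>\<^sup>2"] d by simp
  qed auto
qed

text \<open>The form in which Ito sums are treated: a part \<open>Y\<close> that is small in L2
  only, while the remaining difference converges path by path.\<close>

lemma tends_in_prob_eventually_AE:
  assumes m: "\<And>j. Z j \<in> borel_measurable P" "\<And>j. Y j \<in> borel_measurable P" "A \<in> borel_measurable P"
    and t: "tends_in_prob P Y (\<lambda>_. 0)" and ae: "AE \<omega> in P. (\<lambda>j. Z j \<omega> - Y j \<omega>) \<longlonglongrightarrow> A \<omega>"
  shows "tends_in_prob P Z A"
proof -
  have "tends_in_prob P (\<lambda>j \<omega>. Z j \<omega> - Y j \<omega>) A"
    by (rule tends_in_prob_AE) (use m ae in auto)
  from tends_in_prob_add[OF _ m(3) m(2) _ this t] m show ?thesis by simp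
qed

text \<open>Ito isometry in discrete form; it also covers centred functions of the increments.\<close>

lemma orthogonal_sum:
  fixes v :: "nat \<Rightarrow> 'w \<Rightarrow> real" and g :: "nat \<Rightarrow> real \<Rightarrow> real" and q :: "nat \<Rightarrow> real"
  assumes q: "mono q" "0 \<le> q 0" and v: "\<And>i. v i \<in> borel_measurable (F (q i))" "\<And>i. integrable P (\<lambda>\<omega>. (v i \<omega>)\<^sup>2)"
    and g: "\<And>i. g i \<in> borel_measurable borel" "\<And>i. integrable P (\<lambda>\<omega>. (g i (W (q (Suc i)) \<omega> - W (q i) \<omega>))\<^sup>2)"
      "\<And>i. (\<integral>\<omega>. g i (W (q (Suc i)) \<omega> - W (q i) \<omega>) \<partial>P) = 0" "\<And>i. (\<integral>\<omega>. (g i (W (q (Suc i)) \<omega> - W (q i) \<omega>))\<^sup>2 \<partial>P) = d i"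
  shows "(\<lambda>\<omega>. \<Sum>i<n. v i \<omega> * g i (W (q (Suc i)) \<omega> - W (q i) \<omega>)) \<in> borel_measurable (F (q n)) \<and>
    integrable P (\<lambda>\<omega>. (\<Sum>i<n. v i \<omega> * g i (W (q (Suc i)) \<omega> - W (q i) \<omega>))\<^sup>2) \<and>
    (\<integral>\<omega>. (\<Sum>i<n. v i \<omega> * g i (W (q (Suc i)) \<omega> - W (q i) \<omega>))\<^sup>2 \<partial>P) = (\<Sum>i<n. (\<integral>\<omega>. (v i \<omega>)\<^sup>2 \<partial>P) * d i)"
proof (induction n)
  case (Suc n)
  define S where "S \<omega> = (\<Sum>i<n. v i \<omega> * g i (W (q (Suc i)) \<omega> - W (q i) \<omega>))" for \<omega>
  define N where "N \<omega> = g n (W (q (Suc n)) \<omega> - W (q n) \<omega>)" for \<omega>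
  have qn: "0 \<le> q n" "q n \<le> q (Suc n)" using monoD[OF q(1), of 0 n] q monoD[OF q(1), of n "Suc n"] by auto
  have Sm: "S \<in> borel_measurable (F (q n))" and Si: "integrable P (\<lambda>\<omega>. (S \<omega>)\<^sup>2)"
    and Se: "(\<integral>\<omega>. (S \<omega>)\<^sup>2 \<partial>P) = (\<Sum>i<n. (\<integral>\<omega>. (v i \<omega>)\<^sup>2 \<partial>P) * d i)"
    using Suc unfolding S_def[abs_def] by auto
  have WF: "W (q (Suc n)) \<in> borel_measurable (F (q (Suc n)))" "W (q n) \<in> borel_measurable (F (q (Suc n)))"
    using W_meas_F qn by auto
  have Nm: "N \<in> borel_measurable (F (q (Suc n)))" unfolding N_def[abs_def]
    by (rule measurable_compose[OF borel_measurable_diff[OF WF] g(1)[of n]])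
  note SP = F_meas_P[OF Sm] and NP = F_meas_P[OF Nm] and vP = F_meas_P[OF v(1)[of n]]
  note [measurable] = SP NP vP
  have Ni2: "integrable P (\<lambda>\<omega>. (N \<omega>)\<^sup>2)" "(\<integral>\<omega>. (N \<omega>)\<^sup>2 \<partial>P) = d n" "(\<integral>\<omega>. N \<omega> \<partial>P) = 0" using g unfolding N_def by auto
  have Ni: "integrable P N" by (rule square_integrable_imp_integrable) (use Ni2 in auto)
  have Sv: "integrable P (\<lambda>\<omega>. S \<omega> * v n \<omega>)"
  proof (rule Bochner_Integration.integrable_bound[of P "\<lambda>\<omega>. (S \<omega>)\<^sup>2 + (v n \<omega>)\<^sup>2"])
    show "integrable P (\<lambda>\<omega>. (S \<omega>)\<^sup>2 + (v n \<omega>)\<^sup>2)" using Si v(2) by simp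
    have "\<bar>a * b\<bar> \<le> a\<^sup>2 + b\<^sup>2" for a b :: real
    proof -
      have "2 * \<bar>a\<bar> * \<bar>b\<bar> \<le> \<bar>a\<bar>\<^sup>2 + \<bar>b\<bar>\<^sup>2" "0 \<le> \<bar>a\<bar> * \<bar>b\<bar>" by (rule sum_squares_bound) simp
      then show ?thesis unfolding abs_mult power2_abs by linarith
    qed
    then show "AE \<omega> in P. norm (S \<omega> * v n \<omega>) \<le> norm ((S \<omega>)\<^sup>2 + (v n \<omega>)\<^sup>2)" by simp
  qed simp
  have Svm: "(\<lambda>\<omega>. S \<omega> * v n \<omega>) \<in> borel_measurable (F (q n))" "(\<lambda>\<omega>. (v n \<omega>)\<^sup>2) \<in> borel_measurable (F (q n))"
    using Sm v(1) by auto
  \<comment> \<open>The cross term vanishes: \<open>S\<close> and \<open>v n\<close> are known at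
    time \<open>q n\<close>, while \<open>N\<close> is centred and independent of that past.\<close>
  have c1: "integrable P (\<lambda>\<omega>. S \<omega> * v n \<omega> * N \<omega>)" "(\<integral>\<omega>. S \<omega> * v n \<omega> * N \<omega> \<partial>P) = 0"
    using expectation_indep_incr[OF qn Svm(1) g(1)[of n] Sv] Ni Ni2 unfolding N_def[abs_def] by auto
  have c2: "integrable P (\<lambda>\<omega>. (v n \<omega>)\<^sup>2 * (N \<omega>)\<^sup>2)" "(\<integral>\<omega>. (v n \<omega>)\<^sup>2 * (N \<omega>)\<^sup>2 \<partial>P) = (\<integral>\<omega>. (v n \<omega>)\<^sup>2 \<partial>P) * d n"
    using expectation_indep_incr[OF qn Svm(2), of "\<lambda>z. (g n z)\<^sup>2"] g(1)[of n] v(2) Ni2 unfolding N_def[abs_def] by auto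
  have e: "(\<Sum>i<Suc n. v i \<omega> * g i (W (q (Suc i)) \<omega> - W (q i) \<omega>)) = S \<omega> + v n \<omega> * N \<omega>" for \<omega>
    unfolding S_def N_def by simp
  have e2: "(S \<omega> + v n \<omega> * N \<omega>)\<^sup>2 = (S \<omega>)\<^sup>2 + 2 * (S \<omega> * v n \<omega> * N \<omega>) + (v n \<omega>)\<^sup>2 * (N \<omega>)\<^sup>2" for \<omega>
    by (simp add: power2_eq_square algebra_simps)
  show ?case unfolding e
  proof (intro conjI)
    show "(\<lambda>\<omega>. S \<omega> + v n \<omega> * N \<omega>) \<in> borel_measurable (F (q (Suc n)))"
      using F_meas_mono[OF Sm qn(2)] F_meas_mono[OF v(1) qn(2)] Nm by simp
    show "integrable P (\<lambda>\<omega>. (S \<omega> + v n \<omega> * N \<omega>)\<^sup>2)" unfolding e2 using Si c1 c2 by simp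
    show "(\<integral>\<omega>. (S \<omega> + v n \<omega> * N \<omega>)\<^sup>2 \<partial>P) = (\<Sum>i<Suc n. (\<integral>\<omega>. (v i \<omega>)\<^sup>2 \<partial>P) * d i)"
      unfolding e2 using Si c1 c2 Se by simp
  qed
qed simp

end

text \<open>The one-step error of the Euler scheme for geometric Brownian motion.\<close>

definition gbm_rem :: "real \<Rightarrow> real \<Rightarrow> real \<Rightarrow> real \<Rightarrow> real \<Rightarrow> real" where
  "gbm_rem \<mu> \<sigma> c \<Delta> z = exp ((\<mu> * c - \<sigma>\<^sup>2 * c\<^sup>2 / 2) * \<Delta> + \<sigma> * c * z) - 1 - \<mu> * c * \<Delta> - \<sigma> * c * z"

text \<open>This and the next formula are the first and second moments of \<open>gbm_rem\<close> at
  a centred normal variable of variance \<Delta>. In both the constant and linear terms in \<Delta>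
  cancel, so they are of smaller order than \<Delta>.\<close>

definition gbm_rem_mean :: "real \<Rightarrow> real \<Rightarrow> real \<Rightarrow> real" where
  "gbm_rem_mean \<mu> c \<Delta> = exp (\<mu> * c * \<Delta>) - 1 - \<mu> * c * \<Delta>"

definition gbm_rem_sq :: "real \<Rightarrow> real \<Rightarrow> real \<Rightarrow> real \<Rightarrow> real" where
  "gbm_rem_sq \<mu> \<sigma> c \<Delta> = exp ((2 * \<mu> * c + \<sigma>\<^sup>2 * c\<^sup>2) * \<Delta>) - 2 * (1 + \<mu> * c * \<Delta>) * exp (\<mu> * c * \<Delta>)
     - 2 * \<sigma>\<^sup>2 * c\<^sup>2 * \<Delta> * exp (\<mu> * c * \<Delta>) + (1 + \<mu> * c * \<Delta>)\<^sup>2 + \<sigma>\<^sup>2 * c\<^sup>2 * \<Delta>"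

text \<open>Smallness relative to the length of a cell is what survives summation: over a grid
  covering a fixed interval the errors add up to at most \<open>e\<close> times its length.\<close>

lemma small_of_deriv_0:
  fixes f :: "real \<Rightarrow> real"
  assumes f: "(f has_real_derivative 0) (at 0)" "f 0 = 0" and e: "e > 0"
  shows "\<exists>d>0. \<forall>\<Delta>. 0 \<le> \<Delta> \<longrightarrow> \<Delta> < d \<longrightarrow> f \<Delta> \<le> e * \<Delta>"
proof -
  have "((\<lambda>h. (f (0 + h) - f 0) / h) \<longlongrightarrow> 0) (at 0)" using f(1) unfolding DERIV_def by simp
  then obtain d where d: "d > 0" "\<And>h. h \<noteq> 0 \<Longrightarrow> norm h < d \<Longrightarrow> norm (f h / h) < e"
    unfolding LIM_eq using e f(2) by (auto simp: dist_norm)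
  have "f \<Delta> \<le> e * \<Delta>" if D: "0 \<le> \<Delta>" "\<Delta> < d" for \<Delta>
  proof (cases "\<Delta> = 0")
    case False
    then have "\<bar>f \<Delta> / \<Delta>\<bar> < e" using d(2)[of \<Delta>] D by simp
    then have "f \<Delta> / \<Delta> < e" by linarith
    then show ?thesis using D False by (simp add: field_simps)
  qed (use f in simp)
  then show ?thesis using d(1) by blast
qed

lemma gbm_rem_mean_small: "e > 0 \<Longrightarrow> \<exists>d>0. \<forall>\<Delta>. 0 \<le> \<Delta> \<longrightarrow> \<Delta> < d \<longrightarrow> gbm_rem_mean \<mu> c \<Delta> \<le> e * \<Delta>"
  by (rule small_of_deriv_0) (auto simp: gbm_rem_mean_def intro!: derivative_eq_intros)

lemma gbm_rem_sq_small: "e > 0 \<Longrightarrow> \<exists>d>0. \<forall>\<Delta>. 0 \<le> \<Delta> \<longrightarrow> \<Delta> < d \<longrightarrow> gbm_rem_sq \<mu> \<sigma> c \<Delta> \<le> e * \<Delta>"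
proof (rule small_of_deriv_0)
  show "(gbm_rem_sq \<mu> \<sigma> c has_real_derivative 0) (at 0)"
    unfolding gbm_rem_sq_def[abs_def] by (auto intro!: derivative_eq_intros simp: algebra_simps)
qed (auto simp: gbm_rem_sq_def)

lemma gbm_rem_mean_nonneg: "gbm_rem_mean \<mu> c \<Delta> \<ge> 0"
  unfolding gbm_rem_mean_def using exp_ge_add_one_self[of "\<mu> * c * \<Delta>"] by linarith

context brownian
begin

lemma gbm_rem_expectation:
  assumes "0 \<le> s" "s \<le> r"
  defines "\<Delta> \<equiv> r - s"
  shows "integrable P (\<lambda>\<omega>. gbm_rem \<mu> \<sigma> c \<Delta> (W r \<omega> - W s \<omega>))"
    "(\<integral>\<omega>. gbm_rem \<mu> \<sigma> c \<Delta> (W r \<omega> - W s \<omega>) \<partial>P) = gbm_rem_mean \<mu> c \<Delta>"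
    "integrable P (\<lambda>\<omega>. (gbm_rem \<mu> \<sigma> c \<Delta> (W r \<omega> - W s \<omega>))\<^sup>2)"
      "(\<integral>\<omega>. (gbm_rem \<mu> \<sigma> c \<Delta> (W r \<omega> - W s \<omega>))\<^sup>2 \<partial>P) = gbm_rem_sq \<mu> \<sigma> c \<Delta>"
proof -
  define a where "a = exp ((\<mu> * c - \<sigma>\<^sup>2 * c\<^sup>2 / 2) * \<Delta>)"
  define u where "u = \<sigma> * c"
  define b where "b = 1 + \<mu> * c * \<Delta>"
  define z where "z \<omega> = W r \<omega> - W s \<omega>" for \<omega>
  have e: "gbm_rem \<mu> \<sigma> c \<Delta> (z \<omega>) = a * exp (u * z \<omega>) - b - u * z \<omega>" for \<omega>
    unfolding gbm_rem_def a_def u_def b_def by (simp add: exp_add)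
  have e2: "(a * exp (u * z \<omega>) - b - u * z \<omega>)\<^sup>2 = a\<^sup>2 * exp ((2 * u) * z \<omega>) - 2 * b * a * exp (u * z \<omega>)
    - 2 * a * u * (z \<omega> * exp (u * z \<omega>))
      + b\<^sup>2 + 2 * b * u * z \<omega> + u\<^sup>2 * (z \<omega>)\<^sup>2" for \<omega>
  proof -
    have "exp ((2 * u) * z \<omega>) = exp (u * z \<omega>) * exp (u * z \<omega>)" by (simp add: exp_add[symmetric])
    then show ?thesis by (simp only:) (simp add: power2_eq_square algebra_simps)
  qed
  have i: "integrable P (\<lambda>\<omega>. exp (v * z \<omega>))" "(\<integral>\<omega>. exp (v * z \<omega>) \<partial>P) = exp (v\<^sup>2 * \<Delta> / 2)"
    "integrable P (\<lambda>\<omega>. z \<omega> * exp (v * z \<omega>))" "(\<integral>\<omega>. z \<omega> * exp (v * z \<omega>) \<partial>P) = v * \<Delta> * exp (v\<^sup>2 * \<Delta> / 2)"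
    "integrable P z" "(\<integral>\<omega>. z \<omega> \<partial>P) = 0" "integrable P (\<lambda>\<omega>. (z \<omega>)\<^sup>2)" "(\<integral>\<omega>. (z \<omega>)\<^sup>2 \<partial>P) = \<Delta>" for v
    unfolding z_def \<Delta>_def using exp_incr[OF assms(1,2)] incr_exp_incr[OF assms(1,2)] incr_mean[OF assms(1,2)]
      incr_square[OF assms(1,2)] by auto
  have a1: "a * exp (u\<^sup>2 * \<Delta> / 2) = exp (\<mu> * c * \<Delta>)"
    unfolding a_def u_def exp_add[symmetric]
      by (intro arg_cong[where f = exp]) (simp add: power2_eq_square algebra_simps)
  have a2: "a\<^sup>2 * exp ((2 * u)\<^sup>2 * \<Delta> / 2) = exp ((2 * \<mu> * c + \<sigma>\<^sup>2 * c\<^sup>2) * \<Delta>)"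
    unfolding a_def u_def power2_eq_square exp_add[symmetric]
      by (intro arg_cong[where f = exp]) (simp add: power2_eq_square algebra_simps)
  show "integrable P (\<lambda>\<omega>. gbm_rem \<mu> \<sigma> c \<Delta> (W r \<omega> - W s \<omega>))" unfolding z_def[symmetric] e using i by simp
  have "(\<integral>\<omega>. gbm_rem \<mu> \<sigma> c \<Delta> (z \<omega>) \<partial>P) = a * exp (u\<^sup>2 * \<Delta> / 2) - b"
    unfolding e using i prob_space by simp
  then show "(\<integral>\<omega>. gbm_rem \<mu> \<sigma> c \<Delta> (W r \<omega> - W s \<omega>) \<partial>P) = gbm_rem_mean \<mu> c \<Delta>"
    unfolding a1 unfolding z_def b_def gbm_rem_mean_def by simp
  show "integrable P (\<lambda>\<omega>. (gbm_rem \<mu> \<sigma> c \<Delta> (W r \<omega> - W s \<omega>))\<^sup>2)" unfolding z_def[symmetric] e e2 using i by simp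
  have "(\<integral>\<omega>. (gbm_rem \<mu> \<sigma> c \<Delta> (z \<omega>))\<^sup>2 \<partial>P) = a\<^sup>2 * exp ((2 * u)\<^sup>2 * \<Delta> / 2) - 2 * b * (a * exp (u\<^sup>2 * \<Delta> / 2))
    - 2 * u * u * \<Delta> * (a * exp (u\<^sup>2 * \<Delta> / 2)) + b\<^sup>2 + u\<^sup>2 * \<Delta>"
    unfolding e e2 using i prob_space by simp
  then show "(\<integral>\<omega>. (gbm_rem \<mu> \<sigma> c \<Delta> (W r \<omega> - W s \<omega>))\<^sup>2 \<partial>P) = gbm_rem_sq \<mu> \<sigma> c \<Delta>"
    unfolding a1 a2 unfolding z_def b_def u_def gbm_rem_sq_def by (simp add: power2_eq_square mult_ac)
qed

end

section \<open>Geometric Brownian motion as a limit of Ito sums\<close>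

locale gbm_sol = gbm_path +
  assumes te': "t < te" and pos: "\<mu> > 0" "\<sigma> > 0" "\<eta> > 0" "\<theta> > 0"
begin

definition cf :: "real \<Rightarrow> real" where "cf s = (if s < te then \<eta> else \<theta>)"

definition Y :: "real \<Rightarrow> 'a \<Rightarrow> real" where "Y s \<omega> = \<sigma> * cf s * X s \<omega>"

text \<open>The mesh divides \<open>te - t\<close>, so \<open>te\<close> is a point of every grid
  and the control is constant on each cell.\<close>

definition dl :: "nat \<Rightarrow> real" where "dl j = (te - t) / real (Suc j)"

definition pt :: "nat \<Rightarrow> nat \<Rightarrow> real" where "pt j i = t + real i * dl j"

text \<open>With this many cells the grid reaches \<open>t + (te - t) * real (Suc j)\<close>, so
  every horizon is eventually covered while the mesh still tends to 0.\<close>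

definition nn :: "nat \<Rightarrow> nat" where "nn j = Suc j * Suc j"

text \<open>Simple integrands must be bounded, hence the cap at \<open>j\<close>. On each path and
  compact time interval it is eventually inactive.\<close>

definition \<xi> :: "nat \<Rightarrow> nat \<Rightarrow> 'a \<Rightarrow> real" where "\<xi> j i \<omega> = \<sigma> * cf (pt j i) * min (X (pt j i) \<omega>) (real j)"

definition cb :: real where "cb = max \<eta> \<theta>"

lemma cf_pos: "0 < cf s" "cf s \<le> cb" "0 < cb"
  unfolding cf_def cb_def using pos by auto

lemma cf_meas [measurable]: "cf \<in> borel_measurable borel"
  unfolding cf_def[abs_def] by measurable

lemma dl_pos: "dl j > 0"
  unfolding dl_def using te' by simp

lemma dl_lim: "dl \<longlonglongrightarrow> 0"
  unfolding dl_def[abs_def] by real_asymp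

lemma pt_mono: "mono (pt j)"
  unfolding pt_def using dl_pos[of j] by (intro monoI add_left_mono mult_right_mono) auto

lemma pt_strict: "i < k \<Longrightarrow> pt j i < pt j k"
  unfolding pt_def using dl_pos[of j] by simp

lemma pt_ge: "t \<le> pt j i"
  unfolding pt_def using dl_pos[of j] by simp

lemma pt_0: "pt j 0 = t"
  unfolding pt_def by simp

lemma pt_te: "pt j (Suc j) = te"
  unfolding pt_def dl_def by simp

lemma pt_nn: "pt j (nn j) = t + (te - t) * real (Suc j)"
  unfolding pt_def dl_def nn_def of_nat_mult by (simp del: of_nat_Suc)

lemma pt_step: "pt j (Suc i) = pt j i + dl j"
  unfolding pt_def by (simp add: algebra_simps)

lemma pt_nn_large: "\<forall>\<^sub>F j in sequentially. r \<le> pt j (nn j)"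
proof -
  have "filterlim (\<lambda>j. t + (te - t) * real (Suc j)) at_top sequentially" using te' by real_asymp
  then show ?thesis unfolding pt_nn filterlim_at_top by blast
qed

lemma cell_ex:
  assumes "t < s" "s \<le> pt j (nn j)"
  obtains i where "i < nn j" "pt j i < s" "s \<le> pt j (Suc i)"
proof -
  define k where "k = (LEAST k. s \<le> pt j k)"
  have k: "s \<le> pt j k" "k \<le> nn j" unfolding k_def by (rule LeastI[of _ "nn j"], fact) (rule Least_le, fact)
  then obtain i where i: "k = Suc i" using assms pt_0[of j] by (cases k) auto
  then have "\<not> s \<le> pt j i" using not_less_Least[of i "\<lambda>k. s \<le> pt j k"] unfolding k_def by simp
  then show thesis using that[of i] k i by auto
qed

text \<open>Cells are open on the left, so \<open>te\<close> closes a cell on which \<eta> is used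
  although \<open>cf te\<close> is already \<theta>. Excluding this one time costs nothing in an
  integral.\<close>

lemma cell_cf:
  assumes "pt j i < s" "s \<le> pt j (Suc i)" "s \<noteq> te"
  shows "cf (pt j i) = cf s"
proof (cases "s < te")
  case True
  then show ?thesis using assms unfolding cf_def by simp
next
  case False
  then have "pt j (Suc j) < pt j (Suc i)" using assms unfolding pt_te by simp
  then have "Suc j < Suc i" using monoD[OF pt_mono, of "Suc i" "Suc j" j] by (meson leI not_less)
  then have "te \<le> pt j i" using monoD[OF pt_mono, of "Suc j" i j] unfolding pt_te by simp
  then show ?thesis using False unfolding cf_def by simp
qed

definition Hs :: "nat \<Rightarrow> 'a simple_integrand" where "Hs j = (nn j, pt j, \<xi> j)"

lemma simple_value_cell:
  assumes "i < nn j" "pt j i < s" "s \<le> pt j (Suc i)"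
  shows "simple_value (Hs j) s \<omega> = \<xi> j i \<omega>"
proof -
  have z: "indicator {pt j k<..pt j (Suc k)} s = (0::real)" if "k \<noteq> i" for k
  proof (cases "k < i")
    case True
    then have "pt j (Suc k) \<le> pt j i" by (intro monoD[OF pt_mono]) simp
    then show ?thesis using assms by simp
  next
    case False
    then have "pt j (Suc i) \<le> pt j k" using that by (intro monoD[OF pt_mono]) simp
    then show ?thesis using assms by simp
  qed
  have "simple_value (Hs j) s \<omega> = (\<Sum>k<nn j. \<xi> j k \<omega> * indicator {pt j k<..pt j (Suc k)} s)"
    unfolding simple_value_def Hs_def by simp
  also have "\<dots> = (\<Sum>k<nn j. if k = i then \<xi> j i \<omega> else 0)"
  proof (rule sum.cong[OF refl])
    fix k
    show "\<xi> j k \<omega> * indicator {pt j k<..pt j (Suc k)} s = (if k = i then \<xi> j i \<omega> else 0)"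
    proof (cases "k = i")
      case True
      then show ?thesis using assms by simp
    next
      case False
      show ?thesis unfolding z[OF False] using False by simp
    qed
  qed
  finally show ?thesis using assms by simp
qed

lemma simple_value_cases: "simple_value (Hs j) s \<omega> = 0
  \<or> (\<exists>i<nn j. pt j i < s \<and> s \<le> pt j (Suc i) \<and> simple_value (Hs j) s \<omega> = \<xi> j i \<omega>)"
proof (cases "\<exists>i<nn j. pt j i < s \<and> s \<le> pt j (Suc i)")
  case True
  then show ?thesis using simple_value_cell by blast
next
  case False
  then have "simple_value (Hs j) s \<omega> = 0"
    unfolding simple_value_def Hs_def by (auto intro!: sum.neutral simp: indicator_def)
  then show ?thesis by simp
qed

lemma \<xi>_bound:
  assumes "\<omega> \<in> space M"
  shows "0 \<le> \<xi> j i \<omega>" "\<xi> j i \<omega> \<le> \<sigma> * cb * X (pt j i) \<omega>" "\<xi> j i \<omega> \<le> \<sigma> * cb * real j"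
proof -
  have X: "0 < X (pt j i) \<omega>" using Xpos[OF assms pt_ge] .
  show "0 \<le> \<xi> j i \<omega>" unfolding \<xi>_def using X pos cf_pos(1)[of "pt j i"] by simp
  have c: "\<sigma> * cf (pt j i) \<le> \<sigma> * cb" "0 \<le> \<sigma> * cb" using pos cf_pos by simp_all
  show "\<xi> j i \<omega> \<le> \<sigma> * cb * X (pt j i) \<omega>" unfolding \<xi>_def using X c pos cf_pos
    by (intro mult_mono) (auto intro: less_imp_le)
  show "\<xi> j i \<omega> \<le> \<sigma> * cb * real j" unfolding \<xi>_def using X c pos cf_pos by (intro mult_mono) (auto intro: less_imp_le)
qed

lemma X_sup:
  assumes "\<omega> \<in> space M"
  obtains B where "B > 0" "\<And>s. t \<le> s \<Longrightarrow> s \<le> T \<Longrightarrow> X s \<omega> \<le> B"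
proof -
  have "continuous_on {t..T} (\<lambda>s. X s \<omega>)" using Xc[OF assms] by (rule continuous_on_subset) auto
  then have "bounded ((\<lambda>s. X s \<omega>) ` {t..T})" using compact_continuous_image compact_imp_bounded by blast
  then obtain B where "\<forall>s\<in>{t..T}. \<bar>X s \<omega>\<bar> \<le> B" unfolding bounded_iff by auto
  then show thesis by (intro that[of "\<bar>B\<bar> + 1"]) force+
qed

lemma simple_value_bound:
  assumes w: "\<omega> \<in> space M" and B: "B > 0" "\<And>s. t \<le> s \<Longrightarrow> s \<le> T \<Longrightarrow> X s \<omega> \<le> B" and s: "s \<le> T"
  shows "\<bar>simple_value (Hs j) s \<omega>\<bar> \<le> \<sigma> * cb * B"
  using simple_value_cases[of j s \<omega>]
proof
  assume "\<exists>i<nn j. pt j i < s \<and> s \<le> pt j (Suc i) \<and> simple_value (Hs j) s \<omega> = \<xi> j i \<omega>"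
  then obtain i where i: "pt j i < s" "simple_value (Hs j) s \<omega> = \<xi> j i \<omega>" by blast
  have "\<xi> j i \<omega> \<le> \<sigma> * cb * X (pt j i) \<omega>" by (rule \<xi>_bound[OF w])
  also have "\<dots> \<le> \<sigma> * cb * B" using B(2)[of "pt j i"] pt_ge i s pos cf_pos(3) by (intro mult_left_mono) auto
  finally show ?thesis using \<xi>_bound(1)[OF w] i by simp
qed (use B pos cf_pos(3) in simp)

lemma Y_bound:
  assumes w: "\<omega> \<in> space M" and B: "\<And>s. t \<le> s \<Longrightarrow> s \<le> T \<Longrightarrow> X s \<omega> \<le> B" and s: "t \<le> s" "s \<le> T"
  shows "\<bar>Y s \<omega>\<bar> \<le> \<sigma> * cb * B"
proof -
  have "\<sigma> * cf s * X s \<omega> \<le> \<sigma> * cb * B"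
    using B[OF s] Xpos[OF w s(1)] cf_pos pos by (intro mult_mono) (auto intro: less_imp_le)
  then show ?thesis unfolding Y_def using Xpos[OF w s(1)] cf_pos(1)[of s] pos by simp
qed

lemma simple_value_lim:
  assumes w: "\<omega> \<in> space M" and s: "t < s" "s \<noteq> te"
  shows "(\<lambda>j. simple_value (Hs j) s \<omega>) \<longlonglongrightarrow> Y s \<omega>"
proof -
  obtain B where B: "B > 0" "\<And>v. t \<le> v \<Longrightarrow> v \<le> s \<Longrightarrow> X v \<omega> \<le> B" using X_sup[OF w] by metis
  have "\<exists>v. s \<le> pt j (nn j) \<longrightarrow> B \<le> real j \<longrightarrow> (t \<le> v \<and> v \<le> s \<and> s - dl j \<le> v
    \<and> simple_value (Hs j) s \<omega> = \<sigma> * cf s * X v \<omega>)" for j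
  proof (cases "s \<le> pt j (nn j) \<and> B \<le> real j")
    case True
    obtain i where i: "i < nn j" "pt j i < s" "s \<le> pt j (Suc i)" using cell_ex[OF s(1)] True by blast
    have "min (X (pt j i) \<omega>) (real j) = X (pt j i) \<omega>" using B(2)[OF pt_ge[of j i]] i(2) True by auto
    then have "simple_value (Hs j) s \<omega> = \<sigma> * cf s * X (pt j i) \<omega>"
      unfolding simple_value_cell[OF i] \<xi>_def cell_cf[OF i(2,3) s(2)] by simp
    then show ?thesis using i pt_ge[of j i] unfolding pt_step by (intro exI[of _ "pt j i"]) auto
  qed auto
  then obtain v where v: "\<And>j. s \<le> pt j (nn j) \<Longrightarrow> B \<le> real j \<Longrightarrow>
    t \<le> v j \<and> v j \<le> s \<and> s - dl j \<le> v j \<and> simple_value (Hs j) s \<omega> = \<sigma> * cf s * X (v j) \<omega>"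
    by metis
  define v' where "v' j = (if s \<le> pt j (nn j) \<and> B \<le> real j then v j else s)" for j
  have v': "t \<le> v' j" "v' j \<le> s" "s - dl j \<le> v' j" for j unfolding v'_def using v[of j] s dl_pos[of j] by auto
  have "v' \<longlonglongrightarrow> s"
  proof (rule tendsto_sandwich)
    show "(\<lambda>j. s - dl j) \<longlonglongrightarrow> s" using tendsto_diff[OF tendsto_const[of s] dl_lim] by simp
  qed (use v' in auto)
  then have "(\<lambda>j. X (v' j) \<omega>) \<longlonglongrightarrow> X s \<omega>"
    using continuous_on_tendsto_compose[OF Xc[OF w], of v' s sequentially] v' s by auto
  then have l: "(\<lambda>j. \<sigma> * cf s * X (v' j) \<omega>) \<longlonglongrightarrow> Y s \<omega>" unfolding Y_def by (intro tendsto_mult tendsto_const)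
  have "\<forall>\<^sub>F j in sequentially. simple_value (Hs j) s \<omega> = \<sigma> * cf s * X (v' j) \<omega>"
    using pt_nn_large[of s] eventually_ge_at_top[of "nat \<lceil>B\<rceil>"]
  proof eventually_elim
    case (elim j)
    then have "B \<le> real j" by linarith
    then show ?case using v[of j] elim unfolding v'_def by simp
  qed
  from tendsto_cong[THEN iffD2, OF this l] show ?thesis .
qed

text \<open>Integrands are jointly measurable with respect to the filtration, whereas the
  approximation errors are treated on the completed space; this passes from one to the
  other.\<close>

lemma sets_pair_F: "A \<in> sets (N \<Otimes>\<^sub>M F r) \<Longrightarrow> A \<in> sets (N \<Otimes>\<^sub>M P)"
proof -
  have i: "(\<lambda>\<omega>. \<omega>) \<in> measurable P (F r)" using F_sub_P[of r] by (auto simp: measurable_def)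
  have "(\<lambda>z. (fst z, snd z)) \<in> measurable (N \<Otimes>\<^sub>M P) (N \<Otimes>\<^sub>M F r)"
    by (intro measurable_Pair measurable_compose[OF measurable_snd i] measurable_fst)
  moreover assume A: "A \<in> sets (N \<Otimes>\<^sub>M F r)"
  ultimately have "(\<lambda>z. (fst z, snd z)) -` A \<inter> space (N \<Otimes>\<^sub>M P) \<in> sets (N \<Otimes>\<^sub>M P)" by (rule measurable_sets)
  moreover have "(\<lambda>z. (fst z, snd z)) -` A \<inter> space (N \<Otimes>\<^sub>M P) = A"
    using sets.sets_into_space[OF A] by (auto simp: space_pair_measure)
  ultimately show ?thesis by simp
qed

lemma pair_F_P: "f \<in> borel_measurable (N \<Otimes>\<^sub>M F r) \<Longrightarrow> f \<in> borel_measurable (N \<Otimes>\<^sub>M P)"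
  using sets_pair_F by (auto simp: measurable_def space_pair_measure)

lemma Y_prog: "t \<le> T \<Longrightarrow> (\<lambda>(s, \<omega>). Y s \<omega>) \<in> borel_measurable (restrict_space borel {t..T} \<Otimes>\<^sub>M F T)"
proof -
  assume T: "t \<le> T"
  have X: "(\<lambda>(s, \<omega>). X s \<omega>) \<in> borel_measurable (restrict_space borel {t..T} \<Otimes>\<^sub>M F T)"
    by (rule continuous_progressive) (use Xc F_meas_mono[OF Xm] T in auto)
  have c: "(\<lambda>z. cf (fst z)) \<in> borel_measurable (restrict_space borel {t..T} \<Otimes>\<^sub>M F T)"
    by (rule measurable_compose[OF measurable_fst]) (rule measurable_restrict_space1, simp)
  have "(\<lambda>z. \<sigma> * cf (fst z) * (case z of (s, \<omega>) \<Rightarrow> X s \<omega>)) \<in> borel_measurable (restrict_space borel {t..T} \<Otimes>\<^sub>M F T)"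
    using X c by measurable
  then show ?thesis unfolding Y_def by (simp add: case_prod_beta')
qed

lemma \<xi>_meas: "\<xi> j i \<in> borel_measurable (F (pt j i))"
  unfolding \<xi>_def[abs_def] using Xm[OF pt_ge] by measurable

lemma simple_value_meas: "(\<lambda>(s, \<omega>). simple_value (Hs j) s \<omega>) \<in> borel_measurable (restrict_space borel {t..T} \<Otimes>\<^sub>M P)"
proof -
  have 1: "(\<lambda>z. \<xi> j i (snd z)) \<in> borel_measurable (restrict_space borel {t..T} \<Otimes>\<^sub>M P)" for i
    by (rule measurable_compose[OF measurable_snd F_meas_P[OF \<xi>_meas]])
  have 2: "(\<lambda>z. indicator {pt j i<..pt j (Suc i)} (fst z) :: real)
    \<in> borel_measurable (restrict_space borel {t..T} \<Otimes>\<^sub>M P)" for i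
    by (rule measurable_compose[OF measurable_fst]) (rule measurable_restrict_space1, simp)
  have "(\<lambda>z. \<Sum>i<nn j. \<xi> j i (snd z) * indicator {pt j i<..pt j (Suc i)} (fst z))
    \<in> borel_measurable (restrict_space borel {t..T} \<Otimes>\<^sub>M P)"
    using 1 2 by measurable
  then show ?thesis unfolding simple_value_def Hs_def by (simp add: case_prod_beta')
qed

lemma path_meas:
  assumes w: "\<omega> \<in> space M"
  shows "(\<lambda>s. indicator {t..T} s * Y s \<omega>) \<in> borel_measurable borel"
proof -
  have "(\<lambda>s. indicator {t..T} s *\<^sub>R X s \<omega>) \<in> borel_measurable borel"
    by (rule borel_measurable_continuous_on_indicator) (use Xc[OF w] in \<open>auto intro: continuous_on_subset\<close>)
  then have "(\<lambda>s. \<sigma> * cf s * (indicator {t..T} s *\<^sub>R X s \<omega>)) \<in> borel_measurable borel" by measurable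
  then show ?thesis unfolding Y_def by (simp add: mult_ac)
qed

lemma simple_value_path_meas: "(\<lambda>s. simple_value (Hs j) s \<omega>) \<in> borel_measurable borel"
  unfolding simple_value_def Hs_def by (simp only: prod.case) measurable

lemma finite_Icc: "integrable lborel (\<lambda>s. indicator {t..T} s * (C::real))"
proof -
  have "integrable lborel (indicator {t..T} :: real \<Rightarrow> real)"
    by (rule integrable_real_indicator) (auto simp: emeasure_lborel_Icc_eq)
  then show ?thesis by (intro integrable_mult_left)
qed

lemma AE_generic: "AE s in lborel. s \<noteq> t \<and> s \<noteq> te"
  using AE_lborel_singleton[of t] AE_lborel_singleton[of te] by eventually_elim auto

lemma Y_sq_integrable:
  assumes w: "\<omega> \<in> space M"
  shows "set_integrable lborel {t..T} (\<lambda>s. (Y s \<omega>)\<^sup>2)" "set_integrable lborel {t..T} (\<lambda>s. Y s \<omega>)"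
proof -
  obtain B where B: "B > 0" "\<And>s. t \<le> s \<Longrightarrow> s \<le> T \<Longrightarrow> X s \<omega> \<le> B" using X_sup[OF w] by metis
  have b: "\<bar>indicator {t..T} s * Y s \<omega>\<bar> \<le> indicator {t..T} s * (\<sigma> * cb * B)" for s
    using Y_bound[OF w, where T = T and B = B and s = s] B(2) by (auto split: split_indicator)
  have b2: "\<bar>indicator {t..T} s * (Y s \<omega>)\<^sup>2\<bar> \<le> indicator {t..T} s * (\<sigma> * cb * B)\<^sup>2" for s
    using Y_bound[OF w, where T = T and B = B and s = s] B(2)
      by (auto split: split_indicator simp: abs_le_square_iff[symmetric])
  have m2: "(\<lambda>s. indicator {t..T} s * (Y s \<omega>)\<^sup>2) = (\<lambda>s. (indicator {t..T} s * Y s \<omega>)\<^sup>2)"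
    by (auto split: split_indicator)
  have m2': "(\<lambda>s. indicator {t..T} s * (Y s \<omega>)\<^sup>2) \<in> borel_measurable borel"
    unfolding m2 using path_meas[OF w, of T] by measurable
  show "set_integrable lborel {t..T} (\<lambda>s. (Y s \<omega>)\<^sup>2)" unfolding set_integrable_def
    by (rule Bochner_Integration.integrable_bound[OF finite_Icc[of T "(\<sigma> * cb * B)\<^sup>2"]])
      (use m2' b2 in auto)
  show "set_integrable lborel {t..T} (\<lambda>s. Y s \<omega>)" unfolding set_integrable_def
    by (rule Bochner_Integration.integrable_bound[OF finite_Icc[of T "\<sigma> * cb * B"]])
      (use path_meas[OF w] in \<open>auto intro!: AE_I2 order_trans[OF b abs_ge_self]\<close>)
qed

lemma simple_value_L2:
  assumes w: "\<omega> \<in> space M"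
  shows "(\<lambda>j. LINT s:{t..T}|lborel. (simple_value (Hs j) s \<omega> - Y s \<omega>)\<^sup>2) \<longlonglongrightarrow> 0"
proof -
  obtain B where B: "B > 0" "\<And>s. t \<le> s \<Longrightarrow> s \<le> T \<Longrightarrow> X s \<omega> \<le> B" using X_sup[OF w] by metis
  define C where "C = \<sigma> * cb * B"
  have "(\<lambda>j. LINT s|lborel. indicator {t..T} s *\<^sub>R (simple_value (Hs j) s \<omega> - Y s \<omega>)\<^sup>2)
    \<longlonglongrightarrow> (LINT s|(lborel :: real measure). (0::real))"
  proof (rule integral_dominated_convergence[where w = "\<lambda>s. indicator {t..T} s * (2 * C)\<^sup>2"])
    have e: "(\<lambda>s. indicator {t..T} s *\<^sub>R (simple_value (Hs j) s \<omega> - Y s \<omega>)\<^sup>2)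
      = (\<lambda>s. (indicator {t..T} s * simple_value (Hs j) s \<omega> - indicator {t..T} s * Y s \<omega>)\<^sup>2)" for j
      by (auto split: split_indicator)
    show "(\<lambda>s. indicator {t..T} s *\<^sub>R (simple_value (Hs j) s \<omega> - Y s \<omega>)\<^sup>2) \<in> borel_measurable lborel" for j
      unfolding e using path_meas[OF w, of T] simple_value_path_meas[of j \<omega>] by measurable
    show "AE s in lborel. (\<lambda>j. indicator {t..T} s *\<^sub>R (simple_value (Hs j) s \<omega> - Y s \<omega>)\<^sup>2) \<longlonglongrightarrow> 0"
      using AE_generic
    proof eventually_elim
      case (elim s)
      show ?case
      proof (cases "s \<in> {t..T}")
        case True
        then have "(\<lambda>j. simple_value (Hs j) s \<omega>) \<longlonglongrightarrow> Y s \<omega>" using simple_value_lim[OF w, of s] elim by auto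
        from tendsto_power[OF tendsto_diff[OF this tendsto_const[of "Y s \<omega>"]], of 2] show ?thesis using True by simp
      qed simp
    qed
    show "AE s in lborel. norm (indicator {t..T} s *\<^sub>R (simple_value (Hs j) s \<omega> - Y s \<omega>)\<^sup>2)
      \<le> indicator {t..T} s * (2 * C)\<^sup>2" for j
    proof (rule AE_I2)
      fix s
      have "(simple_value (Hs j) s \<omega> - Y s \<omega>)\<^sup>2 \<le> (2 * C)\<^sup>2" if "s \<in> {t..T}"
      proof -
        have "\<bar>simple_value (Hs j) s \<omega> - Y s \<omega>\<bar> \<le> 2 * C"
          using simple_value_bound[OF w B(1), of T s j] Y_bound[OF w, where T = T and B = B and s = s] B(2) that
            unfolding C_def by auto
        then show ?thesis using B pos cf_pos(3) by (subst abs_le_square_iff[symmetric]) (auto simp: C_def)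
      qed
      then show "norm (indicator {t..T} s *\<^sub>R (simple_value (Hs j) s \<omega> - Y s \<omega>)\<^sup>2) \<le> indicator {t..T} s * (2 * C)\<^sup>2"
        by (auto split: split_indicator)
    qed
  qed (use finite_Icc in auto)
  then show ?thesis unfolding set_lebesgue_integral_def by simp
qed

lemma simple_value_L1:
  assumes w: "\<omega> \<in> space M"
  shows "(\<lambda>j. LINT s:{t..T}|lborel. simple_value (Hs j) s \<omega>) \<longlonglongrightarrow> (LINT s:{t..T}|lborel. Y s \<omega>)"
proof -
  obtain B where B: "B > 0" "\<And>s. t \<le> s \<Longrightarrow> s \<le> T \<Longrightarrow> X s \<omega> \<le> B" using X_sup[OF w] by metis
  define C where "C = \<sigma> * cb * B"
  show ?thesis unfolding set_lebesgue_integral_def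
  proof (rule integral_dominated_convergence[where w = "\<lambda>s. indicator {t..T} s * C"])
    show "(\<lambda>s. indicator {t..T} s *\<^sub>R simple_value (Hs j) s \<omega>) \<in> borel_measurable lborel" for j
      using simple_value_path_meas[of j \<omega>] by measurable
    show "(\<lambda>s. indicator {t..T} s *\<^sub>R Y s \<omega>) \<in> borel_measurable lborel"
      using path_meas[OF w, of T] by simp
    show "AE s in lborel. (\<lambda>j. indicator {t..T} s *\<^sub>R simple_value (Hs j) s \<omega>) \<longlonglongrightarrow> indicator {t..T} s *\<^sub>R Y s \<omega>"
      using AE_generic
    proof eventually_elim
      case (elim s)
      show ?case
      proof (cases "s \<in> {t..T}")
        case True
        then show ?thesis using simple_value_lim[OF w, of s] elim by auto
      qed simp
    qed
    show "AE s in lborel. norm (indicator {t..T} s *\<^sub>R simple_value (Hs j) s \<omega>) \<le> indicator {t..T} s * C" for j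
      using simple_value_bound[OF w B(1), of T _ j] B(2) unfolding C_def
        by (intro AE_I2) (auto split: split_indicator)
  qed (use finite_Icc in auto)
qed

lemma simple_value_integral:
  assumes r: "t \<le> r"
  shows "(LINT s:{t..r}|lborel. simple_value (Hs j) s \<omega>)
    = (\<Sum>i<nn j. \<xi> j i \<omega> * (min (pt j (Suc i)) r - min (pt j i) r))"
proof -
  have cell: "integrable lborel (\<lambda>s. indicator {t..r} s * indicator {pt j i<..pt j (Suc i)} s :: real)
     \<and> (LINT s|lborel. indicator {t..r} s * indicator {pt j i<..pt j (Suc i)} s) = min (pt j (Suc i)) r - min
       (pt j i) r" for i
  proof -
    have le: "pt j i \<le> pt j (Suc i)" by (intro monoD[OF pt_mono]) simp
    have e: "(\<lambda>s. indicator {t..r} s * indicator {pt j i<..pt j (Suc i)} s :: real)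
      = indicator {min (pt j i) r<..min (pt j (Suc i)) r}"
      using pt_ge[of j i] le by (auto simp: fun_eq_iff split: split_indicator)
    show ?thesis unfolding e using le by simp
  qed
  have "(LINT s:{t..r}|lborel. simple_value (Hs j) s \<omega>)
    = (LINT s|lborel. (\<Sum>i<nn j. \<xi> j i \<omega> * (indicator {t..r} s * indicator {pt j i<..pt j (Suc i)} s)))"
    unfolding set_lebesgue_integral_def simple_value_def Hs_def
      by (simp only: prod.case real_scaleR_def sum_distrib_left mult_ac)
  also have "\<dots> = (\<Sum>i<nn j. \<xi> j i \<omega> * (min (pt j (Suc i)) r - min (pt j i) r))"
    using cell by (subst Bochner_Integration.integral_sum) auto
  finally show ?thesis .
qed

definition qt :: "real \<Rightarrow> nat \<Rightarrow> nat \<Rightarrow> real" where "qt r j i = min (pt j i) r"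

text \<open>The one-step errors are centred so that their weighted sum is orthogonal; the subtracted
  means are summed separately, path by path. Capping the grid at \<open>r\<close> leaves empty cells
  beyond \<open>r\<close>, which contribute 0.\<close>

definition Rem :: "real \<Rightarrow> nat \<Rightarrow> 'a \<Rightarrow> real" where
  "Rem r j \<omega> = (\<Sum>i<nn j. X (qt r j i) \<omega> * (gbm_rem \<mu> \<sigma> (cf (pt j i)) (qt r j (Suc i)
    - qt r j i) (W (qt r j (Suc i)) \<omega> - W (qt r j i) \<omega>)
      - gbm_rem_mean \<mu> (cf (pt j i)) (qt r j (Suc i) - qt r j i)))"

lemma qt_props:
  assumes r: "t \<le> r"
  shows "mono (qt r j)" "t \<le> qt r j i" "qt r j i \<le> r" "qt r j 0 = t" "qt r j i \<le> qt r j (Suc i)"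
    "qt r j (Suc i) - qt r j i \<le> dl j"
proof -
  show m: "mono (qt r j)" unfolding qt_def using monoD[OF pt_mono[of j]]
    by (intro monoI) (auto simp: min_def intro: order_trans)
  show "t \<le> qt r j i" "qt r j i \<le> r" "qt r j 0 = t" unfolding qt_def using pt_ge[of j i] r by (auto simp: pt_0)
  show "qt r j i \<le> qt r j (Suc i)" by (rule monoD[OF m]) simp
  show "qt r j (Suc i) - qt r j i \<le> dl j" unfolding qt_def pt_step using dl_pos[of j] by (auto simp: min_def)
qed

lemma X_sq:
  assumes "t \<le> r"
  obtains C where "C \<ge> 0" "\<And>s. t \<le> s \<Longrightarrow> s \<le> r \<Longrightarrow> integrable P (\<lambda>\<omega>. (X s \<omega>)\<^sup>2) \<and> (\<integral>\<omega>. (X s \<omega>)\<^sup>2 \<partial>P) \<le> C"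
proof -
  define l where "l = max (growth \<mu> \<sigma> 2 \<eta>) (max (growth \<mu> \<sigma> 2 \<theta>) 0)"
  have m: "mart (\<le>) l 2" by (rule mart_le) (auto simp: l_def)
  define C where "C = exp (l * (r - t)) * x powr 2"
  have "integrable P (\<lambda>\<omega>. (X s \<omega>)\<^sup>2) \<and> (\<integral>\<omega>. (X s \<omega>)\<^sup>2 \<partial>P) \<le> C" if s: "t \<le> s" "s \<le> r" for s
  proof -
    have [measurable]: "X s \<in> borel_measurable P" using F_meas_P[OF Xm[OF s(1)]] .
    have e: "Z l 2 s \<omega> = exp (- l * (s - t)) * (X s \<omega>)\<^sup>2" if "\<omega> \<in> space M" for \<omega>
      using Xpos[OF that s(1)] unfolding Z_def by (simp add: powr_numeral)
    have "(\<integral>\<^sup>+\<omega>. ennreal ((X s \<omega>)\<^sup>2) \<partial>P) = (\<integral>\<^sup>+\<omega>. ennreal (exp (l * (s - t))) * ennreal (Z l 2 s \<omega>) \<partial>P)"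
      by (intro nn_integral_cong) (simp add: e ennreal_mult[symmetric] mult.assoc[symmetric] exp_add[symmetric])
    also have "\<dots> = ennreal (exp (l * (s - t))) * (\<integral>\<^sup>+\<omega>. ennreal (Z l 2 s \<omega>) \<partial>P)"
      using F_meas_P[OF Z_meas[OF s(1)]] by (intro nn_integral_cmult) auto
    also have "\<dots> \<le> ennreal (exp (l * (s - t))) * ennreal (x powr 2)"
      using mart_start[OF m s(1)] by (intro mult_left_mono) auto
    also have "\<dots> \<le> ennreal C" unfolding C_def using s
      by (subst ennreal_mult[symmetric]) (auto simp: l_def intro!: ennreal_leI mult_right_mono mult_left_mono)
    finally have n: "(\<integral>\<^sup>+\<omega>. ennreal ((X s \<omega>)\<^sup>2) \<partial>P) \<le> ennreal C" .
    have i: "integrable P (\<lambda>\<omega>. (X s \<omega>)\<^sup>2)"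
      using order_le_less_trans[OF n ennreal_less_top] by (intro integrableI_nonneg) auto
    have "ennreal (\<integral>\<omega>. (X s \<omega>)\<^sup>2 \<partial>P) \<le> ennreal C"
      using n by (subst nn_integral_eq_integral[OF i, symmetric]) auto
    then show ?thesis using i by (simp add: C_def)
  qed
  then show thesis by (intro that[of C]) (auto simp: C_def)
qed

lemma sum_q_le: "t \<le> r \<Longrightarrow> (\<Sum>i<nn j. qt r j (Suc i) - qt r j i) \<le> r - t"
  by (subst sum_lessThan_telescope) (auto simp: qt_def pt_0)

lemma dl_eventually: "d > 0 \<Longrightarrow> \<forall>\<^sub>F j in sequentially. dl j < d"
  using order_tendstoD(2)[OF dl_lim] .

lemma small_cf:
  assumes "e > 0" "\<And>c. \<exists>d>0. \<forall>\<Delta>. 0 \<le> \<Delta> \<longrightarrow> \<Delta> < d \<longrightarrow> f c \<Delta> \<le> e * \<Delta>"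
  shows "\<exists>d>0. \<forall>s \<Delta>. 0 \<le> \<Delta> \<longrightarrow> \<Delta> < d \<longrightarrow> f (cf s) \<Delta> \<le> e * (\<Delta>::real)"
proof -
  obtain d1 where d1: "d1 > 0" "\<forall>\<Delta>. 0 \<le> \<Delta> \<longrightarrow> \<Delta> < d1 \<longrightarrow> f \<eta> \<Delta> \<le> e * \<Delta>" using assms(2) by blast
  obtain d2 where d2: "d2 > 0" "\<forall>\<Delta>. 0 \<le> \<Delta> \<longrightarrow> \<Delta> < d2 \<longrightarrow> f \<theta> \<Delta> \<le> e * \<Delta>" using assms(2) by blast
  show ?thesis by (rule exI[of _ "min d1 d2"]) (use d1 d2 in \<open>auto simp: cf_def\<close>)
qed

lemma mean_sum_lim:
  assumes r: "t \<le> r" and w: "\<omega> \<in> space M"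
  shows "(\<lambda>j. \<Sum>i<nn j. X (qt r j i) \<omega> * gbm_rem_mean \<mu> (cf (pt j i)) (qt r j (Suc i) - qt r j i)) \<longlonglongrightarrow> 0"
proof (rule LIMSEQ_I)
  fix e :: real assume e: "e > 0"
  obtain B where B: "B > 0" "\<And>s. t \<le> s \<Longrightarrow> s \<le> r \<Longrightarrow> X s \<omega> \<le> B" using X_sup[OF w] by metis
  define e' where "e' = e / (2 * B * (r - t + 1))"
  have e': "e' > 0" unfolding e'_def using e B r by simp
  obtain d where d: "d > 0" "\<forall>s \<Delta>. 0 \<le> \<Delta> \<longrightarrow> \<Delta> < d \<longrightarrow> gbm_rem_mean \<mu> (cf s) \<Delta> \<le> e' * \<Delta>"
    using small_cf[OF e', of "gbm_rem_mean \<mu>"] gbm_rem_mean_small[OF e'] by blast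
  obtain N where N: "\<And>j. j \<ge> N \<Longrightarrow> dl j < d" using dl_eventually[OF d(1)] unfolding eventually_sequentially by blast
  have "norm ((\<Sum>i<nn j. X (qt r j i) \<omega> * gbm_rem_mean \<mu> (cf (pt j i)) (qt r j (Suc i) - qt r j i)) - 0) < e"
    if "j \<ge> N" for j
  proof -
    have p: "0 \<le> X (qt r j i) \<omega> * gbm_rem_mean \<mu> (cf (pt j i)) (qt r j (Suc i) - qt r j i)" for i
      using Xpos[OF w qt_props(2)[OF r]] gbm_rem_mean_nonneg by (intro mult_nonneg_nonneg) (auto intro: less_imp_le)
    have "(\<Sum>i<nn j. X (qt r j i) \<omega> * gbm_rem_mean \<mu> (cf (pt j i)) (qt r j (Suc i) - qt r j i))
      \<le> (\<Sum>i<nn j. B * (e' * (qt r j (Suc i) - qt r j i)))"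
    proof (intro sum_mono mult_mono)
      fix i
      have "qt r j (Suc i) - qt r j i < d" using qt_props(6)[OF r, of j i] N[OF that] by simp
      then show "gbm_rem_mean \<mu> (cf (pt j i)) (qt r j (Suc i) - qt r j i) \<le> e' * (qt r j (Suc i) - qt r j i)"
        using d(2) qt_props(5)[OF r, of j i] by simp
    qed (use B qt_props[OF r] gbm_rem_mean_nonneg in auto)
    also have "\<dots> = B * e' * (\<Sum>i<nn j. qt r j (Suc i) - qt r j i)" by (simp add: sum_distrib_left mult.assoc)
    also have "\<dots> \<le> B * e' * (r - t)" using sum_q_le[OF r] B e' by (intro mult_left_mono) auto
    also have "\<dots> < e"
    proof -
      have "B * e' * (r - t) \<le> B * e' * (r - t + 1)" using B e' by (intro mult_left_mono) auto
      also have "\<dots> = e / 2"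
      proof -
        have "D \<noteq> 0 \<Longrightarrow> B * (e / (2 * B * D)) * D = e / 2" for D using B by simp
        from this[of "r - t + 1"] show ?thesis unfolding e'_def using r by simp
      qed
      finally show ?thesis using e by simp
    qed
    finally show ?thesis using sum_nonneg[of "{..<nn j}", OF p] by simp
  qed
  then show "\<exists>N. \<forall>j\<ge>N. norm ((\<Sum>i<nn j. X (qt r j i) \<omega> * gbm_rem_mean \<mu> (cf (pt j i)) (qt r j (Suc i) - qt r j i))
    - 0) < e" by blast
qed

text \<open>By orthogonality the second moment is a sum of bounded second moments of the wealth
  times the variances of the centred one-step errors, and each variance is of smaller order than its
  cell.\<close>

lemma Rem_L2:
  assumes r: "t \<le> r"
  shows "Rem r j \<in> borel_measurable P" "integrable P (\<lambda>\<omega>. (Rem r j \<omega>)\<^sup>2)" "(\<lambda>j. \<integral>\<omega>. (Rem r j \<omega>)\<^sup>2 \<partial>P) \<longlonglongrightarrow> 0"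
proof -
  obtain C where C: "C \<ge> 0" "\<And>s. t \<le> s \<Longrightarrow> s \<le> r \<Longrightarrow> integrable P (\<lambda>\<omega>. (X s \<omega>)\<^sup>2) \<and> (\<integral>\<omega>. (X s \<omega>)\<^sup>2 \<partial>P) \<le> C"
    using X_sq[OF r] by blast
  define g where "g j i z = gbm_rem \<mu> \<sigma> (cf (pt j i)) (qt r j (Suc i) - qt r j i) z
    - gbm_rem_mean \<mu> (cf (pt j i)) (qt r j (Suc i) - qt r j i)" for j i z
  define d where "d j i = (\<integral>\<omega>. (g j i (W (qt r j (Suc i)) \<omega> - W (qt r j i) \<omega>))\<^sup>2 \<partial>P)" for j i
  have q0: "0 \<le> qt r j i" for j i using qt_props(2)[OF r, of j i] t0 by simp
  note E = gbm_rem_expectation[OF q0 qt_props(5)[OF r]]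
  have gE: "integrable P (\<lambda>\<omega>. (g j i (W (qt r j (Suc i)) \<omega> - W (qt r j i) \<omega>))\<^sup>2)"
    "(\<integral>\<omega>. g j i (W (qt r j (Suc i)) \<omega> - W (qt r j i) \<omega>) \<partial>P) = 0"
    "d j i \<le> gbm_rem_sq \<mu> \<sigma> (cf (pt j i)) (qt r j (Suc i) - qt r j i)" "0 \<le> d j i" for j i
  proof -
    define K where "K \<omega> = gbm_rem \<mu> \<sigma> (cf (pt j i)) (qt r j (Suc i) - qt r j i) (W (qt r j (Suc i)) \<omega>
      - W (qt r j i) \<omega>)" for \<omega>
    define m where "m = gbm_rem_mean \<mu> (cf (pt j i)) (qt r j (Suc i) - qt r j i)"
    have K: "integrable P K" "(\<integral>\<omega>. K \<omega> \<partial>P) = m" "integrable P (\<lambda>\<omega>. (K \<omega>)\<^sup>2)"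
      "(\<integral>\<omega>. (K \<omega>)\<^sup>2 \<partial>P) = gbm_rem_sq \<mu> \<sigma> (cf (pt j i)) (qt r j (Suc i) - qt r j i)"
      unfolding K_def[abs_def] m_def using E by auto
    have e: "(g j i (W (qt r j (Suc i)) \<omega> - W (qt r j i) \<omega>)) = K \<omega> - m" for \<omega> unfolding g_def K_def m_def ..
    have e2: "(K \<omega> - m)\<^sup>2 = (K \<omega>)\<^sup>2 - 2 * m * K \<omega> + m\<^sup>2" for \<omega> by (simp add: power2_eq_square algebra_simps)
    show "integrable P (\<lambda>\<omega>. (g j i (W (qt r j (Suc i)) \<omega> - W (qt r j i) \<omega>))\<^sup>2)" unfolding e e2 using K by simp
    show "(\<integral>\<omega>. g j i (W (qt r j (Suc i)) \<omega> - W (qt r j i) \<omega>) \<partial>P) = 0" unfolding e using K prob_space by simp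
    have "d j i = gbm_rem_sq \<mu> \<sigma> (cf (pt j i)) (qt r j (Suc i) - qt r j i) - m\<^sup>2"
      unfolding d_def e e2 using K prob_space by (simp add: power2_eq_square)
    then show "d j i \<le> gbm_rem_sq \<mu> \<sigma> (cf (pt j i)) (qt r j (Suc i) - qt r j i)" by simp
    show "0 \<le> d j i" unfolding d_def by simp
  qed
  have gm: "g j i \<in> borel_measurable borel" for j i unfolding g_def[abs_def] gbm_rem_def by measurable
  have orth: "(\<lambda>\<omega>. \<Sum>i<nn j. X (qt r j i) \<omega> * g j i (W (qt r j (Suc i)) \<omega> - W (qt r j i) \<omega>))
    \<in> borel_measurable (F (qt r j (nn j))) \<and>
    integrable P (\<lambda>\<omega>. (\<Sum>i<nn j. X (qt r j i) \<omega> * g j i (W (qt r j (Suc i)) \<omega> - W (qt r j i) \<omega>))\<^sup>2) \<and>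
    (\<integral>\<omega>. (\<Sum>i<nn j. X (qt r j i) \<omega> * g j i (W (qt r j (Suc i)) \<omega> - W (qt r j i) \<omega>))\<^sup>2 \<partial>P) =
      (\<Sum>i<nn j. (\<integral>\<omega>. (X (qt r j i) \<omega>)\<^sup>2 \<partial>P) * d j i)" for j
    by (rule orthogonal_sum[OF qt_props(1)[OF r] q0 _ _ gm gE(1,2)])
      (use Xm[OF qt_props(2)[OF r]] C(2) qt_props(2,3)[OF r] d_def in auto)
  have eR: "Rem r j = (\<lambda>\<omega>. \<Sum>i<nn j. X (qt r j i) \<omega> * g j i (W (qt r j (Suc i)) \<omega> - W (qt r j i) \<omega>))" for j
    unfolding Rem_def[abs_def] g_def ..
  show "Rem r j \<in> borel_measurable P" "integrable P (\<lambda>\<omega>. (Rem r j \<omega>)\<^sup>2)"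
    unfolding eR using orth[of j] F_meas_P by blast+
  show "(\<lambda>j. \<integral>\<omega>. (Rem r j \<omega>)\<^sup>2 \<partial>P) \<longlonglongrightarrow> 0"
  proof (rule LIMSEQ_I)
    fix e :: real assume e: "e > 0"
    define e' where "e' = e / (2 * (C + 1) * (r - t + 1))"
    have e': "e' > 0" unfolding e'_def using e C r by simp
    obtain dd where dd: "dd > 0" "\<forall>s \<Delta>. 0 \<le> \<Delta> \<longrightarrow> \<Delta> < dd \<longrightarrow> gbm_rem_sq \<mu> \<sigma> (cf s) \<Delta> \<le> e' * \<Delta>"
      using small_cf[OF e', of "gbm_rem_sq \<mu> \<sigma>"] gbm_rem_sq_small[OF e'] by blast
    obtain N where N: "\<And>j. j \<ge> N \<Longrightarrow> dl j < dd" using dl_eventually[OF dd(1)] unfolding eventually_sequentially by blast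
    have "norm ((\<integral>\<omega>. (Rem r j \<omega>)\<^sup>2 \<partial>P) - 0) < e" if "j \<ge> N" for j
    proof -
      have "(\<integral>\<omega>. (Rem r j \<omega>)\<^sup>2 \<partial>P) = (\<Sum>i<nn j. (\<integral>\<omega>. (X (qt r j i) \<omega>)\<^sup>2 \<partial>P) * d j i)" unfolding eR using orth[of j]
        by blast
      also have "\<dots> \<le> (\<Sum>i<nn j. (C + 1) * (e' * (qt r j (Suc i) - qt r j i)))"
      proof (intro sum_mono mult_mono)
        fix i
        show "(\<integral>\<omega>. (X (qt r j i) \<omega>)\<^sup>2 \<partial>P) \<le> C + 1" using C(2)[OF qt_props(2,3)[OF r], of j i] by simp
        have "qt r j (Suc i) - qt r j i < dd" using qt_props(6)[OF r, of j i] N[OF that] by simp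
        then show "d j i \<le> e' * (qt r j (Suc i) - qt r j i)"
          using dd(2) qt_props(5)[OF r, of j i] gE(3)[of j i] by (meson diff_ge_0_iff_ge order_trans)
      qed (use C gE in auto)
      also have "\<dots> = (C + 1) * e' * (\<Sum>i<nn j. qt r j (Suc i) - qt r j i)" by (simp add: sum_distrib_left mult.assoc)
      also have "\<dots> \<le> (C + 1) * e' * (r - t + 1)" using sum_q_le[OF r, of j] C e' by (intro mult_left_mono) auto
      also have "\<dots> = e / 2"
      proof -
        have "D \<noteq> 0 \<Longrightarrow> A \<noteq> 0 \<Longrightarrow> A * (e / (2 * A * D)) * D = e / 2" for A D by simp
        from this[of "r - t + 1" "C + 1"] show ?thesis unfolding e'_def using C r by simp
      qed
      finally show ?thesis using e by simp
    qed
    then show "\<exists>N. \<forall>j\<ge>N. norm ((\<integral>\<omega>. (Rem r j \<omega>)\<^sup>2 \<partial>P) - 0) < e" by blast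
  qed
qed

lemma X_steps:
  assumes r: "t \<le> r"
  shows "AE \<omega> in P. \<forall>j i. X (qt r j (Suc i)) \<omega> = X (qt r j i) \<omega>
    * exp (logw \<mu> \<sigma> (cf (pt j i)) (qt r j i) (qt r j (Suc i)) \<omega>)"
proof -
  have "AE \<omega> in P. X (qt r j (Suc i)) \<omega> = X (qt r j i) \<omega>
    * exp (logw \<mu> \<sigma> (cf (pt j i)) (qt r j i) (qt r j (Suc i)) \<omega>)" for j i
  proof (cases "i \<le> j")
    case True
    then have "pt j i < pt j (Suc j)" by (intro pt_strict) simp
    then have c: "cf (pt j i) = \<eta>" unfolding pt_te cf_def by simp
    have "pt j (Suc i) \<le> pt j (Suc j)" using True by (intro monoD[OF pt_mono]) simp
    then have "qt r j (Suc i) \<le> te" unfolding pt_te qt_def by auto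
    then show ?thesis unfolding c by (intro step_before qt_props(2,5)[OF r])
  next
    case False
    then have le: "pt j (Suc j) \<le> pt j i" by (intro monoD[OF pt_mono]) simp
    then have c: "cf (pt j i) = \<theta>" unfolding pt_te cf_def by simp
    show ?thesis
    proof (cases "pt j i \<le> r")
      case True
      then have "te \<le> qt r j i" using le unfolding pt_te qt_def by simp
      then show ?thesis unfolding c by (intro step_after qt_props(5)[OF r])
    next
      case False
      then have "qt r j i = r" "qt r j (Suc i) = r" using monoD[OF pt_mono, of i "Suc i" j] unfolding qt_def by auto
      then show ?thesis by simp
    qed
  qed
  then show ?thesis unfolding AE_all_countable by blast
qed

text \<open>The wealth equation solved for its stochastic integral, with the drift written as
  \<open>\<mu> / \<sigma> * Y\<close>. The equation thus holds by definition, and what remains to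
  prove is that this process is a limit of simple integrals.\<close>

definition Ito :: "real \<Rightarrow> 'a \<Rightarrow> real" where
  "Ito r \<omega> = X r \<omega> - x - \<mu> / \<sigma> * (LINT s:{t..r}|lborel. Y s \<omega>)"

lemma Ito_meas: "t \<le> r \<Longrightarrow> Ito r \<in> borel_measurable (F r)"
  unfolding Ito_def[abs_def] using restrict_measurable_LINT[OF Y_prog] Xm by measurable

lemma simple_integral_Hs: "simple_integral W (Hs j) r \<omega>
  = (\<Sum>i<nn j. \<xi> j i \<omega> * (W (qt r j (Suc i)) \<omega> - W (qt r j i) \<omega>))"
  unfolding simple_integral_def Hs_def qt_def by simp

text \<open>Telescoping over the capped grid splits \<open>X r - x\<close> into the centred
  remainder, its means, the drift sum and the simple integral. The means and the drift sum converge
  on every path; the centred remainder tends to 0 in L2.\<close>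

lemma Ito_lim:
  assumes r: "t \<le> r"
  shows "tends_in_prob P (\<lambda>j. simple_integral W (Hs j) r) (Ito r)"
proof (rule tends_in_prob_eventually_AE[where Y = "\<lambda>j \<omega>. - Rem r j \<omega>"])
  have q0: "0 \<le> qt r j i" for j i using qt_props(2)[OF r, of j i] t0 by simp
  show "simple_integral W (Hs j) r \<in> borel_measurable P" for j
    unfolding simple_integral_Hs[abs_def]
    using F_meas_P[OF \<xi>_meas] W_meas_P[OF q0]
      by (intro borel_measurable_sum borel_measurable_times borel_measurable_diff)
  show "(\<lambda>\<omega>. - Rem r j \<omega>) \<in> borel_measurable P" for j using Rem_L2(1)[OF r] by simp
  show "Ito r \<in> borel_measurable P" using F_meas_P[OF Ito_meas[OF r]] .
  show "tends_in_prob P (\<lambda>j \<omega>. - Rem r j \<omega>) (\<lambda>_. 0)"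
    using Rem_L2[OF r] by (intro tends_in_prob_L2) auto
  show "AE \<omega> in P. (\<lambda>j. simple_integral W (Hs j) r \<omega> - - Rem r j \<omega>) \<longlonglongrightarrow> Ito r \<omega>"
    using X_steps[OF r] AE_space
  proof eventually_elim
    case (elim \<omega>)
    then have w: "\<omega> \<in> space M" by simp
    obtain B where B: "B > 0" "\<And>s. t \<le> s \<Longrightarrow> s \<le> r \<Longrightarrow> X s \<omega> \<le> B" using X_sup[OF w] by metis
    define m where "m j = (\<Sum>i<nn j. X (qt r j i) \<omega> * gbm_rem_mean \<mu> (cf (pt j i)) (qt r j (Suc i) - qt r j i))" for j
    define I where "I j = (LINT s:{t..r}|lborel. simple_value (Hs j) s \<omega>)" for j
    have "(\<lambda>j. X r \<omega> - x - m j - \<mu> / \<sigma> * I j) \<longlonglongrightarrow> X r \<omega> - x - 0 - \<mu> / \<sigma> * (LINT s:{t..r}|lborel. Y s \<omega>)"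
      unfolding m_def I_def by (intro tendsto_diff tendsto_const tendsto_mult mean_sum_lim[OF r w] simple_value_L1[OF
        w])
    then have l: "(\<lambda>j. X r \<omega> - x - m j - \<mu> / \<sigma> * I j) \<longlonglongrightarrow> Ito r \<omega>" unfolding Ito_def by simp
    have "\<forall>\<^sub>F j in sequentially. simple_integral W (Hs j) r \<omega> - - Rem r j \<omega> = X r \<omega> - x - m j - \<mu> / \<sigma> * I j"
      using pt_nn_large[of r] eventually_ge_at_top[of "nat \<lceil>B\<rceil>"]
    proof eventually_elim
      case (elim j)
      have Bj: "B \<le> real j" using elim by linarith
      have st: "X (qt r j (Suc i)) \<omega> = X (qt r j i) \<omega> * exp (logw \<mu> \<sigma> (cf (pt j i)) (qt r j i) (qt r j (Suc i)) \<omega>)"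
        for i
        using \<open>\<forall>j i. _\<close> by blast
      \<comment> \<open>This identity needs the cap in \<open>\<xi>\<close> to be inactive, which
        holds once \<open>j\<close> exceeds the bound \<open>B\<close> of the path on
        \<open>[t, r]\<close>.\<close>
      have inc: "X (qt r j (Suc i)) \<omega> - X (qt r j i) \<omega> =
          X (qt r j i) \<omega> * (gbm_rem \<mu> \<sigma> (cf (pt j i)) (qt r j (Suc i) - qt r j i) (W (qt r j (Suc i)) \<omega> - W
            (qt r j i) \<omega>)
              - gbm_rem_mean \<mu> (cf (pt j i)) (qt r j (Suc i) - qt r j i))
          + X (qt r j i) \<omega> * gbm_rem_mean \<mu> (cf (pt j i)) (qt r j (Suc i) - qt r j i)
          + \<mu> / \<sigma> * (\<xi> j i \<omega> * (min (pt j (Suc i)) r - min (pt j i) r)) + \<xi> j i \<omega> * (W (qt r j (Suc i)) \<omega> - W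
            (qt r j i) \<omega>)" for i
      proof (cases "pt j i \<le> r")
        case True
        have q: "qt r j i = pt j i" using True unfolding qt_def by simp
        have "X (pt j i) \<omega> \<le> real j" using B(2)[OF pt_ge True] Bj by simp
        then have xi: "\<xi> j i \<omega> = \<sigma> * cf (pt j i) * X (qt r j i) \<omega>" unfolding \<xi>_def q by simp
        have m: "min (pt j (Suc i)) r - min (pt j i) r = qt r j (Suc i) - qt r j i" unfolding qt_def ..
        have c: "\<mu> / \<sigma> * (\<sigma> * cf (pt j i) * X (qt r j i) \<omega> * D) = \<mu> * cf (pt j i) * X (qt r j i) \<omega> * D" for D
          using pos by simp
        show ?thesis unfolding st[of i] xi m c gbm_rem_def logw_def by (simp add: algebra_simps)
      next
        case False
        then have "qt r j i = r" "qt r j (Suc i) = r" "min (pt j (Suc i)) r = r" "min (pt j i) r = r"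
          using monoD[OF pt_mono, of i "Suc i" j] unfolding qt_def by auto
        then show ?thesis by (simp add: gbm_rem_def gbm_rem_mean_def)
      qed
      have "X r \<omega> - x = (\<Sum>i<nn j. X (qt r j (Suc i)) \<omega> - X (qt r j i) \<omega>)"
      proof (subst sum_lessThan_telescope)
        have "qt r j (nn j) = r" using elim(1) unfolding qt_def by simp
        then show "X r \<omega> - x = X (qt r j (nn j)) \<omega> - X (qt r j 0) \<omega>" using Xt[OF w] qt_props(4)[OF r] by simp
      qed
      also have "\<dots> = Rem r j \<omega> + m j + \<mu> / \<sigma> * I j + simple_integral W (Hs j) r \<omega>"
        unfolding inc sum.distrib Rem_def m_def I_def simple_value_integral[OF r] simple_integral_Hs sum_distrib_left
          ..
      finally show ?case by simp
    qed
    from tendsto_cong[THEN iffD2, OF this l] show ?case .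
  qed
qed

lemma Y_ito: "is_ito_integral M W t Y Ito"
  unfolding is_ito_integral_def Let_def
proof (intro conjI allI impI exI[of _ Hs])
  show "progressively_measurable F t Y" unfolding progressively_measurable_def using Y_prog by blast
  show "AE \<omega> in M. set_integrable lborel {t..T} (\<lambda>s. (Y s \<omega>)\<^sup>2)" if "t \<le> T" for T
    using Y_sq_integrable by (intro AE_I2) auto
  show "Ito r \<in> borel_measurable (F r)" if "t \<le> r" for r using Ito_meas[OF that] .
  show "is_simple_integrand F t (Hs j)" for j
    unfolding is_simple_integrand_def Hs_def prod.case
  proof (intro conjI allI impI)
    show "t \<le> pt j 0" by (simp add: pt_0)
    show "mono (pt j)" by (rule pt_mono)
    show "\<xi> j i \<in> borel_measurable (F (pt j i))" for i by (rule \<xi>_meas)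
    show "\<exists>B. \<forall>\<omega>\<in>space (F (pt j i)). \<bar>\<xi> j i \<omega>\<bar> \<le> B" for i
      using \<xi>_bound(1,3)[of _ j i] by (intro exI[of _ "\<sigma> * cb * real j"]) auto
  qed
  show "tends_in_prob P (\<lambda>j \<omega>. LINT s:{t..T}|lborel. (simple_value (Hs j) s \<omega> - Y s \<omega>)\<^sup>2) (\<lambda>_. 0)" if T: "t \<le> T" for T
  proof (rule tends_in_prob_AE)
    fix j
    have "(\<lambda>z. ((case z of (s, \<omega>) \<Rightarrow> simple_value (Hs j) s \<omega>) - (case z of (s, \<omega>) \<Rightarrow> Y s \<omega>))\<^sup>2)
      \<in> borel_measurable (restrict_space borel {t..T} \<Otimes>\<^sub>M P)"
      using simple_value_meas[of j T] pair_F_P[OF Y_prog[OF T]] by measurable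
    then show "(\<lambda>\<omega>. LINT s:{t..T}|lborel. (simple_value (Hs j) s \<omega> - Y s \<omega>)\<^sup>2) \<in> borel_measurable P"
      by (intro restrict_measurable_LINT) (simp add: case_prod_beta')
  qed (use simple_value_L2 in \<open>auto intro!: AE_I2\<close>)
  show "tends_in_prob P (\<lambda>j. simple_integral W (Hs j) r) (Ito r)" if "t \<le> r" for r using Ito_lim[OF that] .
qed

end

lemma is_ito_integral_cong:
  assumes e: "\<And>s \<omega>. t \<le> s \<Longrightarrow> Y s \<omega> = Y' s \<omega>"
  shows "is_ito_integral M W t Y I \<longleftrightarrow> is_ito_integral M W t Y' I"
proof -
  have 1: "progressively_measurable F t Y \<longleftrightarrow> progressively_measurable F t Y'" for F :: "real \<Rightarrow> 'a measure"
    unfolding progressively_measurable_def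
    by (intro all_cong imp_cong refl measurable_cong) (auto simp: space_pair_measure e)
  have 2: "set_integrable lborel {t..T} (\<lambda>s. (Y s \<omega>)\<^sup>2) \<longleftrightarrow> set_integrable lborel {t..T} (\<lambda>s. (Y' s \<omega>)\<^sup>2)" for T \<omega>
    by (rule set_integrable_cong) (auto simp: e)
  have 3: "(LINT s:{t..T}|lborel. (f s - Y s \<omega>)\<^sup>2) = (LINT s:{t..T}|lborel. (f s - Y' s \<omega>)\<^sup>2)" for T \<omega> f
    by (rule set_lebesgue_integral_cong) (auto simp: e)
  show ?thesis unfolding is_ito_integral_def 1 2 3 ..
qed

lemma (in gbm_sol) is_wealth_X:
  assumes u: "\<And>s y. t \<le> s \<Longrightarrow> u s y = cf s"
  shows "is_wealth M W \<mu> \<sigma> t x u X"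
  unfolding is_wealth_def
proof (intro conjI ballI allI impI exI[of _ Ito])
  have e: "\<mu> * u s (X s \<omega>) * X s \<omega> = \<mu> / \<sigma> * Y s \<omega>" if "t \<le> s" for s \<omega>
    unfolding Y_def u[OF that] using pos by simp
  show "X t \<omega> = x" if "\<omega> \<in> space M" for \<omega> using Xt[OF that] .
  show "continuous_on {t..} (\<lambda>r. X r \<omega>)" if "\<omega> \<in> space M" for \<omega> using Xc[OF that] .
  show "0 < X r \<omega>" if "\<omega> \<in> space M" "t \<le> r" for r \<omega> using Xpos[OF that] .
  show "X r \<in> borel_measurable (F r)" if "t \<le> r" for r using Xm[OF that] .
  show "AE \<omega> in M. set_integrable lborel {t..r} (\<lambda>s. \<mu> * u s (X s \<omega>) * X s \<omega>)" for r
  proof (rule AE_I2)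
    fix \<omega> assume w: "\<omega> \<in> space M"
    have "set_integrable lborel {t..r} (\<lambda>s. \<mu> / \<sigma> * Y s \<omega>)" using Y_sq_integrable(2)[OF w, of r] by simp
    then show "set_integrable lborel {t..r} (\<lambda>s. \<mu> * u s (X s \<omega>) * X s \<omega>)"
      by (rule set_integrable_cong[THEN iffD1, rotated 3]) (auto simp: e)
  qed
  show "is_ito_integral M W t (\<lambda>s \<omega>. \<sigma> * u s (X s \<omega>) * X s \<omega>) Ito"
    by (rule is_ito_integral_cong[THEN iffD1, OF _ Y_ito]) (simp add: Y_def u)
  show "AE \<omega> in M. X r \<omega> = x + (LINT s:{t..r}|lborel. \<mu> * u s (X s \<omega>) * X s \<omega>) + Ito r \<omega>" if "t \<le> r" for r
  proof (rule AE_I2)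
    fix \<omega> assume w: "\<omega> \<in> space M"
    have "(LINT s:{t..r}|lborel. \<mu> * u s (X s \<omega>) * X s \<omega>) = (LINT s:{t..r}|lborel. \<mu> / \<sigma> * Y s \<omega>)"
      by (rule set_lebesgue_integral_cong) (auto simp: e)
    also have "\<dots> = \<mu> / \<sigma> * (LINT s:{t..r}|lborel. Y s \<omega>)" by simp
    finally show "X r \<omega> = x + (LINT s:{t..r}|lborel. \<mu> * u s (X s \<omega>) * X s \<omega>) + Ito r \<omega>"
      unfolding Ito_def by simp
  qed
qed

text \<open>Wealth paths have to be continuous at every sample point, but Brownian paths are so only
  almost surely. On a null set the process is replaced by the constant \<open>x\<close>; adaptedness
  survives because the filtration contains the null sets.\<close>

lemma (in brownian) gbm_exists:
  assumes t: "0 \<le> t" "t \<le> te" and x: "0 < x"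
  shows "\<exists>X. gbm_path M W t x X \<mu> \<sigma> \<eta> \<theta> te"
proof -
  obtain N where N: "{\<omega> \<in> space M. \<not> continuous_on {0..} (\<lambda>t. W t \<omega>)} \<subseteq> N" "N \<in> null_sets M"
    using W_cont by (auto elim: AE_E simp: null_sets_def)
  have NP: "N \<in> null_sets P" using null_sets_completionI[OF N(2)] .
  define X where "X r \<omega> = (if \<omega> \<in> N then x else gbm \<mu> \<sigma> \<eta> \<theta> t te x r \<omega>)" for r \<omega>
  have "gbm_path M W t x X \<mu> \<sigma> \<eta> \<theta> te"
  proof (unfold_locales)
    show "0 \<le> t" "t \<le> te" using t by auto
    show "continuous_on {t..} (\<lambda>r. X r \<omega>)" if w: "\<omega> \<in> space M" for \<omega>
    proof (cases "\<omega> \<in> N")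
      case False
      then have c: "continuous_on {0..} (\<lambda>t. W t \<omega>)" using N(1) w by blast
      have "continuous_on {t..} (\<lambda>r. W (min r te) \<omega>)" "continuous_on {t..} (\<lambda>r. W (max r te) \<omega>)"
        using t by (auto intro!: continuous_on_compose2[OF c] continuous_intros)
      then have "continuous_on {t..} (\<lambda>r. gbm \<mu> \<sigma> \<eta> \<theta> t te x r \<omega>)"
        unfolding gbm_def logw_def by (intro continuous_intros)
      then show ?thesis unfolding X_def using False by simp
    qed (simp add: X_def)
    show "0 < X r \<omega>" for r \<omega> unfolding X_def gbm_def using x by simp
    show "X r \<in> borel_measurable (F r)" if r: "t \<le> r" for r
    proof (rule F_meas_AE)
      have "W (min r te) \<in> borel_measurable (F r)" "W t \<in> borel_measurable (F r)" using W_meas_F t r by auto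
      then have "(\<lambda>\<omega>. logw \<mu> \<sigma> \<eta> t (min r te) \<omega>) \<in> borel_measurable (F r)" unfolding logw_def
        by (intro borel_measurable_add borel_measurable_times borel_measurable_diff borel_measurable_const)
      moreover have "(\<lambda>\<omega>. logw \<mu> \<sigma> \<theta> te (max r te) \<omega>) \<in> borel_measurable (F r)"
      proof (cases "r \<le> te")
        case True
        then have "max r te = te" by simp
        then show ?thesis by simp
      next
        case False
        then have "W te \<in> borel_measurable (F r)" "W (max r te) \<in> borel_measurable (F r)" using W_meas_F t r by auto
        then show ?thesis unfolding logw_def
          by (intro borel_measurable_add borel_measurable_times borel_measurable_diff borel_measurable_const)
      qed
      ultimately show "(\<lambda>\<omega>. gbm \<mu> \<sigma> \<eta> \<theta> t te x r \<omega>) \<in> borel_measurable (F r)"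
        unfolding gbm_def
        by (intro borel_measurable_times borel_measurable_const borel_measurable_exp[THEN
          measurable_compose[rotated]] borel_measurable_add)
      show "AE \<omega> in P. gbm \<mu> \<sigma> \<eta> \<theta> t te x r \<omega> = X r \<omega>" using AE_not_in[OF NP] by eventually_elim (simp add: X_def)
    qed
    show "X t \<omega> = x" for \<omega> unfolding X_def gbm_def using t by (simp add: min_def max_def)
    show "AE \<omega> in P. X r \<omega> = gbm \<mu> \<sigma> \<eta> \<theta> t te x r \<omega>" for r using AE_not_in[OF NP] by eventually_elim (simp add: X_def)
  qed
  then show ?thesis by blast
qed

section \<open>Uniqueness of the wealth process\<close>

text \<open>The enumeration is continued by the constant \<open>r\<close> beyond \<open>N\<close>,
  since the results on orthogonal sums expect a monotone sequence indexed by all natural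
  numbers.\<close>

lemma fine_grid:
  fixes t r :: real
  assumes G: "finite G" "t \<in> G" "r \<in> G" "G \<subseteq> {t..r}" and tr: "t < r"
  obtains \<pi> :: "nat \<Rightarrow> real" and N where "mono \<pi>" "\<And>k. k < N \<Longrightarrow> \<pi> k < \<pi> (Suc k)" "\<pi> 0 = t" "\<And>k. N \<le> k \<Longrightarrow> \<pi> k = r"
    "\<pi> ` {..N} = G"
proof -
  define xs where "xs = sorted_list_of_set G"
  have xs: "sorted_wrt (<) xs" "set xs = G" "xs \<noteq> []" unfolding xs_def using G by auto
  define N where "N = length xs - 1"
  have len: "length xs = Suc N" unfolding N_def using xs(3) by (cases xs) auto
  define \<pi> where "\<pi> k = (if k \<le> N then xs ! k else r)" for k
  have str: "\<pi> i < \<pi> j" if "i < j" "j \<le> N" for i j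
    using sorted_wrt_nth_less[OF xs(1), of i j] that len unfolding \<pi>_def by auto
  have img: "\<pi> ` {..N} = G"
  proof -
    have "\<pi> ` {..N} = (!) xs ` {..<length xs}" unfolding \<pi>_def len by (auto simp: lessThan_Suc_atMost)
    also have "\<dots> = set xs" by (auto simp: set_conv_nth)
    finally show ?thesis using xs(2) by simp
  qed
  have le: "\<pi> i \<le> \<pi> j" if "i \<le> j" "j \<le> N" for i j using str[of i j] that by (cases "i = j") auto
  have inG: "\<pi> k \<in> G" if "k \<le> N" for k using img that by blast
  have 0: "\<pi> 0 = t"
  proof -
    obtain k where "k \<le> N" "\<pi> k = t" using img G(2) by (metis (no_types, lifting) atMost_iff imageE)
    then have "\<pi> 0 \<le> t" using le[of 0 k] by auto
    moreover have "t \<le> \<pi> 0" using inG[of 0] G(4) by auto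
    ultimately show ?thesis by simp
  qed
  have N: "\<pi> N = r"
  proof -
    obtain k where "k \<le> N" "\<pi> k = r" using img G(3) by (metis (no_types, lifting) atMost_iff imageE)
    then have "r \<le> \<pi> N" using le[of k N] by auto
    moreover have "\<pi> N \<le> r" using inG[of N] G(4) by auto
    ultimately show ?thesis by simp
  qed
  have ge: "\<pi> k = r" if "N \<le> k" for k using N that unfolding \<pi>_def by auto
  have "mono \<pi>"
  proof (rule monoI)
    fix i j :: nat assume ij: "i \<le> j"
    show "\<pi> i \<le> \<pi> j"
    proof (cases "j \<le> N")
      case True
      then show ?thesis using le ij by simp
    next
      case False
      then have "\<pi> j = r" using ge by simp
      moreover have "\<pi> i \<le> r" using inG[of i] G(4) ge[of i] by (cases "i \<le> N") auto
      ultimately show ?thesis by simp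
    qed
  qed
  then show thesis using str 0 ge img by (intro that[of \<pi> N]) auto
qed

lemma grid_telescope:
  fixes f :: "real \<Rightarrow> real"
  assumes m: "mono \<pi>" and st: "\<And>k. k < N \<Longrightarrow> \<pi> k < \<pi> (Suc k)" and ij: "i \<le> j" "j \<le> N"
  shows "(\<Sum>k<N. if \<pi> i \<le> \<pi> k \<and> \<pi> k < \<pi> j then f (\<pi> (Suc k)) - f (\<pi> k) else 0) = f (\<pi> j) - f (\<pi> (i::nat))"
proof -
  have str: "\<pi> a < \<pi> b" if "a < b" "b \<le> N" for a b
    using st[of a] monoD[OF m, of "Suc a" b] that by (metis Suc_leI less_le_trans order_less_le_trans)
  have iff: "\<pi> a \<le> \<pi> b \<longleftrightarrow> a \<le> b" if "a \<le> N" "b \<le> N" for a b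
    using str[of b a] monoD[OF m, of a b] that by (meson leD leI)
  have "(\<Sum>k<N. if \<pi> i \<le> \<pi> k \<and> \<pi> k < \<pi> j then f (\<pi> (Suc k)) - f (\<pi> k) else 0)
    = (\<Sum>k<N. if k \<in> {i..<j} then f (\<pi> (Suc k)) - f (\<pi> k) else 0)"
    by (intro sum.cong refl if_cong) (use iff ij in \<open>auto simp: not_le[symmetric]\<close>)
  also have "\<dots> = (\<Sum>k\<in>{i..<j}. f (\<pi> (Suc k)) - f (\<pi> k))"
    using ij by (subst sum.inter_restrict[symmetric]) (auto intro!: sum.cong)
  also have "\<dots> = f (\<pi> j) - f (\<pi> i)" using sum_Suc_diff'[OF ij(1), of "\<lambda>k. f (\<pi> k)"] .
  finally show ?thesis .
qed

text \<open>The current term is included in the sum that is compared with \<kappa>, so a term is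
  dropped before it could overshoot the bound.\<close>

lemma truncated_sum_le:
  fixes a :: "nat \<Rightarrow> real"
  assumes a: "\<And>k. 0 \<le> a k" and \<kappa>: "0 \<le> \<kappa>"
  shows "(\<Sum>k<n. if (\<Sum>l\<le>k. a l) \<le> \<kappa> then a k else 0) \<le> \<kappa>"
proof (induction n)
  case (Suc n)
  show ?case
  proof (cases "(\<Sum>l\<le>n. a l) \<le> \<kappa>")
    case True
    have "(\<Sum>l\<le>k. a l) \<le> \<kappa>" if "k < Suc n" for k
    proof -
      have "(\<Sum>l\<le>k. a l) \<le> (\<Sum>l\<le>n. a l)" using that a by (intro sum_mono2) auto
      then show ?thesis using True by simp
    qed
    then have "(\<Sum>k<Suc n. if (\<Sum>l\<le>k. a l) \<le> \<kappa> then a k else 0) = (\<Sum>k<Suc n. a k)" by (intro sum.cong) auto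
    then show ?thesis using True by (simp only: lessThan_Suc_atMost)
  next
    case False
    then show ?thesis using Suc by simp
  qed
qed (use \<kappa> in simp)

lemma truncated_eq:
  fixes a :: "nat \<Rightarrow> real"
  assumes a: "\<And>k. 0 \<le> a k" and s: "(\<Sum>k<n. a k) \<le> \<kappa>" and k: "k < n"
  shows "(\<Sum>l\<le>k. a l) \<le> \<kappa>"
proof -
  have "(\<Sum>l\<le>k. a l) \<le> (\<Sum>l<n. a l)" using k a by (intro sum_mono2) auto
  then show ?thesis using s by simp
qed

section \<open>Truncated stochastic sums on a coarse grid\<close>

locale coarse_grid = brownian +
  fixes t r :: real and K :: nat
  assumes t0: "0 \<le> t" and tr: "t < r" and K: "0 < K"
begin

definition hs :: real where "hs = (r - t) / real K"
definition sg :: "nat \<Rightarrow> real" where "sg i = t + real i * hs"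
definition fl :: "real \<Rightarrow> real" where "fl s = sg (nat \<lfloor>(s - t) / hs\<rfloor>)"

lemma hs_pos: "hs > 0" unfolding hs_def using tr K by simp
lemma sg_0 [simp]: "sg 0 = t" unfolding sg_def by simp
lemma sg_K [simp]: "sg K = r" unfolding sg_def hs_def using K by simp
lemma sg_Suc: "sg (Suc i) = sg i + hs" unfolding sg_def by (simp add: algebra_simps)
lemma sg_mono: "mono sg" unfolding sg_def using hs_pos by (intro monoI add_left_mono mult_right_mono) auto
lemma sg_ge: "t \<le> sg i" unfolding sg_def using hs_pos by simp
lemma sg_le: "i \<le> K \<Longrightarrow> sg i \<le> r" using monoD[OF sg_mono, of i K] by simp

lemma fl_eq: "sg i \<le> s \<Longrightarrow> s < sg (Suc i) \<Longrightarrow> fl s = sg i"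
proof -
  assume a: "sg i \<le> s" "s < sg (Suc i)"
  then have "real i \<le> (s - t) / hs" "(s - t) / hs < real i + 1" unfolding sg_def using hs_pos
    by (auto simp: pos_le_divide_eq pos_divide_less_eq algebra_simps)
  then have "\<lfloor>(s - t) / hs\<rfloor> = int i" by (simp add: floor_eq_iff)
  then show ?thesis unfolding fl_def by simp
qed

lemma fl_bounds: assumes "t \<le> s" shows "t \<le> fl s" "fl s \<le> s" "s - hs \<le> fl s"
proof -
  define k where "k = nat \<lfloor>(s - t) / hs\<rfloor>"
  have "0 \<le> (s - t) / hs" using assms hs_pos by simp
  then have "real k \<le> (s - t) / hs" "(s - t) / hs \<le> real k + 1" unfolding k_def by linarith+
  then have "real k * hs \<le> s - t" "s - t \<le> (real k + 1) * hs" using hs_pos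
    by (auto simp: pos_le_divide_eq pos_divide_le_eq)
  then show "t \<le> fl s" "fl s \<le> s" "s - hs \<le> fl s" unfolding fl_def k_def[symmetric] sg_def using hs_pos
    by (auto simp: algebra_simps)
qed

text \<open>\<open>Bt i\<close> is the increment over the \<open>i\<close>-th cell of the integral of \<open>H - V \<circ> fl\<close>, switched off once the
  accumulated quadratic error exceeds \<open>\<kappa>\<close>. This makes it square-integrable although \<open>V\<close> need not be.\<close>

lemma truncated_increments:
  fixes V :: "real \<Rightarrow> 'a \<Rightarrow> real" and H :: "'a simple_integrand"
  assumes H: "is_simple_integrand F t H" and V: "\<And>u. t \<le> u \<Longrightarrow> V u \<in> borel_measurable (F u)" and \<kappa>: "0 < \<kappa>"
  obtains Bt :: "nat \<Rightarrow> 'a \<Rightarrow> real" where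
    "\<And>i. i < K \<Longrightarrow> Bt i \<in> borel_measurable (F (sg (Suc i)))"
    "\<And>i. i < K \<Longrightarrow> integrable P (\<lambda>\<omega>. (Bt i \<omega>)\<^sup>2)"
    "\<And>i U. i < K \<Longrightarrow> U \<in> borel_measurable (F (sg i)) \<Longrightarrow> integrable P (\<lambda>\<omega>. (U \<omega>)\<^sup>2) \<Longrightarrow>
      integrable P (\<lambda>\<omega>. U \<omega> * Bt i \<omega>) \<and> (\<integral>\<omega>. U \<omega> * Bt i \<omega> \<partial>P) = 0"
    "(\<Sum>i<K. \<integral>\<omega>. (Bt i \<omega>)\<^sup>2 \<partial>P) \<le> \<kappa>"
    "\<And>i \<omega>. i < K \<Longrightarrow> (LINT s:{t..r}|lborel. (simple_value H s \<omega> - V (fl s) \<omega>)\<^sup>2) \<le> \<kappa> \<Longrightarrow>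
       Bt i \<omega> = simple_integral W H (sg (Suc i)) \<omega> - simple_integral W H (sg i) \<omega> - V (sg i) \<omega> * (W (sg (Suc i)) \<omega> -
         W (sg i) \<omega>)"
proof -
  obtain n p \<xi> where Heq: "H = (n, p, \<xi>)" by (cases H) auto
  have p: "t \<le> p 0" "mono p" and \<xi>: "\<And>i. i < n \<Longrightarrow> \<xi> i \<in> borel_measurable (F (p i))"
    using H unfolding is_simple_integrand_def Heq by auto
  have pt: "t \<le> p l" for l using monoD[OF p(2), of 0 l] p(1) by simp
  define G where "G = sg ` {..K} \<union> (p ` {..n} \<inter> {t..r})"
  have "sg 0 \<in> sg ` {..K}" "sg K \<in> sg ` {..K}" "sg ` {..K} \<subseteq> {t..r}"
    using sg_ge sg_le by (auto simp del: sg_0 sg_K)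
  then have "finite G" "t \<in> G" "r \<in> G" "G \<subseteq> {t..r}"
    unfolding G_def by auto
  then obtain \<pi> N where \<pi>: "mono \<pi>" "\<And>k. k < N \<Longrightarrow> \<pi> k < \<pi> (Suc k)" "\<pi> 0 = t" "\<And>k. N \<le> k \<Longrightarrow> \<pi> k = r" "\<pi> ` {..N} = G"
    using fine_grid[OF _ _ _ _ tr, of G] by blast
  have \<pi>t: "t \<le> \<pi> k" "0 \<le> \<pi> k" for k using monoD[OF \<pi>(1), of 0 k] \<pi>(3) t0 by auto
  have \<pi>r: "\<pi> k < r" if "k < N" for k using \<pi>(2)[OF that] monoD[OF \<pi>(1), of "Suc k" N] \<pi>(4)[of N] that by simp
  have gap: "g \<le> \<pi> k \<or> \<pi> (Suc k) \<le> g" if "g \<in> G" for g k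
  proof -
    have "g \<in> \<pi> ` {..N}" using that \<pi>(5) by simp
    then obtain a where "g = \<pi> a" by blast
    then show ?thesis using monoD[OF \<pi>(1), of a k] monoD[OF \<pi>(1), of "Suc k" a] by (cases "a \<le> k") auto
  qed
  have gap_p: "p l \<le> \<pi> k \<or> \<pi> (Suc k) \<le> p l" if "l \<le> n" "k < N" for l k
  proof (cases "p l \<le> r")
    case True
    then have "p l \<in> G" unfolding G_def using that pt by auto
    then show ?thesis by (rule gap)
  next
    case False
    have "\<pi> (Suc k) \<le> r" using monoD[OF \<pi>(1), of "Suc k" N] \<pi>(4)[of N] that by simp
    then show ?thesis using False by simp
  qed
  have gap_s: "sg i \<le> \<pi> k \<or> \<pi> (Suc k) \<le> sg i" if "i \<le> K" for i k
    using gap[of "sg i" k] that unfolding G_def by auto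
  \<comment> \<open>A left-closed version of \<open>simple_value\<close>: at a refined grid point it
    gives the value on the cell that follows, which is the one multiplying
    \<open>dW k\<close>.\<close>
  define hv where "hv s \<omega> = (\<Sum>l<n. \<xi> l \<omega> * indicator {p l..<p (Suc l)} s)" for s \<omega>
  define z where "z k \<omega> = hv (\<pi> k) \<omega> - V (fl (\<pi> k)) \<omega>" for k \<omega>
  define \<Delta> where "\<Delta> k = \<pi> (Suc k) - \<pi> k" for k
  have \<Delta>: "0 \<le> \<Delta> k" for k unfolding \<Delta>_def using monoD[OF \<pi>(1), of k "Suc k"] by simp
  have \<Delta>p: "0 < \<Delta> k" if "k < N" for k unfolding \<Delta>_def using \<pi>(2)[OF that] by simp
  \<comment> \<open>The term of cell \<open>k\<close> is included. It is known at the left end of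
    that cell, so the truncation is adapted, and the surviving \<open>zt k\<close> is bounded on
    every cell of positive length.\<close>
  define acc where "acc k \<omega> = (\<Sum>l\<le>k. (z l \<omega>)\<^sup>2 * \<Delta> l)" for k \<omega>
  define zt where "zt k \<omega> = (if acc k \<omega> \<le> \<kappa> then z k \<omega> else 0)" for k \<omega>
  define dW where "dW k \<omega> = W (\<pi> (Suc k)) \<omega> - W (\<pi> k) \<omega>" for k \<omega>
  have hvm: "hv s \<in> borel_measurable (F s)" for s
    unfolding hv_def[abs_def]
  proof (rule borel_measurable_sum)
    fix l assume l: "l \<in> {..<n}"
    show "(\<lambda>\<omega>. \<xi> l \<omega> * indicator {p l..<p (Suc l)} s) \<in> borel_measurable (F s)"
    proof (cases "p l \<le> s")
      case True
      then show ?thesis using F_meas_mono[OF \<xi> True] l by (intro borel_measurable_times borel_measurable_const) auto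
    qed simp
  qed
  have zm: "z k \<in> borel_measurable (F (\<pi> k))" for k
    unfolding z_def[abs_def] using hvm F_meas_mono[OF V[OF fl_bounds(1)[OF \<pi>t(1)]] fl_bounds(2)[OF \<pi>t(1)]]
      by (intro borel_measurable_diff)
  have zmm: "z l \<in> borel_measurable (F (\<pi> k))" if "l \<le> k" for k l
    using F_meas_mono[OF zm monoD[OF \<pi>(1) that]] .
  have accm: "acc k \<in> borel_measurable (F (\<pi> k))" for k
    unfolding acc_def[abs_def] using zmm
      by (intro borel_measurable_sum borel_measurable_times borel_measurable_const borel_measurable_power) auto
  have ztm: "zt k \<in> borel_measurable (F (\<pi> k))" for k
    unfolding zt_def[abs_def] using accm[of k] zm[of k] by measurable
  have ztb: "(zt k \<omega>)\<^sup>2 \<le> \<kappa> / \<Delta> k" if "k < N" for k \<omega>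
  proof (cases "acc k \<omega> \<le> \<kappa>")
    case True
    have "(z k \<omega>)\<^sup>2 * \<Delta> k \<le> acc k \<omega>" unfolding acc_def using \<Delta> by (intro member_le_sum) auto
    then show ?thesis using True \<Delta>p[OF that] unfolding zt_def by (simp add: field_simps)
  next
    case False
    then show ?thesis using \<kappa> \<Delta>[of k] unfolding zt_def by simp
  qed
  have zt_sum: "(\<Sum>k<N. (zt k \<omega>)\<^sup>2 * \<Delta> k) \<le> \<kappa>" for \<omega>
  proof -
    have "(\<Sum>k<N. (zt k \<omega>)\<^sup>2 * \<Delta> k) = (\<Sum>k<N. if (\<Sum>l\<le>k. (z l \<omega>)\<^sup>2 * \<Delta> l) \<le> \<kappa> then (z k \<omega>)\<^sup>2 * \<Delta> k else 0)"
      unfolding zt_def acc_def by (intro sum.cong) auto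
    also have "\<dots> \<le> \<kappa>" by (rule truncated_sum_le) (use \<Delta> \<kappa> in auto)
    finally show ?thesis .
  qed
  \<comment> \<open>Restriction of \<open>zt\<close> to the refined cells inside the
    \<open>i\<close>-th coarse cell, set to 0 from index \<open>N\<close> on.\<close>
  define v where "v i k \<omega> = (if k < N \<and> sg i \<le> \<pi> k \<and> \<pi> k < sg (Suc i) then zt k \<omega> else 0)" for i k \<omega>
  have vm: "v i k \<in> borel_measurable (F (\<pi> k))" for i k
    unfolding v_def[abs_def] using ztm[of k] by (cases "k < N \<and> sg i \<le> \<pi> k \<and> \<pi> k < sg (Suc i)") auto
  have vb: "\<exists>C. \<forall>\<omega>. \<bar>v i k \<omega>\<bar> \<le> C" for i k
  proof (cases "k < N")
    case True
    have "\<bar>v i k \<omega>\<bar> \<le> sqrt (\<kappa> / \<Delta> k)" for \<omega>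
      unfolding v_def using ztb[OF True, of \<omega>] \<kappa> \<Delta>p[OF True] real_sqrt_le_mono[OF ztb[OF True, of \<omega>]] by auto
    then show ?thesis by blast
  next
    case False
    then show ?thesis by (intro exI[of _ 0]) (auto simp: v_def)
  qed
  have vi: "integrable P (\<lambda>\<omega>. (v i k \<omega>)\<^sup>2)" for i k
  proof -
    obtain C where C: "\<And>\<omega>. \<bar>v i k \<omega>\<bar> \<le> C" using vb by blast
    have "(v i k \<omega>)\<^sup>2 \<le> C\<^sup>2" for \<omega> using C[of \<omega>] by (simp add: abs_le_square_iff[symmetric])
    then show ?thesis using F_meas_P[OF vm] by (intro integrable_const_bound[where B = "C\<^sup>2"]) auto
  qed
  define Bt where "Bt i \<omega> = (\<Sum>k<N. v i k \<omega> * dW k \<omega>)" for i \<omega>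
  have \<Delta>E: "integrable P (\<lambda>\<omega>. (dW k \<omega>)\<^sup>2)" "(\<integral>\<omega>. (dW k \<omega>)\<^sup>2 \<partial>P) = \<Delta> k" "integrable P (dW k)" "(\<integral>\<omega>. dW k \<omega> \<partial>P) = 0" for k
    unfolding dW_def[abs_def] \<Delta>_def
      using incr_square[OF \<pi>t(2) monoD[OF \<pi>(1)], of k "Suc k"] incr_mean[OF \<pi>t(2) monoD[OF \<pi>(1)], of k "Suc k"]
      by auto
  have orth: "Bt i \<in> borel_measurable (F (\<pi> N)) \<and> integrable P (\<lambda>\<omega>. (Bt i \<omega>)\<^sup>2)
    \<and> (\<integral>\<omega>. (Bt i \<omega>)\<^sup>2 \<partial>P) = (\<Sum>k<N. (\<integral>\<omega>. (v i k \<omega>)\<^sup>2 \<partial>P) * \<Delta> k)" for i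
    unfolding Bt_def[abs_def] dW_def
    by (rule orthogonal_sum[OF \<pi>(1) \<pi>t(2), where g = "\<lambda>_ z. z"]) (use vm vi \<Delta>E in \<open>auto simp: dW_def[abs_def]\<close>)
  have WmF: "W (\<pi> k) \<in> borel_measurable (F u)" if "\<pi> k \<le> u" for k u using W_meas_F[OF \<pi>t(2) that] .
  show thesis
  proof (rule that[of Bt])
    fix i assume i: "i < K"
    show "integrable P (\<lambda>\<omega>. (Bt i \<omega>)\<^sup>2)" using orth by blast
    show "Bt i \<in> borel_measurable (F (sg (Suc i)))" unfolding Bt_def[abs_def]
    proof (rule borel_measurable_sum)
      fix k assume "k \<in> {..<N}"
      show "(\<lambda>\<omega>. v i k \<omega> * dW k \<omega>) \<in> borel_measurable (F (sg (Suc i)))"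
      proof (cases "\<pi> k < sg (Suc i)")
        case True
        then have le: "\<pi> (Suc k) \<le> sg (Suc i)" "\<pi> k \<le> sg (Suc i)" using gap_s[of "Suc i" k] i by auto
        show ?thesis unfolding dW_def using F_meas_mono[OF vm le(2)] WmF[OF le(1)] WmF[OF le(2)]
          by (intro borel_measurable_times borel_measurable_diff)
      next
        case False
        then have "(\<lambda>\<omega>. v i k \<omega> * dW k \<omega>) = (\<lambda>_. 0)" unfolding v_def by auto
        then show ?thesis by simp
      qed
    qed
    \<comment> \<open>\<open>U\<close> is known at the start of the coarse cell, and each increment
      in the sum comes later; boundedness of \<open>v\<close> gives the integrability of every
      product.\<close>
    show "integrable P (\<lambda>\<omega>. U \<omega> * Bt i \<omega>) \<and> (\<integral>\<omega>. U \<omega> * Bt i \<omega> \<partial>P) = 0"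
      if U: "U \<in> borel_measurable (F (sg i))" "integrable P (\<lambda>\<omega>. (U \<omega>)\<^sup>2)" for U
    proof -
      have Ui: "integrable P U" by (rule square_integrable_imp_integrable) (use U F_meas_P[OF U(1)] in auto)
      have one: "integrable P (\<lambda>\<omega>. U \<omega> * v i k \<omega> * dW k \<omega>) \<and> (\<integral>\<omega>. U \<omega> * v i k \<omega> * dW k \<omega> \<partial>P) = 0" for k
      proof (cases "sg i \<le> \<pi> k")
        case True
        have m: "(\<lambda>\<omega>. U \<omega> * v i k \<omega>) \<in> borel_measurable (F (\<pi> k))" using F_meas_mono[OF U(1) True] vm
          by (intro borel_measurable_times)
        obtain C where C: "\<And>\<omega>. \<bar>v i k \<omega>\<bar> \<le> C" using vb by blast
        have "integrable P (\<lambda>\<omega>. U \<omega> * v i k \<omega>)"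
        proof (rule Bochner_Integration.integrable_bound[of P "\<lambda>\<omega>. C * U \<omega>"])
          show "(\<lambda>\<omega>. U \<omega> * v i k \<omega>) \<in> borel_measurable P" using F_meas_P[OF m] .
          have "\<bar>U \<omega> * v i k \<omega>\<bar> \<le> \<bar>C * U \<omega>\<bar>" for \<omega>
            using mult_right_mono[OF order_trans[OF C[of \<omega>] abs_ge_self[of C]] abs_ge_zero[of "U \<omega>"]]
              by (simp add: abs_mult mult.commute)
          then show "AE \<omega> in P. norm (U \<omega> * v i k \<omega>) \<le> norm (C * U \<omega>)" by simp
        qed (use Ui in simp)
        from expectation_indep_incr[OF \<pi>t(2) monoD[OF \<pi>(1)] m _ this, of "Suc k" "\<lambda>z. z"] \<Delta>E(3,4)[of k]
        show ?thesis unfolding dW_def[abs_def] by simp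
      next
        case False
        then have "(\<lambda>\<omega>. U \<omega> * v i k \<omega> * dW k \<omega>) = (\<lambda>_. 0)" unfolding v_def by auto
        then show ?thesis by simp
      qed
      have e: "U \<omega> * Bt i \<omega> = (\<Sum>k<N. U \<omega> * v i k \<omega> * dW k \<omega>)" for \<omega> unfolding Bt_def
        by (simp add: sum_distrib_left mult.assoc)
      show ?thesis unfolding e using one by simp
    qed
  next
    have "(\<Sum>i<K. \<integral>\<omega>. (Bt i \<omega>)\<^sup>2 \<partial>P) = (\<Sum>i<K. \<Sum>k<N. (\<integral>\<omega>. (v i k \<omega>)\<^sup>2 \<partial>P) * \<Delta> k)" using orth by simp
    also have "\<dots> = (\<Sum>i<K. \<Sum>k<N. (\<integral>\<omega>. (v i k \<omega>)\<^sup>2 * \<Delta> k \<partial>P))" by simp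
    also have "\<dots> = (\<integral>\<omega>. (\<Sum>i<K. \<Sum>k<N. (v i k \<omega>)\<^sup>2 * \<Delta> k) \<partial>P)"
      using vi by simp
    also have "\<dots> \<le> (\<integral>\<omega>. \<kappa> \<partial>P)"
    proof (rule integral_mono)
      show "integrable P (\<lambda>\<omega>. \<Sum>i<K. \<Sum>k<N. (v i k \<omega>)\<^sup>2 * \<Delta> k)" using vi by simp
      fix \<omega>
      have "(\<Sum>i<K. \<Sum>k<N. (v i k \<omega>)\<^sup>2 * \<Delta> k) = (\<Sum>k<N. \<Sum>i<K. (v i k \<omega>)\<^sup>2 * \<Delta> k)" by (rule sum.swap)
      also have "\<dots> \<le> (\<Sum>k<N. (zt k \<omega>)\<^sup>2 * \<Delta> k)"
      proof (rule sum_mono)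
        fix k assume "k \<in> {..<N}"
        \<comment> \<open>The only coarse cell that can contain the refined point, so no refined
          cell is counted twice.\<close>
        define i0 where "i0 = nat \<lfloor>(\<pi> k - t) / hs\<rfloor>"
        have u: "i = i0" if "sg i \<le> \<pi> k" "\<pi> k < sg (Suc i)" for i
        proof -
          have "sg i = sg i0" using fl_eq[OF that] unfolding fl_def i0_def by simp
          then show ?thesis unfolding sg_def using hs_pos by simp
        qed
        have "(v i k \<omega>)\<^sup>2 * \<Delta> k \<le> (if i = i0 then (zt k \<omega>)\<^sup>2 * \<Delta> k else 0)" for i
          using u[of i] \<Delta>[of k] unfolding v_def by auto
        then have "(\<Sum>i<K. (v i k \<omega>)\<^sup>2 * \<Delta> k) \<le> (\<Sum>i<K. if i = i0 then (zt k \<omega>)\<^sup>2 * \<Delta> k else 0)" by (intro sum_mono)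
        also have "\<dots> \<le> (zt k \<omega>)\<^sup>2 * \<Delta> k" using \<Delta>[of k] by simp
        finally show "(\<Sum>i<K. (v i k \<omega>)\<^sup>2 * \<Delta> k) \<le> (zt k \<omega>)\<^sup>2 * \<Delta> k" .
      qed
      also have "\<dots> \<le> \<kappa>" by (rule zt_sum)
      finally show "(\<Sum>i<K. \<Sum>k<N. (v i k \<omega>)\<^sup>2 * \<Delta> k) \<le> \<kappa>" .
    qed simp
    finally show "(\<Sum>i<K. \<integral>\<omega>. (Bt i \<omega>)\<^sup>2 \<partial>P) \<le> \<kappa>" using prob_space by simp
  next
    fix i \<omega> assume i: "i < K" and Q: "(LINT s:{t..r}|lborel. (simple_value H s \<omega> - V (fl s) \<omega>)\<^sup>2) \<le> \<kappa>"
    define a where "a = sg i"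
    define b where "b = sg (Suc i)"
    have ab: "a < b" "t \<le> a" "b \<le> r" unfolding a_def b_def using hs_pos sg_ge sg_le[of "Suc i"] i
      by (auto simp: sg_Suc)
    have aG: "a \<in> G" "b \<in> G" unfolding G_def a_def b_def using i by auto
    have cell: "\<exists>j<K. sg j \<le> \<pi> k \<and> \<pi> (Suc k) \<le> sg (Suc j)" if k: "k < N" for k
    proof -
      define j where "j = nat \<lfloor>(\<pi> k - t) / hs\<rfloor>"
      have "sg j \<le> \<pi> k" "\<pi> k - hs \<le> sg j" using fl_bounds[OF \<pi>t(1), of k] unfolding fl_def j_def by auto
      moreover have "\<pi> k < sg (Suc j)"
      proof -
        have "(\<pi> k - t) / hs < real j + 1" unfolding j_def by linarith
        then show ?thesis using hs_pos unfolding sg_def by (simp add: pos_divide_less_eq algebra_simps)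
      qed
      moreover have "j < K"
      proof (rule ccontr)
        assume "\<not> j < K"
        then have "r \<le> sg j" using monoD[OF sg_mono, of K j] by simp
        then show False using calculation \<pi>r[OF k] by simp
      qed
      moreover have "\<pi> (Suc k) \<le> sg (Suc j)" using gap_s[of "Suc j" k] calculation by auto
      ultimately show ?thesis by blast
    qed
    \<comment> \<open>The integral error equals the full sum that \<open>acc\<close> accumulates. If
      it is at most \<kappa>, no cell is switched off and \<open>Bt\<close> is the true
      increment.\<close>
    have Qeq: "(LINT s:{t..r}|lborel. (simple_value H s \<omega> - V (fl s) \<omega>)\<^sup>2) = (\<Sum>k<N. (z k \<omega>)\<^sup>2 * \<Delta> k)"
    proof -
      have val: "simple_value H s \<omega> - V (fl s) \<omega> = z k \<omega>" if k: "k < N" and s: "\<pi> k < s" "s < \<pi> (Suc k)" for s k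
      proof -
        have "indicator {p l<..p (Suc l)} s = (indicator {p l..<p (Suc l)} (\<pi> k) :: real)" if "l < n" for l
          using gap_p[of l k] gap_p[of "Suc l" k] that k s by (auto simp: indicator_def)
        then have "simple_value H s \<omega> = hv (\<pi> k) \<omega>"
          unfolding simple_value_def Heq hv_def prod.case by (intro sum.cong) auto
        moreover obtain j where j: "j < K" "sg j \<le> \<pi> k" "\<pi> (Suc k) \<le> sg (Suc j)" using cell[OF k] by blast
        then have "fl s = sg j" "fl (\<pi> k) = sg j" using s by (auto intro!: fl_eq)
        ultimately show ?thesis unfolding z_def by simp
      qed
      have "AE s in lborel. s \<notin> G"
        using \<open>finite G\<close> by (intro AE_not_in finite_imp_null_set_lborel)
      then have "AE s in lborel. indicator {t..r} s *\<^sub>R (simple_value H s \<omega> - V (fl s) \<omega>)\<^sup>2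
        = (\<Sum>k<N. (z k \<omega>)\<^sup>2 * indicator {\<pi> k<..<\<pi> (Suc k)} s)"
      proof eventually_elim
        case (elim s)
        show ?case
        proof (cases "s \<in> {t..r}")
          case True
          define L where "L = (LEAST k. s \<le> \<pi> k)"
          have sN: "s \<le> \<pi> N" using True \<pi>(4)[of N] by simp
          have L: "s \<le> \<pi> L" "L \<le> N" unfolding L_def by (rule LeastI[of "\<lambda>k. s \<le> \<pi> k",
            OF sN], rule Least_le[of "\<lambda>k. s \<le> \<pi> k", OF sN])
          have "L \<noteq> 0"
          proof
            assume "L = 0"
            then have "s = t" using L(1) \<pi>(3) True by simp
            then show False using elim \<open>t \<in> G\<close> by simp
          qed
          then obtain k where k: "L = Suc k" by (cases L) auto
          have "\<not> s \<le> \<pi> k" using not_less_Least[of k "\<lambda>k. s \<le> \<pi> k"] k unfolding L_def by simp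
          moreover have "s \<noteq> \<pi> (Suc k)" using elim \<pi>(5) L k by auto
          ultimately have sk: "k < N" "\<pi> k < s" "s < \<pi> (Suc k)" using L k by auto
          have other: "indicator {\<pi> l<..<\<pi> (Suc l)} s = (0::real)" if "l \<noteq> k" for l
          proof (cases "l < k")
            case True
            then have "\<pi> (Suc l) \<le> \<pi> k" by (intro monoD[OF \<pi>(1)]) simp
            then show ?thesis using sk by simp
          next
            case False
            then have "\<pi> (Suc k) \<le> \<pi> l" using that by (intro monoD[OF \<pi>(1)]) simp
            then show ?thesis using sk by simp
          qed
          have "(\<Sum>l<N. (z l \<omega>)\<^sup>2 * indicator {\<pi> l<..<\<pi> (Suc l)} s) = (\<Sum>l<N. if l = k then (z k \<omega>)\<^sup>2 else 0)"
          proof (rule sum.cong[OF refl])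
            fix l show "(z l \<omega>)\<^sup>2 * indicator {\<pi> l<..<\<pi> (Suc l)} s = (if l = k then (z k \<omega>)\<^sup>2 else 0)"
            proof (cases "l = k")
              case True
              then show ?thesis using sk by simp
            next
              case False
              show ?thesis unfolding other[OF False] using False by simp
            qed
          qed
          then show ?thesis using True val[OF sk] sk by simp
        next
          case False
          have "indicator {\<pi> l<..<\<pi> (Suc l)} s = (0::real)" if "l < N" for l
            using False \<pi>t(1)[of l] monoD[OF \<pi>(1), of "Suc l" N] \<pi>(4)[of N] that by (auto simp: indicator_def)
          then show ?thesis using False by simp
        qed
      qed
      then have "(LINT s:{t..r}|lborel. (simple_value H s \<omega> - V (fl s) \<omega>)\<^sup>2)
        = (LINT s|lborel. (\<Sum>k<N. (z k \<omega>)\<^sup>2 * indicator {\<pi> k<..<\<pi> (Suc k)} s))"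
        unfolding set_lebesgue_integral_def
      proof (rule integral_cong_AE[rotated 2])
        have [measurable]: "(\<lambda>s. V (fl s) \<omega>) \<in> borel_measurable borel" unfolding fl_def
          by (rule measurable_compose[of "\<lambda>s. nat \<lfloor>(s - t) / hs\<rfloor>" borel "count_space UNIV" "\<lambda>k. V (sg k) \<omega>"]) auto
        have [measurable]: "(\<lambda>s. simple_value H s \<omega>) \<in> borel_measurable borel"
          unfolding simple_value_def Heq prod.case by measurable
        show "(\<lambda>s. indicator {t..r} s *\<^sub>R (simple_value H s \<omega> - V (fl s) \<omega>)\<^sup>2) \<in> borel_measurable lborel" by measurable
        show "(\<lambda>s. \<Sum>k<N. (z k \<omega>)\<^sup>2 * indicator {\<pi> k<..<\<pi> (Suc k)} s) \<in> borel_measurable lborel" by measurable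
      qed
      also have "\<dots> = (\<Sum>k<N. (z k \<omega>)\<^sup>2 * \<Delta> k)"
      proof (subst Bochner_Integration.integral_sum)
        have "integrable lborel (indicator {\<pi> k<..<\<pi> (Suc k)} :: real \<Rightarrow> real)" for k
          using monoD[OF \<pi>(1), of k "Suc k"] by (intro integrable_real_indicator) auto
        then show "integrable lborel (\<lambda>s. (z k \<omega>)\<^sup>2 * indicator {\<pi> k<..<\<pi> (Suc k)} s)" for k by simp
        show "(\<Sum>k<N. LINT s|lborel. (z k \<omega>)\<^sup>2 * indicator {\<pi> k<..<\<pi> (Suc k)} s) = (\<Sum>k<N. (z k \<omega>)\<^sup>2 * \<Delta> k)"
          using monoD[OF \<pi>(1)] by (intro sum.cong refl) (simp add: \<Delta>_def)
      qed
      finally show ?thesis .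
    qed
    have nt: "zt k \<omega> = z k \<omega>" if "k < N" for k
    proof -
      have "(\<Sum>l\<le>k. (z l \<omega>)\<^sup>2 * \<Delta> l) \<le> \<kappa>"
        by (rule truncated_eq[where n = N]) (use \<Delta> Q Qeq that in auto)
      then show ?thesis unfolding zt_def acc_def by simp
    qed
    have tele: "(\<Sum>k<N. if u \<le> \<pi> k \<and> \<pi> k < w then dW k \<omega> else 0) = W w \<omega> - W u \<omega>" if "u \<in> G" "w \<in> G" "u \<le> w" for u w
    proof (cases "u = w")
      case True
      then show ?thesis by (auto intro!: sum.neutral)
    next
      case False
      have "u \<in> \<pi> ` {..N}" "w \<in> \<pi> ` {..N}" using that \<pi>(5) by auto
      then obtain i' j' where ij: "u = \<pi> i'" "w = \<pi> j'" "i' \<le> N" "j' \<le> N" by blast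
      have "i' \<le> j'" using False that(3) ij monoD[OF \<pi>(1), of j' i'] by (cases "i' \<le> j'") auto
      then show ?thesis using grid_telescope[OF \<pi>(1,2), of N i' j' "\<lambda>s. W s \<omega>"] ij unfolding dW_def by simp
    qed
    \<comment> \<open>Clamping to the coarse cell: the simple integral over the cell is the sum over
      the clamped break points, all of which belong to \<open>G\<close>.\<close>
    define cl where "cl s = max a (min s b)" for s
    have clG: "cl (p l) \<in> G" if "l \<le> n" for l
      unfolding cl_def using aG ab that pt[of l] unfolding G_def by (auto simp: min_def max_def)
    have J: "simple_integral W H b \<omega> - simple_integral W H a \<omega> = (\<Sum>k<N. if a \<le> \<pi> k
      \<and> \<pi> k < b then hv (\<pi> k) \<omega> * dW k \<omega> else 0)"
    proof -
      have "simple_integral W H b \<omega> - simple_integral W H a \<omega>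
        = (\<Sum>l<n. \<xi> l \<omega> * (W (cl (p (Suc l))) \<omega> - W (cl (p l)) \<omega>))"
      proof -
        have \<phi>: "W (min s b) \<omega> - W (min s a) \<omega> = W (cl s) \<omega> - W a \<omega>" for s unfolding cl_def using ab
          by (auto simp: min_def max_def)
        have "\<xi> l \<omega> * (W (min (p (Suc l)) b) \<omega> - W (min (p l) b) \<omega>)
          - \<xi> l \<omega> * (W (min (p (Suc l)) a) \<omega> - W (min (p l) a) \<omega>)
           = \<xi> l \<omega> * (W (cl (p (Suc l))) \<omega> - W (cl (p l)) \<omega>)" for l
          using \<phi>[of "p l"] \<phi>[of "p (Suc l)"] unfolding right_diff_distrib[symmetric]
            by (intro arg_cong[where f = "\<lambda>x. \<xi> l \<omega> * x"]) linarith
        then show ?thesis unfolding simple_integral_def Heq prod.case sum_subtractf[symmetric] by simp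
      qed
      also have "\<dots> = (\<Sum>l<n. \<xi> l \<omega> * (\<Sum>k<N. if cl (p l) \<le> \<pi> k \<and> \<pi> k < cl (p (Suc l)) then dW k \<omega> else 0))"
      proof (intro sum.cong refl arg_cong2[where f = "(*)"] tele[symmetric])
        fix l assume "l \<in> {..<n}"
        then show "cl (p l) \<in> G" "cl (p (Suc l)) \<in> G" using clG by auto
        show "cl (p l) \<le> cl (p (Suc l))" using monoD[OF p(2), of l "Suc l"] unfolding cl_def by auto
      qed
      also have "\<dots> = (\<Sum>l<n. \<Sum>k<N. if a \<le> \<pi> k \<and> \<pi> k
        < b then \<xi> l \<omega> * indicator {p l..<p (Suc l)} (\<pi> k) * dW k \<omega> else 0)"
        unfolding sum_distrib_left
      proof (intro sum.cong refl)
        fix l k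
        have "cl (p l) \<le> \<pi> k \<and> \<pi> k < cl (p (Suc l)) \<longleftrightarrow> (a \<le> \<pi> k \<and> \<pi> k < b) \<and> (p l \<le> \<pi> k \<and> \<pi> k < p (Suc l))"
          unfolding cl_def using ab by auto
        then show "\<xi> l \<omega> * (if cl (p l) \<le> \<pi> k \<and> \<pi> k < cl (p (Suc l)) then dW k \<omega> else 0)
          = (if a \<le> \<pi> k \<and> \<pi> k < b then \<xi> l \<omega> * indicator {p l..<p (Suc l)} (\<pi> k) * dW k \<omega> else 0)" by auto
      qed
      also have "\<dots> = (\<Sum>k<N. \<Sum>l<n. if a \<le> \<pi> k \<and> \<pi> k
        < b then \<xi> l \<omega> * indicator {p l..<p (Suc l)} (\<pi> k) * dW k \<omega> else 0)" by (rule sum.swap)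
      also have "\<dots> = (\<Sum>k<N. if a \<le> \<pi> k \<and> \<pi> k < b then hv (\<pi> k) \<omega> * dW k \<omega> else 0)"
        unfolding hv_def sum_distrib_right by (intro sum.cong refl) auto
      finally show ?thesis .
    qed
    have "Bt i \<omega> = (\<Sum>k<N. if a \<le> \<pi> k \<and> \<pi> k < b then z k \<omega> * dW k \<omega> else 0)"
      unfolding Bt_def v_def a_def b_def using nt by (intro sum.cong) auto
    also have "\<dots> = (\<Sum>k<N. (if a \<le> \<pi> k \<and> \<pi> k < b then hv (\<pi> k) \<omega> * dW k \<omega> else 0) - V a \<omega> * (if a \<le> \<pi> k
      \<and> \<pi> k < b then dW k \<omega> else 0))"
    proof (intro sum.cong refl)
      fix k
      have "fl (\<pi> k) = a" if "a \<le> \<pi> k" "\<pi> k < b" using fl_eq that unfolding a_def b_def by blast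
      then show "(if a \<le> \<pi> k \<and> \<pi> k < b then z k \<omega> * dW k \<omega> else 0)
        = (if a \<le> \<pi> k \<and> \<pi> k < b then hv (\<pi> k) \<omega> * dW k \<omega> else 0) - V a \<omega> * (if a \<le> \<pi> k \<and> \<pi> k < b then dW k \<omega> else 0)"
        unfolding z_def by (auto simp: algebra_simps)
    qed
    also have "\<dots> = simple_integral W H b \<omega> - simple_integral W H a \<omega> - V a \<omega> * (W b \<omega> - W a \<omega>)"
      unfolding sum_subtractf J sum_distrib_left[symmetric] tele[OF aG less_imp_le[OF ab(1)]] ..
    finally show "Bt i \<omega> = simple_integral W H (sg (Suc i)) \<omega> - simple_integral W H (sg i) \<omega>
      - V (sg i) \<omega> * (W (sg (Suc i)) \<omega> - W (sg i) \<omega>)"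
      unfolding a_def b_def .
  qed
qed

end

text \<open>Each factor \<open>1 + C * h\<close> is absorbed into \<open>exp (C * h)\<close>. As the
  error starts at 0, only the accumulated sources \<open>\<beta>\<close> remain, with a factor
  depending on the total time and not on the number of steps.\<close>

lemma discrete_gronwall:
  fixes f \<beta> :: "nat \<Rightarrow> real"
  assumes "f 0 = 0" and C: "C \<ge> 0" and h: "h \<ge> 0" and \<beta>: "\<And>i. \<beta> i \<ge> 0"
    and step: "\<And>i. i < K \<Longrightarrow> f (Suc i) \<le> (1 + C * h) * f i + C * \<beta> i"
  shows "n \<le> K \<Longrightarrow> f n \<le> exp (C * h * real n) * (C * (\<Sum>i<n. \<beta> i))"
proof (induction n)
  case (Suc n)
  define S where "S = C * (\<Sum>i<n. \<beta> i)"
  have S: "S \<ge> 0" unfolding S_def using C \<beta> by (intro mult_nonneg_nonneg sum_nonneg) auto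
  have Ch: "0 \<le> C * h" using C h by simp
  have "f (Suc n) \<le> (1 + C * h) * f n + C * \<beta> n" using step Suc.prems by simp
  also have "\<dots> \<le> (1 + C * h) * (exp (C * h * real n) * S) + C * \<beta> n"
    using Suc Ch C unfolding S_def by (intro add_mono mult_left_mono) auto
  also have "\<dots> \<le> exp (C * h) * (exp (C * h * real n) * S) + exp (C * h * real (Suc n)) * (C * \<beta> n)"
  proof (intro add_mono mult_right_mono)
    show "1 + C * h \<le> exp (C * h)" by (rule exp_ge_add_one_self)
    have "1 \<le> exp (C * h * real (Suc n))" using Ch by simp
    then have "1 * (C * \<beta> n) \<le> exp (C * h * real (Suc n)) * (C * \<beta> n)" using C \<beta> by (intro mult_right_mono) auto
    then show "C * \<beta> n \<le> exp (C * h * real (Suc n)) * (C * \<beta> n)" by simp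
  qed (use S in auto)
  also have "\<dots> = exp (C * h * real (Suc n)) * (S + C * \<beta> n)"
    by (simp add: exp_add[symmetric] distrib_left mult.assoc[symmetric])
  finally show ?case unfolding S_def by (simp add: distrib_left)
qed (use assms in simp)

lemma (in brownian) simple_integral_meas:
  assumes H: "is_simple_integrand F t H" and t: "0 \<le> t" and s: "t \<le> s"
  shows "simple_integral W H s \<in> borel_measurable (F s)"
proof -
  obtain n p \<xi> where Heq: "H = (n, p, \<xi>)" by (cases H) auto
  have p: "t \<le> p 0" "mono p" and \<xi>: "\<And>i. i < n \<Longrightarrow> \<xi> i \<in> borel_measurable (F (p i))"
    using H unfolding is_simple_integrand_def Heq by auto
  have pt: "t \<le> p l" for l using monoD[OF p(2), of 0 l] p(1) by simp
  have Wm: "W (min (p l) s) \<in> borel_measurable (F s)" for l using pt[of l] t s by (intro W_meas_F) auto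
  show ?thesis unfolding simple_integral_def Heq prod.case
  proof (rule borel_measurable_sum)
    fix l assume l: "l \<in> {..<n}"
    show "(\<lambda>\<omega>. \<xi> l \<omega> * (W (min (p (Suc l)) s) \<omega> - W (min (p l) s) \<omega>)) \<in> borel_measurable (F s)"
    proof (cases "p l \<le> s")
      case True
      have "\<xi> l \<in> borel_measurable (F s)" using F_meas_mono[OF \<xi> True] l by simp
      then show ?thesis by (intro borel_measurable_times borel_measurable_diff Wm)
    next
      case False
      then have "min (p (Suc l)) s = s" "min (p l) s = s" using monoD[OF p(2), of l "Suc l"] by auto
      then show ?thesis by simp
    qed
  qed
qed

section \<open>The Euler scheme and its mean-square error\<close>

context coarse_grid
begin

text \<open>The scheme is driven by \<open>W\<close> and the deterministic coefficients alone, so it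
  is the same random variable whichever solution it is compared with.\<close>

primrec euler :: "real \<Rightarrow> real \<Rightarrow> (nat \<Rightarrow> real) \<Rightarrow> real \<Rightarrow> nat \<Rightarrow> 'a \<Rightarrow> real" where
  "euler \<mu> \<sigma> c x 0 \<omega> = x"
| "euler \<mu> \<sigma> c x (Suc i) \<omega> = euler \<mu> \<sigma> c x i \<omega> * (1 + \<mu> * c i * hs + \<sigma> * c i * (W (sg (Suc i)) \<omega> - W (sg i) \<omega>))"

lemma euler_meas: "euler \<mu> \<sigma> c x i \<in> borel_measurable (F (sg i))"
proof (induction i)
  case 0
  have "euler \<mu> \<sigma> c x 0 = (\<lambda>_. x)" by (simp add: fun_eq_iff)
  then show ?case by simp
next
  case (Suc i)
  have le: "sg i \<le> sg (Suc i)" using hs_pos by (simp add: sg_Suc)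
  have "W (sg i) \<in> borel_measurable (F (sg (Suc i)))" "W (sg (Suc i)) \<in> borel_measurable (F (sg (Suc i)))"
    using W_meas_F le sg_ge[of i] sg_ge[of "Suc i"] t0 by auto
  then have "(\<lambda>\<omega>. euler \<mu> \<sigma> c x i \<omega> * (1 + \<mu> * c i * hs + \<sigma> * c i * (W (sg (Suc i)) \<omega> - W (sg i) \<omega>)))
    \<in> borel_measurable (F (sg (Suc i)))"
    using F_meas_mono[OF Suc le]
      by (intro borel_measurable_times borel_measurable_add borel_measurable_diff borel_measurable_const)
  then show ?case by (simp add: fun_eq_iff cong: measurable_cong)
qed

text \<open>A crude common bound for the coefficients in the next lemma, obtained from
  \<open>hs \<le> r - t\<close>; what matters is that it does not depend on the mesh.\<close>

definition gronwall_const :: "real \<Rightarrow> real \<Rightarrow> real \<Rightarrow> real \<Rightarrow> real" where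
  "gronwall_const L \<mu> \<sigma> b = 1 + 2 * (\<sigma>\<^sup>2 * b\<^sup>2) + 2 * (\<sigma>\<^sup>2 * b\<^sup>2) * L + 2 * (1 + L) * (\<mu>\<^sup>2 * b\<^sup>2) + 2 * (1 + L)"

text \<open>\<open>D\<close> is the error so far, \<open>A\<close> the drift error and
  \<open>B\<close> the stochastic error of one cell. The Brownian increment is independent of
  \<open>D\<close> and \<open>B\<close> is orthogonal to \<open>D\<close>, so their cross terms have
  mean 0. No such relation is available for \<open>A\<close>: splitting it off by the weighted
  inequality \<open>sq\<close> costs a factor \<open>1 / hs\<close>.\<close>

lemma gronwall_step:
  fixes D A B :: "'a \<Rightarrow> real" and \<mu> \<sigma> c b :: real
  assumes i: "i < K" and D: "D \<in> borel_measurable (F (sg i))" "integrable P (\<lambda>\<omega>. (D \<omega>)\<^sup>2)"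
    and A: "A \<in> borel_measurable P" "integrable P (\<lambda>\<omega>. (A \<omega>)\<^sup>2)"
    and B: "B \<in> borel_measurable P" "integrable P (\<lambda>\<omega>. (B \<omega>)\<^sup>2)" "integrable P (\<lambda>\<omega>. D \<omega> * B \<omega>)"
      "(\<integral>\<omega>. D \<omega> * B \<omega> \<partial>P) = 0"
    and c: "\<bar>c\<bar> \<le> b"
  defines "D' \<equiv> \<lambda>\<omega>. D \<omega> * (1 + \<mu> * c * hs + \<sigma> * c * (W (sg (Suc i)) \<omega> - W (sg i) \<omega>)) + A \<omega> + B \<omega>"
    and "C \<equiv> gronwall_const (r - t) \<mu> \<sigma> b"
  shows "integrable P (\<lambda>\<omega>. (D' \<omega>)\<^sup>2)"
    and "(\<integral>\<omega>. (D' \<omega>)\<^sup>2 \<partial>P) \<le> (1 + C * hs) * (\<integral>\<omega>. (D \<omega>)\<^sup>2 \<partial>P) + C * ((\<integral>\<omega>. (B \<omega>)\<^sup>2 \<partial>P) + (\<integral>\<omega>. (A \<omega>)\<^sup>2 \<partial>P) / hs)"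
proof -
  define z where "z \<omega> = W (sg (Suc i)) \<omega> - W (sg i) \<omega>" for \<omega>
  \<comment> \<open>The second square absorbs the product of the diffusion term of \<open>D\<close>
    with \<open>B\<close>, about whose mean nothing is known.\<close>
  define g where "g u = (1 + \<sigma> * c * u)\<^sup>2 + (\<sigma> * c * u)\<^sup>2" for u
  have s: "0 \<le> sg i" "sg i \<le> sg (Suc i)" "sg (Suc i) - sg i = hs" using sg_ge[of i] t0 hs_pos by (auto simp: sg_Suc)
  have [measurable]: "W (sg i) \<in> borel_measurable P" "W (sg (Suc i)) \<in> borel_measurable P" using W_meas_P s by auto
  note [measurable] = F_meas_P[OF D(1)] A(1) B(1)
  have zE: "integrable P z" "(\<integral>\<omega>. z \<omega> \<partial>P) = 0" "integrable P (\<lambda>\<omega>. (z \<omega>)\<^sup>2)" "(\<integral>\<omega>. (z \<omega>)\<^sup>2 \<partial>P) = hs"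
    unfolding z_def[abs_def] using incr_mean[OF s(1,2)] incr_square[OF s(1,2)] s(3) by auto
  have ge: "g u = 1 + 2 * \<sigma> * c * u + 2 * (\<sigma>\<^sup>2 * c\<^sup>2) * u\<^sup>2" for u unfolding g_def
    by (simp add: power2_eq_square algebra_simps)
  have gE: "integrable P (\<lambda>\<omega>. g (z \<omega>))" "(\<integral>\<omega>. g (z \<omega>) \<partial>P) = 1 + 2 * (\<sigma>\<^sup>2 * c\<^sup>2) * hs"
    unfolding ge using zE prob_space by auto
  have Dg: "integrable P (\<lambda>\<omega>. (D \<omega>)\<^sup>2 * g (z \<omega>))" "(\<integral>\<omega>. (D \<omega>)\<^sup>2 * g (z \<omega>) \<partial>P)
    = (\<integral>\<omega>. (D \<omega>)\<^sup>2 \<partial>P) * (1 + 2 * (\<sigma>\<^sup>2 * c\<^sup>2) * hs)"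
    using expectation_indep_incr[OF s(1,2), of "\<lambda>\<omega>. (D \<omega>)\<^sup>2" g] D gE unfolding z_def[abs_def] g_def by auto
  define h where "h = hs"
  have h: "h > 0" "h \<le> r - t"
    unfolding h_def using hs_pos sg_le[of "Suc i"] sg_ge[of i] i by (auto simp: sg_Suc)
  define U where "U \<omega> = (1 + h) * ((D \<omega>)\<^sup>2 * g (z \<omega>) + 2 * (D \<omega> * B \<omega>) + 2 * (B \<omega>)\<^sup>2)
    + (1 + 1 / h) * (2 * (\<mu>\<^sup>2 * c\<^sup>2 * h\<^sup>2 * (D \<omega>)\<^sup>2) + 2 * (A \<omega>)\<^sup>2)" for \<omega>
  have sq: "(p + q)\<^sup>2 \<le> (1 + h) * p\<^sup>2 + (1 + 1 / h) * q\<^sup>2" for p q :: real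
  proof -
    have "0 \<le> (h * p - q)\<^sup>2 / h" using h by simp
    also have "\<dots> = h * p\<^sup>2 - 2 * p * q + q\<^sup>2 / h" using h by (simp add: power2_eq_square field_simps)
    finally have "2 * p * q \<le> h * p\<^sup>2 + (1 / h) * q\<^sup>2" by simp
    then show ?thesis by (simp add: power2_sum distrib_right)
  qed
  have bnd: "(D' \<omega>)\<^sup>2 \<le> U \<omega>" for \<omega>
  proof -
    define p where "p = D \<omega> * (1 + \<sigma> * c * z \<omega>) + B \<omega>"
    define q where "q = \<mu> * c * h * D \<omega> + A \<omega>"
    have "D' \<omega> = p + q" unfolding D'_def p_def q_def h_def z_def by (simp add: algebra_simps)
    moreover have "p\<^sup>2 \<le> (D \<omega>)\<^sup>2 * g (z \<omega>) + 2 * (D \<omega> * B \<omega>) + 2 * (B \<omega>)\<^sup>2"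
    proof -
      have "0 \<le> (D \<omega> * (\<sigma> * c * z \<omega>) - B \<omega>)\<^sup>2" by simp
      then show ?thesis unfolding p_def g_def by (simp add: power2_eq_square algebra_simps)
    qed
    moreover have "q\<^sup>2 \<le> 2 * (\<mu>\<^sup>2 * c\<^sup>2 * h\<^sup>2 * (D \<omega>)\<^sup>2) + 2 * (A \<omega>)\<^sup>2"
    proof -
      have "0 \<le> (\<mu> * c * h * D \<omega> - A \<omega>)\<^sup>2" by simp
      then show ?thesis unfolding q_def by (simp add: power2_eq_square algebra_simps)
    qed
    ultimately show ?thesis using sq[of p q] h unfolding U_def by (smt (verit) mult_left_mono divide_pos_pos)
  qed
  have Ui: "integrable P U" unfolding U_def using Dg D B A by simp
  have D'm: "D' \<in> borel_measurable P" unfolding D'_def by measurable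
  show i1: "integrable P (\<lambda>\<omega>. (D' \<omega>)\<^sup>2)"
    by (rule Bochner_Integration.integrable_bound[OF Ui]) (use D'm bnd in \<open>auto intro!: AE_I2 order_trans[OF bnd
      abs_ge_self]\<close>)
  define f where "f = (\<integral>\<omega>. (D \<omega>)\<^sup>2 \<partial>P)"
  define a where "a = (\<integral>\<omega>. (A \<omega>)\<^sup>2 \<partial>P)"
  define \<beta> where "\<beta> = (\<integral>\<omega>. (B \<omega>)\<^sup>2 \<partial>P)"
  have nn: "0 \<le> f" "0 \<le> a" "0 \<le> \<beta>" unfolding f_def a_def \<beta>_def by auto
  have "(\<integral>\<omega>. (D' \<omega>)\<^sup>2 \<partial>P) \<le> (\<integral>\<omega>. U \<omega> \<partial>P)" by (rule integral_mono[OF i1 Ui bnd])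
  also have "\<dots> = (1 + h) * (f * (1 + 2 * (\<sigma>\<^sup>2 * c\<^sup>2) * h) + 2 * \<beta>) + (1 + 1 / h) * (2 * (\<mu>\<^sup>2 * c\<^sup>2 * h\<^sup>2 * f) + 2 * a)"
    unfolding U_def f_def a_def \<beta>_def using Dg D B A by (simp add: h_def)
  also have "\<dots> = f * ((1 + h) * (1 + 2 * (\<sigma>\<^sup>2 * c\<^sup>2) * h) + 2 * (1 + h) * (\<mu>\<^sup>2 * c\<^sup>2) * h) + 2 * (1 + h) * (\<beta> + a / h)"
    using h by (simp add: field_simps power2_eq_square)
  also have "\<dots> \<le> f * (1 + C * h) + C * (\<beta> + a / h)"
  proof -
    define S where "S = \<sigma>\<^sup>2 * c\<^sup>2"
    define S' where "S' = \<sigma>\<^sup>2 * b\<^sup>2"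
    define m where "m = \<mu>\<^sup>2 * c\<^sup>2"
    define m' where "m' = \<mu>\<^sup>2 * b\<^sup>2"
    define L where "L = r - t"
    have cb: "c\<^sup>2 \<le> b\<^sup>2" using c by (simp add: abs_le_square_iff[symmetric])
    have S: "0 \<le> S" "S \<le> S'" "0 \<le> m" "m \<le> m'" unfolding S_def S'_def m_def m'_def using cb
      by (auto intro: mult_left_mono)
    have L: "0 \<le> L" "h \<le> L" using h unfolding L_def by auto
    have Ceq: "C = 1 + 2 * S' + 2 * S' * L + 2 * (1 + L) * m' + 2 * (1 + L)"
      unfolding C_def gronwall_const_def S'_def m'_def L_def ..
    have p: "0 \<le> S' * L" "0 \<le> L * m'" "S * h \<le> S' * L" "h * m \<le> L * m'" using S L h by (auto intro!: mult_mono)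
    have Ceq2: "C = 3 + 2 * S' + 2 * (S' * L) + 2 * m' + 2 * (L * m') + 2 * L" unfolding Ceq
      by (simp add: algebra_simps)
    define a1 where "a1 = S' * L"
    define a2 where "a2 = L * m'"
    define b1 where "b1 = S * h"
    define b2 where "b2 = h * m"
    have q: "0 \<le> a1" "0 \<le> a2" "b1 \<le> a1" "b2 \<le> a2" using p unfolding a1_def a2_def b1_def b2_def by auto
    have Ceq3: "C = 3 + 2 * S' + 2 * a1 + 2 * m' + 2 * a2 + 2 * L" unfolding Ceq2 a1_def a2_def ..
    have k1: "2 * (1 + h) \<le> C"
    proof -
      have "0 \<le> S'" "0 \<le> m'" using S by auto
      then have "0 \<le> S' + a1 + m' + a2" using q by simp
      then show ?thesis unfolding Ceq3 using L by (simp add: algebra_simps)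
    qed
    have "(1 + h) * (1 + 2 * S * h) + 2 * (1 + h) * m * h = 1 + (1 + 2 * S + 2 * (S * h) + 2 * m + 2 * (h * m)) * h"
      by (simp add: algebra_simps)
    also have "\<dots> \<le> 1 + C * h"
    proof -
      have "1 + 2 * S + 2 * (S * h) + 2 * m + 2 * (h * m) \<le> C" unfolding Ceq3 b1_def[symmetric] b2_def[symmetric]
        using S L q by linarith
      then show ?thesis using h by simp
    qed
    finally have k2: "(1 + h) * (1 + 2 * (\<sigma>\<^sup>2 * c\<^sup>2) * h) + 2 * (1 + h) * (\<mu>\<^sup>2 * c\<^sup>2) * h \<le> 1 + C * h"
      unfolding S_def m_def .
    show ?thesis
      by (rule add_mono[OF mult_left_mono[OF k2 nn(1)] mult_right_mono[OF k1]]) (use nn h in auto)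
  qed
  finally show "(\<integral>\<omega>. (D' \<omega>)\<^sup>2 \<partial>P) \<le> (1 + C * hs) * (\<integral>\<omega>. (D \<omega>)\<^sup>2 \<partial>P) + C * ((\<integral>\<omega>. (B \<omega>)\<^sup>2 \<partial>P) + (\<integral>\<omega>. (A \<omega>)\<^sup>2 \<partial>P) / hs)"
    unfolding f_def a_def \<beta>_def h_def by (simp add: mult.commute)
qed

text \<open>The errors \<open>A\<close> and the stochastic increments need not have second moments,
  so the recursion is run with truncated versions. It starts at 0 and coincides with
  \<open>X - euler\<close> off \<open>G1\<close> and \<open>G2\<close>. The Gronwall bound for its
  second moment and the second-moment inequality then give a bound in probability.\<close>

lemma euler_error:
  fixes V :: "real \<Rightarrow> 'a \<Rightarrow> real" and H :: "'a simple_integrand" and X :: "nat \<Rightarrow> 'a \<Rightarrow> real" and \<mu> \<sigma> :: real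
  assumes H: "is_simple_integrand F t H" and V: "\<And>u. t \<le> u \<Longrightarrow> V u \<in> borel_measurable (F u)" and \<kappa>: "0 < \<kappa>"
    and X: "\<And>i. X i \<in> borel_measurable (F (sg i))" and X0: "\<And>\<omega>. \<omega> \<in> space M \<Longrightarrow> X 0 \<omega> = x"
      and VX: "\<And>i \<omega>. V (sg i) \<omega> = \<sigma> * c i * X i \<omega>"
    and c: "\<And>i. \<bar>c i\<bar> \<le> b" and \<delta>: "\<delta> > 0"
  defines "A \<equiv> \<lambda>i \<omega>. X (Suc i) \<omega> - X i \<omega> * (1 + \<mu> * c i * hs)
    - (simple_integral W H (sg (Suc i)) \<omega> - simple_integral W H (sg i) \<omega>)"
    and "C \<equiv> gronwall_const (r - t) \<mu> \<sigma> b"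
  assumes G1: "G1 \<in> sets P" "\<And>\<omega>. \<omega> \<in> space M \<Longrightarrow> \<omega> \<notin> G1 \<Longrightarrow>
    (LINT s:{t..r}|lborel. (simple_value H s \<omega> - V (fl s) \<omega>)\<^sup>2) \<le> \<kappa>"
    and G2: "G2 \<in> sets P" "\<And>\<omega>. \<omega> \<in> space M \<Longrightarrow> \<omega> \<notin> G2 \<Longrightarrow> (\<Sum>i<K. (A i \<omega>)\<^sup>2) \<le> \<kappa> * hs"
  shows "prob {\<omega> \<in> space P. \<delta> < \<bar>X K \<omega> - euler \<mu> \<sigma> c x K \<omega>\<bar>}
    \<le> prob G1 + prob G2 + exp (C * (r - t)) * (C * (2 * \<kappa>)) / \<delta>\<^sup>2"
proof -
  obtain Bt where Bt: "\<And>i. i < K \<Longrightarrow> Bt i \<in> borel_measurable (F (sg (Suc i)))"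
    "\<And>i. i < K \<Longrightarrow> integrable P (\<lambda>\<omega>. (Bt i \<omega>)\<^sup>2)"
    "\<And>i U. i < K \<Longrightarrow> U \<in> borel_measurable (F (sg i)) \<Longrightarrow> integrable P (\<lambda>\<omega>. (U \<omega>)\<^sup>2) \<Longrightarrow>
      integrable P (\<lambda>\<omega>. U \<omega> * Bt i \<omega>) \<and> (\<integral>\<omega>. U \<omega> * Bt i \<omega> \<partial>P) = 0"
    "(\<Sum>i<K. \<integral>\<omega>. (Bt i \<omega>)\<^sup>2 \<partial>P) \<le> \<kappa>"
    "\<And>i \<omega>. i < K \<Longrightarrow> (LINT s:{t..r}|lborel. (simple_value H s \<omega> - V (fl s) \<omega>)\<^sup>2) \<le> \<kappa> \<Longrightarrow>
       Bt i \<omega> = simple_integral W H (sg (Suc i)) \<omega> - simple_integral W H (sg i) \<omega> - V (sg i) \<omega> * (W (sg (Suc i)) \<omega> -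
         W (sg i) \<omega>)"
    using truncated_increments[OF H V \<kappa>] by blast
  have h: "hs > 0" by (rule hs_pos)
  have sgl: "sg i \<le> sg (Suc i)" for i using h by (simp add: sg_Suc)
  have s0: "0 \<le> sg i" for i using sg_ge[of i] t0 by simp
  have Am: "A i \<in> borel_measurable (F (sg (Suc i)))" for i
    unfolding A_def using X[of "Suc i"] F_meas_mono[OF X sgl] simple_integral_meas[OF H t0 sg_ge] F_meas_mono[OF
      simple_integral_meas[OF H t0 sg_ge] sgl]
    by (intro borel_measurable_diff borel_measurable_times borel_measurable_const)
  define At where "At i \<omega> = (if (\<Sum>l\<le>i. (A l \<omega>)\<^sup>2) \<le> \<kappa> * hs then A i \<omega> else 0)" for i \<omega>
  have Atm: "At i \<in> borel_measurable (F (sg (Suc i)))" for i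
  proof -
    have "A l \<in> borel_measurable (F (sg (Suc i)))" if "l \<le> i" for l
      using F_meas_mono[OF Am monoD[OF sg_mono, of "Suc l" "Suc i"]] that by simp
    then have "(\<lambda>\<omega>. \<Sum>l\<le>i. (A l \<omega>)\<^sup>2) \<in> borel_measurable (F (sg (Suc i)))"
      by (intro borel_measurable_sum borel_measurable_power) auto
    then show ?thesis unfolding At_def[abs_def] using Am[of i] by measurable
  qed
  have Atb: "(At i \<omega>)\<^sup>2 \<le> \<kappa> * hs" for i \<omega>
  proof (cases "(\<Sum>l\<le>i. (A l \<omega>)\<^sup>2) \<le> \<kappa> * hs")
    case True
    have "(A i \<omega>)\<^sup>2 \<le> (\<Sum>l\<le>i. (A l \<omega>)\<^sup>2)" by (intro member_le_sum) auto
    then show ?thesis using True unfolding At_def by simp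
  next
    case False
    then show ?thesis unfolding At_def using \<kappa> h by simp
  qed
  have Ati: "integrable P (\<lambda>\<omega>. (At i \<omega>)\<^sup>2)" for i
    using Atb F_meas_P[OF Atm] by (intro integrable_const_bound[where B = "\<kappa> * hs"]) auto
  have At_sum: "(\<Sum>i<K. \<integral>\<omega>. (At i \<omega>)\<^sup>2 \<partial>P) \<le> \<kappa> * hs"
  proof -
    have "(\<Sum>i<K. (At i \<omega>)\<^sup>2) \<le> \<kappa> * hs" for \<omega>
    proof -
      have "(\<Sum>i<K. (At i \<omega>)\<^sup>2) = (\<Sum>i<K. if (\<Sum>l\<le>i. (A l \<omega>)\<^sup>2) \<le> \<kappa> * hs then (A i \<omega>)\<^sup>2 else 0)"
        unfolding At_def by (intro sum.cong) auto
      then show ?thesis using truncated_sum_le[of "\<lambda>l. (A l \<omega>)\<^sup>2" "\<kappa> * hs" K] \<kappa> h by simp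
    qed
    then have "(\<integral>\<omega>. (\<Sum>i<K. (At i \<omega>)\<^sup>2) \<partial>P) \<le> (\<integral>\<omega>. \<kappa> * hs \<partial>P)" using Ati by (intro integral_mono) auto
    then show ?thesis using Ati prob_space by simp
  qed
  define Dt where "Dt = rec_nat (\<lambda>_. 0 :: real) (\<lambda>i D \<omega>. D \<omega> * (1 + \<mu> * c i * hs
    + \<sigma> * c i * (W (sg (Suc i)) \<omega> - W (sg i) \<omega>)) + At i \<omega> + Bt i \<omega>)"
  have Dt0: "Dt 0 = (\<lambda>_. 0)" and DtS: "Dt (Suc i)
    = (\<lambda>\<omega>. Dt i \<omega> * (1 + \<mu> * c i * hs + \<sigma> * c i * (W (sg (Suc i)) \<omega> - W (sg i) \<omega>)) + At i \<omega> + Bt i \<omega>)" for i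
    unfolding Dt_def by simp_all
  have Dtm: "Dt i \<in> borel_measurable (F (sg i))" if "i \<le> K" for i
    using that
  proof (induction i)
    case 0
    then show ?case unfolding Dt0 by simp
  next
    case (Suc i)
    have "W (sg i) \<in> borel_measurable (F (sg (Suc i)))" "W (sg (Suc i)) \<in> borel_measurable (F (sg (Suc i)))"
      using W_meas_F s0 sgl by auto
    then show ?case unfolding DtS using F_meas_mono[OF Suc.IH sgl] Atm Bt(1) Suc.prems
      by (intro borel_measurable_times borel_measurable_add borel_measurable_diff borel_measurable_const) auto
  qed
  have Dti: "integrable P (\<lambda>\<omega>. (Dt i \<omega>)\<^sup>2)" if "i \<le> K" for i
    using that
  proof (induction i)
    case 0
    then show ?case unfolding Dt0 by simp
  next
    case (Suc i)
    then show ?case unfolding DtS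
      by (intro gronwall_step(1)[where b = b] Dtm F_meas_P[OF Atm] F_meas_P[OF Bt(1)] Ati Bt(2) Bt(3)[THEN conjunct1]
        Bt(3)[THEN conjunct2] c) auto
  qed
  define f where "f i = (\<integral>\<omega>. (Dt i \<omega>)\<^sup>2 \<partial>P)" for i
  define \<beta> where "\<beta> i = (if i < K then (\<integral>\<omega>. (Bt i \<omega>)\<^sup>2 \<partial>P) + (\<integral>\<omega>. (At i \<omega>)\<^sup>2 \<partial>P) / hs else 0)" for i
  have C0: "0 \<le> C" unfolding C_def gronwall_const_def using tr by (intro add_nonneg_nonneg mult_nonneg_nonneg) auto
  have "f K \<le> exp (C * hs * real K) * (C * (\<Sum>i<K. \<beta> i))"
  proof (rule discrete_gronwall[where K = K])
    show "f 0 = 0" unfolding f_def Dt0 by simp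
    show "0 \<le> \<beta> i" for i unfolding \<beta>_def using h by simp
    show "f (Suc i) \<le> (1 + C * hs) * f i + C * \<beta> i" if i: "i < K" for i
    proof -
      have "f (Suc i) \<le> (1 + C * hs) * f i + C * ((\<integral>\<omega>. (Bt i \<omega>)\<^sup>2 \<partial>P) + (\<integral>\<omega>. (At i \<omega>)\<^sup>2 \<partial>P) / hs)"
        unfolding f_def DtS C_def
        by (intro gronwall_step(2) Dtm Dti F_meas_P[OF Atm] F_meas_P[OF Bt(1)] Ati Bt(2) Bt(3)[THEN conjunct1]
          Bt(3)[THEN conjunct2] c) (use i in auto)
      then show ?thesis unfolding \<beta>_def using i by simp
    qed
  qed (use C0 h in auto)
  also have "hs * real K = r - t" unfolding hs_def using K by simp
  then have "exp (C * hs * real K) = exp (C * (r - t))" by (simp add: mult.assoc)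
  also have "(\<Sum>i<K. \<beta> i) \<le> 2 * \<kappa>"
  proof -
    have "(\<Sum>i<K. \<beta> i) = (\<Sum>i<K. \<integral>\<omega>. (Bt i \<omega>)\<^sup>2 \<partial>P) + (\<Sum>i<K. \<integral>\<omega>. (At i \<omega>)\<^sup>2 \<partial>P) / hs"
      unfolding \<beta>_def by (simp add: sum.distrib sum_divide_distrib)
    moreover have "(\<Sum>i<K. \<integral>\<omega>. (At i \<omega>)\<^sup>2 \<partial>P) / hs \<le> \<kappa>" using At_sum h by (simp add: field_simps)
    ultimately show ?thesis using Bt(4) by linarith
  qed
  finally have fK: "f K \<le> exp (C * (r - t)) * (C * (2 * \<kappa>))" using C0 by (simp add: mult_left_mono)
  have eq: "X i \<omega> - euler \<mu> \<sigma> c x i \<omega> = Dt i \<omega>" if w: "\<omega> \<in> space M" "\<omega> \<notin> G1" "\<omega> \<notin> G2" and i: "i \<le> K" for \<omega> i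
    using i
  proof (induction i)
    case 0
    then show ?case unfolding Dt0 using X0[OF w(1)] by simp
  next
    case (Suc i)
    then have i: "i < K" by simp
    have IH: "euler \<mu> \<sigma> c x i \<omega> = X i \<omega> - Dt i \<omega>" using Suc by simp
    have "(\<Sum>l\<le>i. (A l \<omega>)\<^sup>2) \<le> \<kappa> * hs" by (rule truncated_eq[where n = K]) (use G2(2) w i in auto)
    then have At: "At i \<omega> = A i \<omega>" unfolding At_def by simp
    have B: "Bt i \<omega> = simple_integral W H (sg (Suc i)) \<omega> - simple_integral W H (sg i) \<omega>
      - V (sg i) \<omega> * (W (sg (Suc i)) \<omega> - W (sg i) \<omega>)"
      by (rule Bt(5)[OF i]) (use G1(2) w in auto)
    show ?case unfolding DtS At B VX A_def euler.simps IH by (simp add: algebra_simps)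
  qed
  have m1: "X K \<in> borel_measurable P" "euler \<mu> \<sigma> c x K \<in> borel_measurable P" "Dt K \<in> borel_measurable P"
    using F_meas_P[OF X] F_meas_P[OF euler_meas] F_meas_P[OF Dtm] by auto
  note [measurable] = m1
  have "prob {\<omega> \<in> space P. \<delta> < \<bar>X K \<omega> - euler \<mu> \<sigma> c x K \<omega>\<bar>} \<le> prob ((G1 \<union> G2) \<union> {\<omega> \<in> space P. \<delta> < \<bar>Dt K \<omega>\<bar>})"
  proof (rule finite_measure_mono)
    show "(G1 \<union> G2) \<union> {\<omega> \<in> space P. \<delta> < \<bar>Dt K \<omega>\<bar>} \<in> events"
      by (intro sets.Un G1(1) G2(1)) measurable
  qed (use eq[OF _ _ _ order_refl] in auto)
  also have "\<dots> \<le> prob (G1 \<union> G2) + prob {\<omega> \<in> space P. \<delta> < \<bar>Dt K \<omega>\<bar>}"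
    by (rule measure_Un_le) (intro sets.Un G1(1) G2(1), measurable)
  also have "prob (G1 \<union> G2) \<le> prob G1 + prob G2" by (rule measure_Un_le[OF G1(1) G2(1)])
  also have "prob {\<omega> \<in> space P. \<delta> < \<bar>Dt K \<omega>\<bar>} \<le> f K / \<delta>\<^sup>2" unfolding f_def
    by (rule prob_gt_le_second_moment[OF Dti m1(3) \<delta>]) simp
  also have "f K / \<delta>\<^sup>2 \<le> exp (C * (r - t)) * (C * (2 * \<kappa>)) / \<delta>\<^sup>2" using fK \<delta> by (intro divide_right_mono) auto
  finally show ?thesis by simp
qed

end

section \<open>Error estimates for an arbitrary solution\<close>

text \<open>Cauchy-Schwarz in variance form: the integral of \<open>(g s - m)\<^sup>2\<close> is
  nonnegative, with \<open>m\<close> the mean of \<open>g\<close> over the interval.\<close>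

lemma sq_integral_le:
  fixes g :: "real \<Rightarrow> real"
  assumes ab: "a < b" and g: "set_integrable lborel {a<..b} g" "set_integrable lborel {a<..b} (\<lambda>s. (g s)\<^sup>2)"
  shows "(LINT s:{a<..b}|lborel. g s)\<^sup>2 \<le> (b - a) * (LINT s:{a<..b}|lborel. (g s)\<^sup>2)"
proof -
  define D where "D = (LINT s:{a<..b}|lborel. g s)"
  define m where "m = D / (b - a)"
  have c: "set_integrable lborel {a<..b} (\<lambda>s. m\<^sup>2)" "(LINT s:{a<..b}|lborel. m\<^sup>2) = (b - a) * m\<^sup>2"
    using ab by (auto simp: set_integrable_def set_lebesgue_integral_def)
  have e: "(g s - m)\<^sup>2 = (g s)\<^sup>2 - 2 * m * g s + m\<^sup>2" for s by (simp add: power2_eq_square algebra_simps)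
  have "0 \<le> (LINT s:{a<..b}|lborel. (g s - m)\<^sup>2)"
    unfolding set_lebesgue_integral_def by (intro integral_nonneg_AE) auto
  also have "\<dots> = (LINT s:{a<..b}|lborel. (g s)\<^sup>2) - 2 * m * D + (b - a) * m\<^sup>2"
    unfolding e D_def using g c
      by (subst set_integral_add | subst set_integral_diff | simp add: set_integrable_mult_right)+
  also have "2 * m * D = 2 * D\<^sup>2 / (b - a)" unfolding m_def by (simp add: power2_eq_square)
  also have "(b - a) * m\<^sup>2 = D\<^sup>2 / (b - a)" unfolding m_def using ab by (simp add: power2_eq_square)
  finally have "D\<^sup>2 / (b - a) \<le> (LINT s:{a<..b}|lborel. (g s)\<^sup>2)" by simp
  then show ?thesis using ab unfolding D_def by (simp add: field_simps)
qed

definition cfun :: "real \<Rightarrow> real \<Rightarrow> real \<Rightarrow> real \<Rightarrow> real" where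
  "cfun te \<eta> \<theta> s = (if s < te then \<eta> else \<theta>)"

lemma cfun_meas [measurable]: "cfun te \<eta> \<theta> \<in> borel_measurable borel"
  unfolding cfun_def[abs_def] by measurable

lemma cfun_bound: "\<bar>cfun te \<eta> \<theta> s\<bar> \<le> max \<bar>\<eta>\<bar> \<bar>\<theta>\<bar>"
  unfolding cfun_def by auto

text \<open>A solution together with its integral \<open>I\<close> and the simple integrands
  \<open>H\<close> that witness it. The drift is expressed through the volatility integrand, so that
  one process controls both discretisation errors.\<close>

locale ito_wealth = brownian M W for M :: "'w measure" and W +
  fixes t x :: real and X I :: "real \<Rightarrow> 'w \<Rightarrow> real" and H :: "nat \<Rightarrow> 'w simple_integrand" and \<mu> \<sigma> \<eta> \<theta> te :: real
  assumes t0: "0 \<le> t" and \<sigma>: "\<sigma> > 0" and \<mu>: "\<mu> > 0"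
    and Xc: "\<And>\<omega>. \<omega> \<in> space M \<Longrightarrow> continuous_on {t..} (\<lambda>r. X r \<omega>)"
    and Xm: "\<And>r. t \<le> r \<Longrightarrow> X r \<in> borel_measurable (F r)"
    and Xt: "\<And>\<omega>. \<omega> \<in> space M \<Longrightarrow> X t \<omega> = x"
    and Hs: "\<And>j. is_simple_integrand F t (H j)"
    and HL: "\<And>T. t \<le> T \<Longrightarrow> tends_in_prob P (\<lambda>j \<omega>. LINT s:{t..T}|lborel. (simple_value (H j) s \<omega>
      - \<sigma> * cfun te \<eta> \<theta> s * X s \<omega>)\<^sup>2) (\<lambda>_. 0)"
    and HI: "\<And>r. t \<le> r \<Longrightarrow> tends_in_prob P (\<lambda>j. simple_integral W (H j) r) (I r)"
    and Im: "\<And>r. t \<le> r \<Longrightarrow> I r \<in> borel_measurable (F r)"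
    and Xeq: "\<And>r. t \<le> r \<Longrightarrow> AE \<omega> in P. X r \<omega> = x + \<mu> / \<sigma> * (LINT s:{t..r}|lborel. \<sigma> * cfun te \<eta> \<theta> s * X s \<omega>) + I r \<omega>"
begin

definition Y :: "real \<Rightarrow> 'w \<Rightarrow> real" where "Y s \<omega> = \<sigma> * cfun te \<eta> \<theta> s * X s \<omega>"
definition cb :: real where "cb = max \<bar>\<eta>\<bar> \<bar>\<theta>\<bar>"

lemma Y_meas: "t \<le> s \<Longrightarrow> Y s \<in> borel_measurable (F s)"
  unfolding Y_def[abs_def] using Xm by (intro borel_measurable_times borel_measurable_const)

lemma Y_bdd:
  assumes w: "\<omega> \<in> space M"
  obtains B where "B > 0" "\<And>s. t \<le> s \<Longrightarrow> s \<le> r \<Longrightarrow> \<bar>Y s \<omega>\<bar> \<le> B"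
proof -
  have "continuous_on {t..r} (\<lambda>s. X s \<omega>)" using Xc[OF w] by (rule continuous_on_subset) auto
  then have "bounded ((\<lambda>s. X s \<omega>) ` {t..r})" using compact_continuous_image compact_imp_bounded by blast
  then obtain B where B: "\<forall>s\<in>{t..r}. \<bar>X s \<omega>\<bar> \<le> B" unfolding bounded_iff by auto
  have "\<bar>Y s \<omega>\<bar> \<le> \<sigma> * cb * \<bar>B\<bar> + 1" if "t \<le> s" "s \<le> r" for s
  proof -
    have "\<bar>\<sigma>\<bar> * \<bar>cfun te \<eta> \<theta> s\<bar> * \<bar>X s \<omega>\<bar> \<le> \<sigma> * cb * \<bar>B\<bar>"
      using cfun_bound[of te \<eta> \<theta> s] B that \<sigma> unfolding cb_def
        by (intro mult_mono) (auto intro: order_trans[OF _ abs_ge_self])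
    then show ?thesis unfolding Y_def abs_mult by simp
  qed
  moreover have "0 \<le> \<sigma> * cb * \<bar>B\<bar>" using \<sigma> unfolding cb_def by (intro mult_nonneg_nonneg) auto
  ultimately show thesis by (intro that[of "\<sigma> * cb * \<bar>B\<bar> + 1"]) auto
qed

lemma Y_path: "\<omega> \<in> space M \<Longrightarrow> (\<lambda>s. indicator {t..r} s * Y s \<omega>) \<in> borel_measurable borel"
proof -
  assume w: "\<omega> \<in> space M"
  have "(\<lambda>s. indicator {t..r} s *\<^sub>R X s \<omega>) \<in> borel_measurable borel"
    by (rule borel_measurable_continuous_on_indicator) (use Xc[OF w] in \<open>auto intro: continuous_on_subset\<close>)
  then have "(\<lambda>s. \<sigma> * cfun te \<eta> \<theta> s * (indicator {t..r} s *\<^sub>R X s \<omega>)) \<in> borel_measurable borel" by measurable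
  then show ?thesis unfolding Y_def by (simp add: mult_ac)
qed

lemma bounded_set_integrable:
  fixes f :: "real \<Rightarrow> real"
  assumes m: "(\<lambda>s. indicator {t..r} s * f s) \<in> borel_measurable borel" and b: "\<And>s. t \<le> s \<Longrightarrow> s \<le> r \<Longrightarrow> \<bar>f s\<bar> \<le> B"
  shows "set_integrable lborel {t..r} f"
proof -
  have "integrable lborel (indicator {t..r} :: real \<Rightarrow> real)"
    by (rule integrable_real_indicator) (auto simp: emeasure_lborel_Icc_eq)
  then have i: "integrable lborel (\<lambda>s. indicator {t..r} s * B)" by (intro integrable_mult_left)
  have "\<bar>indicator {t..r} s * f s\<bar> \<le> indicator {t..r} s * B" for s using b[of s] by (auto split: split_indicator)
  then show ?thesis unfolding set_integrable_def using m
    by (intro Bochner_Integration.integrable_bound[OF i]) (auto intro!: AE_I2 order_trans[OF _ abs_ge_self])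
qed

lemma Y_joint: "t \<le> r \<Longrightarrow> (\<lambda>(s, \<omega>). Y s \<omega>) \<in> borel_measurable (restrict_space borel {t..r} \<Otimes>\<^sub>M P)"
proof -
  assume r: "t \<le> r"
  have X: "(\<lambda>(s, \<omega>). X s \<omega>) \<in> borel_measurable (restrict_space borel {t..r} \<Otimes>\<^sub>M P)"
    by (rule continuous_progressive) (use Xc F_meas_P[OF Xm] r in auto)
  have c: "(\<lambda>z. cfun te \<eta> \<theta> (fst z)) \<in> borel_measurable (restrict_space borel {t..r} \<Otimes>\<^sub>M P)"
    by (rule measurable_compose[OF measurable_fst]) (rule measurable_restrict_space1, simp)
  have "(\<lambda>z. \<sigma> * cfun te \<eta> \<theta> (fst z) * (case z of (s, \<omega>) \<Rightarrow> X s \<omega>))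
    \<in> borel_measurable (restrict_space borel {t..r} \<Otimes>\<^sub>M P)"
    using X c by measurable
  then show ?thesis unfolding Y_def by (simp add: case_prod_beta')
qed

end

locale ito_wealth_grid = ito_wealth M W t x X I H \<mu> \<sigma> \<eta> \<theta> te + coarse_grid M W t r K
  for M :: "'w measure" and W t x X I H \<mu> \<sigma> \<eta> \<theta> te r K
begin

lemma Yfl_joint: "(\<lambda>(s, \<omega>). Y (fl s) \<omega>) \<in> borel_measurable (restrict_space borel {t..r} \<Otimes>\<^sub>M P)"
proof -
  have "(\<lambda>z. Y (sg (nat \<lfloor>(fst z - t) / hs\<rfloor>)) (snd z)) \<in> borel_measurable (restrict_space borel {t..r} \<Otimes>\<^sub>M P)"
  proof (rule measurable_compose_countable'[where f = "\<lambda>k z. Y (sg k) (snd z)" and g = "\<lambda>z. nat \<lfloor>(fst z - t) / hs\<rfloor>"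
    and I = UNIV])
    show "(\<lambda>z. Y (sg k) (snd z)) \<in> borel_measurable (restrict_space borel {t..r} \<Otimes>\<^sub>M P)" for k
      by (rule measurable_compose[OF measurable_snd F_meas_P[OF Y_meas[OF sg_ge]]])
    have [measurable]: "fst \<in> measurable (restrict_space borel {t..r} \<Otimes>\<^sub>M P) (borel :: real measure)"
      by (rule measurable_compose[OF measurable_fst]) (rule measurable_restrict_space1, simp)
    show "(\<lambda>z. nat \<lfloor>(fst z - t) / hs\<rfloor>) \<in> measurable (restrict_space borel {t..r} \<Otimes>\<^sub>M P) (count_space UNIV)"
      by measurable
  qed auto
  then show ?thesis unfolding fl_def by (simp add: case_prod_beta')
qed

lemma Yfl_path: "(\<lambda>s. Y (fl s) \<omega>) \<in> borel_measurable borel"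
  unfolding fl_def
  by (rule measurable_compose[of "\<lambda>s. nat \<lfloor>(s - t) / hs\<rfloor>" borel "count_space UNIV" "\<lambda>k. Y (sg k) \<omega>"]) auto

text \<open>The error of freezing the integrand at the left grid points. It depends on the grid but
  not on the choice of simple integrand; the quantity \<open>Rj\<close> below is the complementary
  error.\<close>

definition Tm :: "'w \<Rightarrow> real" where "Tm \<omega> = (LINT s:{t..r}|lborel. (Y s \<omega> - Y (fl s) \<omega>)\<^sup>2)"

lemma Tm_meas: "Tm \<in> borel_measurable P"
proof -
  have "(\<lambda>z. ((case z of (s, \<omega>) \<Rightarrow> Y s \<omega>) - (case z of (s, \<omega>) \<Rightarrow> Y (fl s) \<omega>))\<^sup>2)
    \<in> borel_measurable (restrict_space borel {t..r} \<Otimes>\<^sub>M P)"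
    using Y_joint[OF less_imp_le[OF tr]] Yfl_joint by measurable
  then show ?thesis unfolding Tm_def[abs_def] by (intro restrict_measurable_LINT) (simp add: case_prod_beta')
qed

definition Rj :: "nat \<Rightarrow> 'w \<Rightarrow> real" where "Rj j \<omega> = (LINT s:{t..r}|lborel. (simple_value (H j) s \<omega> - Y s \<omega>)\<^sup>2)"

lemma simple_value_joint: "(\<lambda>(s, \<omega>). simple_value (H j) s \<omega>) \<in> borel_measurable (restrict_space borel {t..r} \<Otimes>\<^sub>M P)"
  and sv_path: "(\<lambda>s. simple_value (H j) s \<omega>) \<in> borel_measurable borel"
  and sv_bdd: "\<exists>B. \<forall>s. \<bar>simple_value (H j) s \<omega>\<bar> \<le> B"
proof -
  obtain n p \<xi> where Heq: "H j = (n, p, \<xi>)" by (cases "H j") auto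
  have \<xi>: "\<And>i. i < n \<Longrightarrow> \<xi> i \<in> borel_measurable (F (p i))"
    using Hs[of j] unfolding is_simple_integrand_def Heq by auto
  have 1: "(\<lambda>z. \<xi> i (snd z)) \<in> borel_measurable (restrict_space borel {t..r} \<Otimes>\<^sub>M P)" if "i < n" for i
    by (rule measurable_compose[OF measurable_snd F_meas_P[OF \<xi>[OF that]]])
  have 2: "(\<lambda>z. indicator {p i<..p (Suc i)} (fst z) :: real) \<in> borel_measurable (restrict_space borel {t..r} \<Otimes>\<^sub>M P)"
    for i
    by (rule measurable_compose[OF measurable_fst]) (rule measurable_restrict_space1, simp)
  have "(\<lambda>z. \<Sum>i<n. \<xi> i (snd z) * indicator {p i<..p (Suc i)} (fst z))
    \<in> borel_measurable (restrict_space borel {t..r} \<Otimes>\<^sub>M P)"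
    using 1 2 by (intro borel_measurable_sum borel_measurable_times) auto
  then show "(\<lambda>(s, \<omega>). simple_value (H j) s \<omega>) \<in> borel_measurable (restrict_space borel {t..r} \<Otimes>\<^sub>M P)"
    unfolding simple_value_def Heq by (simp add: case_prod_beta')
  show "(\<lambda>s. simple_value (H j) s \<omega>) \<in> borel_measurable borel"
    unfolding simple_value_def Heq by (simp only: prod.case) measurable
  have "\<bar>simple_value (H j) s \<omega>\<bar> \<le> (\<Sum>i<n. \<bar>\<xi> i \<omega>\<bar>)" for s
    unfolding simple_value_def Heq prod.case
    by (rule order_trans[OF sum_abs]) (intro sum_mono, auto simp: abs_mult indicator_def)
  then show "\<exists>B. \<forall>s. \<bar>simple_value (H j) s \<omega>\<bar> \<le> B" by blast
qed

lemma Rj_meas: "Rj j \<in> borel_measurable P"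
proof -
  have "(\<lambda>z. ((case z of (s, \<omega>) \<Rightarrow> simple_value (H j) s \<omega>) - (case z of (s, \<omega>) \<Rightarrow> Y s \<omega>))\<^sup>2)
    \<in> borel_measurable (restrict_space borel {t..r} \<Otimes>\<^sub>M P)"
    using Y_joint[OF less_imp_le[OF tr]] simple_value_joint[of j] by measurable
  then show ?thesis unfolding Rj_def[abs_def] by (intro restrict_measurable_LINT) (simp add: case_prod_beta')
qed

lemma sum_square_le_double: "(p + q)\<^sup>2 \<le> 2 * p\<^sup>2 + 2 * (q\<^sup>2 :: real)"
proof -
  have "0 \<le> (p - q)\<^sup>2" by simp
  then show ?thesis by (simp add: power2_eq_square algebra_simps)
qed

lemma path_integrable:
  assumes w: "\<omega> \<in> space M"
  shows "set_integrable lborel {t..r} (\<lambda>s. Y s \<omega>)" "set_integrable lborel {t..r} (\<lambda>s. Y (fl s) \<omega>)"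
    "set_integrable lborel {t..r} (\<lambda>s. (Y s \<omega> - Y (fl s) \<omega>)\<^sup>2)"
      "set_integrable lborel {t..r} (\<lambda>s. (simple_value (H j) s \<omega> - Y s \<omega>)\<^sup>2)"
proof -
  obtain B where B: "B > 0" "\<And>s. t \<le> s \<Longrightarrow> s \<le> r \<Longrightarrow> \<bar>Y s \<omega>\<bar> \<le> B" using Y_bdd[OF w] by blast
  obtain B' where B': "\<And>s. \<bar>simple_value (H j) s \<omega>\<bar> \<le> B'" using sv_bdd by blast
  have Bf: "\<bar>Y (fl s) \<omega>\<bar> \<le> B" if "t \<le> s" "s \<le> r" for s using fl_bounds[OF that(1)] that by (intro B(2)) auto
  note [measurable] = Y_path[OF w, of r] Yfl_path[of \<omega>] sv_path[of j \<omega>]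
  show "set_integrable lborel {t..r} (\<lambda>s. Y s \<omega>)" by (rule bounded_set_integrable[OF _ B(2)]) simp_all
  show "set_integrable lborel {t..r} (\<lambda>s. Y (fl s) \<omega>)" by (rule bounded_set_integrable[OF _ Bf]) simp_all
  have sq: "\<bar>(p - q)\<^sup>2\<bar> \<le> (C + D)\<^sup>2" if "\<bar>p\<bar> \<le> C" "\<bar>q\<bar> \<le> D" for p q C D :: real
    using that by (simp add: abs_le_square_iff[symmetric])
  have e1: "(\<lambda>s. indicator {t..r} s * (Y s \<omega> - Y (fl s) \<omega>)\<^sup>2)
    = (\<lambda>s. (indicator {t..r} s * Y s \<omega> - indicator {t..r} s * Y (fl s) \<omega>)\<^sup>2)"
    by (auto split: split_indicator)
  show "set_integrable lborel {t..r} (\<lambda>s. (Y s \<omega> - Y (fl s) \<omega>)\<^sup>2)"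
  proof (rule bounded_set_integrable[where B = "(B + B)\<^sup>2"])
    show "(\<lambda>s. indicator {t..r} s * (Y s \<omega> - Y (fl s) \<omega>)\<^sup>2) \<in> borel_measurable borel" unfolding e1 by measurable
  qed (use sq B Bf in blast)
  have e2: "(\<lambda>s. indicator {t..r} s * (simple_value (H j) s \<omega> - Y s \<omega>)\<^sup>2)
    = (\<lambda>s. (indicator {t..r} s * simple_value (H j) s \<omega> - indicator {t..r} s * Y s \<omega>)\<^sup>2)"
    by (auto split: split_indicator)
  show "set_integrable lborel {t..r} (\<lambda>s. (simple_value (H j) s \<omega> - Y s \<omega>)\<^sup>2)"
  proof (rule bounded_set_integrable[where B = "(B' + B)\<^sup>2"])
    show "(\<lambda>s. indicator {t..r} s * (simple_value (H j) s \<omega> - Y s \<omega>)\<^sup>2) \<in> borel_measurable borel" unfolding e2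
      by measurable
  qed (use sq B B' in blast)
qed

lemma grid_integrand_error:
  assumes w: "\<omega> \<in> space M"
  shows "(LINT s:{t..r}|lborel. (simple_value (H j) s \<omega> - Y (fl s) \<omega>)\<^sup>2) \<le> 2 * Rj j \<omega> + 2 * Tm \<omega>"
proof -
  note i = path_integrable(3)[OF w] path_integrable(4)[OF w, of j]
  have "(LINT s:{t..r}|lborel. (simple_value (H j) s \<omega> - Y (fl s) \<omega>)\<^sup>2)
    \<le> (LINT s:{t..r}|lborel. 2 * (simple_value (H j) s \<omega> - Y s \<omega>)\<^sup>2 + 2 * (Y s \<omega> - Y (fl s) \<omega>)\<^sup>2)"
    unfolding set_lebesgue_integral_def
  proof (rule integral_mono')
    show "integrable lborel (\<lambda>s. indicator {t..r} s *\<^sub>R (2 * (simple_value (H j) s \<omega> - Y s \<omega>)\<^sup>2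
      + 2 * (Y s \<omega> - Y (fl s) \<omega>)\<^sup>2))"
      using set_integral_add(1)[OF set_integrable_mult_right[OF i(2), of 2] set_integrable_mult_right[OF i(1), of 2]]
        unfolding set_integrable_def .
    show "indicator {t..r} s *\<^sub>R (simple_value (H j) s \<omega> - Y (fl s) \<omega>)\<^sup>2
      \<le> indicator {t..r} s *\<^sub>R (2 * (simple_value (H j) s \<omega> - Y s \<omega>)\<^sup>2 + 2 * (Y s \<omega> - Y (fl s) \<omega>)\<^sup>2)" for s
      using sum_square_le_double[of "simple_value (H j) s \<omega> - Y s \<omega>" "Y s \<omega> - Y (fl s) \<omega>"]
        by (auto split: split_indicator)
  qed (auto split: split_indicator)
  also have "\<dots> = 2 * Rj j \<omega> + 2 * Tm \<omega>"
    unfolding Rj_def Tm_def using set_integral_add(2)[OF set_integrable_mult_right[OF i(2), of 2]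
      set_integrable_mult_right[OF i(1), of 2]] by simp
  finally show ?thesis .
qed

definition Di :: "nat \<Rightarrow> 'w \<Rightarrow> real" where
  "Di i \<omega> = (LINT s:{sg i<..sg (Suc i)}|lborel. Y s \<omega> - Y (fl s) \<omega>)"

text \<open>Cauchy-Schwarz on each cell gains a factor \<open>hs\<close>, which compensates the
  factor \<open>1 / hs\<close> paid for drift errors in the Gronwall step.\<close>

lemma Di_sum:
  assumes w: "\<omega> \<in> space M"
  shows "(\<Sum>i<K. (Di i \<omega>)\<^sup>2) \<le> hs * Tm \<omega>"
proof -
  define g where "g s = Y s \<omega> - Y (fl s) \<omega>" for s
  have g: "set_integrable lborel {t..r} g" "set_integrable lborel {t..r} (\<lambda>s. (g s)\<^sup>2)"
    unfolding g_def[abs_def] using path_integrable[OF w] by (auto intro: set_integral_diff(1))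
  have sub: "{sg i<..sg (Suc i)} \<subseteq> {t..r}" if "i < K" for i using sg_ge[of i] sg_le[of "Suc i"] that by auto
  have gi: "set_integrable lborel {sg i<..sg (Suc i)} g" "set_integrable lborel {sg i<..sg (Suc i)} (\<lambda>s. (g s)\<^sup>2)"
    if "i < K" for i
    using sub[OF that] by (auto intro: set_integrable_subset[OF g(1)] set_integrable_subset[OF g(2)])
  have "(\<Sum>i<K. (Di i \<omega>)\<^sup>2) \<le> (\<Sum>i<K. hs * (LINT s:{sg i<..sg (Suc i)}|lborel. (g s)\<^sup>2))"
  proof (rule sum_mono)
    fix i assume "i \<in> {..<K}"
    then show "(Di i \<omega>)\<^sup>2 \<le> hs * (LINT s:{sg i<..sg (Suc i)}|lborel. (g s)\<^sup>2)"
      using sq_integral_le[of "sg i" "sg (Suc i)" g] gi[of i] hs_pos unfolding Di_def g_def[symmetric]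
        by (simp add: sg_Suc)
  qed
  also have "\<dots> = hs * (LINT s|lborel. (\<Sum>i<K. indicator {sg i<..sg (Suc i)} s *\<^sub>R (g s)\<^sup>2))"
    using gi(2) unfolding set_lebesgue_integral_def set_integrable_def sum_distrib_left[symmetric]
    by (subst Bochner_Integration.integral_sum) auto
  also have "(LINT s|lborel. (\<Sum>i<K. indicator {sg i<..sg (Suc i)} s *\<^sub>R (g s)\<^sup>2)) \<le> Tm \<omega>"
    unfolding Tm_def g_def[symmetric] set_lebesgue_integral_def
  proof (rule integral_mono')
    show "integrable lborel (\<lambda>s. indicator {t..r} s *\<^sub>R (g s)\<^sup>2)" using g(2) unfolding set_integrable_def .
    show "0 \<le> indicator {t..r} s *\<^sub>R (g s)\<^sup>2" for s by simp
    fix s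
    have "(\<Sum>i<K. indicator {sg i<..sg (Suc i)} s :: real) = real (card {i. i < K \<and> s \<in> {sg i<..sg (Suc i)}})"
    proof -
      have "(\<Sum>i<K. indicator {sg i<..sg (Suc i)} s :: real) = (\<Sum>i\<in>{i. i < K \<and> s \<in> {sg i<..sg (Suc i)}}. 1)"
        by (rule sum.mono_neutral_cong_right) auto
      then show ?thesis by simp
    qed
    moreover have "card {i. i < K \<and> s \<in> {sg i<..sg (Suc i)}} \<le> (if s \<in> {t..r} then 1 else 0)"
    proof -
      \<comment> \<open>The half-open cells are disjoint, so their indicators sum to at most the
        indicator of \<open>[t, r]\<close>.\<close>
      have u: "i = j" if "s \<in> {sg i<..sg (Suc i)}" "s \<in> {sg j<..sg (Suc j)}" for i j
      proof (rule ccontr)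
        assume "i \<noteq> j"
        then consider "Suc i \<le> j" | "Suc j \<le> i" by linarith
        then show False using that monoD[OF sg_mono, of "Suc i" j] monoD[OF sg_mono, of "Suc j" i] by cases auto
      qed
      show ?thesis
      proof (cases "\<exists>i<K. s \<in> {sg i<..sg (Suc i)}")
        case True
        then obtain i where i: "i < K" "s \<in> {sg i<..sg (Suc i)}" by blast
        then have "{i. i < K \<and> s \<in> {sg i<..sg (Suc i)}} = {i}" using u by blast
        moreover have "s \<in> {t..r}" using sub[OF i(1)] i(2) by blast
        ultimately show ?thesis by simp
      next
        case False
        then have e: "{i. i < K \<and> s \<in> {sg i<..sg (Suc i)}} = {}" by blast
        show ?thesis unfolding e by simp
      qed
    qed
    ultimately have "(\<Sum>i<K. indicator {sg i<..sg (Suc i)} s) \<le> (indicator {t..r} s :: real)"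
      by (auto split: split_indicator if_splits)
    from mult_right_mono[OF this, of "(g s)\<^sup>2"]
    show "(\<Sum>i<K. indicator {sg i<..sg (Suc i)} s *\<^sub>R (g s)\<^sup>2) \<le> indicator {t..r} s *\<^sub>R (g s)\<^sup>2"
      by (simp add: sum_distrib_right)
  qed
  finally show ?thesis using hs_pos by (simp add: mult_left_mono)
qed

lemma cell_integral:
  assumes w: "\<omega> \<in> space M" and i: "i < K"
  shows "(LINT s:{t..sg (Suc i)}|lborel. Y s \<omega>) - (LINT s:{t..sg i}|lborel. Y s \<omega>) = Di i \<omega> + hs * Y (sg i) \<omega>"
proof -
  have le: "t \<le> sg i" "sg i \<le> sg (Suc i)" "sg (Suc i) \<le> r" using sg_ge sg_le[of "Suc i"] i hs_pos
    by (auto simp: sg_Suc)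
  have int: "set_integrable lborel A (\<lambda>s. Y s \<omega>)" "set_integrable lborel A (\<lambda>s. Y (fl s) \<omega>)"
    if "A \<subseteq> {t..r}" "A \<in> sets lborel" for A
    using that by (auto intro: set_integrable_subset[OF path_integrable(1)[OF w]] set_integrable_subset[OF
      path_integrable(2)[OF w]])
  have "{t..sg (Suc i)} = {t..sg i} \<union> {sg i<..sg (Suc i)}" using le by auto
  then have "(LINT s:{t..sg (Suc i)}|lborel. Y s \<omega>)
    = (LINT s:{t..sg i}|lborel. Y s \<omega>) + (LINT s:{sg i<..sg (Suc i)}|lborel. Y s \<omega>)"
    using le by (simp only:) (rule set_integral_Un, auto intro!: int)
  moreover have "Di i \<omega> = (LINT s:{sg i<..sg (Suc i)}|lborel. Y s \<omega>)
    - (LINT s:{sg i<..sg (Suc i)}|lborel. Y (fl s) \<omega>)"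
    unfolding Di_def using le by (intro set_integral_diff(2) int) auto
  moreover have "(LINT s:{sg i<..sg (Suc i)}|lborel. Y (fl s) \<omega>) = (LINT s:{sg i<..sg (Suc i)}|lborel. Y (sg i) \<omega>)"
    unfolding set_lebesgue_integral_def
  proof (rule integral_cong_AE)
    show "AE s in lborel. indicator {sg i<..sg (Suc i)} s *\<^sub>R Y (fl s) \<omega>
      = indicator {sg i<..sg (Suc i)} s *\<^sub>R Y (sg i) \<omega>"
      using AE_lborel_singleton[of "sg (Suc i)"]
    proof eventually_elim
      case (elim s)
      then show ?case using fl_eq[of i s] by (auto split: split_indicator)
    qed
  qed (use Yfl_path[of \<omega>] in \<open>simp_all\<close>)
  moreover have "(LINT s:{sg i<..sg (Suc i)}|lborel. Y (sg i) \<omega>) = hs * Y (sg i) \<omega>"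
    using hs_pos unfolding set_lebesgue_integral_def by (simp add: sg_Suc)
  ultimately show ?thesis by simp
qed

text \<open>For a fixed grid the simple integrands are refined: as \<open>j\<close> tends to
  infinity, the events for \<open>Rj\<close> and for the finitely many differences between simple
  integrals and \<open>I\<close> lose their probability. Only the event for \<open>Tm\<close>
  remains, counted twice because it belongs to both exceptional sets.\<close>

lemma grid_error:
  assumes \<delta>: "\<delta> > 0" and \<kappa>: "\<kappa> > 0"
  defines "C \<equiv> gronwall_const (r - t) \<mu> \<sigma> cb" and "\<kappa>T \<equiv> min (\<kappa> / 4) (\<kappa> / (4 * (\<mu> / \<sigma>)\<^sup>2))"
  shows "prob {\<omega> \<in> space P. \<delta> < \<bar>X r \<omega> - euler \<mu> \<sigma> (\<lambda>i. cfun te \<eta> \<theta> (sg i)) x K \<omega>\<bar>}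
    \<le> 2 * prob {\<omega> \<in> space P. \<kappa>T < Tm \<omega>} + exp (C * (r - t)) * (C * (2 * \<kappa>)) / \<delta>\<^sup>2"
proof -
  \<comment> \<open>Chosen so that \<open>K\<close> terms \<open>8 * \<rho>\<^sup>2\<close> make up
    half of \<open>\<kappa> * hs\<close>; the other half is left to the drift errors and is met by
    the second entry of \<open>\<kappa>T\<close>.\<close>
  define \<rho> where "\<rho> = sqrt (\<kappa> * hs / (16 * real K))"
  have \<rho>: "\<rho> > 0" "\<rho>\<^sup>2 = \<kappa> * hs / (16 * real K)" unfolding \<rho>_def using \<kappa> hs_pos K by auto
  define c where "c i = cfun te \<eta> \<theta> (sg i)" for i
  define GT where "GT = {\<omega> \<in> space P. \<kappa>T < Tm \<omega>}"
  define GR where "GR j = {\<omega> \<in> space P. \<kappa> / 4 < \<bar>Rj j \<omega> - 0\<bar>}" for j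
  define GI where "GI j i = {\<omega> \<in> space P. \<rho> < \<bar>simple_integral W (H j) (sg i) \<omega> - I (sg i) \<omega>\<bar>}" for j i
  define N where "N = {\<omega> \<in> space M. \<not> (\<forall>i. X (sg i) \<omega> = x + \<mu> / \<sigma> * (LINT s:{t..sg i}|lborel. Y s \<omega>) + I (sg i) \<omega>)}"
  have "AE \<omega> in P. \<forall>i. X (sg i) \<omega> = x + \<mu> / \<sigma> * (LINT s:{t..sg i}|lborel. Y s \<omega>) + I (sg i) \<omega>"
    unfolding AE_all_countable Y_def using Xeq[OF sg_ge] by blast
  then have N: "N \<in> null_sets P" unfolding N_def using AE_null by blast
  note [measurable] = Tm_meas Rj_meas
  have GT: "GT \<in> sets P" unfolding GT_def by measurable
  have GR: "GR j \<in> sets P" for j unfolding GR_def by measurable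
  have GI: "GI j i \<in> sets P" for j i
  proof -
    have [measurable]: "simple_integral W (H j) (sg i) \<in> borel_measurable P" "I (sg i) \<in> borel_measurable P"
      using F_meas_P[OF simple_integral_meas[OF Hs t0 sg_ge]] F_meas_P[OF Im[OF sg_ge]] by auto
    show ?thesis unfolding GI_def by measurable
  qed
  have bnd: "prob {\<omega> \<in> space P. \<delta> < \<bar>X r \<omega> - euler \<mu> \<sigma> c x K \<omega>\<bar>}
    \<le> (prob GT + prob (GR j)) + (prob GT + (\<Sum>i\<le>K. prob (GI j i))) + exp (C * (r - t)) * (C * (2 * \<kappa>)) / \<delta>\<^sup>2" for j
  proof -
    define J where "J i \<omega> = simple_integral W (H j) (sg i) \<omega>" for i \<omega>
    define G1 where "G1 = GT \<union> GR j"
    define G2 where "G2 = (GT \<union> (\<Union>i\<le>K. GI j i)) \<union> N"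
    have "prob {\<omega> \<in> space P. \<delta> < \<bar>X (sg K) \<omega> - euler \<mu> \<sigma> c x K \<omega>\<bar>}
      \<le> prob G1 + prob G2 + exp (C * (r - t)) * (C * (2 * \<kappa>)) / \<delta>\<^sup>2"
      unfolding C_def
    proof (rule euler_error[where V = Y and H = "H j" and X = "\<lambda>i. X (sg i)" and \<kappa> = \<kappa>])
      show "is_simple_integrand F t (H j)" by (rule Hs)
      show "Y u \<in> borel_measurable (F u)" if "t \<le> u" for u using Y_meas[OF that] .
      show "X (sg i) \<in> borel_measurable (F (sg i))" for i using Xm[OF sg_ge] .
      show "X (sg 0) \<omega> = x" if "\<omega> \<in> space M" for \<omega> using Xt[OF that] by simp
      show "Y (sg i) \<omega> = \<sigma> * c i * X (sg i) \<omega>" for i \<omega> unfolding Y_def c_def ..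
      show "\<bar>c i\<bar> \<le> cb" for i unfolding c_def cb_def by (rule cfun_bound)
      show "G1 \<in> events" unfolding G1_def using GT GR by auto
      show "G2 \<in> events" unfolding G2_def using GT GI N by auto
      fix \<omega> assume w: "\<omega> \<in> space M"
      show "(LINT s:{t..r}|lborel. (simple_value (H j) s \<omega> - Y (fl s) \<omega>)\<^sup>2) \<le> \<kappa>" if "\<omega> \<notin> G1"
      proof -
        have "Tm \<omega> \<le> \<kappa> / 4" "Rj j \<omega> \<le> \<kappa> / 4" using that w unfolding G1_def GT_def GR_def \<kappa>T_def by auto
        then show ?thesis using grid_integrand_error[OF w, of j] by linarith
      qed
      show "(\<Sum>i<K. (X (sg (Suc i)) \<omega> - X (sg i) \<omega> * (1 + \<mu> * c i * hs)
        - (simple_integral W (H j) (sg (Suc i)) \<omega> - simple_integral W (H j) (sg i) \<omega>))\<^sup>2) \<le> \<kappa> * hs"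
        if n: "\<omega> \<notin> G2"
      proof -
        have eq: "X (sg i) \<omega> = x + \<mu> / \<sigma> * (LINT s:{t..sg i}|lborel. Y s \<omega>) + I (sg i) \<omega>" for i
          using n w unfolding G2_def N_def by auto
        have T: "Tm \<omega> \<le> \<kappa> / (4 * (\<mu> / \<sigma>)\<^sup>2)" using n w unfolding G2_def GT_def \<kappa>T_def by auto
        have dJ: "\<bar>J i \<omega> - I (sg i) \<omega>\<bar> \<le> \<rho>" if "i \<le> K" for i
          using n w that unfolding G2_def GI_def J_def by (auto simp: not_less)
        have A: "X (sg (Suc i)) \<omega> - X (sg i) \<omega> * (1 + \<mu> * c i * hs) - (J (Suc i) \<omega> - J i \<omega>)
          = \<mu> / \<sigma> * Di i \<omega> + ((I (sg (Suc i)) \<omega> - J (Suc i) \<omega>) - (I (sg i) \<omega> - J i \<omega>))" if i: "i < K" for i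
        proof -
          have "X (sg (Suc i)) \<omega> - X (sg i) \<omega> = \<mu> / \<sigma> * ((LINT s:{t..sg (Suc i)}|lborel. Y s \<omega>)
            - (LINT s:{t..sg i}|lborel. Y s \<omega>)) + (I (sg (Suc i)) \<omega> - I (sg i) \<omega>)"
            unfolding eq[of "Suc i"] eq[of i] by (simp add: right_diff_distrib)
          also have "\<dots> = \<mu> / \<sigma> * Di i \<omega> + \<mu> / \<sigma> * (hs * Y (sg i) \<omega>) + (I (sg (Suc i)) \<omega> - I (sg i) \<omega>)"
            unfolding cell_integral[OF w i] by (simp add: distrib_left)
          also have "\<mu> / \<sigma> * (hs * Y (sg i) \<omega>) = X (sg i) \<omega> * (\<mu> * c i * hs)" unfolding Y_def c_def using \<sigma> by simp
          finally show ?thesis by (simp add: distrib_left)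
        qed
        have "(\<Sum>i<K. (X (sg (Suc i)) \<omega> - X (sg i) \<omega> * (1 + \<mu> * c i * hs) - (J (Suc i) \<omega> - J i \<omega>))\<^sup>2)
          \<le> (\<Sum>i<K. 2 * (\<mu> / \<sigma>)\<^sup>2 * (Di i \<omega>)\<^sup>2 + 8 * \<rho>\<^sup>2)"
        proof (rule sum_mono)
          fix i assume "i \<in> {..<K}"
          then have i: "i < K" by simp
          have "\<bar>(I (sg (Suc i)) \<omega> - J (Suc i) \<omega>) - (I (sg i) \<omega> - J i \<omega>)\<bar> \<le> 2 * \<rho>"
            using dJ[of i] dJ[of "Suc i"] i by linarith
          then have "((I (sg (Suc i)) \<omega> - J (Suc i) \<omega>) - (I (sg i) \<omega> - J i \<omega>))\<^sup>2 \<le> (2 * \<rho>)\<^sup>2"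
            by (subst abs_le_square_iff[symmetric]) (use \<rho>(1) in simp)
          then show "(X (sg (Suc i)) \<omega> - X (sg i) \<omega> * (1 + \<mu> * c i * hs) - (J (Suc i) \<omega> - J i \<omega>))\<^sup>2
            \<le> 2 * (\<mu> / \<sigma>)\<^sup>2 * (Di i \<omega>)\<^sup>2 + 8 * \<rho>\<^sup>2"
            unfolding A[OF i] using sum_square_le_double[of "\<mu> / \<sigma> * Di i \<omega>"
              "(I (sg (Suc i)) \<omega> - J (Suc i) \<omega>) - (I (sg i) \<omega> - J i \<omega>)"]
            by (simp add: power_mult_distrib power_divide)
        qed
        also have "\<dots> = 2 * (\<mu> / \<sigma>)\<^sup>2 * (\<Sum>i<K. (Di i \<omega>)\<^sup>2) + \<kappa> * hs / 2"
          using K unfolding \<rho>(2) by (simp add: sum.distrib sum_distrib_left)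
        also have "\<dots> \<le> 2 * (\<mu> / \<sigma>)\<^sup>2 * (hs * (\<kappa> / (4 * (\<mu> / \<sigma>)\<^sup>2))) + \<kappa> * hs / 2"
          using order_trans[OF Di_sum[OF w] mult_left_mono[OF T less_imp_le[OF hs_pos]]]
            by (intro add_right_mono mult_left_mono) auto
        also have "\<dots> = \<kappa> * hs" using \<mu> \<sigma> by simp
        finally show ?thesis unfolding J_def .
      qed
    qed (use \<kappa> \<delta> in auto)
    moreover have "prob G1 \<le> prob GT + prob (GR j)" unfolding G1_def by (rule measure_Un_le[OF GT GR])
    moreover have "prob G2 \<le> prob GT + (\<Sum>i\<le>K. prob (GI j i))"
    proof -
      have "prob G2 \<le> prob (GT \<union> (\<Union>i\<le>K. GI j i)) + prob N" unfolding G2_def using GT GI N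
        by (intro measure_Un_le) auto
      also have "prob N = 0" using N by (simp add: measure_eq_0_null_sets)
      also have "prob (GT \<union> (\<Union>i\<le>K. GI j i)) \<le> prob GT + prob (\<Union>i\<le>K. GI j i)" using GT GI by (intro measure_Un_le) auto
      also have "prob (\<Union>i\<le>K. GI j i) \<le> (\<Sum>i\<le>K. prob (GI j i))" using GI by (intro measure_UNION_le) auto
      finally show ?thesis by simp
    qed
    ultimately show ?thesis by simp
  qed
  have "(\<lambda>j. (prob GT + prob (GR j)) + (prob GT + (\<Sum>i\<le>K. prob (GI j i))) + exp (C * (r - t)) * (C * (2 * \<kappa>)) / \<delta>\<^sup>2)
    \<longlonglongrightarrow> (prob GT + 0) + (prob GT + (\<Sum>i\<le>K. 0)) + exp (C * (r - t)) * (C * (2 * \<kappa>)) / \<delta>\<^sup>2"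
  proof (intro tendsto_add tendsto_sum tendsto_const)
    have "tends_in_prob P Rj (\<lambda>_. 0)" using HL[OF less_imp_le[OF tr]] unfolding Rj_def[abs_def] Y_def .
    then show "(\<lambda>j. prob (GR j)) \<longlonglongrightarrow> 0" unfolding GR_def tends_in_prob_def
      by (elim allE[of _ "\<kappa> / 4"] impE) (use \<kappa> in simp)
    show "(\<lambda>j. prob (GI j i)) \<longlonglongrightarrow> 0" for i
      using HI[OF sg_ge[of i]] \<rho>(1) unfolding GI_def tends_in_prob_def by simp
  qed
  from LIMSEQ_le_const[OF this, of "prob {\<omega> \<in> space P. \<delta> < \<bar>X r \<omega> - euler \<mu> \<sigma> c x K \<omega>\<bar>}"] bnd
  show ?thesis unfolding c_def GT_def by auto
qed

end

section \<open>Refinement of the grid\<close>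

context ito_wealth
begin

lemma fl_lim:
  assumes tr: "t < r" and s: "t \<le> s"
  shows "(\<lambda>m. coarse_grid.fl t r (Suc m) s) \<longlonglongrightarrow> s"
proof (rule tendsto_sandwich)
  have b: "s - (r - t) / real (Suc m) \<le> coarse_grid.fl t r (Suc m) s \<and> coarse_grid.fl t r (Suc m) s \<le> s" for m
  proof -
    interpret g: coarse_grid M W t r "Suc m" by unfold_locales (use t0 tr in auto)
    show ?thesis using g.fl_bounds[OF s] unfolding g.hs_def by auto
  qed
  show "\<forall>\<^sub>F m in sequentially. s - (r - t) / real (Suc m) \<le> coarse_grid.fl t r (Suc m) s"
    "\<forall>\<^sub>F m in sequentially. coarse_grid.fl t r (Suc m) s \<le> s"
    using b by auto
  show "(\<lambda>m. s - (r - t) / real (Suc m)) \<longlonglongrightarrow> s" by real_asymp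
qed simp

text \<open>The wealth is continuous, so the integrand can jump only where the control switches;
  rounding down may stay on the wrong side of \<open>te\<close> only at \<open>te\<close>
  itself.\<close>

lemma Y_fl_lim:
  assumes tr: "t < r" and s: "t \<le> s" "s \<noteq> te" and w: "\<omega> \<in> space M"
  shows "(\<lambda>m. Y (coarse_grid.fl t r (Suc m) s) \<omega>) \<longlonglongrightarrow> Y s \<omega>"
proof -
  note l = fl_lim[OF tr s(1)]
  have ge: "t \<le> coarse_grid.fl t r (Suc m) s" for m
  proof -
    interpret g: coarse_grid M W t r "Suc m" by unfold_locales (use t0 tr in auto)
    show ?thesis using g.fl_bounds[OF s(1)] by simp
  qed
  have X: "(\<lambda>m. X (coarse_grid.fl t r (Suc m) s) \<omega>) \<longlonglongrightarrow> X s \<omega>"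
    using continuous_on_tendsto_compose[OF Xc[OF w] l] ge s by auto
  have "\<forall>\<^sub>F m in sequentially. cfun te \<eta> \<theta> (coarse_grid.fl t r (Suc m) s) = cfun te \<eta> \<theta> s"
  proof (cases "s < te")
    case True
    show ?thesis using order_tendstoD(2)[OF l True] by eventually_elim (use True in \<open>simp add: cfun_def\<close>)
  next
    case False
    then have gt: "te < s" using s by simp
    show ?thesis using order_tendstoD(1)[OF l gt] by eventually_elim (use gt in \<open>simp add: cfun_def\<close>)
  qed
  then have "(\<lambda>m. cfun te \<eta> \<theta> (coarse_grid.fl t r (Suc m) s)) \<longlonglongrightarrow> cfun te \<eta> \<theta> s" by (rule tendsto_eventually)
  then show ?thesis unfolding Y_def using X by (intro tendsto_mult tendsto_const)
qed

definition euler_end :: "real \<Rightarrow> nat \<Rightarrow> 'w \<Rightarrow> real" where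
  "euler_end r m = coarse_grid.euler W t r (Suc m) \<mu> \<sigma> (\<lambda>i. cfun te \<eta> \<theta> (coarse_grid.sg t r (Suc m) i)) x (Suc m)"

lemma euler_end_meas: "t < r \<Longrightarrow> euler_end r m \<in> borel_measurable P"
proof -
  assume tr: "t < r"
  interpret g: coarse_grid M W t r "Suc m" by unfold_locales (use t0 tr in auto)
  show ?thesis unfolding euler_end_def by (rule F_meas_P[OF g.euler_meas])
qed

lemma euler_lim:
  assumes tr: "t < r"
  shows "tends_in_prob P (\<lambda>m \<omega>. X r \<omega> - euler_end r m \<omega>) (\<lambda>_. 0)"
  unfolding tends_in_prob_def
proof (intro allI impI)
  fix \<delta> :: real assume \<delta>: "\<delta> > 0"
  define T where "T m \<omega> = (LINT s:{t..r}|lborel. (Y s \<omega> - Y (coarse_grid.fl t r (Suc m) s) \<omega>)\<^sup>2)" for m \<omega>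
  have Tm: "T m \<in> borel_measurable P" for m
  proof -
    interpret g: ito_wealth_grid M W t x X I H \<mu> \<sigma> \<eta> \<theta> te r "Suc m" by unfold_locales (use t0 tr in auto)
    show ?thesis using g.Tm_meas unfolding g.Tm_def[abs_def] T_def[abs_def] .
  qed
  have "tends_in_prob P T (\<lambda>_. 0)"
  proof (rule tends_in_prob_AE[OF Tm])
    show "AE \<omega> in P. (\<lambda>m. T m \<omega>) \<longlonglongrightarrow> 0"
    proof (rule AE_I2)
      fix \<omega> assume "\<omega> \<in> space P"
      then have w: "\<omega> \<in> space M" by simp
      obtain B where B: "B > 0" "\<And>s. t \<le> s \<Longrightarrow> s \<le> r \<Longrightarrow> \<bar>Y s \<omega>\<bar> \<le> B" using Y_bdd[OF w] by blast
      have "(\<lambda>m. LINT s|lborel. indicator {t..r} s *\<^sub>R (Y s \<omega> - Y (coarse_grid.fl t r (Suc m) s) \<omega>)\<^sup>2)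
        \<longlonglongrightarrow> (LINT s|(lborel :: real measure). (0::real))"
      proof (rule integral_dominated_convergence[where w = "\<lambda>s. indicator {t..r} s * (2 * B)\<^sup>2"])
        show "AE s in lborel. (\<lambda>m. indicator {t..r} s *\<^sub>R (Y s \<omega> - Y (coarse_grid.fl t r (Suc m) s) \<omega>)\<^sup>2) \<longlonglongrightarrow> 0"
          using AE_lborel_singleton[of te]
        proof eventually_elim
          case (elim s)
          show ?case
          proof (cases "s \<in> {t..r}")
            case True
            then have "(\<lambda>m. Y (coarse_grid.fl t r (Suc m) s) \<omega>) \<longlonglongrightarrow> Y s \<omega>" using Y_fl_lim[OF tr _ elim w] by simp
            from tendsto_power[OF tendsto_diff[OF tendsto_const[of "Y s \<omega>"] this], of 2] show ?thesis using True
              by simp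
          qed simp
        qed
        fix m
        interpret g: ito_wealth_grid M W t x X I H \<mu> \<sigma> \<eta> \<theta> te r "Suc m" by unfold_locales (use t0 tr in auto)
        show "(\<lambda>s. indicator {t..r} s *\<^sub>R (Y s \<omega> - Y (coarse_grid.fl t r (Suc m) s) \<omega>)\<^sup>2) \<in> borel_measurable lborel"
          using g.path_integrable(3)[OF w] unfolding set_integrable_def by (rule borel_measurable_integrable)
        show "AE s in lborel. norm (indicator {t..r} s *\<^sub>R (Y s \<omega> - Y (coarse_grid.fl t r (Suc m) s) \<omega>)\<^sup>2)
          \<le> indicator {t..r} s * (2 * B)\<^sup>2"
        proof (rule AE_I2)
          fix s
          have "(Y s \<omega> - Y (coarse_grid.fl t r (Suc m) s) \<omega>)\<^sup>2 \<le> (2 * B)\<^sup>2" if "s \<in> {t..r}"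
          proof -
            have "\<bar>Y s \<omega> - Y (coarse_grid.fl t r (Suc m) s) \<omega>\<bar> \<le> 2 * B"
              using B(2)[of s] B(2)[of "coarse_grid.fl t r (Suc m) s"] g.fl_bounds[of s] that by auto
            then show ?thesis using B by (subst abs_le_square_iff[symmetric]) auto
          qed
          then show "norm (indicator {t..r} s *\<^sub>R (Y s \<omega> - Y (coarse_grid.fl t r (Suc m) s) \<omega>)\<^sup>2)
            \<le> indicator {t..r} s * (2 * B)\<^sup>2"
            by (auto split: split_indicator)
        qed
      next
        have "integrable lborel (indicator {t..r} :: real \<Rightarrow> real)"
          by (rule integrable_real_indicator) (auto simp: emeasure_lborel_Icc_eq)
        then show "integrable lborel (\<lambda>s. indicator {t..r} s * (2 * B)\<^sup>2)" by (intro integrable_mult_left)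
      qed auto
      then show "(\<lambda>m. T m \<omega>) \<longlonglongrightarrow> 0" unfolding T_def set_lebesgue_integral_def by simp
    qed
  qed simp
  then have Tlim: "(\<lambda>m. prob {\<omega> \<in> space P. \<epsilon> < \<bar>T m \<omega>\<bar>}) \<longlonglongrightarrow> 0" if "\<epsilon> > 0" for \<epsilon> using that unfolding tends_in_prob_def
    by simp
  have Tnn: "0 \<le> T m \<omega>" for m \<omega> unfolding T_def set_lebesgue_integral_def by (intro integral_nonneg_AE) auto
  define C where "C = coarse_grid.gronwall_const (r - t) \<mu> \<sigma> cb"
  have Cpos: "C > 0"
  proof -
    interpret g: coarse_grid M W t r "Suc 0" by unfold_locales (use t0 tr in auto)
    show ?thesis unfolding C_def g.gronwall_const_def using tr
      by (intro add_nonneg_pos add_nonneg_nonneg mult_nonneg_nonneg) auto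
  qed
  show "(\<lambda>m. prob {\<omega> \<in> space P. \<delta> < \<bar>X r \<omega> - euler_end r m \<omega> - 0\<bar>}) \<longlonglongrightarrow> 0"
  proof (rule LIMSEQ_I)
    fix e :: real assume e: "e > 0"
    \<comment> \<open>Makes the Gronwall contribution equal to \<open>e / 2\<close>. The mesh is
      refined only afterwards, until the event for \<open>T\<close> has probability below
      \<open>e / 4\<close>, which enters twice.\<close>
    define \<kappa> where "\<kappa> = e * \<delta>\<^sup>2 / (4 * (exp (C * (r - t)) * C))"
    have \<kappa>: "\<kappa> > 0" unfolding \<kappa>_def using e \<delta> Cpos by simp
    define \<kappa>T where "\<kappa>T = min (\<kappa> / 4) (\<kappa> / (4 * (\<mu> / \<sigma>)\<^sup>2))"
    have \<kappa>T: "\<kappa>T > 0" unfolding \<kappa>T_def using \<kappa> \<mu> \<sigma> by simp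
    have last: "exp (C * (r - t)) * (C * (2 * \<kappa>)) / \<delta>\<^sup>2 = e / 2" unfolding \<kappa>_def using \<delta> Cpos
      by (simp add: field_simps)
    obtain m0 where m0: "\<And>m. m \<ge> m0 \<Longrightarrow> prob {\<omega> \<in> space P. \<kappa>T < \<bar>T m \<omega>\<bar>} < e / 4"
      using order_tendstoD(2)[OF Tlim[OF \<kappa>T], of "e / 4"] e unfolding eventually_sequentially by auto
    have "norm (prob {\<omega> \<in> space P. \<delta> < \<bar>X r \<omega> - euler_end r m \<omega> - 0\<bar>} - 0) < e" if "m \<ge> m0" for m
    proof -
      interpret g: ito_wealth_grid M W t x X I H \<mu> \<sigma> \<eta> \<theta> te r "Suc m" by unfold_locales (use t0 tr in auto)
      have "prob {\<omega> \<in> space P. \<delta> < \<bar>X r \<omega> - euler_end r m \<omega>\<bar>} \<le> 2 * prob {\<omega> \<in> space P. \<kappa>T < T m \<omega>} + e / 2"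
        using g.grid_error[OF \<delta> \<kappa>] unfolding last[symmetric] euler_end_def \<kappa>T_def C_def g.Tm_def T_def .
      moreover have "prob {\<omega> \<in> space P. \<kappa>T < T m \<omega>} < e / 4" using m0[OF that] Tnn by simp
      ultimately show ?thesis by simp
    qed
    then show "\<exists>m0. \<forall>m\<ge>m0. norm (prob {\<omega> \<in> space P. \<delta> < \<bar>X r \<omega> - euler_end r m \<omega> - 0\<bar>} - 0) < e" by blast
  qed
qed

end

text \<open>Both solutions are approximated in probability by the same Euler values, so their
  difference is 0 in probability and hence almost surely at the given time.\<close>

lemma (in brownian) wealth_unique:
  assumes 1: "ito_wealth M W t x X I H \<mu> \<sigma> \<eta> \<theta> te" and 2: "ito_wealth M W t x X' I' H' \<mu> \<sigma> \<eta> \<theta> te" and r: "t \<le> r"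
  shows "AE \<omega> in P. X r \<omega> = X' r \<omega>"
proof (cases "t = r")
  case True
  show ?thesis by (rule AE_I2) (use ito_wealth.Xt[OF 1] ito_wealth.Xt[OF 2] True in auto)
next
  case False
  then have tr: "t < r" using r by simp
  interpret a: ito_wealth M W t x X I H \<mu> \<sigma> \<eta> \<theta> te by (rule 1)
  interpret b: ito_wealth M W t x X' I' H' \<mu> \<sigma> \<eta> \<theta> te by (rule 2)
  have m: "X r \<in> borel_measurable P" "X' r \<in> borel_measurable P"
    using F_meas_P[OF a.Xm[OF r]] F_meas_P[OF b.Xm[OF r]] by auto
  note [measurable] = m
  have me: "a.euler_end r n \<in> borel_measurable P" for n by (rule a.euler_end_meas[OF tr])
  \<comment> \<open>The Euler values of the two interpretations are the same function, since their
    definition mentions neither the solution nor its integral.\<close>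
  have neg: "tends_in_prob P (\<lambda>n \<omega>. a.euler_end r n \<omega> - X' r \<omega>) (\<lambda>_. 0)"
    using b.euler_lim[OF tr] unfolding tends_in_prob_def by (simp add: abs_minus_commute)
  have "tends_in_prob P (\<lambda>n \<omega>. (X r \<omega> - a.euler_end r n \<omega>) + (a.euler_end r n \<omega> - X' r \<omega>)) (\<lambda>\<omega>. 0 + 0)"
    by (rule tends_in_prob_add[OF _ _ _ _ a.euler_lim[OF tr] neg]) (use m me in auto)
  then have "tends_in_prob P (\<lambda>n \<omega>. X r \<omega> - X' r \<omega>) (\<lambda>_. 0)" by simp
  then have z: "prob {\<omega> \<in> space P. \<delta> < \<bar>X r \<omega> - X' r \<omega>\<bar>} = 0" if "\<delta> > 0" for \<delta>
    using that unfolding tends_in_prob_def by (simp add: LIMSEQ_const_iff)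
  have "AE \<omega> in P. \<not> 1 / real (Suc n) < \<bar>X r \<omega> - X' r \<omega>\<bar>" for n
  proof (rule AE_I[where N = "{\<omega> \<in> space P. 1 / real (Suc n) < \<bar>X r \<omega> - X' r \<omega>\<bar>}"])
    show "{\<omega> \<in> space P. 1 / real (Suc n) < \<bar>X r \<omega> - X' r \<omega>\<bar>} \<in> sets P" by measurable
    show "emeasure P {\<omega> \<in> space P. 1 / real (Suc n) < \<bar>X r \<omega> - X' r \<omega>\<bar>} = 0"
      using z[of "1 / real (Suc n)"] unfolding emeasure_eq_measure by simp
  qed auto
  then have "AE \<omega> in P. \<forall>n. \<not> 1 / real (Suc n) < \<bar>X r \<omega> - X' r \<omega>\<bar>" unfolding AE_all_countable by blast
  then show ?thesis
  proof eventually_elim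
    case (elim \<omega>)
    show ?case
    proof (rule ccontr)
      assume "X r \<omega> \<noteq> X' r \<omega>"
      then obtain n :: nat where "1 / real (Suc n) < \<bar>X r \<omega> - X' r \<omega>\<bar>" using nat_approx_posE[of "\<bar>X r \<omega> - X' r \<omega>\<bar>"]
        by auto
      then show False using elim by blast
    qed
  qed
qed

section \<open>Identification of the selected wealth process\<close>

lemma (in brownian) is_wealth_ito_wealth:
  assumes w: "is_wealth M W \<mu> \<sigma> t x u X" and t: "0 \<le> t" and p: "\<mu> > 0" "\<sigma> > 0"
    and u: "\<And>s y. t \<le> s \<Longrightarrow> u s y = cfun te \<eta> \<theta> s"
  shows "\<exists>I H. ito_wealth M W t x X I H \<mu> \<sigma> \<eta> \<theta> te"
proof -
  obtain I where I: "is_ito_integral M W t (\<lambda>s \<omega>. \<sigma> * u s (X s \<omega>) * X s \<omega>) I"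
    "\<And>r. t \<le> r \<Longrightarrow> AE \<omega> in M. X r \<omega> = x + (LINT s:{t..r}|lborel. \<mu> * u s (X s \<omega>) * X s \<omega>) + I r \<omega>"
    using w unfolding is_wealth_def by blast
  have "is_ito_integral M W t (\<lambda>s \<omega>. \<sigma> * cfun te \<eta> \<theta> s * X s \<omega>) I"
    by (rule is_ito_integral_cong[THEN iffD1, OF _ I(1)]) (simp add: u)
  then obtain H where H: "\<And>j. is_simple_integrand F t (H j)"
    "\<And>T. t \<le> T \<Longrightarrow> tends_in_prob P (\<lambda>j \<omega>. LINT s:{t..T}|lborel. (simple_value (H j) s \<omega>
      - \<sigma> * cfun te \<eta> \<theta> s * X s \<omega>)\<^sup>2) (\<lambda>_. 0)"
    "\<And>r. t \<le> r \<Longrightarrow> tends_in_prob P (\<lambda>j. simple_integral W (H j) r) (I r)"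
    and Im: "\<And>r. t \<le> r \<Longrightarrow> I r \<in> borel_measurable (F r)"
    unfolding is_ito_integral_def Let_def by blast
  have "ito_wealth M W t x X I H \<mu> \<sigma> \<eta> \<theta> te"
  proof (unfold_locales)
    show "AE \<omega> in P. X r \<omega> = x + \<mu> / \<sigma> * (LINT s:{t..r}|lborel. \<sigma> * cfun te \<eta> \<theta> s * X s \<omega>) + I r \<omega>" if r: "t \<le> r"
      for r
    proof -
      have "(LINT s:{t..r}|lborel. \<mu> * u s (X s \<omega>) * X s \<omega>)
        = \<mu> / \<sigma> * (LINT s:{t..r}|lborel. \<sigma> * cfun te \<eta> \<theta> s * X s \<omega>)" for \<omega>
      proof -
        have "(LINT s:{t..r}|lborel. \<mu> * u s (X s \<omega>) * X s \<omega>)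
          = (LINT s:{t..r}|lborel. \<mu> / \<sigma> * (\<sigma> * cfun te \<eta> \<theta> s * X s \<omega>))"
          by (rule set_lebesgue_integral_cong) (use u p in auto)
        then show ?thesis by (simp only: set_integral_mult_right)
      qed
      then show ?thesis using AE_completion[OF I(2)[OF r]] by simp
    qed
  qed (use t p H Im w[unfolded is_wealth_def] in auto)
  then show ?thesis by blast
qed

text \<open>Existence makes the indefinite choice a genuine solution, and uniqueness identifies it
  with the explicit process. Almost sure equality at each fixed time is enough; continuity and
  positivity of the chosen paths come from the definition of a wealth process.\<close>

lemma (in brownian) wealth_gbm_path:
  assumes t: "0 \<le> t" "t < te" and x: "0 < x" and p: "\<mu> > 0" "\<sigma> > 0" "\<eta> > 0" "\<theta> > 0"
    and u: "\<And>s y. t \<le> s \<Longrightarrow> u s y = cfun te \<eta> \<theta> s"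
  shows "gbm_path M W t x (wealth M W \<mu> \<sigma> t x u) \<mu> \<sigma> \<eta> \<theta> te"
proof -
  obtain G where G: "gbm_path M W t x G \<mu> \<sigma> \<eta> \<theta> te" using gbm_exists[OF t(1) less_imp_le[OF t(2)] x] by blast
  interpret g: gbm_sol M W t x G \<mu> \<sigma> \<eta> \<theta> te
    by (rule gbm_sol.intro[OF G]) (unfold_locales, use t p in auto)
  have wG: "is_wealth M W \<mu> \<sigma> t x u G" by (rule g.is_wealth_X) (simp add: u cfun_def g.cf_def)
  define X where "X = wealth M W \<mu> \<sigma> t x u"
  have wX: "is_wealth M W \<mu> \<sigma> t x u X" unfolding X_def wealth_def by (rule someI[of "is_wealth M W \<mu> \<sigma> t x u", OF wG])
  obtain I H where 1: "ito_wealth M W t x X I H \<mu> \<sigma> \<eta> \<theta> te" using is_wealth_ito_wealth[OF wX t(1) p(1,2) u] by blast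
  obtain I' H' where 2: "ito_wealth M W t x G I' H' \<mu> \<sigma> \<eta> \<theta> te" using is_wealth_ito_wealth[OF wG t(1) p(1,2) u]
    by blast
  have "gbm_path M W t x X \<mu> \<sigma> \<eta> \<theta> te"
  proof (unfold_locales)
    show "AE \<omega> in P. X r \<omega> = gbm \<mu> \<sigma> \<eta> \<theta> t te x r \<omega>" if r: "t \<le> r" for r
      using wealth_unique[OF 1 2 r] g.XG[OF r] by eventually_elim simp
  qed (use t wX[unfolded is_wealth_def] in auto)
  then show ?thesis unfolding X_def .
qed

section \<open>Equilibrium\<close>

text \<open>Here \<open>z\<close> is wealth in units of the threshold \<open>b\<close>,
  \<open>p\<close> is \<open>a * b\<close>, and \<open>1 - e\<close> is the reward at
  \<open>b\<close>. Both sides agree at 1, so slopes are compared: \<open>ln u \<le> u - 1\<close>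
  and \<open>p \<ge> 1 - \<alpha>\<close> order the decaying factors, and the second part of
  \<open>e\<close> is smooth fit in the form \<open>e * p \<le> (1 - e) * \<alpha>\<close>.\<close>

lemma power_majorant:
  fixes \<alpha> p e z :: real
  assumes al: "0 < \<alpha>" "\<alpha> < 1" and p: "1 - \<alpha> \<le> p" and e: "0 \<le> e" "e * (p + \<alpha>) \<le> \<alpha>" and z: "1 \<le> z"
  shows "1 - e * exp (- p * (z - 1)) \<le> (1 - e) * z powr \<alpha>"
proof -
  define g where "g z = (1 - e) * z powr \<alpha> + e * exp (- p * (z - 1))" for z :: real
  have "g 1 \<le> g z"
  proof (rule DERIV_nonneg_imp_nondecreasing[OF z])
    fix u :: real assume u: "1 \<le> u" "u \<le> z"
    have "(g has_real_derivative (1 - e) * (\<alpha> * u powr (\<alpha> - 1)) - e * p * exp (- p * (u - 1))) (at u)"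
      unfolding g_def[abs_def] using u by (auto intro!: derivative_eq_intros)
    moreover have "e * p * exp (- p * (u - 1)) \<le> (1 - e) * (\<alpha> * u powr (\<alpha> - 1))"
    proof -
      have "(1 - \<alpha>) * ln u \<le> p * (u - 1)"
        using ln_le_minus_one[of u] u al p by (intro mult_mono) auto
      then have "exp (- p * (u - 1)) \<le> exp ((\<alpha> - 1) * ln u)" by (simp add: algebra_simps)
      also have "\<dots> = u powr (\<alpha> - 1)" using u by (simp add: powr_def)
      finally have ex: "exp (- p * (u - 1)) \<le> u powr (\<alpha> - 1)" .
      have ep: "e * p \<le> (1 - e) * \<alpha>" using e by (simp add: algebra_simps)
      have "0 \<le> (1 - e) * \<alpha>" using ep mult_nonneg_nonneg[of e p] e p al by linarith
      from mult_mono[OF ep ex this]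
      have "e * p * exp (- p * (u - 1)) \<le> (1 - e) * \<alpha> * u powr (\<alpha> - 1)" by simp
      then show ?thesis by (simp add: mult.assoc)
    qed
    ultimately show "\<exists>D. (g has_real_derivative D) (at u) \<and> 0 \<le> D" by (intro exI conjI) (assumption, simp)
  qed
  then show ?thesis unfolding g_def by simp
qed

text \<open>The Lagrange remainder of order four is nonnegative for either sign of
  \<open>w\<close>.\<close>

lemma exp_ge_cubic: "1 - w + w\<^sup>2 / 2 - w ^ 3 / 6 \<le> exp (- w)" for w :: real
proof -
  obtain s where "exp (- w) = (\<Sum>m<4. (- w) ^ m / fact m) + exp s / fact 4 * (- w) ^ 4"
    using Maclaurin_exp_le[of "- w" 4] by blast
  then have "exp (- w) = 1 - w + w\<^sup>2 / 2 - w ^ 3 / 6 + exp s / fact 4 * w ^ 4"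
    by (simp add: eval_nat_numeral fact_numeral lessThan_Suc)
  then show ?thesis by simp
qed

text \<open>Where \<open>f\<close> is not integrable, its Bochner integral is \<open>0\<close>; hence the sign conditions below.\<close>

lemma lebesgue_integral_le_of_nn:
  assumes "\<And>\<omega>. \<omega> \<in> space M \<Longrightarrow> f \<omega> \<le> g \<omega>" and g: "(\<integral>\<^sup>+\<omega>. ennreal (g \<omega>) \<partial>M) \<le> ennreal c" and c: "0 \<le> c"
  shows "(\<integral>\<omega>. f \<omega> \<partial>M) \<le> c"
proof (cases "integrable M f")
  case True
  have "(\<integral>\<^sup>+\<omega>. ennreal (f \<omega>) \<partial>M) \<le> ennreal c"
    using g by (rule order_trans[rotated]) (intro nn_integral_mono ennreal_leI assms(1))
  then have "enn2real (\<integral>\<^sup>+\<omega>. ennreal (f \<omega>) \<partial>M) \<le> c" using c by (rule enn2real_leI[rotated])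
  then show ?thesis unfolding real_lebesgue_integral_def[OF True] using enn2real_nonneg[of "\<integral>\<^sup>+\<omega>. ennreal (- f \<omega>) \<partial>M"]
    by linarith
qed (simp add: c not_integrable_integral_eq)

lemma lebesgue_integral_le_of_integrable:
  fixes f g :: "'b \<Rightarrow> real"
  assumes "\<And>\<omega>. \<omega> \<in> space M \<Longrightarrow> f \<omega> \<le> g \<omega>" "integrable M g" "0 \<le> (\<integral>\<omega>. g \<omega> \<partial>M)"
  shows "(\<integral>\<omega>. f \<omega> \<partial>M) \<le> (\<integral>\<omega>. g \<omega> \<partial>M)"
proof (cases "integrable M f")
  case True
  then show ?thesis using assms by (intro integral_mono) auto
qed (use assms in \<open>simp add: not_integrable_integral_eq\<close>)

lemma Limsup_right_le_0:
  assumes "\<And>\<epsilon>. \<epsilon> > 0 \<Longrightarrow> d \<epsilon> \<le> (0::real)"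
  shows "Limsup (at_right 0) (\<lambda>\<epsilon>. ereal (d \<epsilon> / \<epsilon>)) \<le> 0"
proof (rule Limsup_bounded)
  show "\<forall>\<^sub>F \<epsilon> in at_right 0. ereal (d \<epsilon> / \<epsilon>) \<le> 0"
    using eventually_at_right_less[of 0] by eventually_elim (use assms in \<open>simp add: divide_nonpos_pos\<close>)
qed

lemma Limsup_right_derivative:
  fixes \<phi> :: "real \<Rightarrow> real"
  assumes \<phi>: "(\<phi> has_real_derivative D) (at 0)" and D: "D \<le> 0"
    and le: "\<forall>\<^sub>F \<epsilon> in at_right 0. d \<epsilon> \<le> \<phi> \<epsilon> - \<phi> 0"
  shows "Limsup (at_right 0) (\<lambda>\<epsilon>. ereal (d \<epsilon> / \<epsilon>)) \<le> 0"
proof -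
  have "((\<lambda>\<epsilon>. (\<phi> \<epsilon> - \<phi> 0) / \<epsilon>) \<longlongrightarrow> D) (at_right 0)"
    using \<phi> unfolding has_field_derivative_iff by (simp add: filterlim_at_split)
  then have "((\<lambda>\<epsilon>. ereal ((\<phi> \<epsilon> - \<phi> 0) / \<epsilon>)) \<longlongrightarrow> ereal D) (at_right 0)" by simp
  then have L: "Limsup (at_right 0) (\<lambda>\<epsilon>. ereal ((\<phi> \<epsilon> - \<phi> 0) / \<epsilon>)) = ereal D"
    by (rule lim_imp_Limsup[rotated]) simp
  have "Limsup (at_right 0) (\<lambda>\<epsilon>. ereal (d \<epsilon> / \<epsilon>)) \<le> Limsup (at_right 0) (\<lambda>\<epsilon>. ereal ((\<phi> \<epsilon> - \<phi> 0) / \<epsilon>))"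
  proof (rule Limsup_mono)
    show "\<forall>\<^sub>F \<epsilon> in at_right 0. ereal (d \<epsilon> / \<epsilon>) \<le> ereal ((\<phi> \<epsilon> - \<phi> 0) / \<epsilon>)"
      using le eventually_at_right_less[of 0] by eventually_elim (simp add: divide_right_mono)
  qed
  then show ?thesis unfolding L using D by (simp add: order_trans)
qed

text \<open>With \<open>R = 2 * \<beta> + \<mu>\<^sup>2 / \<sigma>\<^sup>2\<close> and completing
  the square in the control, the growth rate of the power \<alpha> is
  \<open>\<beta> - \<beta> * (1 - \<mu> * c / R)\<^sup>2\<close>. Thus \<theta> is the maximiser and
  \<alpha> is the power for which the maximal rate equals the discount rate.\<close>

lemma optimal_growth:
  fixes \<mu> \<sigma> \<beta> \<alpha> \<theta> :: real
  assumes pos: "\<mu> > 0" "\<sigma> > 0" "\<beta> > 0"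
    and theta: "\<theta> = 2 * \<beta> / \<mu> + \<mu> / \<sigma>\<^sup>2" and alpha: "\<alpha> = 2 * \<beta> / (2 * \<beta> + \<mu>\<^sup>2 / \<sigma>\<^sup>2)"
  shows "0 < \<alpha>" "\<alpha> < 1" "\<theta> > 0" "\<mu> * \<theta> = 2 * \<beta> / \<alpha>" "\<sigma>\<^sup>2 * \<theta>\<^sup>2 = 2 * \<beta> / \<alpha> / (1 - \<alpha>)"
    "growth \<mu> \<sigma> \<alpha> c \<le> \<beta>" "growth \<mu> \<sigma> \<alpha> \<theta> = \<beta>"
proof -
  define R where "R = 2 * \<beta> + \<mu>\<^sup>2 / \<sigma>\<^sup>2"
  have R: "R > 0" "2 * \<beta> < R" unfolding R_def using pos by (auto intro: add_pos_pos)
  have al: "\<alpha> = 2 * \<beta> / R" "1 - \<alpha> = \<mu>\<^sup>2 / \<sigma>\<^sup>2 / R" unfolding alpha R_def[symmetric] using R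
    by (auto simp: R_def diff_divide_eq_iff)
  have th: "\<theta> = R / \<mu>" unfolding theta R_def using pos by (simp add: add_divide_distrib power2_eq_square)
  show "0 < \<alpha>" "\<alpha> < 1" "\<theta> > 0" unfolding al th using R pos by auto
  show "\<mu> * \<theta> = 2 * \<beta> / \<alpha>" unfolding al th using R pos by simp
  show "\<sigma>\<^sup>2 * \<theta>\<^sup>2 = 2 * \<beta> / \<alpha> / (1 - \<alpha>)" unfolding al(2) unfolding al th using R pos by (simp add: power2_eq_square)
  have g: "growth \<mu> \<sigma> \<alpha> c = \<beta> - \<beta> * (1 - \<mu> * c / R)\<^sup>2" for c
  proof -
    have "growth \<mu> \<sigma> \<alpha> c = \<alpha> * \<mu> * c - \<alpha> * (1 - \<alpha>) / 2 * \<sigma>\<^sup>2 * c\<^sup>2" unfolding growth_def by (simp add: field_simps)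
    also have "\<dots> = 2 * \<beta> / R * \<mu> * c - 2 * \<beta> / R * (\<mu>\<^sup>2 / \<sigma>\<^sup>2 / R) / 2 * \<sigma>\<^sup>2 * c\<^sup>2" unfolding al(2) unfolding al(1) ..
    also have "\<dots> = \<beta> - \<beta> * (1 - \<mu> * c / R)\<^sup>2" using R pos by (simp add: power2_eq_square field_simps)
    finally show ?thesis .
  qed
  show "growth \<mu> \<sigma> \<alpha> c \<le> \<beta>" "growth \<mu> \<sigma> \<alpha> \<theta> = \<beta>" unfolding g th using R pos by auto
qed

text \<open>The left side is the generator under the optimal control minus the discount rate,
  applied to the exponential reward where \<open>y\<close> is \<open>a\<close> times the wealth:
  \<open>2 * \<beta> / \<alpha>\<close> and \<open>2 * \<beta> / \<alpha> / (1 - \<alpha>)\<close>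
  are \<mu> * \<theta> and the squared volatility. Beyond the threshold \<open>p\<close> waiting
  loses to first order.\<close>

lemma drift_nonpos:
  fixes \<alpha> \<beta> p y e :: real
  assumes al: "0 < \<alpha>" "\<alpha> < 1" and \<beta>: "\<beta> > 0" and p: "1 - \<alpha> \<le> p" "p \<le> y" and e: "0 \<le> e" "e * (p + \<alpha>) \<le> \<alpha>"
  shows "- \<beta> * (1 - e) + e * (2 * \<beta> / \<alpha> * y - (2 * \<beta> / \<alpha> / (1 - \<alpha>)) * y\<^sup>2 / 2) \<le> 0"
proof -
  have "(1 - \<alpha>) * (2 * y - p) \<le> y\<^sup>2"
  proof -
    have "0 \<le> (y - (1 - \<alpha>))\<^sup>2" by simp
    moreover have "(1 - \<alpha>) * (1 - \<alpha>) \<le> (1 - \<alpha>) * p" using p al by (intro mult_left_mono) auto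
    ultimately show ?thesis by (simp add: power2_eq_square algebra_simps)
  qed
  then have "2 * y - y\<^sup>2 / (1 - \<alpha>) \<le> p" using al by (simp add: field_simps)
  then have "e * (2 * y - y\<^sup>2 / (1 - \<alpha>) + \<alpha>) \<le> e * (p + \<alpha>)" using e by (intro mult_left_mono) auto
  then have "e * (2 * y - y\<^sup>2 / (1 - \<alpha>) + \<alpha>) - \<alpha> \<le> 0" using e by linarith
  then have "\<beta> / \<alpha> * (e * (2 * y - y\<^sup>2 / (1 - \<alpha>) + \<alpha>) - \<alpha>) \<le> 0" using al \<beta> by (intro mult_nonneg_nonpos) auto
  also have "\<beta> / \<alpha> * (e * (2 * y - y\<^sup>2 / (1 - \<alpha>) + \<alpha>) - \<alpha>)
    = - \<beta> * (1 - e) + e * (2 * \<beta> / \<alpha> * y - (2 * \<beta> / \<alpha> / (1 - \<alpha>)) * y\<^sup>2 / 2)"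
    using al by (simp add: field_simps)
  finally show ?thesis .
qed

section \<open>Rewards of immediate and delayed exit\<close>

context wealth_path
begin

definition reward :: "real \<Rightarrow> real \<Rightarrow> real \<Rightarrow> real \<Rightarrow> real \<Rightarrow> 'w \<Rightarrow> real" where
  "reward \<beta> a \<kappa> b s \<omega> = (if exit_time {0<..<b} s X \<omega> < \<infinity>
     then exp (- \<beta> * (real_of_ereal (exit_time {0<..<b} s X \<omega>) - t)) *
       (1 - exp (- a * (X (real_of_ereal (exit_time {0<..<b} s X \<omega>)) \<omega> - \<kappa>))) else 0)"

lemma reward_start:
  assumes w: "\<omega> \<in> space M" and xb: "x \<le> b"
  shows "reward \<beta> a \<kappa> b t \<omega> = (1 - exp (- a * (b - \<kappa>))) * pay b t \<beta> 0 \<omega>"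
  using order_refl[of t] w
proof (cases rule: exit_cases[where b = b])
  case (fin \<tau>)
  have "X \<tau> \<omega> = b" using fin Xt[OF w] xb by simp
  moreover have "0 < X \<tau> \<omega>" using Xpos[OF w fin(2)] .
  ultimately show ?thesis using fin(1) unfolding reward_def pay_def Z_def by simp
qed (simp add: reward_def pay_def)

lemma reward_exceed:
  assumes w: "\<omega> \<in> space M" and xb: "b \<le> x"
  shows "reward \<beta> a \<kappa> b t \<omega> = 1 - exp (- a * (x - \<kappa>))"
  using order_refl[of t] w
proof (cases rule: exit_cases[where b = b])
  case (fin \<tau>)
  have "\<tau> = t" using fin(4)[of t] fin(2) Xt[OF w] xb by fastforce
  then show ?thesis using fin(1) Xt[OF w] unfolding reward_def by simp
next
  case inf
  then show ?thesis using inf(2)[of t] Xt[OF w] xb by simp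
qed

text \<open>A rule that starts watching at \<open>s > t\<close> may find the wealth above
  \<open>b\<close> and stops there. The reward at such a value is dominated by the power function
  normalised to agree with it at \<open>b\<close>.\<close>

lemma reward_le_pay:
  assumes w: "\<omega> \<in> space M" and s: "t \<le> s" and b: "b > 0" and a: "a > 0"
    and al: "0 < \<alpha>" "\<alpha> < 1" and p: "1 - \<alpha> \<le> a * b" and e: "exp (- a * (b - \<kappa>)) * (a * b + \<alpha>) \<le> \<alpha>"
  shows "reward \<beta> a \<kappa> b s \<omega> \<le> (1 - exp (- a * (b - \<kappa>))) / b powr \<alpha> * pay b s \<beta> \<alpha> \<omega>"
  using s w
proof (cases rule: exit_cases[where b = b])
  case (fin \<tau>)
  have z: "1 \<le> X \<tau> \<omega> / b" using fin(3) b by simp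
  have "exp (- a * (X \<tau> \<omega> - \<kappa>)) = exp (- a * (b - \<kappa>)) * exp (- (a * b) * (X \<tau> \<omega> / b - 1))"
    unfolding exp_add[symmetric] using b by (intro arg_cong[where f = exp]) (simp add: field_simps)
  then have "1 - exp (- a * (X \<tau> \<omega> - \<kappa>)) \<le> (1 - exp (- a * (b - \<kappa>))) * (X \<tau> \<omega> / b) powr \<alpha>"
    using power_majorant[OF al p _ e z] by simp
  also have "\<dots> = (1 - exp (- a * (b - \<kappa>))) / b powr \<alpha> * X \<tau> \<omega> powr \<alpha>"
    using Xpos[OF w order_trans[OF s fin(2)]] b by (simp add: powr_divide)
  finally have "exp (- \<beta> * (\<tau> - t)) * (1 - exp (- a * (X \<tau> \<omega> - \<kappa>))) \<le>
    exp (- \<beta> * (\<tau> - t)) * ((1 - exp (- a * (b - \<kappa>))) / b powr \<alpha> * X \<tau> \<omega> powr \<alpha>)" by (rule mult_left_mono) simp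
  then show ?thesis using fin(1) unfolding reward_def pay_def Z_def by (simp add: mult.left_commute)
qed (simp add: reward_def pay_def)

text \<open>If the wealth at \<open>s\<close> is below \<open>b\<close>, the reward stays below the
  discount factor whatever the later exit is, so \<open>q \<ge> 1\<close> suffices and the later
  exit need not be evaluated.\<close>

lemma reward_le:
  assumes w: "\<omega> \<in> space M" and s: "t \<le> s" and \<beta>: "\<beta> > 0" and q: "b \<le> X s \<omega> \<Longrightarrow> 1 - exp (- a * (X s \<omega> - \<kappa>)) \<le> q"
    "X s \<omega> < b \<Longrightarrow> 1 \<le> q"
  shows "reward \<beta> a \<kappa> b s \<omega> \<le> exp (- \<beta> * (s - t)) * q"
  using s w
proof (cases rule: exit_cases[where b = b])
  case inf
  then show ?thesis using inf(2)[of s] q(2) by (simp add: reward_def)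
next
  case (fin \<tau>)
  show ?thesis
  proof (cases "b \<le> X s \<omega>")
    case True
    then have "\<tau> = s" using fin(4)[of s] fin(2) by fastforce
    then show ?thesis using fin(1) q(1)[OF True] by (simp add: reward_def)
  next
    case False
    have "exp (- \<beta> * (\<tau> - t)) * (1 - exp (- a * (X \<tau> \<omega> - \<kappa>))) \<le> exp (- \<beta> * (\<tau> - t)) * q"
    proof (rule mult_left_mono)
      show "1 - exp (- a * (X \<tau> \<omega> - \<kappa>)) \<le> q"
        using q(2) False exp_gt_zero[of "- a * (X \<tau> \<omega> - \<kappa>)"] by linarith
    qed simp
    also have "\<dots> \<le> exp (- \<beta> * (s - t)) * q" using fin(2) \<beta> q(2) False by (intro mult_right_mono) auto
    finally show ?thesis using fin(1) unfolding reward_def by simp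
  qed
qed

end

text \<open>The odd Taylor polynomial lies below the exponential everywhere; the quartic term lifts the bound
  above \<open>1\<close> on \<open>(0, b)\<close>, where the delayed stopping rule does not stop yet.\<close>

definition taylor_bound :: "real \<Rightarrow> real \<Rightarrow> real \<Rightarrow> real \<Rightarrow> real \<Rightarrow> real" where
  "taylor_bound a x e C y = 1 - e * (1 - a * (y - x) + (a * (y - x))\<^sup>2 / 2 - (a * (y - x)) ^ 3 / 6) + C * (y - x) ^ 4"

text \<open>On \<open>(0, b)\<close> the number \<open>v = a * (x - y)\<close> is between 0 and
  \<open>a * x\<close>, so the subtracted cubic is at most its value at \<open>a * x\<close>. The
  constant \<open>C\<close> lets the quartic term equal this worst case at distance
  \<open>x - b\<close>, and it is larger further down.\<close>

lemma taylor_bound_ge: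
  assumes a: "a > 0" and e: "e \<ge> 0" and b: "b < x"
    and C: "C = e * (1 + a * x + (a * x)\<^sup>2 / 2 + (a * x) ^ 3 / 6) / (x - b) ^ 4" and x: "x > 0"
  shows "1 - e * exp (- a * (y - x)) \<le> taylor_bound a x e C y"
    "0 < y \<Longrightarrow> y < b \<Longrightarrow> 1 \<le> taylor_bound a x e C y"
proof -
  have C0: "C \<ge> 0" unfolding C using a e b x by (intro divide_nonneg_nonneg mult_nonneg_nonneg add_nonneg_nonneg) auto
  have "e * (1 - a * (y - x) + (a * (y - x))\<^sup>2 / 2 - (a * (y - x)) ^ 3 / 6) \<le> e * exp (- a * (y - x))"
    using exp_ge_cubic[of "a * (y - x)"] e by (intro mult_left_mono) auto
  then show "1 - e * exp (- a * (y - x)) \<le> taylor_bound a x e C y"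
    unfolding taylor_bound_def using mult_nonneg_nonneg[OF C0, of "(y - x) ^ 4"] by simp
  assume y: "0 < y" "y < b"
  define v where "v = a * (x - y)"
  have v: "0 \<le> v" "v \<le> a * x" unfolding v_def using a y b by auto
  have w: "a * (y - x) = - v" unfolding v_def by (simp add: algebra_simps)
  have "1 + v + v\<^sup>2 / 2 + v ^ 3 / 6 \<le> 1 + a * x + (a * x)\<^sup>2 / 2 + (a * x) ^ 3 / 6"
    using v by (intro add_mono divide_right_mono power_mono) auto
  then have "e * (1 + v + v\<^sup>2 / 2 + v ^ 3 / 6) \<le> e * (1 + a * x + (a * x)\<^sup>2 / 2 + (a * x) ^ 3 / 6)" using e
    by (rule mult_left_mono)
  also have "\<dots> = C * (x - b) ^ 4" unfolding C using b by simp
  also have "\<dots> \<le> C * (x - y) ^ 4" using C0 y b by (intro mult_left_mono power_mono) auto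
  also have "(x - y) ^ 4 = (y - x) ^ 4" by (simp add: power4_eq_xxxx algebra_simps)
  finally show "1 \<le> taylor_bound a x e C y" unfolding taylor_bound_def w by simp
qed

context gbm_path
begin

lemma moment_nat:
  assumes "\<eta> = \<theta>" "t \<le> r"
  shows "integrable P (\<lambda>\<omega>. X r \<omega> ^ n)" "(\<integral>\<omega>. X r \<omega> ^ n \<partial>P) = x ^ n * exp (growth \<mu> \<sigma> (real n) \<theta> * (r - t))"
proof -
  have e: "X r \<omega> powr real n = X r \<omega> ^ n" if "\<omega> \<in> space P" for \<omega> using Xpos[of \<omega> r] that assms
    by (simp add: powr_realpow)
  note m = moment[of "real n" "growth \<mu> \<sigma> (real n) \<theta>", OF _ refl assms(2)]
  have x: "x powr real n = x ^ n" using X_pos_x by (simp add: powr_realpow)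
  show "integrable P (\<lambda>\<omega>. X r \<omega> ^ n)" 
    using m(1) assms(1) by (subst Bochner_Integration.integrable_cong[OF refl e[symmetric]]) auto
  show "(\<integral>\<omega>. X r \<omega> ^ n \<partial>P) = x ^ n * exp (growth \<mu> \<sigma> (real n) \<theta> * (r - t))"
    
    using m(2) assms(1) unfolding x by (subst Bochner_Integration.integral_cong[OF refl e[symmetric]]) auto
qed

text \<open>The expectation of \<open>taylor_bound\<close> after a delay \<epsilon>, expanded
  binomially; \<open>m n\<close> is the \<open>n\<close>-th moment of geometric Brownian
  motion.\<close>

definition taylor_mean :: "real \<Rightarrow> real \<Rightarrow> real \<Rightarrow> real \<Rightarrow> real" where
  "taylor_mean a e C \<epsilon> = (let m = (\<lambda>n. x ^ n * exp (growth \<mu> \<sigma> (real n) \<theta> * \<epsilon>)) in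
     1 - e * (1 - a * (m 1 - x) + a\<^sup>2 / 2 * (m 2 - 2 * x * m 1 + x\<^sup>2) - a ^ 3 / 6 * (m 3 - 3 * x * m 2 + 3 * x\<^sup>2 * m 1 -
       x ^ 3))
     + C * (m 4 - 4 * x * m 3 + 6 * x\<^sup>2 * m 2 - 4 * x ^ 3 * m 1 + x ^ 4))"

lemma taylor_bound_integral:
  assumes "\<eta> = \<theta>" and \<epsilon>: "0 \<le> \<epsilon>"
  shows "integrable P (\<lambda>\<omega>. taylor_bound a x e C (X (t + \<epsilon>) \<omega>))"
    "(\<integral>\<omega>. taylor_bound a x e C (X (t + \<epsilon>) \<omega>) \<partial>P) = taylor_mean a e C \<epsilon>"
proof -
  have r: "t \<le> t + \<epsilon>" using \<epsilon> by simp
  define U where "U n \<omega> = X (t + \<epsilon>) \<omega> ^ n" for n \<omega>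
  have U: "integrable P (U n)" "(\<integral>\<omega>. U n \<omega> \<partial>P) = x ^ n * exp (growth \<mu> \<sigma> (real n) \<theta> * \<epsilon>)" for n
    using moment_nat[OF assms(1) r, of n] unfolding U_def[abs_def] by simp_all
  have eq: "taylor_bound a x e C (X (t + \<epsilon>) \<omega>) =
    1 - e * (1 - a * (U 1 \<omega> - x) + a\<^sup>2 / 2 * (U 2 \<omega> - 2 * x * U 1 \<omega> + x\<^sup>2) - a ^ 3 / 6 * (U 3 \<omega> - 3 * x * U 2 \<omega> + 3 *
      x\<^sup>2 * U 1 \<omega> - x ^ 3))
     + C * (U 4 \<omega> - 4 * x * U 3 \<omega> + 6 * x\<^sup>2 * U 2 \<omega> - 4 * x ^ 3 * U 1 \<omega> + x ^ 4)" for \<omega>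
  proof -
    define y where "y = X (t + \<epsilon>) \<omega>"
    have p: "(y - x)\<^sup>2 = y\<^sup>2 - 2 * x * y + x\<^sup>2" "(y - x) ^ 3 = y ^ 3 - 3 * x * y\<^sup>2 + 3 * x\<^sup>2 * y - x ^ 3"
      "(y - x) ^ 4 = y ^ 4 - 4 * x * y ^ 3 + 6 * x\<^sup>2 * y\<^sup>2 - 4 * x ^ 3 * y + x ^ 4"
      by (simp_all add: power2_eq_square power3_eq_cube power4_eq_xxxx algebra_simps)
    show ?thesis unfolding taylor_bound_def U_def y_def[symmetric] power_mult_distrib p by simp
  qed
  show "integrable P (\<lambda>\<omega>. taylor_bound a x e C (X (t + \<epsilon>) \<omega>))"
    unfolding eq using U(1) by simp
  show "(\<integral>\<omega>. taylor_bound a x e C (X (t + \<epsilon>) \<omega>) \<partial>P) = taylor_mean a e C \<epsilon>"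
    unfolding eq taylor_mean_def Let_def using U(1) by (simp add: U(2) base.prob_space)
qed

text \<open>Only the first two powers of the displacement contribute to first order in time, so the
  cubic and quartic corrections, and with them \<open>C\<close>, disappear. What is left is the
  generator applied to the exponential reward.\<close>

lemma taylor_mean_derivative:
  "(taylor_mean a e C has_real_derivative e * (a * \<mu> * \<theta> * x - a\<^sup>2 / 2 * \<sigma>\<^sup>2 * \<theta>\<^sup>2 * x\<^sup>2)) (at 0)"
proof -
  define q where "q n = growth \<mu> \<sigma> (real n) \<theta>" for n
  have d: "((\<lambda>\<epsilon>. x ^ n * exp (q n * \<epsilon>)) has_real_derivative x ^ n * q n) (at 0)" for n
    by (auto intro!: derivative_eq_intros)
  have q: "q 1 = \<mu> * \<theta>" "q 2 = 2 * (\<mu> * \<theta>) + \<sigma>\<^sup>2 * \<theta>\<^sup>2" "q 3 = 3 * (\<mu> * \<theta>) + 3 * (\<sigma>\<^sup>2 * \<theta>\<^sup>2)"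
    "q 4 = 4 * (\<mu> * \<theta>) + 6 * (\<sigma>\<^sup>2 * \<theta>\<^sup>2)"
    unfolding q_def growth_def by (simp_all add: algebra_simps)
  show ?thesis
    unfolding taylor_mean_def[abs_def] Let_def q_def[symmetric]
    apply (rule DERIV_cong)
     apply (rule derivative_eq_intros d refl)+
    unfolding q by (simp add: power2_eq_square power3_eq_cube power4_eq_xxxx algebra_simps)
qed

lemma taylor_mean_0: "taylor_mean a e C 0 = 1 - e"
  unfolding taylor_mean_def Let_def by (simp add: power2_eq_square power3_eq_cube power4_eq_xxxx)

end

section \<open>Pay-offs of the constant control and the equilibrium conditions\<close>

text \<open>The last condition on \<open>b\<close> is the threshold equation in the form of an
  inequality. In this form it passes to smaller benchmarks, and to larger wealth by monotonicity of
  \<open>x - h x\<close>.\<close>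

locale constant_control = brownian M W for M :: "'w measure" and W +
  fixes \<mu> \<sigma> \<beta> a k \<alpha> \<theta> b :: real and h :: "real \<Rightarrow> real"
  assumes pos: "\<mu> > 0" "\<sigma> > 0" "\<beta> > 0" "a > 0"
    and theta: "\<theta> = 2 * \<beta> / \<mu> + \<mu> / \<sigma>\<^sup>2" and alpha: "\<alpha> = 2 * \<beta> / (2 * \<beta> + \<mu>\<^sup>2 / \<sigma>\<^sup>2)"
    and b: "b > 0" "1 - \<alpha> \<le> a * b" "exp (- a * (b - h b - k)) * (a * b + \<alpha>) \<le> \<alpha>"
    and h_incr: "mono_on {0..} h" and h_resid: "mono_on {0..} (\<lambda>x. x - h x)"
begin

lemmas opt = optimal_growth[OF pos(1-3) theta alpha]

abbreviation "J t x u s \<equiv> payoff M W \<mu> \<sigma> \<beta> a k h t x u (exit_time {0<..<b} s)"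

definition gain :: "real \<Rightarrow> real" where
  "gain x = 1 - exp (- a * (b - (h x + k)))"

lemma gain:
  assumes "0 < x" "x \<le> b"
  shows "exp (- a * (b - (h x + k))) * (a * b + \<alpha>) \<le> \<alpha>" "0 \<le> gain x"
proof -
  have "h x \<le> h b" using assms b by (intro mono_onD[OF h_incr]) auto
  then have "exp (- a * (b - (h x + k))) \<le> exp (- a * (b - h b - k))" using pos by simp
  then have "exp (- a * (b - (h x + k))) * (a * b + \<alpha>) \<le> exp (- a * (b - h b - k)) * (a * b + \<alpha>)"
    using pos opt b by (intro mult_right_mono) auto
  then show le: "exp (- a * (b - (h x + k))) * (a * b + \<alpha>) \<le> \<alpha>" using b by linarith
  also have "\<alpha> \<le> 1 * (a * b + \<alpha>)" using pos b by simp
  finally have "exp (- a * (b - (h x + k))) \<le> 1" using pos opt b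
    by (subst (asm) mult_le_cancel_right) (auto simp: add_pos_pos)
  then show "0 \<le> gain x" unfolding gain_def by simp
qed

lemma gbm_constant:
  assumes "0 \<le> t" "0 < x"
  shows "gbm_path M W t x (wealth M W \<mu> \<sigma> t x (\<lambda>_ _. \<theta>)) \<mu> \<sigma> \<theta> \<theta> (t + 1)"
  using assms pos opt by (intro wealth_gbm_path) (auto simp: cfun_def)

lemma gbm_perturbed:
  assumes "0 \<le> t" "0 < x" "0 < \<epsilon>" "0 < \<eta>"
  shows "gbm_path M W t x (wealth M W \<mu> \<sigma> t x (perturbed (\<lambda>_. \<theta>) t \<epsilon> \<eta>)) \<mu> \<sigma> \<eta> \<theta> (t + \<epsilon>)"
  using assms pos opt by (intro wealth_gbm_path) (auto simp: cfun_def perturbed_def)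

lemma J_reward:
  "J t x u s = (\<integral>\<omega>. wealth_path.reward t (wealth M W \<mu> \<sigma> t x u) \<beta> a (h x + k) b s \<omega> \<partial>P)"
  if "wealth_path M W t x (wealth M W \<mu> \<sigma> t x u)"
  unfolding payoff_def Let_def wealth_path.reward_def[OF that] diff_diff_eq ..

lemma J_below:
  assumes "0 \<le> t" "0 < x" "x \<le> b"
  shows "J t x (\<lambda>_ _. \<theta>) t = gain x * (x / b) powr \<alpha>"
proof -
  interpret g: gbm_path M W t x "wealth M W \<mu> \<sigma> t x (\<lambda>_ _. \<theta>)" \<mu> \<sigma> \<theta> \<theta> "t + 1"
    by (rule gbm_constant) (use assms in auto)
  have "J t x (\<lambda>_ _. \<theta>) t = (\<integral>\<omega>. gain x * g.pay b t \<beta> 0 \<omega> \<partial>P)"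
    unfolding J_reward[OF g.wealth_path_axioms] gain_def
    by (intro Bochner_Integration.integral_cong refl g.reward_start) (use assms in auto)
  also have "\<dots> = gain x * (\<integral>\<omega>. g.pay b t \<beta> 0 \<omega> \<partial>P)" by simp
  also have "(\<integral>\<omega>. g.pay b t \<beta> 0 \<omega> \<partial>P) = (x / b) powr \<alpha>"
    by (rule g.pay_value[OF assms(3) b(1) pos(3) opt(1) g.mart_le g.mart_ge g.mart_le[OF order_refl order_refl]])
      (simp_all add: opt)
  finally show ?thesis .
qed

lemma J_above:
  assumes "0 \<le> t" "b \<le> x"
  shows "J t x (\<lambda>_ _. \<theta>) t = 1 - exp (- a * (x - h x - k))"
proof -
  interpret g: gbm_path M W t x "wealth M W \<mu> \<sigma> t x (\<lambda>_ _. \<theta>)" \<mu> \<sigma> \<theta> \<theta> "t + 1"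
    by (rule gbm_constant) (use assms b in auto)
  have "J t x (\<lambda>_ _. \<theta>) t = (\<integral>\<omega>. 1 - exp (- a * (x - (h x + k))) \<partial>P)"
    unfolding J_reward[OF g.wealth_path_axioms]
    by (intro Bochner_Integration.integral_cong refl g.reward_exceed) (use assms in auto)
  also have "\<dots> = 1 - exp (- a * (x - (h x + k)))" using base.prob_space by simp
  finally show ?thesis by (simp add: diff_diff_eq)
qed

text \<open>The power \<alpha> of the wealth, discounted at rate \<beta>, is a supermartingale that
  dominates the delayed reward and gives the undelayed pay-off at the start. The comparison
  therefore holds for every delay and not only in the limit.\<close>

lemma J_delayed_below:
  assumes "0 \<le> t" "0 < x" "x \<le> b" "0 < \<epsilon>"
  shows "J t x (\<lambda>_ _. \<theta>) (t + \<epsilon>) \<le> J t x (\<lambda>_ _. \<theta>) t"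
proof -
  interpret g: gbm_path M W t x "wealth M W \<mu> \<sigma> t x (\<lambda>_ _. \<theta>)" \<mu> \<sigma> \<theta> \<theta> "t + 1"
    by (rule gbm_constant) (use assms in auto)
  define K where "K = gain x / b powr \<alpha>"
  have K: "K \<ge> 0" unfolding K_def using gain(2)[OF assms(2,3)] by simp
  have "J t x (\<lambda>_ _. \<theta>) (t + \<epsilon>) \<le> K * x powr \<alpha>"
  \<comment> \<open>The bound by the nonnegative integral of \<open>pay\<close> is applied after
    division by \<open>K\<close>; with \<open>K = 0\<close> the reward itself is
    nonpositive.\<close>
  proof (cases "K = 0")
    case True
    have "J t x (\<lambda>_ _. \<theta>) (t + \<epsilon>) \<le> 0" unfolding J_reward[OF g.wealth_path_axioms]
    proof (rule lebesgue_integral_le_of_nn[where g = "\<lambda>_. 0"])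
      show "g.reward \<beta> a (h x + k) b (t + \<epsilon>) \<omega> \<le> 0" if "\<omega> \<in> space P" for \<omega>
        using g.reward_le_pay[of \<omega> "t + \<epsilon>" b a \<alpha> "h x + k" \<beta>] that assms b pos opt(1,2) gain(1)[OF assms(2,3)] True
        unfolding K_def gain_def by simp
    qed auto
    then show ?thesis using True by simp
  next
    case False
    then have K0: "K > 0" using K by simp
    have "(\<integral>\<omega>. g.reward \<beta> a (h x + k) b (t + \<epsilon>) \<omega> / K \<partial>P) \<le> x powr \<alpha>"
    proof (rule lebesgue_integral_le_of_nn)
      show "g.reward \<beta> a (h x + k) b (t + \<epsilon>) \<omega> / K \<le> g.pay b (t + \<epsilon>) \<beta> \<alpha> \<omega>" if "\<omega> \<in> space P" for \<omega>
      proof -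
        have "g.reward \<beta> a (h x + k) b (t + \<epsilon>) \<omega> \<le> K * g.pay b (t + \<epsilon>) \<beta> \<alpha> \<omega>"
          unfolding K_def gain_def
          by (rule g.reward_le_pay) (use that assms b pos opt(1,2) gain(1)[OF assms(2,3)] in auto)
        then show ?thesis using K0 by (simp add: pos_divide_le_eq mult.commute)
      qed
      show "(\<integral>\<^sup>+\<omega>. ennreal (g.pay b (t + \<epsilon>) \<beta> \<alpha> \<omega>) \<partial>P) \<le> ennreal (x powr \<alpha>)"
        by (rule g.pay_upper[OF _ g.mart_le]) (use assms opt in auto)
    qed simp
    then show ?thesis unfolding J_reward[OF g.wealth_path_axioms] using K0
      by (simp add: pos_divide_le_eq mult.commute)
  qed
  also have "\<dots> = J t x (\<lambda>_ _. \<theta>) t" unfolding J_below[OF assms(1-3)] K_def using assms by (simp add: powr_divide)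
  finally show ?thesis .
qed

text \<open>The same power is a supermartingale under any constant proportion, hence also under a
  switch from \<eta> to \<theta>. No perturbation of positive length gains anything, so no expansion
  in \<epsilon> is needed.\<close>

lemma J_perturbed:
  assumes "0 \<le> t" "0 < x" "x \<le> b" "0 < \<epsilon>" "0 < \<eta>"
  shows "J t x (perturbed (\<lambda>_. \<theta>) t \<epsilon> \<eta>) t \<le> J t x (\<lambda>_ _. \<theta>) t"
proof -
  interpret g: gbm_path M W t x "wealth M W \<mu> \<sigma> t x (perturbed (\<lambda>_. \<theta>) t \<epsilon> \<eta>)" \<mu> \<sigma> \<eta> \<theta> "t + \<epsilon>"
    by (rule gbm_perturbed) (use assms in auto)
  have "J t x (perturbed (\<lambda>_. \<theta>) t \<epsilon> \<eta>) t = (\<integral>\<omega>. gain x * g.pay b t \<beta> 0 \<omega> \<partial>P)"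
    unfolding J_reward[OF g.wealth_path_axioms] gain_def
    by (intro Bochner_Integration.integral_cong refl g.reward_start) (use assms in auto)
  also have "\<dots> = gain x * (\<integral>\<omega>. g.pay b t \<beta> 0 \<omega> \<partial>P)" by simp
  also have "\<dots> \<le> gain x * (x / b) powr \<alpha>"
    by (intro mult_left_mono g.pay_upper_start g.mart_le gain) (use assms b pos opt in auto)
  finally show ?thesis unfolding J_below[OF assms(1-3)] .
qed

text \<open>The function \<open>\<phi>\<close> bounds the delayed pay-off and equals the undelayed
  one at 0, so its derivative bounds the upper limit and is nonpositive by
  \<open>drift_nonpos\<close>. The integral comparison requires \<open>\<phi> \<epsilon>\<close> to
  be nonnegative, which holds near 0 because \<open>e < 1\<close>.\<close>

lemma J_delayed_above:
  assumes t: "0 \<le> t" and x: "b < x"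
  shows "Limsup (at_right 0) (\<lambda>\<epsilon>. ereal ((J t x (\<lambda>_ _. \<theta>) (t + \<epsilon>) - J t x (\<lambda>_ _. \<theta>) t) / \<epsilon>)) \<le> 0"
proof -
  have x0: "0 < x" using b x by simp
  interpret g: gbm_path M W t x "wealth M W \<mu> \<sigma> t x (\<lambda>_ _. \<theta>)" \<mu> \<sigma> \<theta> \<theta> "t + 1"
    by (rule gbm_constant) (use t x0 in auto)
  define e where "e = exp (- a * (x - (h x + k)))"
  define C where "C = e * (1 + a * x + (a * x)\<^sup>2 / 2 + (a * x) ^ 3 / 6) / (x - b) ^ 4"
  define \<phi> where "\<phi> \<epsilon> = exp (- \<beta> * \<epsilon>) * g.taylor_mean a e C \<epsilon>" for \<epsilon>
  \<comment> \<open>Monotonicity of \<open>x - h x\<close> carries the threshold inequality from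
    \<open>b\<close> to the larger initial wealth \<open>x\<close>.\<close>
  have eb: "e * (a * b + \<alpha>) \<le> \<alpha>"
  proof -
    have "b - h b \<le> x - h x" using mono_onD[OF h_resid, of b x] b x by simp
    then have "e \<le> exp (- a * (b - h b - k))" unfolding e_def using pos by simp
    then have "e * (a * b + \<alpha>) \<le> exp (- a * (b - h b - k)) * (a * b + \<alpha>)"
      using pos opt b by (intro mult_right_mono) auto
    then show ?thesis using b by linarith
  qed
  have e1: "e < 1"
  proof (rule ccontr)
    assume "\<not> e < 1"
    then have "1 * (a * b + \<alpha>) \<le> e * (a * b + \<alpha>)" using pos opt b by (intro mult_right_mono) auto
    from order_trans[OF this eb] show False using mult_pos_pos[OF pos(4) b(1)] by simp
  qed
  have \<phi>0: "\<phi> 0 = 1 - e" unfolding \<phi>_def g.taylor_mean_0 by simp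
  have D: "(\<phi> has_real_derivative - \<beta> * (1 - e) + e * (a * \<mu> * \<theta> * x - a\<^sup>2 / 2 * \<sigma>\<^sup>2 * \<theta>\<^sup>2 * x\<^sup>2)) (at 0)"
    unfolding \<phi>_def[abs_def]
    by (rule DERIV_cong, (rule derivative_eq_intros g.taylor_mean_derivative refl)+) (simp add: g.taylor_mean_0)
  have bound: "J t x (\<lambda>_ _. \<theta>) (t + \<epsilon>) \<le> \<phi> \<epsilon>" if \<epsilon>: "0 < \<epsilon>" "0 < \<phi> \<epsilon>" for \<epsilon>
  proof -
    note tb = g.taylor_bound_integral[of \<epsilon> a e C, OF refl less_imp_le[OF \<epsilon>(1)]]
    let ?g = "\<lambda>\<omega>. exp (- \<beta> * \<epsilon>) * taylor_bound a x e C (wealth M W \<mu> \<sigma> t x (\<lambda>_ _. \<theta>) (t + \<epsilon>) \<omega>)"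
    have I: "(\<integral>\<omega>. ?g \<omega> \<partial>P) = \<phi> \<epsilon>" unfolding \<phi>_def integral_mult_right_zero tb(2) ..
    have "(\<integral>\<omega>. g.reward \<beta> a (h x + k) b (t + \<epsilon>) \<omega> \<partial>P) \<le> (\<integral>\<omega>. ?g \<omega> \<partial>P)"
    proof (rule lebesgue_integral_le_of_integrable)
      fix \<omega> assume "\<omega> \<in> space P"
      then have w: "\<omega> \<in> space M" by simp
      let ?y = "wealth M W \<mu> \<sigma> t x (\<lambda>_ _. \<theta>) (t + \<epsilon>) \<omega>"
      have y: "0 < ?y" using g.Xpos[OF w] \<epsilon> by simp
      have e0: "e \<ge> 0" unfolding e_def by simp
      note tbg = taylor_bound_ge[OF pos(4) e0 x C_def x0, of ?y]
      have "exp (- a * (?y - (h x + k))) = e * exp (- a * (?y - x))"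
        unfolding e_def exp_add[symmetric] by (intro arg_cong[where f = exp]) (simp add: algebra_simps)
      then show "g.reward \<beta> a (h x + k) b (t + \<epsilon>) \<omega> \<le> ?g \<omega>"
        using g.reward_le[OF w, of "t + \<epsilon>" \<beta> b a "h x + k" "taylor_bound a x e C ?y"] tbg y \<epsilon> pos by simp
    qed (use tb(1) I \<epsilon> in auto)
    then show ?thesis unfolding J_reward[OF g.wealth_path_axioms] I .
  qed
  show ?thesis
  proof (rule Limsup_right_derivative[OF D])
    have "a * \<mu> * \<theta> * x = 2 * \<beta> / \<alpha> * (a * x)" unfolding opt(4)[symmetric] by simp
    moreover have "a\<^sup>2 / 2 * \<sigma>\<^sup>2 * \<theta>\<^sup>2 * x\<^sup>2 = (2 * \<beta> / \<alpha> / (1 - \<alpha>)) * (a * x)\<^sup>2 / 2"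
      unfolding opt(5)[symmetric] by (simp add: power_mult_distrib)
    ultimately show "- \<beta> * (1 - e) + e * (a * \<mu> * \<theta> * x - a\<^sup>2 / 2 * \<sigma>\<^sup>2 * \<theta>\<^sup>2 * x\<^sup>2) \<le> 0"
      using drift_nonpos[OF opt(1,2) pos(3) b(2), of "a * x" e] eb x pos unfolding e_def by simp
    have "\<forall>\<^sub>F \<epsilon> in at_right 0. 0 < \<phi> \<epsilon>"
      using DERIV_isCont[OF D] \<phi>0 e1 unfolding isCont_def filterlim_at_split
      by (intro order_tendstoD(1)[of _ "\<phi> 0"]) auto
    then show "\<forall>\<^sub>F \<epsilon> in at_right 0. J t x (\<lambda>_ _. \<theta>) (t + \<epsilon>) - J t x (\<lambda>_ _. \<theta>) t \<le> \<phi> \<epsilon> - \<phi> 0"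
      using eventually_at_right_less[of 0]
    proof eventually_elim
      case (elim \<epsilon>)
      then show ?case using bound[of \<epsilon>] J_above[OF t, of x] x unfolding \<phi>0 e_def by (simp add: diff_diff_eq)
    qed
  qed
qed

lemma equilibrium:
  assumes ineq: "\<And>x. 0 < x \<Longrightarrow> x < b \<Longrightarrow> 1 - exp (- a * (x - h x - k)) \<le> (x / b) powr \<alpha> * (1 - exp (- a * (b - h x - k)))"
  shows "equilibrium M W \<mu> \<sigma> \<beta> a k h (\<lambda>_. \<theta>) {0<..<b}"
  unfolding equilibrium_def Let_def
proof (intro conjI allI impI ballI)
  show "admissible (\<lambda>_. \<theta>)" unfolding admissible_def
  proof (intro conjI exI)
    show "\<theta>-lipschitz_on {0<..} (\<lambda>x. x * \<theta>)"
      using opt(3) by (intro lipschitz_onI) (auto simp: dist_real_def left_diff_distrib[symmetric] abs_mult)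
  qed (use opt in auto)
  show "open {0<..<b}" "{0<..<b} \<subseteq> {0<..}" by auto
  fix t x :: real assume t: "0 \<le> t"
  show "1 - exp (- a * (x - h x - k)) \<le> J t x (\<lambda>_ _. \<theta>) t" if x: "0 < x"
  proof (cases "x < b")
    case True
    then show ?thesis using ineq[OF x True] J_below[OF t x] unfolding gain_def
      by (simp add: diff_diff_eq mult.commute)
  next
    case False
    then show ?thesis using J_above[OF t, of x] by simp
  qed
  show "Limsup (at_right 0) (\<lambda>\<epsilon>. ereal ((J t x (\<lambda>_ _. \<theta>) (t + \<epsilon>) - J t x (\<lambda>_ _. \<theta>) t) / \<epsilon>)) \<le> 0" if x: "0 < x"
  proof (cases "x \<le> b")
    case True
    then show ?thesis using J_delayed_below[OF t x] by (intro Limsup_right_le_0) auto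
  qed (use J_delayed_above[OF t] in auto)
  show "Limsup (at_right 0) (\<lambda>\<epsilon>. ereal ((J t x (perturbed (\<lambda>_. \<theta>) t \<epsilon> \<eta>) t - J t x (\<lambda>_ _. \<theta>) t) / \<epsilon>)) \<le> 0"
    if "x \<in> {0<..<b}" "0 < \<eta>" for \<eta>
    using J_perturbed[OF t, of x _ \<eta>] that by (intro Limsup_right_le_0) auto
qed

end

theorem proposition4p2:
  fixes \<mu> \<sigma> \<beta> a k \<alpha> \<theta>star xstar x0star :: real
    and h h' h'' :: "real \<Rightarrow> real"
    and M :: "'w measure" and W :: "real \<Rightarrow> 'w \<Rightarrow> real"
  assumes pos: "\<mu> > 0" "\<sigma> > 0" "\<beta> > 0" "a > 0" "k > 0"
    and h_incr: "mono_on {0..} h"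
    and h_zero: "h 0 = 0"
    and h_resid: "mono_on {0..} (\<lambda>x. x - h x)"
    and h_deriv: "\<And>x. x \<ge> 0 \<Longrightarrow> (h has_real_derivative h' x) (at x within {0..})"
    and h_deriv2: "\<And>x. x \<ge> 0 \<Longrightarrow> (h' has_real_derivative h'' x) (at x within {0..})"
    and theta: "\<theta>star = 2 * \<beta> / \<mu> + \<mu> / \<sigma>\<^sup>2"
    and alpha: "\<alpha> = 2 * \<beta> / (2 * \<beta> + \<mu>\<^sup>2 / \<sigma>\<^sup>2)"
    and xstar: "xstar > 0" "\<alpha> = (a * xstar + \<alpha>) * exp (- a * (xstar - h xstar - k))"
    and x0star: "x0star > 0" "\<alpha> = (a * x0star + \<alpha>) * exp (- a * (x0star - k))"
    and x0star_gt: "x0star > (2 - \<alpha>) / a"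
    and h_concave: "\<And>x. 0 < x \<Longrightarrow> x < xstar \<Longrightarrow> h'' x \<le> 0"
    and h_slope: "\<And>x. 0 < x \<Longrightarrow> x < xstar \<Longrightarrow>
        h' x < Min {1 / (2 * (1 + 1 / (a * x0star + \<alpha> - 1))),
                    1 / (1 - exp (- a * xstar))
                      * (1 - \<alpha> / min (\<alpha> * exp (a * k)) (2 * exp (\<alpha> - 2 + a * k))),
                    1 / 2}"
  shows "(\<forall>x. 0 < x \<and> x < xstar \<longrightarrow>
            (x / xstar) powr \<alpha> * (1 - exp (- a * (xstar - h x - k)))
              \<ge> 1 - exp (- a * (x - h x - k)))
       \<and> (xstar \<ge> \<mu>\<^sup>2 * \<alpha> / (2 * \<beta> * \<sigma>\<^sup>2 * a) \<longrightarrow>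
            brownian_motion M W \<longrightarrow>
            equilibrium M W \<mu> \<sigma> \<beta> a k h (\<lambda>_. \<theta>star) {0<..<xstar})"
proof -
  note al = optimal_growth(1,2)[OF pos(1-3) theta alpha]
  have y0: "a * x0star + \<alpha> - 1 > 1" using x0star_gt pos by (simp add: pos_divide_less_eq mult.commute)
  \<comment> \<open>The benchmark acts as an additional nonnegative cost \<open>a * h xstar\<close>,
    and a larger cost moves the threshold up.\<close>
  have y: "a * x0star \<le> a * xstar"
  proof (rule threshold_ge[OF al, where c = "a * k" and H = "a * h xstar"])
    have "h 0 \<le> h xstar" using xstar by (intro mono_onD[OF h_incr]) auto
    then show "0 \<le> a * h xstar" using pos h_zero by simp
    show "\<alpha> = (a * xstar + \<alpha>) * exp (- (a * xstar - a * h xstar - a * k))"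
      using xstar(2) by (simp add: algebra_simps)
    show "\<alpha> = (a * x0star + \<alpha>) * exp (- (a * x0star - a * k))"
      using x0star(2) by (simp add: right_diff_distrib)
  qed (use pos xstar in auto)
  \<comment> \<open>The bound \<open>1 / (2 * (1 + 1 / (y + \<alpha> - 1)))\<close> increases with
    the threshold \<open>y\<close>, so the one given at \<open>x0star\<close> implies the one at
    \<open>xstar\<close>, which is the form in which smooth fit uses it.\<close>
  have slope: "h' x \<le> (a * xstar + \<alpha> - 1) / (2 * (a * xstar + \<alpha>))" if "0 < x" "x < xstar" for x
  proof -
    have "h' x \<le> 1 / (2 * (1 + 1 / (a * x0star + \<alpha> - 1)))" using h_slope[OF that] by simp
    also have "\<dots> \<le> 1 / (2 * (1 + 1 / (a * xstar + \<alpha> - 1)))"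
      using y y0 by (intro divide_left_mono mult_left_mono add_left_mono mult_pos_pos add_pos_pos) auto
    also have "\<dots> = (a * xstar + \<alpha> - 1) / (2 * (a * xstar + \<alpha>))" using y y0 by (simp add: field_simps)
    finally show ?thesis .
  qed
  note ineq = stopping_inequality[OF pos(4,5) al h_incr h_zero h_deriv h_deriv2 xstar h_concave slope]
  have "equilibrium M W \<mu> \<sigma> \<beta> a k h (\<lambda>_. \<theta>star) {0<..<xstar}" if bm: "brownian_motion M W"
  proof -
    interpret constant_control M W \<mu> \<sigma> \<beta> a k \<alpha> \<theta>star xstar h
      by unfold_locales (use pos theta alpha xstar(1) h_incr h_resid bm in simp_all, use y y0 in linarith, use
        xstar(2) in \<open>simp add: mult.commute\<close>)
    show ?thesis by (rule equilibrium) (rule ineq)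
  qed
  then show ?thesis using ineq by blast
qed

end
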